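(* Let $N\ge1$, let $p\ge1$, let $A:\mathbb{R}^N\to\mathbb{R}^N$ be Lipschitz, and let $(\rho_n)_{n\in\mathbb{N}}$ be a sequence of nonnegative measurable functions on $(0,\infty)$ (radial mollifiers) such that $$ \lim_{n\to+\infty}\int_\delta^\infty\rho_n(r)\,r^{N-1-p}\,dr=0\ \text{ for all }\delta>0,\qquad \int_0^1\rho_n(r)\,r^{N-1}\,dr=1\ \text{ for all } n . $$ Then, for every $u\in W^{1,p}_{A,K}(\mathbb{R}^N)$, $$ \lim_{n\to+\infty}\iint_{\mathbb{R}^{2N}}\frac{|\Psi_u(x,y)-\Psi_u(x,x)|_p^p}{\|x-y\|_K^p}\,\rho_n(\|x-y\|_K)\,dx\,dy=p\int_{\mathbb{R}^N}\|\nabla u-\mathrm{i}A(x)u\|_{Z_p^*K}^p\,dx . $$ Furthermore, if $p=1$ and $u\in BV_{A,K}(\mathbb{R}^N)$, then $$ \lim_{n\to+\infty}\iint_{\mathbb{R}^{2N}}\frac{|\Psi_u(x,y)-\Psi_u(x,x)|_1}{\|x-y\|_K}\,\rho_n(\|x-y\|_K)\,dx\,dy=|Du|_{A,K}. $$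
   Context: $K\subset\mathbb{R}^N$ is a convex, symmetric (about the origin) set containing the origin such that $\|x\|_K:=\inf\{\lambda>0: x/\lambda\in K\}$ is a norm on $\mathbb{R}^N$ with unit ball $K$ (so $K$ is a compact convex symmetric set with nonempty interior). $|\cdot|$ is the Euclidean norm on $\mathbb{R}^N$. For $p\ge1$ and $z\in\mathbb{C}^N$, $|z|_p:=\big(|(\Re z_1,\dots,\Re z_N)|^p+|(\Im z_1,\dots,\Im z_N)|^p\big)^{1/p}$; likewise for $z\in\mathbb{C}$, $|z|_p:=(|\Re z|^p+|\Im z|^p)^{1/p}$. For $v\in\mathbb{C}^N$, $x\in\mathbb{R}^N$, $v\cdot x=\sum_j v_jx_j\in\mathbb{C}$, and $$\|v\|_{Z_p^*K}:=\Big(\frac{N+p}{p}\int_K|v\cdot x|_p^p\,dx\Big)^{1/p}.$$ $L^p(\mathbb{R}^N,\mathbb{C})$ is the space of measurable $u:\mathbb{R}^N\to\mathbb{C}$ with $\int_{\mathbb{R}^N}|u|_p^p\,dx<\infty$. $W^{1,p}_{A,K}(\mathbb{R}^N)$ is the space of $u\in L^p(\mathbb{R}^N,\mathbb{C})$ (with weak gradient $\nabla u$) such that $\int_{\mathbb{R}^N}\|\nabla u-\mathrm{i}A(x)u\|_{Z_p^*K}^p\,dx<\infty$. For $u:\mathbb{R}^N\to\mathbb{C}$, $\Psi_u(x,y):=e^{\mathrm{i}(x-y)\cdot A\left(\frac{x+y}{2}\right)}u(y)$ for $x,y\in\mathbb{R}^N$ (so $\Psi_u(x,x)=u(x)$).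 $\|\cdot\|_{Z_1^*K^*}$ is the dual norm of $\|\cdot\|_{Z_1^*K}$ on $\mathbb{R}^N$: $\|v\|_{Z_1^*K^*}:=\sup\{\sum_j v_jw_j: w\in\mathbb{R}^N,\ \|w\|_{Z_1^*K}\le1\}$. For complex-valued $u\in L^1_{\rm loc}(\mathbb{R}^N)$, $|Du|_{A,K}:=C_{1,A,K,u}+C_{2,A,K,u}$, where $$C_{1,A,K,u}:=\sup_{\varphi}\int_{\mathbb{R}^N}\big(\Re u\,\mathrm{div}\,\varphi-A\cdot\varphi\,\Im u\big)\,dx,\qquad C_{2,A,K,u}:=\sup_{\varphi}\int_{\mathbb{R}^N}\big(\Im u\,\mathrm{div}\,\varphi+A\cdot\varphi\,\Re u\big)\,dx,$$ both suprema over $\varphi\in C^1_c(\mathbb{R}^N,\mathbb{R}^N)$ with $\|\varphi(x)\|_{Z_1^*K^*}\le1$ for all $x\in\mathbb{R}^N$. $BV_{A,K}(\mathbb{R}^N)$ is the set of complex-valued $u\in L^1(\mathbb{R}^N)$ with $|Du|_{A,K}<\infty$. *)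

theory Defs
  imports "HOL-Analysis.Analysis"
begin

section \<open>Norms attached to the convex body\<close>

text \<open>The infimum is taken in the reals, so it is unspecified if no dilate of \<open>K\<close> contains \<open>x\<close>;
  this cannot happen for any \<open>x\<close> once \<open>gauge_norm K\<close> is a norm.\<close>

definition gauge_norm :: "(real^'n) set \<Rightarrow> real^'n \<Rightarrow> real" where
  "gauge_norm K x = Inf {t. t > 0 \<and> x /\<^sub>R t \<in> K}"

definition is_norm :: "('a::real_vector \<Rightarrow> real) \<Rightarrow> bool" where
  "is_norm f \<longleftrightarrow>
     (\<forall>x. 0 \<le> f x) \<and> (\<forall>x. f x = 0 \<longleftrightarrow> x = 0) \<and>
     (\<forall>c x. f (c *\<^sub>R x) = \<bar>c\<bar> * f x) \<and> (\<forall>x y. f (x + y) \<le> f x + f y)"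

definition cnorm_p :: "real \<Rightarrow> complex \<Rightarrow> real" where
  "cnorm_p p z = (\<bar>Re z\<bar> powr p + \<bar>Im z\<bar> powr p) powr (1 / p)"

definition cvec :: "real^'n \<Rightarrow> complex^'n" where
  "cvec w = (\<chi> j. complex_of_real (w $ j))"

text \<open>The bilinear pairing (no complex conjugation).\<close>

definition cdot :: "complex^'n \<Rightarrow> real^'n \<Rightarrow> complex" where
  "cdot v x = (\<Sum>j\<in>UNIV. v $ j * complex_of_real (x $ j))"

definition zstar_norm :: "real \<Rightarrow> (real^'n) set \<Rightarrow> complex^'n \<Rightarrow> real" where
  "zstar_norm p K v =
     ((real CARD('n) + p) / p * (LINT x:K|lebesgue. cnorm_p p (cdot v x) powr p)) powr (1 / p)"

definition zstar1_dual_norm :: "(real^'n) set \<Rightarrow> real^'n \<Rightarrow> real" where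
  "zstar1_dual_norm K v = (SUP w\<in>{w. zstar_norm 1 K (cvec w) \<le> 1}. v \<bullet> w)"

section \<open>Test functions and weak gradients\<close>

definition partial :: "'n \<Rightarrow> (real^'n \<Rightarrow> 'b::real_normed_vector) \<Rightarrow> real^'n \<Rightarrow> 'b" where
  "partial j f x = frechet_derivative f (at x) (axis j 1)"

primrec Ck :: "nat \<Rightarrow> (real^'n \<Rightarrow> 'b::real_normed_vector) \<Rightarrow> bool" where
  "Ck 0 f = continuous_on UNIV f"
| "Ck (Suc k) f = ((\<forall>x. f differentiable (at x)) \<and> (\<forall>j. Ck k (partial j f)))"

definition has_compact_support :: "(real^'n \<Rightarrow> 'b::zero) \<Rightarrow> bool" where
  "has_compact_support f \<longleftrightarrow> compact (closure {x. f x \<noteq> 0})"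

definition divergence :: "(real^'n \<Rightarrow> real^'n) \<Rightarrow> real^'n \<Rightarrow> real" where
  "divergence \<phi> x = (\<Sum>j\<in>UNIV. partial j \<phi> x $ j)"

definition loc_integrable :: "(real^'n \<Rightarrow> 'b::euclidean_space) \<Rightarrow> bool" where
  "loc_integrable f \<longleftrightarrow> (\<forall>S. compact S \<longrightarrow> f absolutely_integrable_on S)"

definition has_weak_gradient :: "(real^'n \<Rightarrow> complex) \<Rightarrow> (real^'n \<Rightarrow> complex^'n) \<Rightarrow> bool" where
  "has_weak_gradient u G \<longleftrightarrow>
     loc_integrable u \<and> loc_integrable G \<and>
     (\<forall>\<phi> :: real^'n \<Rightarrow> real. (\<forall>k. Ck k \<phi>) \<and> has_compact_support \<phi> \<longrightarrow>
        (\<forall>j. (LINT x|lebesgue. partial j \<phi> x *\<^sub>R u x) = - (LINT x|lebesgue. \<phi> x *\<^sub>R (G x $ j))))"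

section \<open>Magnetic function spaces\<close>

definition Lp :: "real \<Rightarrow> (real^'n \<Rightarrow> complex) set" where
  "Lp p = {u \<in> borel_measurable lebesgue.
             (\<integral>\<^sup>+ x. ennreal (cnorm_p p (u x) powr p) \<partial>lebesgue) < \<infinity>}"

text \<open>\<open>magnetic_gradient A u G x\<close> is \<open>\<nabla>u(x) - \<i> A(x) u(x)\<close> when \<open>G\<close> is the weak gradient of \<open>u\<close>.\<close>

definition magnetic_gradient ::
  "(real^'n \<Rightarrow> real^'n) \<Rightarrow> (real^'n \<Rightarrow> complex) \<Rightarrow> (real^'n \<Rightarrow> complex^'n) \<Rightarrow> real^'n \<Rightarrow> complex^'n" where
  "magnetic_gradient A u G x = (\<chi> j. G x $ j - \<i> * complex_of_real (A x $ j) * u x)"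

definition magnetic_energy ::
  "real \<Rightarrow> (real^'n \<Rightarrow> real^'n) \<Rightarrow> (real^'n) set \<Rightarrow> (real^'n \<Rightarrow> complex) \<Rightarrow> (real^'n \<Rightarrow> complex^'n) \<Rightarrow> ennreal" where
  "magnetic_energy p A K u G =
     (\<integral>\<^sup>+ x. ennreal (zstar_norm p K (magnetic_gradient A u G x) powr p) \<partial>lebesgue)"

definition W_mag ::
  "real \<Rightarrow> (real^'n \<Rightarrow> real^'n) \<Rightarrow> (real^'n) set \<Rightarrow> (real^'n \<Rightarrow> complex) set" where
  "W_mag p A K = {u \<in> Lp p. \<exists>G. has_weak_gradient u G \<and> magnetic_energy p A K u G < \<infinity>}"

definition bv_tests :: "(real^'n) set \<Rightarrow> (real^'n \<Rightarrow> real^'n) set" where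
  "bv_tests K = {\<phi>. Ck 1 \<phi> \<and> has_compact_support \<phi> \<and> (\<forall>x. zstar1_dual_norm K (\<phi> x) \<le> 1)}"

definition C1_mag :: "(real^'n \<Rightarrow> real^'n) \<Rightarrow> (real^'n) set \<Rightarrow> (real^'n \<Rightarrow> complex) \<Rightarrow> ereal" where
  "C1_mag A K u = (SUP \<phi>\<in>bv_tests K.
     ereal (LINT x|lebesgue. Re (u x) * divergence \<phi> x - (A x \<bullet> \<phi> x) * Im (u x)))"

definition C2_mag :: "(real^'n \<Rightarrow> real^'n) \<Rightarrow> (real^'n) set \<Rightarrow> (real^'n \<Rightarrow> complex) \<Rightarrow> ereal" where
  "C2_mag A K u = (SUP \<phi>\<in>bv_tests K.
     ereal (LINT x|lebesgue. Im (u x) * divergence \<phi> x + (A x \<bullet> \<phi> x) * Re (u x)))"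

definition total_variation_mag ::
  "(real^'n \<Rightarrow> real^'n) \<Rightarrow> (real^'n) set \<Rightarrow> (real^'n \<Rightarrow> complex) \<Rightarrow> ereal" where
  "total_variation_mag A K u = C1_mag A K u + C2_mag A K u"

definition BV_mag :: "(real^'n \<Rightarrow> real^'n) \<Rightarrow> (real^'n) set \<Rightarrow> (real^'n \<Rightarrow> complex) set" where
  "BV_mag A K = {u. integrable lebesgue u \<and> total_variation_mag A K u < \<infinity>}"

section \<open>The nonlocal functional\<close>

definition Psi ::
  "(real^'n \<Rightarrow> real^'n) \<Rightarrow> (real^'n \<Rightarrow> complex) \<Rightarrow> real^'n \<Rightarrow> real^'n \<Rightarrow> complex" where
  "Psi A u x y = exp (\<i> * complex_of_real ((x - y) \<bullet> A ((x + y) /\<^sub>R 2))) * u y"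

text \<open>The integrand vanishes on the diagonal, so the value of \<open>\<rho>\<close> at \<open>0\<close> is irrelevant.\<close>

definition nonlocal_energy ::
  "real \<Rightarrow> (real^'n \<Rightarrow> real^'n) \<Rightarrow> (real^'n) set \<Rightarrow> (real \<Rightarrow> real) \<Rightarrow> (real^'n \<Rightarrow> complex) \<Rightarrow> ennreal" where
  "nonlocal_energy p A K \<rho> u =
     (\<integral>\<^sup>+ (x, y). ennreal (cnorm_p p (Psi A u x y - Psi A u x x) powr p
                         / gauge_norm K (x - y) powr p * \<rho> (gauge_norm K (x - y)))
        \<partial>(lebesgue :: ((real^'n) \<times> (real^'n)) measure))"

end

theory Submission
  imports Defs "HOL-Probability.Probability_Measure"
begin

text \<open>With \<open>y = x + h\<close> and polar coordinates for the norm of \<open>K\<close>, the double integral becomes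
  \<open>\<integral> \<rho>\<^sub>n(r) r powr (N - 1) * S(r) dr\<close> over \<open>r > 0\<close>, where \<open>S(r)\<close> (\<open>sphere_energy\<close>) integrates the
  \<open>p\<close>-th power of the magnetic difference quotients of \<open>u\<close> of step \<open>r\<close> over all directions
  (\<open>nonlocal_energy_eq\<close>). The hypotheses on \<open>\<rho>\<^sub>n\<close> make \<open>\<rho>\<^sub>n(r) r powr (N - 1) dr\<close> concentrate at
  \<open>r = 0\<close> with total mass tending to one there, and \<open>S(r)\<close> is bounded by a multiple of
  \<open>r powr (- p)\<close>, which the tail hypothesis controls. Hence the limit is \<open>lim S(r)\<close> as \<open>r \<rightarrow> 0\<close>
  (\<open>radial_limit\<close>), and the mollifiers \<open>\<rho>\<^sub>n\<close> leave the discussion.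

  To find \<open>lim S(r)\<close>, mollify: \<open>u\<^sub>m = \<eta>\<^sub>m * u\<close> and \<open>D\<^sub>m = \<nabla>u\<^sub>m - \<i> A u\<^sub>m\<close>. Write \<open>e(v)\<close> for the density
  \<open>p \<parallel>v\<parallel>\<^sup>p\<close> formed with the norm \<open>Z\<^sub>p\<^sup>* K\<close> (\<open>energy_density\<close>), and \<open>S\<^sub>v\<close> for the function \<open>S\<close> of \<open>v\<close>.
  Four estimates compare \<open>S\<close> with the energies \<open>\<integral> e(D\<^sub>m)\<close>.

  \<^item> For smooth \<open>v\<close>, \<open>S\<^sub>v(r)\<close> is at most \<open>\<integral> e(\<nabla>v - \<i> A v)\<close>, up to a weight and an error of order
    \<open>r\<close> (\<open>sphere_energy_smooth_le\<close>): integrate the derivative of the gauged function along the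
    segment from \<open>x\<close> to \<open>x + h\<close> and apply Jensen's inequality. The weight appears because the norm
    \<open>\<bar>z\<bar>\<^sub>p\<close> on the complex numbers is not invariant under rotations unless \<open>p = 2\<close>; it is close to
    one for small \<open>r\<close> wherever \<open>A\<close> is bounded, and never exceeds a constant.
  \<^item> For smooth \<open>v\<close>, \<open>\<integral> e(\<nabla>v - \<i> A v)\<close> is at most \<open>liminf S\<^sub>v(r)\<close>, by Fatou's lemma
    (\<open>energy_density_le_liminf_sphere_energy\<close>).
  \<^item> Mollifying increases \<open>S(r)\<close> at most by a factor tending to one and an error of order \<open>\<epsilon>\<close>, uniformly in
    \<open>r\<close> (\<open>sphere_energy_mollified_le\<close>).
  \<^item> \<open>S(r)\<close> is lower semicontinuous along the mollification (\<open>sphere_energy_le_liminf\<close>).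

  So if the energies \<open>\<integral> e(D\<^sub>m)\<close> tend to \<open>l\<close> and are tight at infinity, then \<open>S(r) \<rightarrow> l\<close>
  (\<open>sphere_energy_tendsto\<close>). Tightness is what removes the weight, as \<open>A\<close> may be unbounded.

  For \<open>u\<close> in the magnetic Sobolev space, \<open>D\<^sub>m\<close> is the mollification of \<open>\<nabla>u - \<i> A u\<close> up to an error
  of order \<open>\<epsilon>\<close>, by the Lipschitz bound on \<open>A\<close>, and Jensen's inequality gives convergence and
  tightness (\<open>Sobolev_sphere_energy_tendsto\<close>).

  For \<open>u\<close> of bounded variation and \<open>p = 1\<close>, the density splits as \<open>\<parallel>Re D\<^sub>m\<parallel> + \<parallel>Im D\<^sub>m\<parallel>\<close>, and
  \<open>Im D\<^sub>m\<close> is \<open>Re D\<^sub>m\<close> for the function \<open>-\<i> u\<close>, so the two suprema in \<open>\<bar>Du\<bar>\<close> are one problem. Write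
  \<open>bv_pairing u \<psi>\<close> for the integral under the first supremum. A test field bounds
  \<open>\<integral> \<parallel>Re D\<^sub>m\<parallel>\<close> from below since \<open>bv_pairing u\<^sub>m \<psi> = - \<integral> \<psi> \<bullet> Re D\<^sub>m\<close> (\<open>energy_lower\<close>). Conversely, the
  field in the dual ball that attains the norm of \<open>Re D\<^sub>m(x)\<close> is given by a formula; after
  mollification it is a test field, and moving the mollifier between field and function costs only
  \<open>O(\<epsilon>)\<close> (\<open>energy_upper\<close>). Tightness holds because such a field, placed away from the support of
  an almost optimal test field, can be added to it (\<open>energy_tight\<close>).\<close>

section \<open>Smooth mollifiers\<close>

text \<open>The functions \<open>q(1/t) exp (-1/t)\<close>, extended by zero to \<open>t \<le> 0\<close>. The polynomial factor makes the
  class closed under differentiation, so that smoothness of the standard bump function follows from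
  one derivative computation.\<close>

definition flat_exp :: "real poly \<Rightarrow> real \<Rightarrow> real" where
  "flat_exp q t = (if t > 0 then poly q (1 / t) * exp (- (1 / t)) else 0)"

lemma poly_times_exp_neg_tendsto_0:
  "((\<lambda>s. poly q s * exp (- s)) \<longlongrightarrow> (0::real)) at_top"
proof -
  have "((\<lambda>s. \<Sum>i\<le>degree q. coeff q i * (s ^ i / exp s)) \<longlongrightarrow> (\<Sum>i\<le>degree q. coeff q i * 0)) at_top"
    by (intro tendsto_sum tendsto_mult tendsto_const tendsto_power_div_exp_0)
  moreover have "(\<lambda>s. \<Sum>i\<le>degree q. coeff q i * (s ^ i / exp s)) = (\<lambda>s. poly q s * exp (- s))"
    by (auto simp: poly_altdef sum_distrib_right exp_minus divide_inverse mult.assoc)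
  ultimately show ?thesis by simp
qed

lemma flat_exp_has_derivative:
  "(flat_exp q has_field_derivative flat_exp ([:0, 0, 1:] * (q - pderiv q)) t) (at t)"
proof -
  consider "t > 0" | "t < 0" | "t = 0" by linarith
  then show ?thesis
  proof cases
    case 1
    have "((\<lambda>t. poly q (1 / t) * exp (- (1 / t))) has_field_derivative
            flat_exp ([:0, 0, 1:] * (q - pderiv q)) t) (at t)"
      using 1 by (auto intro!: derivative_eq_intros poly_DERIV[THEN DERIV_chain2]
          simp: flat_exp_def field_simps power2_eq_square)
    then show ?thesis
      by (rule has_field_derivative_transform_within[OF _ 1]) (auto simp: flat_exp_def dist_real_def)
  next
    case 2
    have "((\<lambda>t. 0) has_field_derivative flat_exp ([:0, 0, 1:] * (q - pderiv q)) t) (at t)"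
      using 2 by (auto simp: flat_exp_def)
    then show ?thesis
      by (rule has_field_derivative_transform_within[of _ _ _ _ "-t"])
        (use 2 in \<open>auto simp: flat_exp_def dist_real_def\<close>)
  next
    case 3
    have "((\<lambda>h. flat_exp q h / h) \<longlongrightarrow> 0) (at_right 0)"
    proof -
      have "((\<lambda>h::real. poly ([:0,1:] * q) (inverse h) * exp (- inverse h)) \<longlongrightarrow> 0) (at_right 0)"
        by (rule filterlim_compose[OF poly_times_exp_neg_tendsto_0 filterlim_inverse_at_top_right])
      moreover have "eventually (\<lambda>h. poly ([:0,1:] * q) (inverse h) * exp (- inverse h) = flat_exp q h / h)
          (at_right 0)"
        by (auto simp: eventually_at_right_less flat_exp_def field_simps intro!: eventually_at_rightI[of 0 1])
      ultimately show ?thesis by (rule Lim_transform_eventually)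
    qed
    moreover have "((\<lambda>h. flat_exp q h / h) \<longlongrightarrow> 0) (at_left 0)"
      by (rule Lim_transform_eventually[OF tendsto_const[of 0]])
        (auto simp: flat_exp_def intro!: eventually_at_leftI[of "-1" 0])
    ultimately have "((\<lambda>h. flat_exp q h / h) \<longlongrightarrow> 0) (at 0)"
      by (simp add: filterlim_at_split)
    then show ?thesis using 3 by (simp add: has_field_derivative_iff flat_exp_def)
  qed
qed

lemma continuous_flat_exp: "continuous_on UNIV (flat_exp q)"
  by (meson DERIV_continuous_on flat_exp_has_derivative has_field_derivative_at_within)

lemma flat_exp_chain:
  fixes f :: "'a::real_normed_vector \<Rightarrow> real"
  assumes "(f has_derivative f') (at x)"
  shows "((\<lambda>x. flat_exp q (f x)) has_derivative
    (\<lambda>h. flat_exp ([:0, 0, 1:] * (q - pderiv q)) (f x) * f' h)) (at x)"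
  using has_derivative_compose[OF assms, of "flat_exp q"] flat_exp_has_derivative
  by (simp add: has_field_derivative_def)

lemma partial_eqI: "(f has_derivative f') (at x) \<Longrightarrow> partial j f x = f' (axis j 1)"
  unfolding partial_def using frechet_derivative_at by force

lemma Ck_continuous: "Ck k f \<Longrightarrow> continuous_on UNIV f"
  by (cases k) (simp_all add: continuous_on_eq_continuous_at[OF open_UNIV] differentiable_imp_continuous_within)

lemma Ck_mono: "Ck (Suc k) f \<Longrightarrow> Ck k f"
proof (induction k arbitrary: f)
  case 0 then show ?case using Ck_continuous[of "Suc 0" f] by simp
next
  case (Suc k)
  then show ?case by (metis Ck.simps(2))
qed

lemma differentiable_has_partials:
  assumes "f differentiable (at x)"
  shows "(f has_derivative (\<lambda>h. \<Sum>j\<in>UNIV. h $ j *\<^sub>R partial j f x)) (at (x::real^'n))"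
proof -
  obtain f' where f': "(f has_derivative f') (at x)" using assms by (auto simp: differentiable_def)
  have lin: "linear f'" using f' by (rule has_derivative_linear)
  have "f' h = (\<Sum>j\<in>UNIV. h $ j *\<^sub>R partial j f x)" for h
  proof -
    have "f' h = f' (\<Sum>j\<in>UNIV. h $ j *\<^sub>R axis j 1)"
      using basis_expansion[of h] by (simp add: scalar_mult_eq_scaleR)
    also have "\<dots> = (\<Sum>j\<in>UNIV. h $ j *\<^sub>R f' (axis j 1))"
      using lin by (simp add: linear_sum linear_cmul)
    finally show ?thesis using partial_eqI[OF f'] by simp
  qed
  then have "f' = (\<lambda>h. \<Sum>j\<in>UNIV. h $ j *\<^sub>R partial j f x)" by auto
  then show ?thesis using f' by simp
qed

lemma Ck_mult:
  fixes f g :: "real^'n \<Rightarrow> real"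
  assumes "Ck k f" "Ck k g"
  shows "Ck k (\<lambda>x. f x * g x)"
  using assms
proof (induction k arbitrary: f g)
  case 0 then show ?case by (auto intro: continuous_intros)
next
  case (Suc k)
  note fd = frechet_derivative_works[THEN iffD1]
  have add: "Ck k f \<Longrightarrow> Ck k g \<Longrightarrow> Ck k (\<lambda>x. f x + g x)" for f g :: "real^'n \<Rightarrow> real" and k
  proof (induction k arbitrary: f g)
    case 0 then show ?case by (auto intro: continuous_intros)
  next
    case (Suc k)
    then have "partial j (\<lambda>x. f x + g x) = (\<lambda>x. partial j f x + partial j g x)" for j
      using partial_eqI[OF has_derivative_add[OF fd fd], of f _ g j] by (intro ext) (simp add: partial_def)
    with Suc show ?case by auto
  qed
  have p: "partial j (\<lambda>x. f x * g x) = (\<lambda>x. f x * partial j g x + partial j f x * g x)" for j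
    using Suc.prems
    using partial_eqI[OF has_derivative_mult[OF fd fd], of f _ g j] by (intro ext) (simp add: partial_def)
  show ?case unfolding Ck.simps p
    using Suc Ck_mono[OF Suc.prems(1)] Ck_mono[OF Suc.prems(2)]
    by (auto intro!: add Suc.IH differentiable_mult)
qed

lemma Ck_const: "Ck k (\<lambda>x::real^'n. c::real)"
proof (induction k arbitrary: c)
  case (Suc k)
  have "partial j (\<lambda>x::real^'n. c) = (\<lambda>x. 0)" for j by (auto simp: partial_eqI[OF has_derivative_const])
  with Suc show ?case by auto
qed auto

lemma Ck_component: "Ck k (\<lambda>x::real^'n. c * x $ i :: real)"
proof (cases k)
  case (Suc l)
  have "((\<lambda>x::real^'n. c * x $ i) has_derivative (\<lambda>h. c * h $ i)) (at x)" for x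
    by (auto intro!: derivative_eq_intros bounded_linear.has_derivative[OF bounded_linear_vec_nth])
  from partial_eqI[OF this] have "partial j (\<lambda>x::real^'n. c * x $ i) = (\<lambda>x. c * axis j 1 $ i)" for j by auto
  moreover have "(\<lambda>x::real^'n. c * x $ i) differentiable (at x)" for x
    unfolding differentiable_def
    by (rule exI[of _ "\<lambda>h. c * h $ i"])
      (auto intro!: derivative_eq_intros bounded_linear.has_derivative[OF bounded_linear_vec_nth])
  ultimately show ?thesis using Suc Ck_const by auto
qed (auto intro!: continuous_intros)

lemma Ck_translate:
  fixes f :: "real^'n \<Rightarrow> 'b::real_normed_vector"
  assumes "Ck k f" shows "Ck k (\<lambda>y. f (y - x))"
proof -
  have d: "((\<lambda>y. f (y - x)) has_derivative frechet_derivative f (at (y - x))) (at y)"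
    if "\<forall>x. f differentiable (at x)" for f :: "real^'n \<Rightarrow> 'b" and y
  proof -
    have "(f has_derivative frechet_derivative f (at (y - x))) (at (y - x))"
      using that frechet_derivative_works by blast
    then show ?thesis
      using has_derivative_compose[of "\<lambda>y. y - x" "\<lambda>h. h" y UNIV f "frechet_derivative f (at (y - x))"]
      by (simp add: has_derivative_diff[OF has_derivative_ident has_derivative_const, simplified])
  qed
  show ?thesis using assms
  proof (induction k arbitrary: f)
    case 0 then show ?case by (auto intro!: continuous_on_compose2[of UNIV f] continuous_intros)
  next
    case (Suc k)
    then have df: "\<forall>x. f differentiable (at x)" by auto
    have "partial j (\<lambda>y. f (y - x)) = (\<lambda>y. partial j f (y - x))" for j
      using partial_eqI[OF d[OF df]] by (auto simp: partial_def)
    moreover have "(\<lambda>y. f (y - x)) differentiable (at y)" for y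
      using d[OF df] by (auto simp: differentiable_def)
    ultimately show ?case using Suc by auto
  qed
qed

text \<open>Each partial derivative is the product of a linear function and a function of the same kind with
  another polynomial, so induction on \<open>k\<close> works for all polynomials at once.\<close>

lemma Ck_flat_exp_radial: "Ck k (\<lambda>x::real^'n. flat_exp q (a - (norm x)\<^sup>2))"
proof (induction k arbitrary: q)
  case 0 show ?case
    by (auto intro!: continuous_on_compose2[OF continuous_flat_exp] continuous_intros)
next
  case (Suc k)
  let ?q = "[:0, 0, 1:] * (q - pderiv q)"
  have "((\<lambda>x::real^'n. a - (norm x)\<^sup>2) has_derivative (\<lambda>h. - (2 * (x \<bullet> h)))) (at x)" for x
    unfolding dot_square_norm[symmetric]
    by (auto intro!: derivative_eq_intros simp: inner_commute)
  note D = flat_exp_chain[OF this, of q]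
  have "partial j (\<lambda>x::real^'n. flat_exp q (a - (norm x)\<^sup>2))
      = (\<lambda>x. flat_exp ?q (a - (norm x)\<^sup>2) * ((- 2) * x $ j))" for j
    using partial_eqI[OF D] by (auto simp: inner_axis)
  moreover have "(\<lambda>x::real^'n. flat_exp q (a - (norm x)\<^sup>2)) differentiable (at x)" for x
    using D by (auto simp: differentiable_def)
  ultimately show ?case
    using Ck_mult[OF Suc[of ?q] Ck_component[of k "-2"]] unfolding Ck.simps by presburger
qed

text \<open>Evenness lets a mollifier be moved from one factor of an integral to the other without a
  reflection, and \<open>\<epsilon> \<le> 1\<close> keeps all error terms linear in \<open>\<epsilon>\<close>.\<close>

definition mollifier :: "(real^'n \<Rightarrow> real) \<Rightarrow> real \<Rightarrow> bool" where
  "mollifier \<eta> \<epsilon> \<longleftrightarrow> 0 < \<epsilon> \<and> \<epsilon> \<le> 1 \<and> (\<forall>k. Ck k \<eta>) \<and> (\<forall>x. 0 \<le> \<eta> x) \<and> (\<forall>x. \<eta> (- x) = \<eta> x)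
     \<and> (\<forall>x. \<epsilon> \<le> norm x \<longrightarrow> \<eta> x = 0) \<and> (\<integral>\<^sup>+x. ennreal (\<eta> x) \<partial>lborel) = 1"

lemma mollifier_exists:
  assumes "0 < \<epsilon>" "\<epsilon> \<le> 1"
  shows "\<exists>\<eta>::real^'n \<Rightarrow> real. mollifier \<eta> \<epsilon>"
proof -
  define b where "b = (\<lambda>x::real^'n. flat_exp 1 (\<epsilon>\<^sup>2 - (norm x)\<^sup>2))"
  have Ckb: "Ck k b" for k unfolding b_def by (rule Ck_flat_exp_radial)
  have cont: "continuous_on UNIV b" using Ck_continuous[OF Ckb] .
  have [measurable]: "b \<in> borel_measurable borel" by (rule borel_measurable_continuous_onI[OF cont])
  have b0: "0 \<le> b x" and b1: "b x \<le> 1" for x by (auto simp: b_def flat_exp_def)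
  have bz: "b x = 0" if "\<epsilon> \<le> norm x" for x
  proof -
    have "\<epsilon>\<^sup>2 \<le> (norm x)\<^sup>2" using that assms by (intro power_mono) auto
    then show ?thesis by (simp add: b_def flat_exp_def)
  qed
  have bp: "b x > 0" if "norm x < \<epsilon>" for x
    using power_strict_mono[OF that, of 2] by (auto simp: b_def flat_exp_def)
  define I where "I = (\<integral>\<^sup>+x. ennreal (b x) \<partial>lborel)"
  have "ennreal (b x) \<le> indicator (cball 0 \<epsilon>) x" for x
    using b1[of x] bz[of x] by (auto simp: indicator_def)
  then have "I \<le> (\<integral>\<^sup>+x. indicator (cball (0::real^'n) \<epsilon>) x \<partial>lborel)"
    unfolding I_def by (rule nn_integral_mono)
  also have "\<dots> < \<infinity>" using emeasure_lborel_cball_finite[of 0 \<epsilon>] by (simp add: top.not_eq_extremum)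
  finally have fin: "I < \<infinity>" .
  have "I \<noteq> 0"
  proof
    assume "I = 0"
    then have "AE x in lborel. b x = 0" unfolding I_def
      by (subst (asm) nn_integral_0_iff_AE) (auto simp: b0 order.antisym)
    then have "AE x in lborel. x \<notin> ball (0::real^'n) \<epsilon>"
    proof (rule eventually_mono)
      fix x assume "b x = 0" then show "x \<notin> ball 0 \<epsilon>" using bp[of x] by auto
    qed
    then have "emeasure lborel (ball (0::real^'n) \<epsilon>) = 0" 
      using AE_iff_measurable[of "ball (0::real^'n) \<epsilon>" lborel "\<lambda>x. x \<notin> ball 0 \<epsilon>"]
      by (simp add: ball_def)
    then show False using open_not_negligible[of "ball (0::real^'n) \<epsilon>"] assms
      by (auto simp: negligible_iff_emeasure0 emeasure_completion)
  qed
  define c where "c = enn2real I"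
  have c: "c > 0" "I = ennreal c" using fin \<open>I \<noteq> 0\<close> 
    by (auto simp: c_def enn2real_positive_iff less_top zero_less_iff_neq_zero)
  have "mollifier (\<lambda>x. inverse c * b x) \<epsilon>"
    unfolding mollifier_def
  proof (intro conjI allI impI)
    show "Ck k (\<lambda>x. inverse c * b x)" for k by (intro Ck_mult Ck_const Ckb)
    have "(\<integral>\<^sup>+x. ennreal (inverse c * b x) \<partial>lborel) = ennreal (inverse c) * I"
      unfolding I_def using c by (subst nn_integral_cmult[symmetric]) (auto simp: ennreal_mult b0)
    also have "\<dots> = 1" using c by (simp add: ennreal_mult[symmetric])
    finally show "(\<integral>\<^sup>+x. ennreal (inverse c * b x) \<partial>lborel) = 1" .
  qed (use assms c b0 bz in \<open>auto simp: b_def\<close>)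
  then show ?thesis by blast
qed

section \<open>Powers of the p-norm on the complex numbers\<close>

text \<open>This is \<open>cnorm_p p z powr p\<close> for \<open>p \<ge> 1\<close>, without the outer roots. It is convex and homogeneous of
  degree \<open>p\<close>.\<close>

definition norm_pow :: "real \<Rightarrow> complex \<Rightarrow> real" where
  "norm_pow p z = \<bar>Re z\<bar> powr p + \<bar>Im z\<bar> powr p"

lemma norm_pow_nonneg [simp]: "0 \<le> norm_pow p z" by (simp add: norm_pow_def)

lemma norm_pow_zero [simp]: "norm_pow p 0 = 0" by (simp add: norm_pow_def)

lemma norm_pow_scale: "norm_pow p (of_real c * z) = \<bar>c\<bar> powr p * norm_pow p z"
  by (simp add: norm_pow_def abs_mult powr_mult distrib_left)

lemma continuous_norm_pow [continuous_intros]: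
  "0 < p \<Longrightarrow> continuous_on S f \<Longrightarrow> continuous_on S (\<lambda>x. norm_pow p (f x))"
  unfolding norm_pow_def by (auto intro!: continuous_intros continuous_on_powr')

lemma norm_pow_measurable [measurable (raw)]:
  assumes [measurable]: "f \<in> borel_measurable M"
  shows "(\<lambda>x. norm_pow p (f x)) \<in> borel_measurable M"
  unfolding norm_pow_def by measurable

lemma convex_on_abs_powr:
  assumes "1 \<le> p" shows "convex_on UNIV (\<lambda>x::real. \<bar>x\<bar> powr p)"
proof (rule convex_onI)
  fix t x y :: real assume t: "0 < t" "t < 1"
  have key: "((1 - t) * a + t * b) powr p \<le> (1 - t) * a powr p + t * b powr p"
    if ab: "0 \<le> a" "0 \<le> b" for a b
  proof (cases "a = 0 \<or> b = 0")
    case True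
    have s: "(s * c) powr p \<le> s * c powr p" if "0 < s" "s < 1" "0 \<le> c" for s c :: real
      using powr_le_one_le[of s p] that assms by (simp add: powr_mult mult_right_mono)
    show ?thesis using True s[of t b] s[of "1 - t" a] t ab by auto
  next
    case False
    then show ?thesis
      using convex_onD[OF powr_convex[OF assms], of t a b] t ab by simp
  qed
  have "\<bar>(1 - t) *\<^sub>R x + t *\<^sub>R y\<bar> powr p \<le> ((1 - t) * \<bar>x\<bar> + t * \<bar>y\<bar>) powr p"
    using t abs_triangle_ineq[of "(1 - t) * x" "t * y"] assms
    by (intro powr_mono2) (auto simp: abs_mult)
  also have "\<dots> \<le> (1 - t) * \<bar>x\<bar> powr p + t * \<bar>y\<bar> powr p" by (rule key) auto
  finally show "\<bar>(1 - t) *\<^sub>R x + t *\<^sub>R y\<bar> powr p \<le> (1 - t) * \<bar>x\<bar> powr p + t * \<bar>y\<bar> powr p" .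
qed auto

text \<open>Convexity with the weights \<open>1/(1+l)\<close> and \<open>l/(1+l)\<close>. With \<open>l\<close> small, the first term keeps a constant
  close to one, at the price of a large constant on the second; in the applications the second term
  is of order \<open>l powr p\<close>, which pays for it.\<close>

lemma norm_pow_add_le:
  assumes p: "1 \<le> p" and l: "0 < l"
  shows "norm_pow p (a + b) \<le> (1 + l) powr (p - 1) * norm_pow p a + (1 + 1 / l) powr (p - 1) * norm_pow p b"
proof -
  have key: "\<bar>x + y\<bar> powr p \<le> (1 + l) powr (p - 1) * \<bar>x\<bar> powr p + (1 + 1 / l) powr (p - 1) * \<bar>y\<bar> powr p"
    for x y :: real
  proof -
    define t where "t = l / (1 + l)"
    have t: "0 < t" "t < 1" and t1: "1 - t = 1 / (1 + l)" "1 / t = 1 + 1 / l"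
      using l by (auto simp: t_def field_simps)
    have eq: "x + y = (1 - t) *\<^sub>R (x / (1 - t)) + t *\<^sub>R (y / t)" using t by simp
    have sc: "s * \<bar>z / s\<bar> powr p = (1 / s) powr (p - 1) * \<bar>z\<bar> powr p" if "0 < s" for s z :: real
      using that by (simp add: abs_mult powr_divide powr_diff)
    have "\<bar>x + y\<bar> powr p \<le> (1 - t) * \<bar>x / (1 - t)\<bar> powr p + t * \<bar>y / t\<bar> powr p"
      unfolding eq using t by (intro convex_onD[OF convex_on_abs_powr[OF p]]) auto
    also have "\<dots> = (1 / (1 - t)) powr (p - 1) * \<bar>x\<bar> powr p + (1 / t) powr (p - 1) * \<bar>y\<bar> powr p"
      using t by (simp only: sc)
    finally show ?thesis using t1 by simp
  qed
  show ?thesis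
    using key[of "Re a" "Re b"] key[of "Im a" "Im b"] by (simp add: norm_pow_def distrib_left)
qed

lemma norm_pow_mult_le:
  assumes p: "1 \<le> p"
  shows "norm_pow p (w * z) \<le> (\<bar>Re w\<bar> + \<bar>Im w\<bar>) powr p * norm_pow p z"
proof (cases "w = 0")
  case False
  define m where "m = \<bar>Re w\<bar> + \<bar>Im w\<bar>"
  have m: "m > 0" using False unfolding m_def by (auto simp: complex_eq_iff)
  define t where "t = \<bar>Im w\<bar> / m"
  have t: "0 \<le> t" "t \<le> 1" "m * t = \<bar>Im w\<bar>" "m * (1 - t) = \<bar>Re w\<bar>"
    using m by (auto simp: t_def m_def field_simps)
  have key: "\<bar>c\<bar> powr p \<le> m powr p * ((1 - t) * \<bar>x\<bar> powr p + t * \<bar>y\<bar> powr p)"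
    if "\<bar>c\<bar> \<le> \<bar>Re w\<bar> * \<bar>x\<bar> + \<bar>Im w\<bar> * \<bar>y\<bar>" for c x y :: real
  proof -
    have "\<bar>Re w\<bar> * \<bar>x\<bar> + \<bar>Im w\<bar> * \<bar>y\<bar> = m * ((1 - t) * \<bar>x\<bar> + t * \<bar>y\<bar>)"
      unfolding t(3,4)[symmetric] by (simp add: algebra_simps)
    then have "\<bar>c\<bar> powr p \<le> (m * ((1 - t) * \<bar>x\<bar> + t * \<bar>y\<bar>)) powr p"
      using that p by (intro powr_mono2) auto
    also have "\<dots> = m powr p * \<bar>(1 - t) *\<^sub>R \<bar>x\<bar> + t *\<^sub>R \<bar>y\<bar>\<bar> powr p"
      using t m by (simp add: powr_mult)
    also have "\<dots> \<le> m powr p * ((1 - t) * \<bar>\<bar>x\<bar>\<bar> powr p + t * \<bar>\<bar>y\<bar>\<bar> powr p)"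
      using t by (intro mult_left_mono convex_onD[OF convex_on_abs_powr[OF p]]) auto
    finally show ?thesis by simp
  qed
  have "\<bar>Re (w * z)\<bar> powr p \<le> m powr p * ((1 - t) * \<bar>Re z\<bar> powr p + t * \<bar>Im z\<bar> powr p)"
    by (rule key) (metis abs_mult abs_triangle_ineq4 times_complex.simps(1))
  moreover have "\<bar>Im (w * z)\<bar> powr p \<le> m powr p * ((1 - t) * \<bar>Im z\<bar> powr p + t * \<bar>Re z\<bar> powr p)"
    by (rule key) (metis abs_mult abs_triangle_ineq times_complex.simps(2))
  ultimately have "norm_pow p (w * z) \<le> m powr p * ((1 - t) * \<bar>Re z\<bar> powr p + t * \<bar>Im z\<bar> powr p)
      + m powr p * ((1 - t) * \<bar>Im z\<bar> powr p + t * \<bar>Re z\<bar> powr p)"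
    unfolding norm_pow_def by (rule add_mono)
  also have "\<dots> = m powr p * norm_pow p z" unfolding norm_pow_def by (simp add: algebra_simps)
  finally show ?thesis unfolding m_def .
qed simp

lemma norm_pow_mult_le_norm:
  assumes p: "1 \<le> p" and "cmod w \<le> c"
  shows "norm_pow p (w * z) \<le> (2 * c) powr p * norm_pow p z"
proof -
  have "\<bar>Re w\<bar> + \<bar>Im w\<bar> \<le> 2 * c"
    using abs_Re_le_cmod[of w] abs_Im_le_cmod[of w] assms by linarith
  then have "(\<bar>Re w\<bar> + \<bar>Im w\<bar>) powr p \<le> (2 * c) powr p" using p by (intro powr_mono2) auto
  then show ?thesis using norm_pow_mult_le[OF p, of w z] norm_pow_nonneg[of p z]
    by (meson mult_right_mono order_trans)
qed

text \<open>A rotation does not preserve the norm \<open>\<bar>z\<bar>\<^sub>p\<close>. It acts with operator norm at most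
  \<open>\<bar>cos a\<bar> + \<bar>sin a\<bar>\<close>, which is at most two and tends to one for small angles.\<close>

lemma norm_pow_cis_le:
  assumes p: "1 \<le> p" and "\<bar>a\<bar> \<le> b"
  shows "norm_pow p (cis a * z) \<le> (min 2 (1 + b)) powr p * norm_pow p z"
proof -
  have "\<bar>Re (cis a)\<bar> + \<bar>Im (cis a)\<bar> \<le> min 2 (1 + b)"
    using abs_sin_x_le_abs_x[of a] abs_cos_le_one[of a] abs_sin_le_one[of a] assms
    by (simp del: abs_cos_le_one abs_sin_le_one)
  then have "(\<bar>Re (cis a)\<bar> + \<bar>Im (cis a)\<bar>) powr p \<le> (min 2 (1 + b)) powr p"
    using p by (intro powr_mono2) auto
  then show ?thesis using norm_pow_mult_le[OF p, of "cis a" z] norm_pow_nonneg[of p z]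
    by (meson mult_right_mono order_trans)
qed

lemma abs_powr_Jensen:
  assumes "prob_space M" "1 \<le> p" and X: "integrable M (X :: 'a \<Rightarrow> real)"
  shows "ennreal (\<bar>\<integral>x. X x \<partial>M\<bar> powr p) \<le> (\<integral>\<^sup>+x. ennreal (\<bar>X x\<bar> powr p) \<partial>M)"
proof -
  interpret prob_space M by fact
  have [measurable]: "X \<in> borel_measurable M" using X by simp
  show ?thesis
  proof (cases "integrable M (\<lambda>x. \<bar>X x\<bar> powr p)")
    case True
    have "\<bar>\<integral>x. X x \<partial>M\<bar> powr p \<le> (\<integral>x. \<bar>X x\<bar> powr p \<partial>M)"
      by (rule jensens_inequality[OF X _ _ True convex_on_abs_powr[OF assms(2)]]) auto
    then show ?thesis using True by (simp add: nn_integral_eq_integral)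
  next
    case False
    then have "(\<integral>\<^sup>+x. ennreal (\<bar>X x\<bar> powr p) \<partial>M) = \<infinity>"
      using top.not_eq_extremum by (subst (asm) integrable_iff_bounded) fastforce
    then show ?thesis by simp
  qed
qed

lemma norm_pow_Jensen:
  assumes "prob_space M" "1 \<le> p" and f: "integrable M f"
  shows "ennreal (norm_pow p (\<integral>x. f x \<partial>M)) \<le> (\<integral>\<^sup>+x. ennreal (norm_pow p (f x)) \<partial>M)"
proof -
  have [measurable]: "f \<in> borel_measurable M" using f by simp
  have "ennreal (norm_pow p (\<integral>x. f x \<partial>M))
      = ennreal (\<bar>\<integral>x. Re (f x) \<partial>M\<bar> powr p) + ennreal (\<bar>\<integral>x. Im (f x) \<partial>M\<bar> powr p)"
    using f by (simp add: norm_pow_def)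
  also have "\<dots> \<le> (\<integral>\<^sup>+x. ennreal (\<bar>Re (f x)\<bar> powr p) \<partial>M) + (\<integral>\<^sup>+x. ennreal (\<bar>Im (f x)\<bar> powr p) \<partial>M)"
    using f by (intro add_mono abs_powr_Jensen assms) auto
  also have "\<dots> = (\<integral>\<^sup>+x. ennreal (norm_pow p (f x)) \<partial>M)"
    by (subst nn_integral_add[symmetric]) (auto simp: norm_pow_def)
  finally show ?thesis .
qed

lemma cball_borel [measurable]: "cball a r \<in> sets borel" by simp

lemma nn_integral_le_from_cballs:
  fixes g :: "real^'n \<Rightarrow> ennreal"
  assumes [measurable]: "g \<in> borel_measurable borel"
    and le: "\<And>n::nat. (\<integral>\<^sup>+x. g x * indicator (cball 0 (real n)) x \<partial>lborel) \<le> C"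
  shows "(\<integral>\<^sup>+x. g x \<partial>lborel) \<le> C"
proof -
  have "(\<integral>\<^sup>+x. g x \<partial>lborel) = (\<integral>\<^sup>+x. (SUP n::nat. g x * indicator (cball 0 (real n)) x) \<partial>lborel)"
  proof (rule nn_integral_cong)
    fix x :: "real^'n"
    have "g x \<le> (SUP n::nat. g x * indicator (cball 0 (real n)) x)"
    proof -
      obtain n :: nat where "norm x \<le> real n" using real_arch_simple by blast
      then show ?thesis by (intro SUP_upper2[of n]) auto
    qed
    moreover have "(SUP n::nat. g x * indicator (cball 0 (real n)) x) \<le> g x"
      by (intro SUP_least) (auto simp: indicator_def)
    ultimately show "g x = (SUP n::nat. g x * indicator (cball 0 (real n)) x)" by order
  qed
  also have "\<dots> = (SUP n::nat. \<integral>\<^sup>+x. g x * indicator (cball 0 (real n)) x \<partial>lborel)"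
    by (intro nn_integral_monotone_convergence_SUP)
      (auto simp: incseq_def le_fun_def indicator_def)
  also have "\<dots> \<le> C" using le by (intro SUP_least)
  finally show ?thesis .
qed

text \<open>On each ball a subsequence converges almost everywhere, so that Fatou's lemma applies there. The
  balls are exhausted at the end because the right-hand side does not depend on them.\<close>

lemma nn_integral_lsc_L1loc:
  fixes f :: "nat \<Rightarrow> real^'n \<Rightarrow> complex"
  assumes [measurable]: "\<And>m. f m \<in> borel_measurable borel" "g \<in> borel_measurable borel"
    and \<Phi>: "continuous_on UNIV (\<Phi> :: complex \<Rightarrow> real)"
    and conv: "\<And>R. (\<lambda>m. \<integral>\<^sup>+x. ennreal (norm (f m x - g x)) * indicator (cball 0 R) x \<partial>lborel) \<longlonglongrightarrow> 0"
  shows "(\<integral>\<^sup>+x. ennreal (\<Phi> (g x)) \<partial>lborel) \<le> liminf (\<lambda>m. \<integral>\<^sup>+x. ennreal (\<Phi> (f m x)) \<partial>lborel)"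
proof -
  have [measurable]: "\<Phi> \<in> borel_measurable borel" by (rule borel_measurable_continuous_onI[OF \<Phi>])
  let ?l = "liminf (\<lambda>m. \<integral>\<^sup>+x. ennreal (\<Phi> (f m x)) \<partial>lborel)"
  obtain r where r: "strict_mono r" and rl: "((\<lambda>m. \<integral>\<^sup>+x. ennreal (\<Phi> (f m x)) \<partial>lborel) \<circ> r) \<longlonglongrightarrow> ?l"
    using liminf_subseq_lim by blast
  show ?thesis
  proof (rule nn_integral_le_from_cballs)
    fix n :: nat
    \<comment> \<open>the shift by \<open>k\<close> below makes the differences integrable on the ball, not just eventually so\<close>
    define e where "e m = (\<integral>\<^sup>+x. ennreal (norm (f (r m) x - g x)) * indicator (cball 0 (real n)) x \<partial>lborel)" for m
    have e0: "e \<longlonglongrightarrow> 0" unfolding e_def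
      using LIMSEQ_subseq_LIMSEQ[OF conv r] by (simp add: comp_def)
    then have "eventually (\<lambda>m. e m < 1) sequentially" by (rule order_tendstoD) auto
    then obtain k where k: "\<And>m. k \<le> m \<Longrightarrow> e m < 1" by (auto simp: eventually_sequentially)
    define d where "d m x = indicator (cball 0 (real n)) x *\<^sub>R (f (r (m + k)) x - g x)" for m x
    have [measurable]: "d m \<in> borel_measurable borel" for m
      unfolding d_def by (intro borel_measurable_scaleR borel_measurable_indicator borel_measurable_diff assms) simp
    have nd: "(\<integral>\<^sup>+x. ennreal (norm (d m x)) \<partial>lborel) = e (m + k)" for m
      unfolding d_def e_def by (intro nn_integral_cong) (auto simp: indicator_def)
    have int: "integrable lborel (d m)" for m
      unfolding integrable_iff_bounded using nd[of m] k[of "m + k"] by (auto simp: less_top intro: order_less_trans)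
    have "(\<lambda>m. ennreal (\<integral>x. norm (d m x) \<partial>lborel)) = (\<lambda>m. e (m + k))"
      using int nd by (subst nn_integral_eq_integral[symmetric]) auto
    moreover have "(\<lambda>m. e (m + k)) \<longlonglongrightarrow> 0" using LIMSEQ_ignore_initial_segment[OF e0] .
    ultimately have "(\<lambda>m. (\<integral>x. norm (d m x) \<partial>lborel)) \<longlonglongrightarrow> 0"
      using tendsto_ennreal_iff[of "\<lambda>m. \<integral>x. norm (d m x) \<partial>lborel" sequentially 0] by simp
    from tendsto_L1_AE_subseq[OF int this] obtain s where s: "strict_mono s"
      and ae: "AE x in lborel. (\<lambda>m. d (s m) x) \<longlonglongrightarrow> 0" by blast
    define q where "q m = r (s m + k)" for m
    have "(\<integral>\<^sup>+x. ennreal (\<Phi> (g x)) * indicator (cball 0 (real n)) x \<partial>lborel)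
        \<le> (\<integral>\<^sup>+x. liminf (\<lambda>m. ennreal (\<Phi> (f (q m) x))) \<partial>lborel)"
    proof (rule nn_integral_mono_AE, use ae in eventually_elim)
      fix x :: "real^'n" assume lim: "(\<lambda>m. d (s m) x) \<longlonglongrightarrow> 0"
      show "ennreal (\<Phi> (g x)) * indicator (cball 0 (real n)) x \<le> liminf (\<lambda>m. ennreal (\<Phi> (f (q m) x)))"
      proof (cases "x \<in> cball 0 (real n)")
        case True
        then have "(\<lambda>m. f (q m) x) \<longlonglongrightarrow> g x" using lim by (simp add: d_def q_def LIM_zero_cancel)
        then have "(\<lambda>m. \<Phi> (f (q m) x)) \<longlonglongrightarrow> \<Phi> (g x)"
          using continuous_on_tendsto_compose[OF \<Phi>] by auto
        then have "(\<lambda>m. ennreal (\<Phi> (f (q m) x))) \<longlonglongrightarrow> ennreal (\<Phi> (g x))" by (rule tendsto_ennrealI)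
        from lim_imp_Liminf[OF _ this] show ?thesis by (simp add: indicator_def)
      qed simp
    qed
    also have "\<dots> \<le> liminf (\<lambda>m. \<integral>\<^sup>+x. ennreal (\<Phi> (f (q m) x)) \<partial>lborel)"
      by (intro nn_integral_liminf) auto
    also have "\<dots> = ?l"
    proof -
      have "strict_mono (\<lambda>m. s m + k)" using s by (simp add: strict_mono_def)
      from LIMSEQ_subseq_LIMSEQ[OF rl this] 
      have "(\<lambda>m. \<integral>\<^sup>+x. ennreal (\<Phi> (f (q m) x)) \<partial>lborel) \<longlonglongrightarrow> ?l"
        by (simp add: comp_def q_def)
      then show ?thesis by (intro lim_imp_Liminf) auto
    qed
    finally show "(\<integral>\<^sup>+x. ennreal (\<Phi> (g x)) * indicator (cball 0 (real n)) x \<partial>lborel) \<le> ?l" .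
  qed auto
qed

section \<open>Convolution with compactly supported kernels\<close>

lemma lborel_distr_reflect: "distr lborel borel (\<lambda>z. x - z) = (lborel :: (real^'n) measure)"
  using lborel_affine[of "- 1" x] by (simp add: density_1)

lemma nn_integral_translate:
  assumes [measurable]: "f \<in> borel_measurable borel"
  shows "(\<integral>\<^sup>+z. f (z + x) \<partial>lborel) = (\<integral>\<^sup>+z. f (z::real^'n) \<partial>lborel)"
  by (subst (2) lborel_distr_plus[of x, symmetric]) (simp add: nn_integral_distr add.commute)

lemma integral_reflect:
  fixes f :: "real^'n \<Rightarrow> 'b::{banach, second_countable_topology}"
  assumes [measurable]: "f \<in> borel_measurable borel"
  shows "(\<integral>z. f (x - z) \<partial>lborel) = (\<integral>z. f z \<partial>lborel)"
  by (subst (2) lborel_distr_reflect[of x, symmetric]) (simp add: integral_distr)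

lemma integrable_reflect:
  fixes f :: "real^'n \<Rightarrow> 'b::{banach, second_countable_topology}"
  assumes [measurable]: "f \<in> borel_measurable borel"
  shows "integrable lborel (\<lambda>z. f (x - z)) \<longleftrightarrow> integrable lborel f"
  by (subst (2) lborel_distr_reflect[of x, symmetric]) (simp add: integrable_distr_eq)

text \<open>Local integrability of a Borel function in terms of the Borel measure \<open>lborel\<close>. All estimates are
  carried out for Borel functions, for which Fubini's theorem and the measurability prover are
  available.\<close>

definition locint :: "(real^'n \<Rightarrow> 'b::euclidean_space) \<Rightarrow> bool" where
  "locint f \<longleftrightarrow> f \<in> borel_measurable borel \<and>
     (\<forall>R. integrable lborel (\<lambda>x. indicator (cball 0 R) x *\<^sub>R f x))"

lemma norm_integral_le:
  fixes F :: "'a \<Rightarrow> 'b::{banach, second_countable_topology}"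
  assumes "integrable M F" "integrable M g" "\<And>x. norm (F x) \<le> g x"
  shows "norm (\<integral>x. F x \<partial>M) \<le> (\<integral>x. g x \<partial>M)"
proof -
  have "norm (\<integral>x. F x \<partial>M) \<le> (\<integral>x. norm (F x) \<partial>M)" by (rule integral_norm_bound)
  also have "\<dots> \<le> (\<integral>x. g x \<partial>M)" using assms by (intro integral_mono) auto
  finally show ?thesis .
qed

text \<open>Only continuity is demanded, so that partial derivatives of mollifiers and divergences of test
  fields are covered too.\<close>

definition kernel_within :: "(real^'n \<Rightarrow> real) \<Rightarrow> real \<Rightarrow> bool" where
  "kernel_within \<kappa> \<epsilon> \<longleftrightarrow> continuous_on UNIV \<kappa> \<and> (\<forall>z. \<epsilon> \<le> norm z \<longrightarrow> \<kappa> z = 0)"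

definition conv :: "(real^'n \<Rightarrow> real) \<Rightarrow> (real^'n \<Rightarrow> 'b::euclidean_space) \<Rightarrow> real^'n \<Rightarrow> 'b" where
  "conv \<kappa> f x = (\<integral>y. \<kappa> (x - y) *\<^sub>R f y \<partial>lborel)"

lemma locint_measurable: "locint f \<Longrightarrow> f \<in> borel_measurable borel" by (simp add: locint_def)

lemma integrable_imp_locint:
  fixes f :: "real^'n \<Rightarrow> 'b::euclidean_space"
  assumes "integrable lborel f" shows "locint f"
  unfolding locint_def
proof (intro conjI allI)
  show "f \<in> borel_measurable borel" using borel_measurable_integrable[OF assms] by simp
  show "integrable lborel (\<lambda>x. indicator (cball 0 R) x *\<^sub>R f x)" for R
    by (rule integrable_mult_indicator[OF _ assms]) simp
qed

lemma kernel_within_bounded: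
  assumes "kernel_within \<kappa> \<epsilon>" obtains C where "0 \<le> C" "\<And>z. \<bar>\<kappa> z\<bar> \<le> C"
proof -
  have "bounded (\<kappa> ` cball 0 \<epsilon>)"
    using assms by (auto simp: kernel_within_def intro!: compact_imp_bounded compact_continuous_image
        intro: continuous_on_subset)
  then obtain C where "\<forall>y\<in>\<kappa> ` cball 0 \<epsilon>. norm y \<le> C" using bounded_iff by blast
  then have C: "\<bar>\<kappa> z\<bar> \<le> C" if "z \<in> cball 0 \<epsilon>" for z using that by auto
  have "\<bar>\<kappa> z\<bar> \<le> max C 0" for z
    using C[of z] assms by (cases "norm z \<le> \<epsilon>") (auto simp: kernel_within_def)
  then show thesis by (intro that[of "max C 0"]) auto
qed

lemma kernel_within_measurable: "kernel_within \<kappa> \<epsilon> \<Longrightarrow> \<kappa> \<in> borel_measurable borel"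
  by (simp add: kernel_within_def borel_measurable_continuous_onI)

lemma kernel_within_uniformly_continuous:
  assumes k: "kernel_within \<kappa> \<epsilon>" and "0 < e"
  obtains d where "0 < d" "\<And>y z. dist y z < d \<Longrightarrow> \<bar>\<kappa> y - \<kappa> z\<bar> < e"
proof -
  have "uniformly_continuous_on (cball 0 (\<epsilon> + 1)) \<kappa>"
    using k by (auto simp: kernel_within_def intro!: compact_uniformly_continuous intro: continuous_on_subset)
  then obtain d where d: "0 < d"
    and D: "\<And>y z. y \<in> cball 0 (\<epsilon> + 1) \<Longrightarrow> z \<in> cball 0 (\<epsilon> + 1) \<Longrightarrow> dist y z < d \<Longrightarrow> dist (\<kappa> y) (\<kappa> z) < e"
    using \<open>0 < e\<close> unfolding uniformly_continuous_on_def by metis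
  have "\<bar>\<kappa> y - \<kappa> z\<bar> < e" if yz: "dist y z < min d 1" for y z
  proof (cases "norm y < \<epsilon> \<or> norm z < \<epsilon>")
    case True
    have "norm y \<le> norm z + 1" "norm z \<le> norm y + 1" using yz norm_triangle_ineq3[of y z] by (auto simp: dist_norm)
    then show ?thesis using True D[of y z] yz by (auto simp: dist_norm)
  next
    case False
    then show ?thesis using k \<open>0 < e\<close> by (auto simp: kernel_within_def)
  qed
  then show thesis using d by (intro that[of "min d 1"]) auto
qed

lemma locint_mult_bounded:
  fixes f :: "real^'n \<Rightarrow> 'b::euclidean_space" and h :: "real^'n \<Rightarrow> 'b"
  assumes f: "locint f" and [measurable]: "h \<in> borel_measurable borel"
    and bd: "\<And>y. norm (h y) \<le> C * norm (indicator (cball 0 R) y *\<^sub>R f y)"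
  shows "integrable lborel h"
proof (rule Bochner_Integration.integrable_bound)
  show "integrable lborel (\<lambda>y. C * norm (indicator (cball 0 R) y *\<^sub>R f y))"
    using f by (intro integrable_mult_right integrable_norm) (simp add: locint_def)
  show "AE y in lborel. norm (h y) \<le> norm (C * norm (indicator (cball 0 R) y *\<^sub>R f y))"
    using bd by (intro AE_I2) (metis abs_ge_self order_trans real_norm_def)
qed simp

lemma conv_integrable:
  assumes k: "kernel_within \<kappa> \<epsilon>" and f: "locint f"
  shows "integrable lborel (\<lambda>y. \<kappa> (x - y) *\<^sub>R f y)"
proof -
  obtain C where C: "0 \<le> C" "\<And>z. \<bar>\<kappa> z\<bar> \<le> C" using kernel_within_bounded[OF k] by metis
  note [measurable] = kernel_within_measurable[OF k] locint_measurable[OF f]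
  show ?thesis
  proof (rule locint_mult_bounded[OF f])
    fix y
    show "norm (\<kappa> (x - y) *\<^sub>R f y) \<le> C * norm (indicator (cball 0 (norm x + \<epsilon>)) y *\<^sub>R f y)"
    proof (cases "norm y \<le> norm x + \<epsilon>")
      case True then show ?thesis using C by (auto intro!: mult_right_mono)
    next
      case False
      then have "\<epsilon> \<le> norm (x - y)" using norm_triangle_ineq3[of x y] by linarith
      then have "\<kappa> (x - y) = 0" using k by (auto simp: kernel_within_def)
      then show ?thesis using C by simp
    qed
  qed measurable
qed

lemma conv_altdef:
  assumes k: "kernel_within \<kappa> \<epsilon>" and f: "locint f"
  shows "conv \<kappa> f x = (\<integral>z. \<kappa> z *\<^sub>R f (x - z) \<partial>lborel)"
    and "integrable lborel (\<lambda>z. \<kappa> z *\<^sub>R f (x - z))"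
proof -
  note [measurable] = kernel_within_measurable[OF k] locint_measurable[OF f]
  show "conv \<kappa> f x = (\<integral>z. \<kappa> z *\<^sub>R f (x - z) \<partial>lborel)"
    unfolding conv_def by (subst integral_reflect[of _ x, symmetric]) auto
  show "integrable lborel (\<lambda>z. \<kappa> z *\<^sub>R f (x - z))"
    using conv_integrable[OF k f, of x] integrable_reflect[of "\<lambda>y. \<kappa> (x - y) *\<^sub>R f y" x] by simp
qed

lemma conv_continuous:
  fixes f :: "real^'n \<Rightarrow> 'b::euclidean_space"
  assumes k: "kernel_within \<kappa> \<epsilon>" and f: "locint f"
  shows "continuous_on UNIV (conv \<kappa> f)"
  unfolding continuous_on_iff
proof (intro ballI allI impI)
  fix x :: "real^'n" and e :: real assume "0 < e"
  note [measurable] = kernel_within_measurable[OF k] locint_measurable[OF f]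
  let ?g = "\<lambda>y. norm (indicator (cball 0 (norm x + \<epsilon> + 1)) y *\<^sub>R f y)"
  have gi: "integrable lborel ?g" using f by (intro integrable_norm) (simp add: locint_def)
  define C where "C = (\<integral>y. ?g y \<partial>lborel) + 1"
  have C: "C > 0" "(\<integral>y. ?g y \<partial>lborel) < C" unfolding C_def by (auto intro!: add_nonneg_pos)
  obtain d where d: "0 < d" "\<And>y z. dist y z < d \<Longrightarrow> \<bar>\<kappa> y - \<kappa> z\<bar> < e / C"
    using kernel_within_uniformly_continuous[OF k, of "e / C"] \<open>0 < e\<close> C by (metis divide_pos_pos)
  show "\<exists>d>0. \<forall>x'\<in>UNIV. dist x' x < d \<longrightarrow> dist (conv \<kappa> f x') (conv \<kappa> f x) < e"
  proof (intro exI[of _ "min d 1"] conjI ballI impI)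
    fix x' assume x': "dist x' x < min d 1"
    then have xx: "norm (x' - x) < 1" by (simp add: dist_norm)
    have "dist (conv \<kappa> f x') (conv \<kappa> f x) = norm (\<integral>y. (\<kappa> (x' - y) - \<kappa> (x - y)) *\<^sub>R f y \<partial>lborel)"
      unfolding conv_def dist_norm using conv_integrable[OF k f]
      by (subst Bochner_Integration.integral_diff[symmetric]) (auto simp: scaleR_diff_left)
    also have "\<dots> \<le> (\<integral>y. e / C * ?g y \<partial>lborel)"
    proof (rule norm_integral_le)
      show "integrable lborel (\<lambda>y. (\<kappa> (x' - y) - \<kappa> (x - y)) *\<^sub>R f y)"
        using conv_integrable[OF k f] by (auto simp: scaleR_diff_left)
      fix y
      show "norm ((\<kappa> (x' - y) - \<kappa> (x - y)) *\<^sub>R f y) \<le> e / C * ?g y"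
      proof (cases "norm y \<le> norm x + \<epsilon> + 1")
        case True
        have "\<bar>\<kappa> (x' - y) - \<kappa> (x - y)\<bar> \<le> e / C" using d(2)[of "x' - y" "x - y"] x' by (auto simp: dist_norm)
        then have "\<bar>\<kappa> (x' - y) - \<kappa> (x - y)\<bar> * norm (f y) \<le> e / C * norm (f y)"
          by (rule mult_right_mono) simp
        then show ?thesis using True by simp
      next
        case False
        have "norm y \<le> norm (x - y) + norm x" "norm y \<le> norm (x' - y) + norm x'" "norm x' \<le> norm x + 1"
          using xx norm_triangle_ineq3[of x y] norm_triangle_ineq3[of x' y] norm_triangle_ineq3[of x' x]
          by linarith+
        then have "\<epsilon> \<le> norm (x - y)" "\<epsilon> \<le> norm (x' - y)" using False by linarith+
        then have "\<kappa> (x - y) = 0" "\<kappa> (x' - y) = 0" using k unfolding kernel_within_def by blast+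
        then show ?thesis using \<open>0 < e\<close> C by simp
      qed
    qed (use gi in \<open>auto simp del: norm_scaleR\<close>)
    also have "\<dots> = e / C * (\<integral>y. ?g y \<partial>lborel)" by simp
    also have "\<dots> < e / C * C" using C \<open>0 < e\<close> by (intro mult_strict_left_mono) auto
    finally show "dist (conv \<kappa> f x') (conv \<kappa> f x) < e" using C by simp
  qed (use d(1) in auto)
qed

lemma conv_measurable:
  "kernel_within \<kappa> \<epsilon> \<Longrightarrow> locint f \<Longrightarrow> conv \<kappa> f \<in> borel_measurable borel"
  by (intro borel_measurable_continuous_onI conv_continuous)

lemma kernel_within_partial:
  fixes \<kappa> :: "real^'n \<Rightarrow> real"
  assumes k: "kernel_within \<kappa> \<epsilon>" and C: "Ck 1 \<kappa>"
  shows "kernel_within (partial j \<kappa>) (\<epsilon> + 1)"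
  unfolding kernel_within_def
proof (intro conjI allI impI)
  show "continuous_on UNIV (partial j \<kappa>)" using C by simp
  fix z :: "real^'n" assume z: "\<epsilon> + 1 \<le> norm z"
  have "((\<lambda>z. 0) has_derivative (\<lambda>h. 0)) (at z)" by simp
  then have "(\<kappa> has_derivative (\<lambda>h. 0)) (at z)"
  proof (rule has_derivative_transform_within[where d = 1])
    fix x' assume "dist x' z < 1"
    then have "\<epsilon> \<le> norm x'" using z norm_triangle_ineq3[of z x'] by (auto simp: dist_norm norm_minus_commute)
    then show "0 = \<kappa> x'" using k by (auto simp: kernel_within_def)
  qed auto
  from partial_eqI[OF this] show "partial j \<kappa> z = 0" .
qed

text \<open>The mean value inequality with uniformly continuous partial derivatives. Uniformity in the base
  point is what allows differentiation under the integral sign.\<close>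

lemma uniform_linearization:
  fixes \<kappa> :: "real^'n \<Rightarrow> real"
  assumes k: "kernel_within \<kappa> \<epsilon>" and C: "Ck 1 \<kappa>" and "0 < e"
  obtains d where "0 < d"
    "\<And>z h. norm h < d \<Longrightarrow> \<bar>\<kappa> (z + h) - \<kappa> z - (\<Sum>j\<in>UNIV. h $ j * partial j \<kappa> (z::real^'n))\<bar> \<le> e * norm h"
proof -
  define e' where "e' = e / real CARD('n)"
  have e': "0 < e'" using \<open>0 < e\<close> by (simp add: e'_def)
  have "\<exists>d>0. \<forall>y z. dist y z < d \<longrightarrow> \<bar>partial j \<kappa> y - partial j \<kappa> z\<bar> < e'" for j
    using kernel_within_uniformly_continuous[OF kernel_within_partial[OF k C] e'] by metis
  then obtain D where D: "\<And>j. D j > 0"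
     "\<And>j y z. dist y z < D j \<Longrightarrow> \<bar>partial j \<kappa> y - partial j \<kappa> z\<bar> < e'" by metis
  define d where "d = Min (range D)"
  have d: "0 < d" using D(1) by (auto simp: d_def)
  have dD: "d \<le> D j" for j by (auto simp: d_def)
  let ?g = "\<lambda>(z::real^'n) (h::real^'n). \<Sum>j\<in>UNIV. h $ j * partial j \<kappa> z"
  have der: "(\<kappa> has_derivative ?g z) (at z within S)" for z S
    using differentiable_has_partials[of \<kappa> z] C by (auto intro: has_derivative_at_withinI)
  have "\<bar>\<kappa> (z + h) - \<kappa> z - ?g z h\<bar> \<le> e * norm h" if h: "norm h < d" for z h
  proof -
    have "norm (\<kappa> (z + h) - \<kappa> z - ?g z ((z + h) - z)) \<le> norm ((z + h) - z) * e"
    proof (rule differentiable_bound_linearization[of z "z + h" "ball z d" \<kappa> ?g z e])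
      fix t :: real assume t: "t \<in> {0..1}"
      have "\<bar>t\<bar> * norm h \<le> 1 * norm h" using t by (intro mult_right_mono) auto
      then show "z + t *\<^sub>R (z + h - z) \<in> ball z d" using h by (auto simp: dist_norm)
    next
      fix y assume y: "y \<in> ball z d"
      show "(\<kappa> has_derivative ?g y) (at y within ball z d)" by (rule der)
      show "onorm (?g y - ?g z) \<le> e"
      proof (rule onorm_le)
        fix v :: "real^'n"
        have "norm ((?g y - ?g z) v) = \<bar>\<Sum>j\<in>UNIV. v $ j * (partial j \<kappa> y - partial j \<kappa> z)\<bar>"
          by (simp add: right_diff_distrib sum_subtractf)
        also have "\<dots> \<le> (\<Sum>j\<in>UNIV. \<bar>v $ j\<bar> * \<bar>partial j \<kappa> y - partial j \<kappa> z\<bar>)"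
          by (rule order_trans[OF sum_abs]) (simp add: abs_mult)
        also have "\<dots> \<le> (\<Sum>j\<in>(UNIV::'n set). norm v * e')"
        proof (intro sum_mono mult_mono component_le_norm_cart)
          fix j show "\<bar>partial j \<kappa> y - partial j \<kappa> z\<bar> \<le> e'"
            using D(2)[of y z j] dD[of j] y by (auto simp: dist_commute)
        qed auto
        also have "\<dots> = e * norm v" by (simp add: e'_def)
        finally show "norm ((?g y - ?g z) v) \<le> e * norm v" .
      qed
    qed (use d(1) in auto)
    then show ?thesis by (simp add: mult.commute)
  qed
  with d show thesis by (rule that)
qed

text \<open>The error of the linearization is at most \<open>e \<bar>h\<bar>\<close> uniformly in the kernel variable, and it vanishes outside a
  fixed ball, on which the other factor is integrable.\<close>

lemma conv_has_derivative:
  fixes f :: "real^'n \<Rightarrow> 'b::euclidean_space"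
  assumes k: "kernel_within \<kappa> \<epsilon>" and C1: "Ck 1 \<kappa>" and f: "locint f"
  shows "(conv \<kappa> f has_derivative (\<lambda>h. \<Sum>j\<in>UNIV. h $ j *\<^sub>R conv (partial j \<kappa>) f x)) (at x)"
  unfolding has_derivative_at_alt
proof (intro conjI allI impI)
  show "bounded_linear (\<lambda>h. \<Sum>j\<in>UNIV. h $ j *\<^sub>R conv (partial j \<kappa>) f x)"
    by (intro bounded_linear_sum bounded_linear_scaleR_const bounded_linear_vec_nth)
  fix e :: real assume "0 < e"
  note kp = kernel_within_partial[OF k C1]
  note [measurable] = kernel_within_measurable[OF k] locint_measurable[OF f]
  let ?g = "\<lambda>y. norm (indicator (cball 0 (norm x + \<epsilon> + 1)) y *\<^sub>R f y)"
  have gi: "integrable lborel ?g" using f by (intro integrable_norm) (simp add: locint_def)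
  define C where "C = (\<integral>y. ?g y \<partial>lborel) + 1"
  have C: "C > 0" "(\<integral>y. ?g y \<partial>lborel) \<le> C" unfolding C_def by (auto intro!: add_nonneg_pos)
  obtain d where d: "0 < d" "\<And>z h. norm h < d \<Longrightarrow>
      \<bar>\<kappa> (z + h) - \<kappa> z - (\<Sum>j\<in>UNIV. h $ j * partial j \<kappa> z)\<bar> \<le> e / C * norm h"
    using uniform_linearization[OF k C1 divide_pos_pos[OF \<open>0 < e\<close> C(1)]] by blast
  show "\<exists>d>0. \<forall>y. norm (y - x) < d \<longrightarrow>
     norm (conv \<kappa> f y - conv \<kappa> f x - (\<Sum>j\<in>UNIV. (y - x) $ j *\<^sub>R conv (partial j \<kappa>) f x)) \<le> e * norm (y - x)"
  proof (intro exI[of _ "min d 1"] conjI allI impI)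
    fix x' assume x': "norm (x' - x) < min d 1"
    then have xx: "norm (x' - x) < 1" by simp
    define h where "h = x' - x"
    let ?L = "\<lambda>y. \<kappa> (x' - y) - \<kappa> (x - y) - (\<Sum>j\<in>UNIV. h $ j * partial j \<kappa> (x - y))"
    have eq: "?L y *\<^sub>R f y = \<kappa> (x' - y) *\<^sub>R f y - \<kappa> (x - y) *\<^sub>R f y
        - (\<Sum>j\<in>UNIV. h $ j *\<^sub>R (partial j \<kappa> (x - y) *\<^sub>R f y))" for y
      by (simp add: scaleR_diff_left scaleR_sum_left)
    have int: "integrable lborel (\<lambda>y. ?L y *\<^sub>R f y)"
      unfolding eq using conv_integrable[OF k f] conv_integrable[OF kp f] 
      by (intro Bochner_Integration.integrable_diff Bochner_Integration.integrable_sum integrable_scaleR_right)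
    have "conv \<kappa> f x' - conv \<kappa> f x - (\<Sum>j\<in>UNIV. h $ j *\<^sub>R conv (partial j \<kappa>) f x)
        = (\<integral>y. ?L y *\<^sub>R f y \<partial>lborel)"
      unfolding eq conv_def using conv_integrable[OF k f] conv_integrable[OF kp f]
      by (simp del: scaleR_scaleR)
    also have "norm \<dots> \<le> (\<integral>y. e / C * norm h * ?g y \<partial>lborel)"
    proof (rule norm_integral_le[OF int])
      fix y
      show "norm (?L y *\<^sub>R f y) \<le> e / C * norm h * ?g y"
      proof (cases "norm y \<le> norm x + \<epsilon> + 1")
        case True
        have "\<bar>?L y\<bar> \<le> e / C * norm h" using d(2)[of h "x - y"] x' by (simp add: h_def)
        then have "\<bar>?L y\<bar> * norm (f y) \<le> e / C * norm h * norm (f y)" by (rule mult_right_mono) simp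
        then show ?thesis using True by simp
      next
        case False
        have "norm y \<le> norm (x - y) + norm x" "norm y \<le> norm (x' - y) + norm x'" "norm x' \<le> norm x + 1"
          using xx norm_triangle_ineq3[of x y] norm_triangle_ineq3[of x' y] norm_triangle_ineq3[of x' x]
          by linarith+
        then have "\<epsilon> + 1 \<le> norm (x - y)" "\<epsilon> \<le> norm (x - y)" "\<epsilon> \<le> norm (x' - y)" using False by linarith+
        then have "\<kappa> (x - y) = 0" "\<kappa> (x' - y) = 0" "\<And>j. partial j \<kappa> (x - y) = 0"
          using k kp unfolding kernel_within_def by blast+
        then show ?thesis using \<open>0 < e\<close> C by simp
      qed
    qed (use gi in \<open>auto simp del: norm_scaleR\<close>)
    also have "\<dots> = e / C * norm h * (\<integral>y. ?g y \<partial>lborel)" by simp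
    also have "\<dots> \<le> e / C * norm h * C" using C \<open>0 < e\<close> by (intro mult_left_mono) auto
    also have "\<dots> = e * norm h" using C by simp
    finally show "norm (conv \<kappa> f x' - conv \<kappa> f x - (\<Sum>j\<in>UNIV. (x' - x) $ j *\<^sub>R conv (partial j \<kappa>) f x))
        \<le> e * norm (x' - x)" by (simp add: h_def)
  qed (use d(1) in auto)
qed

text \<open>Young's inequality in \<open>L\<^sup>1\<close>, localized: the convolution on \<open>B\<close> only sees the values of \<open>q\<close> on the
  set \<open>B'\<close> that the support of the kernel reaches from \<open>B\<close>.\<close>

lemma nn_conv_le:
  fixes q :: "real^'n \<Rightarrow> ennreal" and \<kappa> :: "real^'n \<Rightarrow> ennreal"
  assumes [measurable]: "q \<in> borel_measurable borel" "\<kappa> \<in> borel_measurable borel" "B \<in> sets borel" "B' \<in> sets borel"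
    and sub: "\<And>x z. x \<in> B \<Longrightarrow> \<kappa> z \<noteq> 0 \<Longrightarrow> x - z \<in> B'"
  shows "(\<integral>\<^sup>+x. (\<integral>\<^sup>+z. \<kappa> z * q (x - z) \<partial>lborel) * indicator B x \<partial>lborel)
      \<le> (\<integral>\<^sup>+z. \<kappa> z \<partial>lborel) * (\<integral>\<^sup>+x. q x * indicator B' x \<partial>lborel)"
proof -
  have "(\<integral>\<^sup>+x. (\<integral>\<^sup>+z. \<kappa> z * q (x - z) \<partial>lborel) * indicator B x \<partial>lborel)
      = (\<integral>\<^sup>+x. (\<integral>\<^sup>+z. \<kappa> z * q (x - z) * indicator B x \<partial>lborel) \<partial>lborel)"
    by (simp add: nn_integral_multc)
  also have "\<dots> \<le> (\<integral>\<^sup>+x. (\<integral>\<^sup>+z. \<kappa> z * (q (x - z) * indicator B' (x - z)) \<partial>lborel) \<partial>lborel)"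
  proof (intro nn_integral_mono)
    fix x z :: "real^'n"
    show "\<kappa> z * q (x - z) * indicator B x \<le> \<kappa> z * (q (x - z) * indicator B' (x - z))"
      using sub[of x z] by (cases "\<kappa> z = 0") (auto simp: indicator_def)
  qed
  also have "\<dots> = (\<integral>\<^sup>+z. (\<integral>\<^sup>+x. \<kappa> z * (q (x - z) * indicator B' (x - z)) \<partial>lborel) \<partial>lborel)"
    by (rule lborel_pair.Fubini') measurable
  also have "\<dots> = (\<integral>\<^sup>+z. \<kappa> z * (\<integral>\<^sup>+x. q x * indicator B' x \<partial>lborel) \<partial>lborel)"
    using nn_integral_translate[of "\<lambda>x. q x * indicator B' x" "- z" for z]
    by (simp add: nn_integral_cmult)
  also have "\<dots> = (\<integral>\<^sup>+z. \<kappa> z \<partial>lborel) * (\<integral>\<^sup>+x. q x * indicator B' x \<partial>lborel)"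
    by (simp add: nn_integral_multc)
  finally show ?thesis .
qed

section \<open>Approximation by mollification\<close>

lemma mollifier_kernel_within: "mollifier \<eta> \<epsilon> \<Longrightarrow> kernel_within \<eta> \<epsilon>"
  unfolding mollifier_def kernel_within_def using Ck_continuous by blast

lemma mollifier_C1: "mollifier \<eta> \<epsilon> \<Longrightarrow> Ck 1 \<eta>" by (auto simp: mollifier_def)

lemma mollifier_nonneg: "mollifier \<eta> \<epsilon> \<Longrightarrow> 0 \<le> \<eta> x" by (auto simp: mollifier_def)

lemma mollifier_measurable: "mollifier \<eta> \<epsilon> \<Longrightarrow> \<eta> \<in> borel_measurable borel"
  by (rule kernel_within_measurable[OF mollifier_kernel_within])

lemma mollifier_integral:
  assumes m: "mollifier \<eta> \<epsilon>"
  shows "integrable lborel \<eta>" "(\<integral>x. \<eta> x \<partial>lborel) = 1"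
proof -
  note [measurable] = mollifier_measurable[OF m]
  have "has_bochner_integral lborel \<eta> 1"
    using m by (intro has_bochner_integral_nn_integral) (auto simp: mollifier_def)
  then show "integrable lborel \<eta>" "(\<integral>x. \<eta> x \<partial>lborel) = 1"
    by (auto simp: has_bochner_integral_iff)
qed

lemma mollifier_Jensen:
  assumes m: "mollifier \<eta> \<epsilon>" and p: "1 \<le> p" and [measurable]: "g \<in> borel_measurable borel"
    and int: "integrable lborel (\<lambda>z. \<eta> z *\<^sub>R g z)"
  shows "ennreal (norm_pow p (\<integral>z. \<eta> z *\<^sub>R g z \<partial>lborel)) \<le> (\<integral>\<^sup>+z. ennreal (\<eta> z) * ennreal (norm_pow p (g z)) \<partial>lborel)"
proof -
  note [measurable] = mollifier_measurable[OF m]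
  have n: "AE z in lborel. 0 \<le> \<eta> z" using mollifier_nonneg[OF m] by auto
  let ?M = "density lborel (\<lambda>z. ennreal (\<eta> z))"
  have "prob_space ?M"
    using m by (intro prob_spaceI) (auto simp: emeasure_density mollifier_def)
  moreover have "integrable ?M g" using int n by (subst integrable_density) auto
  ultimately have "ennreal (norm_pow p (\<integral>z. g z \<partial>?M)) \<le> (\<integral>\<^sup>+z. ennreal (norm_pow p (g z)) \<partial>?M)"
    using p by (intro norm_pow_Jensen)
  then show ?thesis using n by (simp add: integral_density nn_integral_density)
qed

text \<open>The common form of the commutator estimates. A quantity \<open>f\<close> computed from the mollified function
  is the mollification of the original quantity \<open>a\<close> plus a commutator with the small kernel \<open>k\<close>.
  Splitting with ratio \<open>\<epsilon>\<close> keeps the constant of the main term at \<open>(1 + \<epsilon>) powr (p - 1)\<close>; Jensen's inequality for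
  the probability density \<open>\<eta>\<close> handles each part.\<close>

lemma mollified_norm_pow_le:
  fixes a b :: "real^'n \<Rightarrow> complex"
  assumes m: "mollifier \<eta> \<epsilon>" and p: "1 \<le> p"
    and [measurable]: "a \<in> borel_measurable borel" "b \<in> borel_measurable borel"
      "\<And>x. k x \<in> borel_measurable borel" "B \<in> sets borel" "B' \<in> sets borel"
    and k: "\<And>x z. norm z < \<epsilon> \<Longrightarrow> cmod (k x z) \<le> c"
    and inta: "\<And>x. integrable lborel (\<lambda>z. \<eta> z *\<^sub>R a (x - z))"
    and intb: "\<And>x. integrable lborel (\<lambda>z. \<eta> z *\<^sub>R (k x z * b (x - z)))"
    and f: "\<And>x. f x = (\<integral>z. \<eta> z *\<^sub>R a (x - z) \<partial>lborel) + (\<integral>z. \<eta> z *\<^sub>R (k x z * b (x - z)) \<partial>lborel)"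
    and sub: "\<And>x z. x \<in> B \<Longrightarrow> norm z < \<epsilon> \<Longrightarrow> x - z \<in> B'"
  shows "(\<integral>\<^sup>+x. ennreal (norm_pow p (f x)) * indicator B x \<partial>lborel)
    \<le> ennreal ((1 + \<epsilon>) powr (p - 1)) * (\<integral>\<^sup>+x. ennreal (norm_pow p (a x)) * indicator B' x \<partial>lborel)
      + ennreal ((1 + 1 / \<epsilon>) powr (p - 1) * (2 * c) powr p) * (\<integral>\<^sup>+x. ennreal (norm_pow p (b x)) \<partial>lborel)"
proof -
  note [measurable] = mollifier_measurable[OF m]
  have e: "0 < \<epsilon>" using m by (simp add: mollifier_def)
  let ?C1 = "(1 + \<epsilon>) powr (p - 1)" and ?C2 = "(1 + 1 / \<epsilon>) powr (p - 1)"
  let ?A = "\<lambda>x. \<integral>\<^sup>+z. ennreal (\<eta> z) * ennreal (norm_pow p (a (x - z))) \<partial>lborel"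
  let ?B = "\<lambda>x. \<integral>\<^sup>+z. ennreal (\<eta> z) * ennreal (norm_pow p (b (x - z))) \<partial>lborel"
  have pt: "ennreal (norm_pow p (f x)) \<le> ennreal ?C1 * ?A x + ennreal (?C2 * (2 * c) powr p) * ?B x" for x
  proof -
    have "ennreal (norm_pow p (f x)) \<le> ennreal (?C1 * norm_pow p (\<integral>z. \<eta> z *\<^sub>R a (x - z) \<partial>lborel)
        + ?C2 * norm_pow p (\<integral>z. \<eta> z *\<^sub>R (k x z * b (x - z)) \<partial>lborel))"
      unfolding f by (intro ennreal_leI norm_pow_add_le p e)
    also have "\<dots> = ennreal ?C1 * ennreal (norm_pow p (\<integral>z. \<eta> z *\<^sub>R a (x - z) \<partial>lborel))
        + ennreal ?C2 * ennreal (norm_pow p (\<integral>z. \<eta> z *\<^sub>R (k x z * b (x - z)) \<partial>lborel))"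
      by (simp add: ennreal_mult ennreal_plus)
    also have "\<dots> \<le> ennreal ?C1 * ?A x
        + ennreal ?C2 * (\<integral>\<^sup>+z. ennreal (\<eta> z) * ennreal (norm_pow p (k x z * b (x - z))) \<partial>lborel)"
      by (intro add_mono mult_left_mono mollifier_Jensen[OF m p] inta intb) auto
    also have "(\<integral>\<^sup>+z. ennreal (\<eta> z) * ennreal (norm_pow p (k x z * b (x - z))) \<partial>lborel)
        \<le> (\<integral>\<^sup>+z. ennreal ((2 * c) powr p) * (ennreal (\<eta> z) * ennreal (norm_pow p (b (x - z)))) \<partial>lborel)"
    proof (intro nn_integral_mono)
      fix z
      show "ennreal (\<eta> z) * ennreal (norm_pow p (k x z * b (x - z)))
          \<le> ennreal ((2 * c) powr p) * (ennreal (\<eta> z) * ennreal (norm_pow p (b (x - z))))"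
      proof (cases "norm z < \<epsilon>")
        case True
        have "ennreal (norm_pow p (k x z * b (x - z))) \<le> ennreal ((2 * c) powr p * norm_pow p (b (x - z)))"
          by (intro ennreal_leI norm_pow_mult_le_norm p k True)
        then have "ennreal (\<eta> z) * ennreal (norm_pow p (k x z * b (x - z)))
            \<le> ennreal (\<eta> z) * (ennreal ((2 * c) powr p) * ennreal (norm_pow p (b (x - z))))"
          by (intro mult_left_mono) (auto simp: ennreal_mult)
        then show ?thesis by (simp add: mult_ac)
      next
        case False
        then have "\<eta> z = 0" using m by (auto simp: mollifier_def)
        then show ?thesis by simp
      qed
    qed
    also have "\<dots> = ennreal ((2 * c) powr p) * ?B x" by (intro nn_integral_cmult) measurable
    finally show ?thesis by (simp add: mult_left_mono ennreal_mult mult.assoc)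
  qed
  have i1: "(\<integral>\<^sup>+z. ennreal (\<eta> z) \<partial>lborel) = 1" using m by (simp add: mollifier_def)
  have nz: "norm z < \<epsilon>" if "ennreal (\<eta> z) \<noteq> 0" for z using that m by (force simp: mollifier_def)
  have "(\<integral>\<^sup>+x. ennreal (norm_pow p (f x)) * indicator B x \<partial>lborel)
      \<le> (\<integral>\<^sup>+x. ennreal ?C1 * (?A x * indicator B x)
        + ennreal (?C2 * (2 * c) powr p) * (?B x * indicator UNIV x) \<partial>lborel)"
    using pt by (intro nn_integral_mono) (auto simp: indicator_def)
  also have "\<dots> = ennreal ?C1 * (\<integral>\<^sup>+x. ?A x * indicator B x \<partial>lborel)
      + ennreal (?C2 * (2 * c) powr p) * (\<integral>\<^sup>+x. ?B x * indicator UNIV x \<partial>lborel)"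
    by (simp add: nn_integral_add nn_integral_cmult)
  also have "\<dots> \<le> ennreal ?C1 * (1 * (\<integral>\<^sup>+x. ennreal (norm_pow p (a x)) * indicator B' x \<partial>lborel))
      + ennreal (?C2 * (2 * c) powr p) * (1 * (\<integral>\<^sup>+x. ennreal (norm_pow p (b x)) * indicator UNIV x \<partial>lborel))"
    unfolding i1[symmetric] using nz sub
    by (intro add_mono mult_left_mono nn_conv_le) auto
  finally show ?thesis by simp
qed

lemma norm_conv_le:
  assumes m: "mollifier \<eta> \<epsilon>" and f: "locint f"
  shows "ennreal (norm (conv \<eta> f x)) \<le> (\<integral>\<^sup>+z. ennreal (\<eta> z) * ennreal (norm (f (x - z))) \<partial>lborel)"
proof -
  have "ennreal (norm (conv \<eta> f x)) \<le> (\<integral>\<^sup>+z. ennreal (norm (\<eta> z *\<^sub>R f (x - z))) \<partial>lborel)"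
    unfolding conv_altdef(1)[OF mollifier_kernel_within[OF m] f]
    by (rule integral_norm_bound_ennreal) (rule conv_altdef(2)[OF mollifier_kernel_within[OF m] f])
  then show ?thesis by (simp add: ennreal_mult mollifier_nonneg[OF m])
qed

lemma mollify_L1_le:
  assumes m: "mollifier \<eta> \<epsilon>" and f: "locint f"
    and [measurable]: "B \<in> sets borel" "B' \<in> sets borel"
    and sub: "\<And>x z. x \<in> B \<Longrightarrow> norm z < \<epsilon> \<Longrightarrow> x - z \<in> B'"
  shows "(\<integral>\<^sup>+x. ennreal (norm (conv \<eta> f x)) * indicator B x \<partial>lborel)
    \<le> (\<integral>\<^sup>+x. ennreal (norm (f x)) * indicator B' x \<partial>lborel)"
proof -
  note [measurable] = mollifier_measurable[OF m] locint_measurable[OF f]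
  have i1: "(\<integral>\<^sup>+z. ennreal (\<eta> z) \<partial>lborel) = 1" using m by (simp add: mollifier_def)
  have nz: "norm z < \<epsilon>" if "ennreal (\<eta> z) \<noteq> 0" for z using that m by (force simp: mollifier_def)
  have "(\<integral>\<^sup>+x. ennreal (norm (conv \<eta> f x)) * indicator B x \<partial>lborel)
      \<le> (\<integral>\<^sup>+x. (\<integral>\<^sup>+z. ennreal (\<eta> z) * ennreal (norm (f (x - z))) \<partial>lborel) * indicator B x \<partial>lborel)"
    by (intro nn_integral_mono mult_right_mono norm_conv_le[OF m f]) simp
  also have "\<dots> \<le> 1 * (\<integral>\<^sup>+x. ennreal (norm (f x)) * indicator B' x \<partial>lborel)"
    unfolding i1[symmetric] using nz sub by (intro nn_conv_le) auto
  finally show ?thesis by simp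
qed

lemma ennreal_tendsto_0I:
  fixes T :: "nat \<Rightarrow> ennreal"
  assumes "\<And>e::real. 0 < e \<Longrightarrow> \<exists>g. g \<longlonglongrightarrow> 0 \<and> (\<forall>m. T m \<le> g m + ennreal e)"
  shows "T \<longlonglongrightarrow> 0"
proof (rule order_tendstoI)
  fix a :: ennreal assume "0 < a"
  then obtain b :: ennreal where b: "0 < b" "b < a" using dense by blast
  define e where "e = enn2real b / 2"
  have be: "b = ennreal (2 * e)" and e: "0 < e"
  proof -
    have "b < top" using b(2) top.not_eq_extremum[of b] by auto
    then show "b = ennreal (2 * e)" "0 < e" using b by (auto simp: e_def enn2real_positive_iff)
  qed
  obtain g where g: "g \<longlonglongrightarrow> 0" "\<And>m. T m \<le> g m + ennreal e" using assms[OF e] by blast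
  have "eventually (\<lambda>m. g m < ennreal e) sequentially" using g(1) e by (intro order_tendstoD) auto
  then show "eventually (\<lambda>m. T m < a) sequentially"
  proof eventually_elim
    case (elim m)
    have "T m \<le> ennreal e + ennreal e" using g(2)[of m] elim by (meson add_right_mono less_imp_le order_trans)
    also have "\<dots> = b" using e by (simp add: be ennreal_plus[symmetric] del: ennreal_plus)
    finally show ?case using b by simp
  qed
qed simp

text \<open>For an open set the mollifications converge pointwise on the set, so the part lost inside tends to
  zero by dominated convergence. Mollification does not increase the total mass, hence the part
  gained outside is no larger than the part lost inside.\<close>

lemma mollify_indicator_open:
  assumes m: "\<And>m. mollifier (\<eta> m) (\<epsilon> m)" and e0: "\<epsilon> \<longlonglongrightarrow> 0"
    and U: "open (U :: (real^'n) set)" "emeasure lborel U < \<infinity>"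
  shows "(\<lambda>m. \<integral>\<^sup>+x. ennreal \<bar>conv (\<eta> m) (indicator U) x - indicator U x\<bar> \<partial>lborel) \<longlonglongrightarrow> 0"
proof -
  have Ub [measurable]: "U \<in> sets borel" using U by simp
  have iU: "integrable lborel (indicator U :: _ \<Rightarrow> real)" using U by (intro integrable_real_indicator) auto
  note lU = integrable_imp_locint[OF iU]
  note k = mollifier_kernel_within[OF m]
  define v where "v m = conv (\<eta> m) (indicator U :: _ \<Rightarrow> real)" for m
  have vm [measurable]: "v m \<in> borel_measurable borel" for m
    unfolding v_def by (rule conv_measurable[OF k lU])
  have v0: "0 \<le> v m x" for m x
    unfolding v_def conv_def using mollifier_nonneg[OF m] by (intro integral_nonneg_AE) auto
  have "(\<integral>\<^sup>+x. ennreal (v m x) \<partial>lborel) \<le> emeasure lborel U" for m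
    using mollify_L1_le[OF m[of m] lU, of UNIV UNIV] v0 by (simp add: v_def ennreal_indicator)
  then have vU: "(\<integral>\<^sup>+x. ennreal (v m x) \<partial>lborel) \<le> (\<integral>\<^sup>+x. ennreal (indicator U x) \<partial>lborel)" for m
    by (simp add: ennreal_indicator)
  define P where "P m = (\<integral>\<^sup>+x. ennreal (max 0 (indicator U x - v m x)) \<partial>lborel)" for m
  define N where "N m = (\<integral>\<^sup>+x. ennreal (max 0 (v m x - indicator U x)) \<partial>lborel)" for m
  have "(\<integral>\<^sup>+x. ennreal (v m x) \<partial>lborel) + P m = (\<integral>\<^sup>+x. ennreal (indicator U x) \<partial>lborel) + N m" for m
    unfolding P_def N_def
    by (subst (1 2) nn_integral_add[symmetric]) (auto simp: v0 ennreal_plus[symmetric] max_def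
        simp del: ennreal_plus intro!: nn_integral_cong)
  then have "emeasure lborel U + N m = (\<integral>\<^sup>+x. ennreal (v m x) \<partial>lborel) + P m" for m
    by (simp add: ennreal_indicator)
  moreover have "(\<integral>\<^sup>+x. ennreal (v m x) \<partial>lborel) + P m \<le> emeasure lborel U + P m" for m
    using vU[of m] by (intro add_right_mono) (simp add: ennreal_indicator)
  ultimately have "emeasure lborel U + N m \<le> emeasure lborel U + P m" for m by metis
  then have NP: "N m \<le> P m" for m
    using U(2) unfolding ennreal_add_left_cancel_le by (metis infinity_ennreal_def order_less_irrefl)
  have "P \<longlonglongrightarrow> (\<integral>\<^sup>+x. 0 \<partial>(lborel :: (real^'n) measure))" unfolding P_def
  proof (rule nn_integral_dominated_convergence[where w = "indicator U"])
    show "AE x in lborel. ennreal (max 0 (indicator U x - v j x)) \<le> indicator U x" for j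
    proof (rule AE_I2)
      fix x :: "real^'n"
      have "max 0 (indicator U x - v j x) \<le> indicator U x" using v0[of j x] by (auto simp: indicator_def)
      then have "ennreal (max 0 (indicator U x - v j x)) \<le> ennreal (indicator U x)" by (rule ennreal_leI)
      then show "ennreal (max 0 (indicator U x - v j x)) \<le> indicator U x" by (simp add: ennreal_indicator)
    qed
    show "AE x in lborel. (\<lambda>j. ennreal (max 0 (indicator U x - v j x))) \<longlonglongrightarrow> 0"
    proof (rule AE_I2)
      fix x :: "real^'n"
      show "(\<lambda>j. ennreal (max 0 (indicator U x - v j x))) \<longlonglongrightarrow> 0"
      proof (cases "x \<in> U")
        case True
        then obtain d where d: "0 < d" "ball x d \<subseteq> U" using U openE by blast
        have "eventually (\<lambda>j. \<epsilon> j < d) sequentially" using e0 d by (intro order_tendstoD) auto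
        then have "eventually (\<lambda>j. ennreal (max 0 (indicator U x - v j x)) = 0) sequentially"
        proof eventually_elim
          case (elim j)
          have "v j x = (\<integral>z. \<eta> j z \<partial>lborel)" unfolding v_def conv_altdef(1)[OF k lU]
          proof (intro Bochner_Integration.integral_cong refl)
            fix z
            show "\<eta> j z *\<^sub>R indicator U (x - z) = \<eta> j z"
            proof (cases "norm z < \<epsilon> j")
              case True
              then have "x - z \<in> U" using elim d by (auto simp: dist_norm)
              then show ?thesis by simp
            qed (use k[of j] in \<open>auto simp: kernel_within_def\<close>)
          qed
          then show ?case using True mollifier_integral[OF m[of j]] by simp
        qed
        then show ?thesis by (rule tendsto_eventually)
      next
        case False
        have "max 0 (- v j x) = 0" for j using v0[of j x] by simp
        then show ?thesis using False by simp
      qed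
    qed
  qed (use U in auto)
  then have P0: "P \<longlonglongrightarrow> 0" by simp
  have "(\<lambda>m. 2 * P m) \<longlonglongrightarrow> 2 * 0" by (intro tendsto_mult_ennreal tendsto_const P0) auto
  then have lim: "(\<lambda>m. 2 * P m) \<longlonglongrightarrow> 0" by simp
  have bd: "(\<integral>\<^sup>+x. ennreal \<bar>v m x - indicator U x\<bar> \<partial>lborel) \<le> 2 * P m" for m
  proof -
    have "(\<integral>\<^sup>+x. ennreal \<bar>v m x - indicator U x\<bar> \<partial>lborel) = P m + N m"
      unfolding P_def N_def
      by (subst nn_integral_add[symmetric]) (auto simp: ennreal_plus[symmetric] max_def abs_if
          simp del: ennreal_plus intro!: nn_integral_cong)
    also have "\<dots> \<le> P m + P m" using NP by (rule add_left_mono)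
    finally show ?thesis by (simp add: mult_2)
  qed
  have "(\<lambda>m. \<integral>\<^sup>+x. ennreal \<bar>v m x - indicator U x\<bar> \<partial>lborel) \<longlonglongrightarrow> 0"
    by (rule tendsto_sandwich[OF _ _ tendsto_const lim]) (use bd in \<open>auto intro!: always_eventually\<close>)
  then show ?thesis unfolding v_def .
qed

lemma conv_diff:
  assumes "kernel_within \<kappa> \<epsilon>" "locint f" "locint g"
  shows "conv \<kappa> (\<lambda>x. f x - g x) x = conv \<kappa> f x - conv \<kappa> g x"
  unfolding conv_def using conv_integrable[OF assms(1,2), of x] conv_integrable[OF assms(1,3), of x]
  by (simp add: scaleR_diff_right)

lemma conv_add:
  assumes "kernel_within \<kappa> \<epsilon>" "locint f" "locint g"
  shows "conv \<kappa> (\<lambda>x. f x + g x) x = conv \<kappa> f x + conv \<kappa> g x"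
  unfolding conv_def using conv_integrable[OF assms(1,2), of x] conv_integrable[OF assms(1,3), of x]
  by (simp add: scaleR_add_right)

text \<open>Mollification contracts the \<open>L\<^sup>1\<close> norm, so approximating \<open>f\<close> by \<open>g\<close> costs the distance twice.\<close>

lemma mollify_perturb:
  fixes f g :: "real^'n \<Rightarrow> 'b::euclidean_space"
  assumes m: "mollifier \<eta> \<epsilon>" and f: "integrable lborel f" and g: "integrable lborel g"
  shows "(\<integral>\<^sup>+x. ennreal (norm (conv \<eta> f x - f x)) \<partial>lborel)
    \<le> (\<integral>\<^sup>+x. ennreal (norm (conv \<eta> g x - g x)) \<partial>lborel) + 2 * (\<integral>\<^sup>+x. ennreal (norm (f x - g x)) \<partial>lborel)"
proof -
  note k = mollifier_kernel_within[OF m]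
  note lf = integrable_imp_locint[OF f] and lg = integrable_imp_locint[OF g]
  have lfg: "locint (\<lambda>x. f x - g x)" using f g by (intro integrable_imp_locint) auto
  note [measurable] = locint_measurable[OF lf] locint_measurable[OF lg] conv_measurable[OF k lf]
    conv_measurable[OF k lg] conv_measurable[OF k lfg]
  have "norm (conv \<eta> f x - f x) \<le> norm (conv \<eta> g x - g x) + (norm (conv \<eta> (\<lambda>x. f x - g x) x) + norm (f x - g x))" for x
    unfolding conv_diff[OF k lf lg] by norm
  then have "(\<integral>\<^sup>+x. ennreal (norm (conv \<eta> f x - f x)) \<partial>lborel) \<le> (\<integral>\<^sup>+x. ennreal (norm (conv \<eta> g x - g x))
      + (ennreal (norm (conv \<eta> (\<lambda>x. f x - g x) x)) + ennreal (norm (f x - g x))) \<partial>lborel)"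
    by (intro nn_integral_mono) (simp add: ennreal_plus[symmetric] ennreal_leI del: ennreal_plus)
  also have "\<dots> = (\<integral>\<^sup>+x. ennreal (norm (conv \<eta> g x - g x)) \<partial>lborel)
      + ((\<integral>\<^sup>+x. ennreal (norm (conv \<eta> (\<lambda>x. f x - g x) x)) \<partial>lborel) + (\<integral>\<^sup>+x. ennreal (norm (f x - g x)) \<partial>lborel))"
    by (simp add: nn_integral_add)
  also have "\<dots> \<le> (\<integral>\<^sup>+x. ennreal (norm (conv \<eta> g x - g x)) \<partial>lborel)
      + ((\<integral>\<^sup>+x. ennreal (norm (f x - g x)) \<partial>lborel) + (\<integral>\<^sup>+x. ennreal (norm (f x - g x)) \<partial>lborel))"
    using mollify_L1_le[OF m lfg, of UNIV UNIV] by (intro add_mono) auto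
  finally show ?thesis by (simp add: mult_2)
qed

text \<open>Induction over integrable functions. Outer regularity reduces indicators of measurable sets to the
  case of open sets, and \<open>mollify_perturb\<close> passes to limits.\<close>

lemma mollify_L1:
  fixes f :: "real^'n \<Rightarrow> 'b::euclidean_space"
  assumes m: "\<And>m. mollifier (\<eta> m) (\<epsilon> m)" and e0: "\<epsilon> \<longlonglongrightarrow> 0" and f: "integrable lborel f"
  shows "(\<lambda>m. \<integral>\<^sup>+x. ennreal (norm (conv (\<eta> m) f x - f x)) \<partial>lborel) \<longlonglongrightarrow> 0"
  using f
proof (induction rule: integrable_induct)
  case (base A c)
  have A [measurable]: "A \<in> sets borel" using base by simp
  have iA: "integrable lborel (indicator A :: _ \<Rightarrow> real)" using base by (intro integrable_real_indicator) auto
  have "(\<lambda>m. \<integral>\<^sup>+x. ennreal \<bar>conv (\<eta> m) (indicator A) x - indicator A x\<bar> \<partial>lborel) \<longlonglongrightarrow> 0"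
  proof (rule ennreal_tendsto_0I)
    fix e :: real assume e: "0 < e"
    obtain U where U: "open U" "A \<subseteq> U" "emeasure lborel (U - A) < ennreal (e / 2)"
      using outer_regular_lborel[OF A, of "e / 2"] e by auto
    have [measurable]: "U \<in> sets borel" using U by simp
    have "emeasure lborel U = emeasure lborel A + emeasure lborel (U - A)"
      using U by (subst plus_emeasure) (auto intro!: arg_cong[of _ _ "emeasure lborel"])
    also have "\<dots> < \<infinity>" using base U(3) by (auto simp: order_less_trans[OF U(3)])
    finally have fU: "emeasure lborel U < \<infinity>" .
    have iU: "integrable lborel (indicator U :: _ \<Rightarrow> real)" using fU by (intro integrable_real_indicator) auto
    have "(\<integral>\<^sup>+x. ennreal (norm (indicator A x - indicator U x :: real)) \<partial>lborel) = emeasure lborel (U - A)"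
    proof -
      have "ennreal (norm (indicator A x - indicator U x :: real)) = indicator (U - A) x" for x
        using U(2) by (auto simp: indicator_def)
      then show ?thesis by simp
    qed
    then have "2 * (\<integral>\<^sup>+x. ennreal (norm (indicator A x - indicator U x :: real)) \<partial>lborel) \<le> 2 * ennreal (e / 2)"
      using U(3) by (intro mult_left_mono) auto
    also have "\<dots> = ennreal e" using e by (simp add: ennreal_mult[symmetric] flip: ennreal_numeral)
    finally have "2 * (\<integral>\<^sup>+x. ennreal (norm (indicator A x - indicator U x :: real)) \<partial>lborel) \<le> ennreal e" .
    then have "(\<integral>\<^sup>+x. ennreal \<bar>conv (\<eta> m) (indicator A) x - indicator A x\<bar> \<partial>lborel)
        \<le> (\<integral>\<^sup>+x. ennreal \<bar>conv (\<eta> m) (indicator U) x - indicator U x\<bar> \<partial>lborel) + ennreal e" for m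
      using order_trans[OF mollify_perturb[OF m[of m] iA iU] add_left_mono] by simp
    then show "\<exists>g. g \<longlonglongrightarrow> 0 \<and> (\<forall>m. (\<integral>\<^sup>+x. ennreal \<bar>conv (\<eta> m) (indicator A) x - indicator A x\<bar> \<partial>lborel) \<le> g m + ennreal e)"
      using mollify_indicator_open[OF m e0 U(1) fU] by blast
  qed
  then have "(\<lambda>m. ennreal (norm c) * (\<integral>\<^sup>+x. ennreal \<bar>conv (\<eta> m) (indicator A) x - indicator A x\<bar> \<partial>lborel)) \<longlonglongrightarrow> ennreal (norm c) * 0"
    by (intro tendsto_mult_ennreal tendsto_const) auto
  moreover have "(\<integral>\<^sup>+x. ennreal (norm (conv (\<eta> m) (\<lambda>x. indicator A x *\<^sub>R c) x - indicator A x *\<^sub>R c)) \<partial>lborel)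
     = ennreal (norm c) * (\<integral>\<^sup>+x. ennreal \<bar>conv (\<eta> m) (indicator A) x - indicator A x\<bar> \<partial>lborel)" for m
  proof -
    note lA = integrable_imp_locint[OF iA]
    note [measurable] = conv_measurable[OF mollifier_kernel_within[OF m[of m]] lA]
    have "conv (\<eta> m) (\<lambda>x. indicator A x *\<^sub>R c) x = conv (\<eta> m) (indicator A) x *\<^sub>R c" for x
      unfolding conv_def using conv_integrable[OF mollifier_kernel_within[OF m[of m]] lA, of x]
      by (subst integral_scaleR_left[symmetric]) auto
    then show ?thesis
      by (subst nn_integral_cmult[symmetric]) (auto simp: scaleR_diff_left[symmetric] ennreal_mult mult.commute)
  qed
  ultimately show ?case by simp
next
  case (add f g)
  note k = mollifier_kernel_within[OF m]
  note lf = integrable_imp_locint[OF add(1)] and lg = integrable_imp_locint[OF add(2)]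
  have bd: "(\<integral>\<^sup>+x. ennreal (norm (conv (\<eta> m) (\<lambda>x. f x + g x) x - (f x + g x))) \<partial>lborel)
     \<le> (\<integral>\<^sup>+x. ennreal (norm (conv (\<eta> m) f x - f x)) \<partial>lborel) + (\<integral>\<^sup>+x. ennreal (norm (conv (\<eta> m) g x - g x)) \<partial>lborel)" for m
  proof -
    note [measurable] = locint_measurable[OF lf] locint_measurable[OF lg] conv_measurable[OF k[of m] lf]
      conv_measurable[OF k[of m] lg]
    have "norm (conv (\<eta> m) (\<lambda>x. f x + g x) x - (f x + g x)) \<le> norm (conv (\<eta> m) f x - f x) + norm (conv (\<eta> m) g x - g x)" for x
      unfolding conv_add[OF k lf lg] by norm
    then show ?thesis
      by (subst nn_integral_add[symmetric])
        (auto intro!: nn_integral_mono simp: ennreal_plus[symmetric] ennreal_leI simp del: ennreal_plus)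
  qed
  have "(\<lambda>m. (\<integral>\<^sup>+x. ennreal (norm (conv (\<eta> m) f x - f x)) \<partial>lborel) + (\<integral>\<^sup>+x. ennreal (norm (conv (\<eta> m) g x - g x)) \<partial>lborel)) \<longlonglongrightarrow> 0 + 0"
    by (intro tendsto_add add)
  then have lim: "(\<lambda>m. (\<integral>\<^sup>+x. ennreal (norm (conv (\<eta> m) f x - f x)) \<partial>lborel) + (\<integral>\<^sup>+x. ennreal (norm (conv (\<eta> m) g x - g x)) \<partial>lborel)) \<longlonglongrightarrow> 0"
    by simp
  show ?case
    by (rule tendsto_sandwich[OF _ _ tendsto_const lim]) (use bd in \<open>auto intro!: always_eventually\<close>)
next
  case (lim f s)
  note [measurable] = borel_measurable_integrable[OF lim(1)] borel_measurable_integrable[OF lim(4)]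
  have "(\<lambda>i. \<integral>\<^sup>+x. ennreal (norm (f x - s i x)) \<partial>lborel) \<longlonglongrightarrow> (\<integral>\<^sup>+x. 0 \<partial>(lborel :: (real^'n) measure))"
  proof (rule nn_integral_dominated_convergence[where w = "\<lambda>x. ennreal (3 * norm (f x))"])
    have "(\<integral>\<^sup>+x. ennreal (norm (3 *\<^sub>R f x)) \<partial>lborel) < \<infinity>"
      using integrable_scaleR_right[OF lim(4), of 3] unfolding integrable_iff_bounded by blast
    then show "(\<integral>\<^sup>+x. ennreal (3 * norm (f x)) \<partial>lborel) < \<infinity>" by simp
    show "AE x in lborel. ennreal (norm (f x - s i x)) \<le> ennreal (3 * norm (f x))" for i
    proof (intro AE_I2 ennreal_leI)
      fix x :: "real^'n" show "norm (f x - s i x) \<le> 3 * norm (f x)"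
        using lim(3)[of x i] norm_triangle_ineq4[of "f x" "s i x"] by simp
    qed
    show "AE x in lborel. (\<lambda>i. ennreal (norm (f x - s i x))) \<longlonglongrightarrow> 0"
    proof (intro AE_I2)
      fix x :: "real^'n"
      have "(\<lambda>i. norm (f x - s i x)) \<longlonglongrightarrow> norm (f x - f x)" using lim(2)[of x] by (intro tendsto_intros) auto
      from tendsto_ennrealI[OF this] show "(\<lambda>i. ennreal (norm (f x - s i x))) \<longlonglongrightarrow> 0" by simp
    qed
  qed auto
  then have s0: "(\<lambda>i. \<integral>\<^sup>+x. ennreal (norm (f x - s i x)) \<partial>lborel) \<longlonglongrightarrow> 0" by simp
  show ?case
  proof (rule ennreal_tendsto_0I)
    fix e :: real assume e: "0 < e"
    have "eventually (\<lambda>i. (\<integral>\<^sup>+x. ennreal (norm (f x - s i x)) \<partial>lborel) < ennreal (e / 2)) sequentially"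
      using s0 e by (intro order_tendstoD) auto
    then obtain i where i: "(\<integral>\<^sup>+x. ennreal (norm (f x - s i x)) \<partial>lborel) < ennreal (e / 2)"
      by (auto simp: eventually_sequentially)
    then have "2 * (\<integral>\<^sup>+x. ennreal (norm (f x - s i x)) \<partial>lborel) \<le> 2 * ennreal (e / 2)"
      by (intro mult_left_mono) auto
    also have "\<dots> = ennreal e" using e by (simp add: ennreal_mult[symmetric] flip: ennreal_numeral)
    finally have "2 * (\<integral>\<^sup>+x. ennreal (norm (f x - s i x)) \<partial>lborel) \<le> ennreal e" .
    then have "(\<integral>\<^sup>+x. ennreal (norm (conv (\<eta> m) f x - f x)) \<partial>lborel)
        \<le> (\<integral>\<^sup>+x. ennreal (norm (conv (\<eta> m) (s i) x - s i x)) \<partial>lborel) + ennreal e" for m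
      by (rule order_trans[OF mollify_perturb[OF m[of m] lim(4) lim(1)[of i]] add_left_mono])
    then show "\<exists>g. g \<longlonglongrightarrow> 0 \<and> (\<forall>m. (\<integral>\<^sup>+x. ennreal (norm (conv (\<eta> m) f x - f x)) \<partial>lborel) \<le> g m + ennreal e)"
      using lim(5)[of i] by blast
  qed
qed

lemma mollify_L1loc:
  fixes f :: "real^'n \<Rightarrow> 'b::euclidean_space"
  assumes m: "\<And>m. mollifier (\<eta> m) (\<epsilon> m)" and e0: "\<epsilon> \<longlonglongrightarrow> 0" and f: "locint f"
  shows "(\<lambda>m. \<integral>\<^sup>+x. ennreal (norm (conv (\<eta> m) f x - f x)) * indicator (cball 0 R) x \<partial>lborel) \<longlonglongrightarrow> 0"
proof -
  define g where "g x = indicator (cball 0 (R + 1)) x *\<^sub>R f x" for x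
  have g: "integrable lborel g" using f unfolding locint_def g_def by blast
  have "conv (\<eta> m) f x = conv (\<eta> m) g x" if "norm x \<le> R" for m x
    unfolding conv_def
  proof (intro Bochner_Integration.integral_cong refl)
    fix y
    show "\<eta> m (x - y) *\<^sub>R f y = \<eta> m (x - y) *\<^sub>R g y"
    proof (cases "norm y \<le> R + 1")
      case False
      then have "1 \<le> norm (x - y)" using that norm_triangle_ineq3[of x y] by linarith
      then have "\<eta> m (x - y) = 0" using m[of m] unfolding mollifier_def by (meson order_trans)
      then show ?thesis by simp
    qed (simp add: g_def)
  qed
  then have "(\<integral>\<^sup>+x. ennreal (norm (conv (\<eta> m) f x - f x)) * indicator (cball 0 R) x \<partial>lborel)
     \<le> (\<integral>\<^sup>+x. ennreal (norm (conv (\<eta> m) g x - g x)) \<partial>lborel)" for m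
    by (intro nn_integral_mono) (auto simp: indicator_def g_def)
  then show ?thesis
    by (intro tendsto_sandwich[OF _ _ tendsto_const mollify_L1[OF m e0 g]] always_eventually allI) simp_all
qed

section \<open>Polar coordinates for a norm\<close>

lemma nn_integral_scaleR:
  fixes f :: "real^'n \<Rightarrow> ennreal"
  assumes [measurable]: "f \<in> borel_measurable borel" and s: "0 < s"
  shows "(\<integral>\<^sup>+h. f h \<partial>lborel) = ennreal (s ^ CARD('n)) * (\<integral>\<^sup>+k. f (s *\<^sub>R k) \<partial>lborel)"
proof -
  have "(lborel :: (real^'n) measure) = density (distr lborel borel (\<lambda>x. 0 + s *\<^sub>R x)) (\<lambda>_. \<bar>s\<bar> ^ DIM(real^'n))"
    using s by (intro lborel_affine) auto
  then have "(\<integral>\<^sup>+h. f h \<partial>lborel) = (\<integral>\<^sup>+h. f h \<partial>density (distr lborel borel (\<lambda>x. 0 + s *\<^sub>R x)) (\<lambda>_. \<bar>s\<bar> ^ DIM(real^'n)))"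
    by simp
  also have "\<dots> = ennreal (s ^ CARD('n)) * (\<integral>\<^sup>+k. f (s *\<^sub>R k) \<partial>lborel)"
    using s by (simp add: nn_integral_density nn_integral_distr nn_integral_cmult)
  finally show ?thesis .
qed

text \<open>The normalization that turns an average over the dilates of a ball into the identity, in
  \<open>polar_coordinates_homogeneous\<close>.\<close>

lemma nn_integral_inverse_power:
  assumes a: "0 < a" and n: "0 < n"
  shows "(\<integral>\<^sup>+s. ennreal (real n * a ^ n * s powr (- real n - 1)) * indicator {a..} s \<partial>lborel) = 1"
proof -
  let ?N = "real n"
  have "(\<integral>\<^sup>+s. ennreal (?N * a ^ n * s powr (- ?N - 1)) * indicator {a..} s \<partial>lborel)
     = ennreal (0 - (- (a ^ n * a powr (- ?N))))"
  proof (rule nn_integral_FTC_atLeast[where F = "\<lambda>s. - (a ^ n * s powr (- ?N))"])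
    fix s assume s: "a \<le> s"
    show "((\<lambda>s. - (a ^ n * s powr (- ?N))) has_real_derivative ?N * a ^ n * s powr (- ?N - 1)) (at s)"
      using s a n by (auto intro!: derivative_eq_intros)
    show "0 \<le> ?N * a ^ n * s powr (- ?N - 1)" using a by simp
  next
    have "((\<lambda>s. - (a ^ n * s powr (- ?N))) \<longlongrightarrow> - (a ^ n * 0)) at_top"
      using n by (intro tendsto_intros tendsto_neg_powr filterlim_ident) auto
    then show "((\<lambda>s. - (a ^ n * s powr (- ?N))) \<longlongrightarrow> 0) at_top" by simp
  qed measurable
  also have "a ^ n * a powr (- ?N) = 1"
    using a by (simp add: powr_minus powr_realpow)
  finally show ?thesis by simp
qed

text \<open>The inner integral over \<open>K\<close> depends on \<open>k\<close> only through its direction and thus is an integral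
  against the cone measure of the unit sphere. The proof substitutes
  \<open>r = s * G k\<close>, then \<open>h = s *\<^sub>R k\<close>, and integrates out the auxiliary dilation \<open>s\<close> last.\<close>

lemma polar_coordinates_homogeneous:
  fixes f :: "real^'n \<Rightarrow> ennreal" and G :: "real^'n \<Rightarrow> real" and radial_proj :: "real^'n \<Rightarrow> real^'n"
  assumes [measurable]: "f \<in> borel_measurable borel" "G \<in> borel_measurable borel"
      "radial_proj \<in> borel_measurable borel" "K \<in> sets borel"
    and G_pos: "\<And>x. 0 < G x \<longleftrightarrow> x \<noteq> 0" and G_scaleR: "\<And>c x. G (c *\<^sub>R x) = \<bar>c\<bar> * G x"
    and G_radial_proj_scaleR: "\<And>x. G x *\<^sub>R radial_proj x = x" and mem_K: "\<And>x. x \<in> K \<longleftrightarrow> G x \<le> 1"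
  shows "(\<integral>\<^sup>+h. f h \<partial>lborel) = (\<integral>\<^sup>+r. (\<integral>\<^sup>+k. ennreal (real CARD('n) * r powr (real CARD('n) - 1)) * f (r *\<^sub>R radial_proj k)
            * indicator K k \<partial>lborel) * indicator {0<..} r \<partial>lborel)"
proof -
  let ?N = "real CARD('n)"
  have G0: "0 \<le> G x" for x using G_pos[of x] G_scaleR[of 0 x] by (cases "x = 0") auto
  have ae0: "AE k in lborel. k \<noteq> (0::real^'n)" by (rule AE_lborel_singleton)
  have "(\<integral>\<^sup>+r. (\<integral>\<^sup>+k. ennreal (?N * r powr (?N - 1)) * f (r *\<^sub>R radial_proj k) * indicator K k \<partial>lborel) * indicator {0<..} r \<partial>lborel)
    = (\<integral>\<^sup>+r. (\<integral>\<^sup>+k. ennreal (?N * r powr (?N - 1)) * f (r *\<^sub>R radial_proj k) * indicator K k * indicator {0<..} r \<partial>lborel) \<partial>lborel)"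
    by (simp add: nn_integral_multc)
  also have "\<dots> = (\<integral>\<^sup>+k. (\<integral>\<^sup>+r. ennreal (?N * r powr (?N - 1)) * f (r *\<^sub>R radial_proj k) * indicator K k * indicator {0<..} r \<partial>lborel) \<partial>lborel)"
    by (rule lborel_pair.Fubini') measurable
  also have "\<dots> = (\<integral>\<^sup>+k. (\<integral>\<^sup>+s. ennreal (?N * G k ^ CARD('n) * s powr (?N - 1)) * f (s *\<^sub>R k) * indicator K k * indicator {0<..} s \<partial>lborel) \<partial>lborel)"
  proof (intro nn_integral_cong_AE, use ae0 in eventually_elim)
    fix k :: "real^'n" assume k: "k \<noteq> 0"
    have "(\<integral>\<^sup>+r. ennreal (?N * r powr (?N - 1)) * f (r *\<^sub>R radial_proj k) * indicator K k * indicator {0<..} r \<partial>lborel)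
      = ennreal \<bar>G k\<bar> * (\<integral>\<^sup>+s. ennreal (?N * (0 + G k * s) powr (?N - 1)) * f ((0 + G k * s) *\<^sub>R radial_proj k) * indicator K k * indicator {0<..} (0 + G k * s) \<partial>lborel)"
      using k G_pos[of k] by (intro nn_integral_real_affine) auto
    also have "\<dots> = (\<integral>\<^sup>+s. ennreal (G k) * (ennreal (?N * (G k * s) powr (?N - 1)) * f ((G k * s) *\<^sub>R radial_proj k) * indicator K k * indicator {0<..} (G k * s)) \<partial>lborel)"
      using G_pos[of k] k by (subst nn_integral_cmult) auto
    also have "\<dots> = (\<integral>\<^sup>+s. ennreal (?N * G k ^ CARD('n) * s powr (?N - 1)) * f (s *\<^sub>R k) * indicator K k * indicator {0<..} s \<partial>lborel)"
    proof (intro nn_integral_cong)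
      fix s :: real
      show "ennreal (G k) * (ennreal (?N * (G k * s) powr (?N - 1)) * f ((G k * s) *\<^sub>R radial_proj k) * indicator K k * indicator {0<..} (G k * s))
        = ennreal (?N * G k ^ CARD('n) * s powr (?N - 1)) * f (s *\<^sub>R k) * indicator K k * indicator {0<..} s"
      proof (cases "0 < s")
        case True
        have "(G k * s) *\<^sub>R radial_proj k = s *\<^sub>R k" using G_radial_proj_scaleR[of k] by (metis mult.commute scaleR_scaleR)
        moreover have "ennreal (G k) * ennreal (?N * (G k * s) powr (?N - 1)) = ennreal (?N * G k ^ CARD('n) * s powr (?N - 1))"
          using True G_pos[of k] k
          by (subst ennreal_mult[symmetric]) (auto simp: powr_mult powr_realpow[symmetric] powr_diff)
        ultimately show ?thesis using True k G_pos[of k] by (simp add: indicator_def mult.assoc[symmetric])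
      next
        case False
        then have "\<not> 0 < G k * s" 
            using zero_less_mult_pos[of "G k" s] G_pos[of k] k by blast
        then show ?thesis using False by (simp add: indicator_def)
      qed
    qed
    finally show "(\<integral>\<^sup>+r. ennreal (?N * r powr (?N - 1)) * f (r *\<^sub>R radial_proj k) * indicator K k * indicator {0<..} r \<partial>lborel)
      = (\<integral>\<^sup>+s. ennreal (?N * G k ^ CARD('n) * s powr (?N - 1)) * f (s *\<^sub>R k) * indicator K k * indicator {0<..} s \<partial>lborel)" .
  qed
  finally have e1: "(\<integral>\<^sup>+r. (\<integral>\<^sup>+k. ennreal (?N * r powr (?N - 1)) * f (r *\<^sub>R radial_proj k) * indicator K k \<partial>lborel) * indicator {0<..} r \<partial>lborel) = (\<integral>\<^sup>+k. (\<integral>\<^sup>+s. ennreal (?N * G k ^ CARD('n) * s powr (?N - 1)) * f (s *\<^sub>R k) * indicator K k * indicator {0<..} s \<partial>lborel) \<partial>lborel)" .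
  have e2: "(\<integral>\<^sup>+k. (\<integral>\<^sup>+s. ennreal (?N * G k ^ CARD('n) * s powr (?N - 1)) * f (s *\<^sub>R k) * indicator K k * indicator {0<..} s \<partial>lborel) \<partial>lborel) = (\<integral>\<^sup>+s. (\<integral>\<^sup>+k. ennreal (?N * G k ^ CARD('n) * s powr (?N - 1)) * f (s *\<^sub>R k) * indicator K k * indicator {0<..} s \<partial>lborel) \<partial>lborel)"
    by (rule lborel_pair.Fubini') measurable
  have e3: "(\<integral>\<^sup>+s. (\<integral>\<^sup>+k. ennreal (?N * G k ^ CARD('n) * s powr (?N - 1)) * f (s *\<^sub>R k) * indicator K k * indicator {0<..} s \<partial>lborel) \<partial>lborel) = (\<integral>\<^sup>+s. (\<integral>\<^sup>+h. ennreal (?N * G h ^ CARD('n) * s powr (- ?N - 1)) * f h * (if G h \<le> s then 1 else 0) * indicator {0<..} s \<partial>lborel) \<partial>lborel)"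
  proof (rule nn_integral_cong)
    fix s :: real
    show "(\<integral>\<^sup>+k. ennreal (?N * G k ^ CARD('n) * s powr (?N - 1)) * f (s *\<^sub>R k) * indicator K k * indicator {0<..} s \<partial>lborel)
      = (\<integral>\<^sup>+h. ennreal (?N * G h ^ CARD('n) * s powr (- ?N - 1)) * f h * (if G h \<le> s then 1 else 0) * indicator {0<..} s \<partial>lborel)"
    proof (cases "0 < s")
      case s: True
      have "(\<integral>\<^sup>+h. ennreal (?N * G h ^ CARD('n) * s powr (- ?N - 1)) * f h * (if G h \<le> s then 1 else 0) * indicator {0<..} s \<partial>lborel)
        = ennreal (s ^ CARD('n)) * (\<integral>\<^sup>+k. ennreal (?N * (s * G k) ^ CARD('n) * s powr (- ?N - 1)) * f (s *\<^sub>R k) * (if s * G k \<le> s then 1 else 0) * indicator {0<..} s \<partial>lborel)"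
        by (rule nn_integral_scaleR[OF _ s, where f = "\<lambda>h. ennreal (?N * G h ^ CARD('n) * s powr (- ?N - 1)) * f h * (if G h \<le> s then 1 else 0) * indicator {0<..} s", unfolded G_scaleR abs_of_pos[OF s]])
          measurable
      also have "\<dots> = (\<integral>\<^sup>+k. ennreal (s ^ CARD('n)) * (ennreal (?N * (s * G k) ^ CARD('n) * s powr (- ?N - 1)) * f (s *\<^sub>R k) * (if s * G k \<le> s then 1 else 0) * indicator {0<..} s) \<partial>lborel)"
        by (intro nn_integral_cmult[symmetric]) measurable
      also have "\<dots> = (\<integral>\<^sup>+k. ennreal (?N * G k ^ CARD('n) * s powr (?N - 1)) * f (s *\<^sub>R k) * indicator K k * indicator {0<..} s \<partial>lborel)"
      proof (intro nn_integral_cong)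
        fix k :: "real^'n"
        have e: "s ^ CARD('n) * (?N * (s * G k) ^ CARD('n) * s powr (- ?N - 1)) = ?N * G k ^ CARD('n) * s powr (?N - 1)"
          using s by (simp add: power_mult_distrib powr_realpow[symmetric] powr_diff powr_minus field_simps)
        have "ennreal (s ^ CARD('n)) * ennreal (?N * (s * G k) ^ CARD('n) * s powr (- ?N - 1)) = ennreal (?N * G k ^ CARD('n) * s powr (?N - 1))"
          using s G0[of k] by (subst ennreal_mult[symmetric]) (auto simp: e)
        moreover have "(if s * G k \<le> s then 1 else 0 :: ennreal) = indicator K k"
          using s by (auto simp: indicator_def mem_K)
        ultimately show "ennreal (s ^ CARD('n)) * (ennreal (?N * (s * G k) ^ CARD('n) * s powr (- ?N - 1)) * f (s *\<^sub>R k) * (if s * G k \<le> s then 1 else 0) * indicator {0<..} s)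
           = ennreal (?N * G k ^ CARD('n) * s powr (?N - 1)) * f (s *\<^sub>R k) * indicator K k * indicator {0<..} s"
          by (simp only: mult.assoc[symmetric])
      qed
      finally show ?thesis by simp
    qed simp
  qed
  have e4: "(\<integral>\<^sup>+s. (\<integral>\<^sup>+h. ennreal (?N * G h ^ CARD('n) * s powr (- ?N - 1)) * f h * (if G h \<le> s then 1 else 0) * indicator {0<..} s \<partial>lborel) \<partial>lborel) = (\<integral>\<^sup>+h. (\<integral>\<^sup>+s. ennreal (?N * G h ^ CARD('n) * s powr (- ?N - 1)) * f h * (if G h \<le> s then 1 else 0) * indicator {0<..} s \<partial>lborel) \<partial>lborel)"
    by (rule lborel_pair.Fubini') measurable
  have e5: "(\<integral>\<^sup>+h. (\<integral>\<^sup>+s. ennreal (?N * G h ^ CARD('n) * s powr (- ?N - 1)) * f h * (if G h \<le> s then 1 else 0) * indicator {0<..} s \<partial>lborel) \<partial>lborel) = (\<integral>\<^sup>+h. f h \<partial>lborel)"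
  proof (intro nn_integral_cong_AE, use ae0 in eventually_elim)
    fix h :: "real^'n" assume h: "h \<noteq> 0"
    have "(\<integral>\<^sup>+s. ennreal (?N * G h ^ CARD('n) * s powr (- ?N - 1)) * f h * (if G h \<le> s then 1 else 0) * indicator {0<..} s \<partial>lborel)
      = (\<integral>\<^sup>+s. f h * (ennreal (?N * G h ^ CARD('n) * s powr (- ?N - 1)) * indicator {G h..} s) \<partial>lborel)"
    proof (intro nn_integral_cong)
      fix s :: real
      show "ennreal (?N * G h ^ CARD('n) * s powr (- ?N - 1)) * f h * (if G h \<le> s then 1 else 0) * indicator {0<..} s
        = f h * (ennreal (?N * G h ^ CARD('n) * s powr (- ?N - 1)) * indicator {G h..} s)"
      proof (cases "G h \<le> s")
        case True
        then have "0 < s" using h G_pos[of h] by linarith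
        then show ?thesis using True by (simp add: indicator_def mult.commute)
      qed simp
    qed
    also have "\<dots> = f h * 1" using h G_pos[of h] by (subst nn_integral_cmult) (auto simp: nn_integral_inverse_power)
    finally show "(\<integral>\<^sup>+s. ennreal (?N * G h ^ CARD('n) * s powr (- ?N - 1)) * f h * (if G h \<le> s then 1 else 0) * indicator {0<..} s \<partial>lborel) = f h"
      by simp
  qed
  show ?thesis unfolding e1 e2 e3 e4 e5 ..
qed

lemma cis_measurable [measurable (raw)]:
  assumes [measurable]: "f \<in> borel_measurable M"
  shows "(\<lambda>x. cis (f x)) \<in> borel_measurable M"
proof -
  have "cis \<in> borel_measurable borel"
    by (rule borel_measurable_continuous_onI) (auto intro!: continuous_intros)
  from measurable_compose[OF assms this] show ?thesis .
qed

lemma vec_nth_measurable [measurable (raw)]: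
  fixes f :: "'a \<Rightarrow> 'b::{second_countable_topology, t2_space, real_normed_vector}^'n"
  assumes [measurable]: "f \<in> borel_measurable M"
  shows "(\<lambda>x. f x $ j) \<in> borel_measurable M"
proof -
  have "(\<lambda>v::'b^'n. v $ j) \<in> borel_measurable borel"
    by (rule borel_measurable_continuous_onI) (auto intro!: continuous_intros)
  from measurable_compose[OF assms this] show ?thesis .
qed

lemma cdot_measurable [measurable (raw)]:
  assumes [measurable]: "f \<in> borel_measurable M" "g \<in> borel_measurable M"
  shows "(\<lambda>x. cdot (f x) (g x) :: complex) \<in> borel_measurable M"
  unfolding cdot_def by measurable

lemma cdot_scaleR: "cdot v (c *\<^sub>R x) = of_real c * cdot v x"
  by (simp add: cdot_def sum_distrib_left mult_ac)

locale convex_body =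
  fixes K :: "(real^'n) set"
  assumes is_norm: "is_norm (gauge_norm K)" and unit_ball: "{x. gauge_norm K x \<le> 1} = K"
begin

abbreviation G :: "real^'n \<Rightarrow> real" where "G \<equiv> gauge_norm K"

lemma G_nonneg [simp]: "0 \<le> G x" and G_eq_0 [simp]: "G x = 0 \<longleftrightarrow> x = 0"
  and G_scaleR [simp]: "G (c *\<^sub>R x) = \<bar>c\<bar> * G x" and G_triangle: "G (x + y) \<le> G x + G y"
  using is_norm by (auto simp: is_norm_def)

lemma G_minus [simp]: "G (- x) = G x" using G_scaleR[of "-1" x] by simp

lemma G_pos [simp]: "0 < G x \<longleftrightarrow> x \<noteq> 0" using G_nonneg[of x] G_eq_0[of x] by linarith

lemma mem_K: "x \<in> K \<longleftrightarrow> G x \<le> 1" using unit_ball by auto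

lemma G_le: obtains C where "0 < C" "\<And>x. G x \<le> C * norm x"
proof -
  define C where "C = (\<Sum>j\<in>UNIV. G (axis j 1)) + 1"
  have "G x \<le> C * norm x" for x
  proof -
    have sum: "G (\<Sum>j\<in>J. f j) \<le> (\<Sum>j\<in>J. G (f j))" if "finite J" for J and f :: "'n \<Rightarrow> real^'n"
      using that
    proof induction
      case (insert j J) then show ?case using G_triangle[of "f j" "sum f J"] by simp
    qed (simp add: G_eq_0[THEN iffD2])
    have "G x = G (\<Sum>j\<in>UNIV. x $ j *\<^sub>R axis j 1)"
      using basis_expansion[of x] by (simp add: scalar_mult_eq_scaleR)
    also have "\<dots> \<le> (\<Sum>j\<in>UNIV. G (x $ j *\<^sub>R axis j 1))" by (rule sum) simp
    also have "\<dots> \<le> (\<Sum>j\<in>UNIV. norm x * G (axis j 1))"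
      by (intro sum_mono) (auto intro!: mult_right_mono component_le_norm_cart)
    also have "\<dots> \<le> C * norm x" by (simp add: C_def sum_distrib_left algebra_simps)
    finally show ?thesis .
  qed
  moreover have "0 < C" unfolding C_def by (intro add_nonneg_pos sum_nonneg) auto
  ultimately show thesis using that by blast
qed

lemma continuous_G: "continuous_on S G"
proof -
  obtain C where C: "0 < C" "\<And>x. G x \<le> C * norm x" using G_le by metis
  have "\<bar>G x - G y\<bar> \<le> C * norm (x - y)" for x y
    using G_triangle[of "x - y" y] G_triangle[of "y - x" x] C(2)[of "x - y"] G_minus[of "x - y"] by simp
  then have "C-lipschitz_on S G" using C by (intro lipschitz_onI) (auto simp: dist_norm)
  then show ?thesis by (rule lipschitz_on_continuous_on)
qed

lemma G_measurable [measurable]: "G \<in> borel_measurable borel"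
  by (rule borel_measurable_continuous_onI[OF continuous_G])

lemma G_ge: obtains c where "0 < c" "\<And>x. c * norm x \<le> G x"
proof -
  have "axis undefined 1 \<in> sphere (0::real^'n) 1" by simp
  then obtain x0 where x0: "x0 \<in> sphere 0 1" "\<And>y. y \<in> sphere 0 1 \<Longrightarrow> G x0 \<le> G y"
    using continuous_attains_inf[OF compact_sphere _ continuous_G] by (metis empty_iff)
  have "G x0 * norm x \<le> G x" for x
  proof (cases "x = 0")
    case False
    have "G x0 \<le> G ((1 / norm x) *\<^sub>R x)" using False by (intro x0(2)) simp
    then show ?thesis using False by (simp add: field_simps)
  qed simp
  moreover have "0 < G x0" using x0(1) by auto
  ultimately show thesis using that by blast
qed

lemma compact_K: "compact K"
proof -
  obtain c where c: "0 < c" "\<And>x. c * norm x \<le> G x" using G_ge by metis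
  have "closed {x. G x \<le> 1}" by (intro closed_Collect_le continuous_G continuous_intros)
  moreover have "norm x \<le> 1 / c" if "x \<in> K" for x
    using c(1) c(2)[of x] that by (simp add: mem_K field_simps)
  ultimately show ?thesis unfolding compact_eq_bounded_closed bounded_iff by (auto simp: unit_ball)
qed

lemma K_measurable [measurable]: "K \<in> sets borel"
  using compact_K by (simp add: borel_compact)

lemma emeasure_K_finite: "emeasure lborel K < \<infinity>"
  using compact_K emeasure_bounded_finite compact_imp_bounded by blast

text \<open>The projection to the unit sphere of the norm, with a point of the sphere as default value at the
  origin, so that no exceptional set has to be carried along.\<close>

definition radial_proj :: "real^'n \<Rightarrow> real^'n" where
  "radial_proj x = (let e = (if x = 0 then axis undefined 1 else x) in e /\<^sub>R G e)"

lemma radial_proj_measurable [measurable]: "radial_proj \<in> borel_measurable borel"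
  unfolding radial_proj_def Let_def by measurable

lemma G_radial_proj [simp]: "G (radial_proj x) = 1"
  by (auto simp: radial_proj_def Let_def)

lemma radial_proj_eq: "x \<noteq> 0 \<Longrightarrow> radial_proj x = x /\<^sub>R G x" by (simp add: radial_proj_def)

lemma G_radial_proj_scaleR: "G x *\<^sub>R radial_proj x = x" by (cases "x = 0") (auto simp: radial_proj_eq G_eq_0[THEN iffD2])

lemma radial_proj_bound: obtains R where "1 \<le> R" "\<And>x. norm (radial_proj x) \<le> R"
proof -
  obtain c where c: "0 < c" "\<And>x. c * norm x \<le> G x" using G_ge by metis
  have "norm (radial_proj x) \<le> 1 / c" for x using c(1) c(2)[of "radial_proj x"] by (simp add: field_simps)
  then show thesis using that[of "max 1 (1 / c)"] by (simp add: le_max_iff_disj)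
qed

lemma polar_coordinates:
  fixes f :: "real^'n \<Rightarrow> ennreal"
  assumes f: "f \<in> borel_measurable borel"
  shows "(\<integral>\<^sup>+h. f h \<partial>lborel) = (\<integral>\<^sup>+r. (\<integral>\<^sup>+k. ennreal (real CARD('n) * r powr (real CARD('n) - 1)) * f (r *\<^sub>R radial_proj k)
            * indicator K k \<partial>lborel) * indicator {0<..} r \<partial>lborel)"
  by (rule polar_coordinates_homogeneous[OF f G_measurable radial_proj_measurable K_measurable])
    (auto simp: mem_K G_radial_proj_scaleR)

text \<open>For \<open>p \<ge> 1\<close> this is \<open>p\<close> times the \<open>p\<close>-th power of the \<open>Z\<^sub>p\<^sup>* K\<close> norm, see \<open>zstar_norm_powr\<close>. The
  integrand depends only on the direction of \<open>k\<close>, like the one of \<open>sphere_energy\<close>, whose limit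
  at small radii it is.\<close>

definition energy_density :: "real \<Rightarrow> complex^'n \<Rightarrow> ennreal" where
  "energy_density p v = (\<integral>\<^sup>+k. ennreal (real CARD('n) * norm_pow p (cdot v (radial_proj k))) * indicator K k \<partial>lborel)"

lemma energy_density_measurable [measurable (raw)]:
  assumes [measurable]: "f \<in> borel_measurable M"
  shows "(\<lambda>x. energy_density p (f x)) \<in> borel_measurable M"
  unfolding energy_density_def by measurable

lemma nn_integral_powr_unit:
  assumes "-1 < a"
  shows "(\<integral>\<^sup>+r. ennreal (r powr a) * indicator {0<..1} r \<partial>lborel) = ennreal (1 / (a + 1))"
proof -
  have "((\<lambda>x. x powr a) has_integral (1 / (a + 1))) {0..1}"
    using has_integral_powr_from_0[OF assms, of 1] by simp
  then have "((\<lambda>x. x powr a * indicator {0..1} x) has_integral (1 / (a + 1))) UNIV"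
    by (subst (asm) has_integral_restrict_UNIV[symmetric], elim has_integral_eq[rotated]) (auto simp: indicator_def)
  then have "(\<integral>\<^sup>+r. ennreal (r powr a * indicator {0..1} r) \<partial>lborel) = ennreal (1 / (a + 1))"
    using assms by (intro nn_integral_has_integral_lborel) (auto simp: indicator_def)
  moreover have "(\<integral>\<^sup>+r. ennreal (r powr a) * indicator {0<..1} r \<partial>lborel) = (\<integral>\<^sup>+r. ennreal (r powr a * indicator {0..1} r) \<partial>lborel)"
    by (intro nn_integral_cong) (auto simp: indicator_def)
  ultimately show ?thesis by simp
qed

lemma cnorm_powr: "1 \<le> p \<Longrightarrow> cnorm_p p z powr p = norm_pow p z"
  by (simp add: cnorm_p_def norm_pow_def powr_powr)

text \<open>Homogeneity of degree \<open>p\<close>: the radial integral of \<open>r powr (N - 1 + p)\<close> over the unit interval is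
  \<open>1 / (N + p)\<close>, which explains the factor \<open>(N + p) / p\<close> in the definition of the norm.\<close>

lemma nn_integral_K_energy_density:
  assumes p: "1 \<le> p"
  shows "(\<integral>\<^sup>+k. ennreal (norm_pow p (cdot v k)) * indicator K k \<partial>lborel) = ennreal (1 / (real CARD('n) + p)) * energy_density p v"
proof -
  let ?N = "real CARD('n)"
  have "(\<integral>\<^sup>+k. ennreal (norm_pow p (cdot v k)) * indicator K k \<partial>lborel)
     = (\<integral>\<^sup>+r. (\<integral>\<^sup>+k. ennreal (?N * r powr (?N - 1)) * (ennreal (norm_pow p (cdot v (r *\<^sub>R radial_proj k))) * indicator K (r *\<^sub>R radial_proj k))
            * indicator K k \<partial>lborel) * indicator {0<..} r \<partial>lborel)"
    by (rule polar_coordinates) measurable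
  also have "\<dots> = (\<integral>\<^sup>+r. energy_density p v * (ennreal (r powr (?N - 1 + p)) * indicator {0<..1} r) \<partial>lborel)"
  proof (intro nn_integral_cong)
    fix r :: real
    show "(\<integral>\<^sup>+k. ennreal (?N * r powr (?N - 1)) * (ennreal (norm_pow p (cdot v (r *\<^sub>R radial_proj k))) * indicator K (r *\<^sub>R radial_proj k))
            * indicator K k \<partial>lborel) * indicator {0<..} r = energy_density p v * (ennreal (r powr (?N - 1 + p)) * indicator {0<..1} r)"
    proof (cases "0 < r")
      case r: True
      have "(\<integral>\<^sup>+k. ennreal (?N * r powr (?N - 1)) * (ennreal (norm_pow p (cdot v (r *\<^sub>R radial_proj k))) * indicator K (r *\<^sub>R radial_proj k))
            * indicator K k \<partial>lborel)
        = (\<integral>\<^sup>+k. (ennreal (r powr (?N - 1 + p)) * indicator {0<..1} r) * (ennreal (?N * norm_pow p (cdot v (radial_proj k))) * indicator K k) \<partial>lborel)"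
      proof (intro nn_integral_cong)
        fix k
        have "(indicator K (r *\<^sub>R radial_proj k) :: ennreal) = indicator {0<..1} r"
          using r by (auto simp: indicator_def mem_K)
        moreover have "ennreal (?N * r powr (?N - 1)) * ennreal (norm_pow p (cdot v (r *\<^sub>R radial_proj k)))
            = ennreal (r powr (?N - 1 + p)) * ennreal (?N * norm_pow p (cdot v (radial_proj k)))"
          using r by (simp add: cdot_scaleR norm_pow_scale ennreal_mult[symmetric] powr_add mult_ac)
        ultimately show "ennreal (?N * r powr (?N - 1)) * (ennreal (norm_pow p (cdot v (r *\<^sub>R radial_proj k))) * indicator K (r *\<^sub>R radial_proj k)) * indicator K k
          = (ennreal (r powr (?N - 1 + p)) * indicator {0<..1} r) * (ennreal (?N * norm_pow p (cdot v (radial_proj k))) * indicator K k)"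
          by (simp add: mult.assoc[symmetric]) (simp add: mult_ac)
      qed
      also have "\<dots> = (ennreal (r powr (?N - 1 + p)) * indicator {0<..1} r) * energy_density p v"
        unfolding energy_density_def by (intro nn_integral_cmult) measurable
      finally show ?thesis using r by (simp add: mult.commute)
    qed simp
  qed
  also have "\<dots> = energy_density p v * ennreal (1 / (?N + p))"
    using nn_integral_powr_unit[of "?N - 1 + p"] p by (subst nn_integral_cmult) auto
  finally show ?thesis by (simp add: mult.commute)
qed

lemma K_integral_finite:
  assumes f: "continuous_on UNIV (f :: real^'n \<Rightarrow> real)"
  shows "integrable lborel (\<lambda>k. indicator K k *\<^sub>R f k)"
proof -
  show ?thesis using compact_K continuous_on_subset[OF f subset_UNIV] by (rule borel_integrable_compact)
qed

lemma zstar_norm_powr: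
  assumes p: "1 \<le> p"
  shows "ennreal (p * zstar_norm p K v powr p) = energy_density p v"
proof -
  let ?N = "real CARD('n)" and ?I = "LINT x:K|lebesgue. cnorm_p p (cdot v x) powr p"
  have int: "integrable lborel (\<lambda>k. indicator K k *\<^sub>R norm_pow p (cdot v k))"
    using p unfolding cdot_def by (intro K_integral_finite continuous_intros) auto
  have "?I = (\<integral>k. indicator K k *\<^sub>R norm_pow p (cdot v k) \<partial>lborel)"
    unfolding set_lebesgue_integral_def cnorm_powr[OF p] by (rule integral_completion) measurable
  moreover have "ennreal (\<integral>k. indicator K k *\<^sub>R norm_pow p (cdot v k) \<partial>lborel)
      = (\<integral>\<^sup>+k. ennreal (norm_pow p (cdot v k)) * indicator K k \<partial>lborel)"
    using int by (subst nn_integral_eq_integral[symmetric]) (auto intro!: nn_integral_cong simp: indicator_def)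
  ultimately have I: "ennreal ?I = ennreal (1 / (?N + p)) * energy_density p v"
    using nn_integral_K_energy_density[OF p] by simp
  have I0: "0 \<le> ?I" unfolding set_lebesgue_integral_def
    by (intro integral_nonneg_AE) auto
  have "p * zstar_norm p K v powr p = (?N + p) * ?I"
    using p I0 unfolding zstar_norm_def by (simp add: powr_powr)
  then have "ennreal (p * zstar_norm p K v powr p) = ennreal (?N + p) * (ennreal (1 / (?N + p)) * energy_density p v)"
    using p I0 by (simp add: ennreal_mult I del: ennreal_plus)
  also have "\<dots> = energy_density p v"
    using p by (simp add: mult.assoc[symmetric] ennreal_mult[symmetric] del: ennreal_plus)
  finally show ?thesis .
qed

end

section \<open>Reduction to the radial variable\<close>

text \<open>On \<open>r < 1\<close> the factor \<open>r powr (- p)\<close> is at least one, so the tail hypothesis also shows that the mass between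
  \<open>\<delta>\<close> and \<open>1\<close> vanishes in the limit. All but an arbitrarily small part of the unit mass therefore
  sits at \<open>r \<le> \<delta>\<close>, where \<open>S\<close> is close to its limit, and for \<open>r > \<delta>\<close> the growth bound on
  \<open>S\<close> matches the tail hypothesis.\<close>

lemma radial_limit:
  fixes \<rho> :: "nat \<Rightarrow> real \<Rightarrow> real" and S :: "real \<Rightarrow> ennreal" and N p :: real
  assumes [measurable]: "\<And>n. \<rho> n \<in> borel_measurable borel" "S \<in> borel_measurable borel"
    and p: "1 \<le> p"
    and lim: "(S \<longlongrightarrow> l) (at_right 0)" and l: "l < \<infinity>"
    and bd: "\<And>r. 0 < r \<Longrightarrow> S r \<le> C * ennreal (r powr (- p))" and C: "C < \<infinity>"
    and tail: "\<And>\<delta>. 0 < \<delta> \<Longrightarrow> (\<lambda>n. \<integral>\<^sup>+ r\<in>{\<delta><..}. ennreal (\<rho> n r * r powr (N - 1 - p)) \<partial>lborel) \<longlonglongrightarrow> 0"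
    and one: "\<And>n. (\<integral>\<^sup>+ r\<in>{0<..<1}. ennreal (\<rho> n r * r powr (N - 1)) \<partial>lborel) = 1"
    and pos: "\<And>n r. 0 \<le> \<rho> n r"
  shows "(\<lambda>n. \<integral>\<^sup>+ r. ennreal (\<rho> n r * r powr (N - 1)) * S r * indicator {0<..} r \<partial>lborel) \<longlonglongrightarrow> l"
proof -
  define E where "E n = (\<integral>\<^sup>+ r. ennreal (\<rho> n r * r powr (N - 1)) * S r * indicator {0<..} r \<partial>lborel)" for n
  define m where "m \<delta> n = (\<integral>\<^sup>+ r. ennreal (\<rho> n r * r powr (N - 1)) * indicator {0<..\<delta>} r \<partial>lborel)" for \<delta> n
  define t where "t \<delta> n = (\<integral>\<^sup>+ r. ennreal (\<rho> n r * r powr (N - 1 - p)) * indicator {\<delta><..} r \<partial>lborel)" for \<delta> n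
  have t0: "t \<delta> \<longlonglongrightarrow> 0" if "0 < \<delta>" for \<delta> unfolding t_def using tail[OF that] .
  have m1: "m \<delta> n \<le> 1" if "\<delta> < 1" for \<delta> n
    unfolding m_def one[of n, symmetric] using that by (intro nn_integral_mono) (auto simp: indicator_def)
  have mt: "1 \<le> m \<delta> n + t \<delta> n" if "\<delta> < 1" for \<delta> n
  proof -
    have "1 \<le> (\<integral>\<^sup>+ r. ennreal (\<rho> n r * r powr (N - 1)) * indicator {0<..\<delta>} r
        + ennreal (\<rho> n r * r powr (N - 1 - p)) * indicator {\<delta><..} r \<partial>lborel)"
      unfolding one[of n, symmetric]
    proof (intro nn_integral_mono)
      fix r :: real
      show "ennreal (\<rho> n r * r powr (N - 1)) * indicator {0<..<1} r \<le> ennreal (\<rho> n r * r powr (N - 1)) * indicator {0<..\<delta>} r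
        + ennreal (\<rho> n r * r powr (N - 1 - p)) * indicator {\<delta><..} r"
      proof (cases "0 < r \<and> r < 1 \<and> \<delta> < r")
        case True
        then have "r powr (N - 1) \<le> r powr (N - 1 - p)" using p by (intro powr_mono') auto
        then have "ennreal (\<rho> n r * r powr (N - 1)) \<le> ennreal (\<rho> n r * r powr (N - 1 - p))"
          using pos by (intro ennreal_leI mult_left_mono)
        then show ?thesis using True by (simp add: indicator_def)
      qed (auto simp: indicator_def)
    qed
    also have "\<dots> = m \<delta> n + t \<delta> n" unfolding m_def t_def by (intro nn_integral_add) measurable
    finally show ?thesis .
  qed
  have "E \<longlonglongrightarrow> l"
  proof (rule order_tendstoI)
    fix a assume "l < a"
    then obtain b where b: "l < b" "b < a" using dense by blast
    have "eventually (\<lambda>r. S r < b) (at_right 0)" using lim b by (intro order_tendstoD)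
    then obtain d where d: "0 < d" "\<And>r. 0 < r \<Longrightarrow> r < d \<Longrightarrow> S r < b"
      by (auto simp: eventually_at_right_field)
    define \<delta> where "\<delta> = min d 1 / 2"
    have \<delta>: "0 < \<delta>" "\<delta> < 1" "\<delta> < d" using d by (auto simp: \<delta>_def)
    have up: "E n \<le> b + C * t \<delta> n" for n
    proof -
      have "E n \<le> (\<integral>\<^sup>+ r. b * (ennreal (\<rho> n r * r powr (N - 1)) * indicator {0<..\<delta>} r)
        + C * (ennreal (\<rho> n r * r powr (N - 1 - p)) * indicator {\<delta><..} r) \<partial>lborel)"
        unfolding E_def
      proof (intro nn_integral_mono)
        fix r :: real
        show "ennreal (\<rho> n r * r powr (N - 1)) * S r * indicator {0<..} r \<le> b * (ennreal (\<rho> n r * r powr (N - 1)) * indicator {0<..\<delta>} r)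
          + C * (ennreal (\<rho> n r * r powr (N - 1 - p)) * indicator {\<delta><..} r)"
        proof (cases "0 < r")
          case True
          show ?thesis
          proof (cases "r \<le> \<delta>")
            case rd: True
            then have "S r \<le> b" using d(2)[OF True] \<delta> by (simp add: less_imp_le)
            then show ?thesis using True rd by (simp add: indicator_def mult.commute mult_right_mono)
          next
            case False
            have "ennreal (\<rho> n r * r powr (N - 1)) * S r \<le> ennreal (\<rho> n r * r powr (N - 1)) * (C * ennreal (r powr (- p)))"
              by (intro mult_left_mono bd True) auto
            also have "\<dots> = C * ennreal ((\<rho> n r * r powr (N - 1)) * r powr (- p))"
              using pos by (simp add: ennreal_mult mult_ac)
            also have "(\<rho> n r * r powr (N - 1)) * r powr (- p) = \<rho> n r * r powr (N - 1 - p)"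
              by (simp add: powr_add[symmetric] mult.assoc)
            finally show ?thesis using True False by (simp add: indicator_def)
          qed
        qed simp
      qed
      also have "\<dots> = b * m \<delta> n + C * t \<delta> n"
        unfolding m_def t_def by (subst nn_integral_add) (auto simp: nn_integral_cmult)
      also have "\<dots> \<le> b * 1 + C * t \<delta> n"
        using m1[OF \<delta>(2)] by (intro add_right_mono mult_left_mono) auto
      finally show ?thesis by simp
    qed
    have "(\<lambda>n. b + C * t \<delta> n) \<longlonglongrightarrow> b + C * 0"
      using t0[OF \<delta>(1)] C by (intro tendsto_add tendsto_const tendsto_mult_ennreal) auto
    then have "eventually (\<lambda>n. b + C * t \<delta> n < a) sequentially"
      using b by (intro order_tendstoD) auto
    then show "eventually (\<lambda>n. E n < a) sequentially"
      by eventually_elim (use up in \<open>auto intro: order_le_less_trans\<close>)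
  next
    fix a assume "a < l"
    then obtain b where b: "a < b" "b < l" using dense by blast
    have bf: "b < top" using b(2) l by (simp add: order_less_trans)
    have "eventually (\<lambda>r. b < S r) (at_right 0)" using lim b by (intro order_tendstoD)
    then obtain d where d: "0 < d" "\<And>r. 0 < r \<Longrightarrow> r < d \<Longrightarrow> b < S r"
      by (auto simp: eventually_at_right_field)
    define \<delta> where "\<delta> = min d 1 / 2"
    have \<delta>: "0 < \<delta>" "\<delta> < 1" "\<delta> < d" using d by (auto simp: \<delta>_def)
    have lo: "b * m \<delta> n \<le> E n" for n
    proof -
      have "b * m \<delta> n = (\<integral>\<^sup>+ r. b * (ennreal (\<rho> n r * r powr (N - 1)) * indicator {0<..\<delta>} r) \<partial>lborel)"
        unfolding m_def by (intro nn_integral_cmult[symmetric]) measurable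
      also have "\<dots> \<le> E n" unfolding E_def
      proof (intro nn_integral_mono)
        fix r :: real
        show "b * (ennreal (\<rho> n r * r powr (N - 1)) * indicator {0<..\<delta>} r) \<le> ennreal (\<rho> n r * r powr (N - 1)) * S r * indicator {0<..} r"
        proof (cases "0 < r \<and> r \<le> \<delta>")
          case True
          then have "b \<le> S r" using d(2)[of r] \<delta> by (simp add: less_imp_le)
          then show ?thesis using True by (simp add: indicator_def mult.commute mult_right_mono)
        qed (auto simp: indicator_def)
      qed
      finally show ?thesis .
    qed
    have "(\<lambda>n. a + b * t \<delta> n) \<longlonglongrightarrow> a + b * 0"
      using t0[OF \<delta>(1)] bf by (intro tendsto_add tendsto_const tendsto_mult_ennreal) auto
    then have "eventually (\<lambda>n. a + b * t \<delta> n < b) sequentially"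
      using b by (intro order_tendstoD) auto
    then show "eventually (\<lambda>n. a < E n) sequentially"
    proof eventually_elim
      case (elim n)
      have "b * 1 \<le> b * (m \<delta> n + t \<delta> n)" by (intro mult_left_mono mt \<delta>) auto
      also have "\<dots> \<le> E n + b * t \<delta> n" using lo[of n] by (simp add: distrib_left add_right_mono)
      finally have *: "b \<le> E n + b * t \<delta> n" by simp
      show "a < E n"
      proof (rule ccontr)
        assume "\<not> a < E n"
        then have "E n + b * t \<delta> n \<le> a + b * t \<delta> n" by (intro add_right_mono) auto
        with * elim show False by order
      qed
    qed
  qed
  then show ?thesis unfolding E_def .
qed

text \<open>The difference \<open>\<Psi>\<^sub>u(x, x + h) - \<Psi>\<^sub>u(x, x)\<close> as a function of the increment \<open>h\<close>.\<close>

definition magnetic_diff :: "(real^'n \<Rightarrow> real^'n) \<Rightarrow> (real^'n \<Rightarrow> complex) \<Rightarrow> real^'n \<Rightarrow> real^'n \<Rightarrow> complex" where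
  "magnetic_diff A u h x = cis (- (h \<bullet> A (x + h /\<^sub>R 2))) * u (x + h) - u x"

lemma Psi_eq_magnetic_diff: "Psi A u x (x + h) - Psi A u x x = magnetic_diff A u h x"
proof -
  have e: "(x + (x + h)) /\<^sub>R 2 = x + h /\<^sub>R 2"
    by (simp add: scaleR_add_right[symmetric] add.assoc[symmetric]) (simp add: scaleR_add_right mult_2[symmetric] scaleR_2[symmetric])
  show ?thesis unfolding Psi_def magnetic_diff_def e by (simp add: cis_conv_exp)
qed

locale magnetic = convex_body K for K :: "(real^'n) set" +
  fixes A :: "real^'n \<Rightarrow> real^'n" and L p :: real
  assumes lipA: "L-lipschitz_on UNIV A" and p1: "1 \<le> p"
begin

lemma A_diff_le: "norm (A x - A y) \<le> L * norm (x - y)"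
  using lipschitz_onD[OF lipA, of x y] by (simp add: dist_norm)

lemma L_nonneg: "0 \<le> L" using lipschitz_on_nonneg[OF lipA] .

lemma continuous_A: "continuous_on S A"
  using lipschitz_on_continuous_on[OF lipA] continuous_on_subset by blast

lemma A_measurable [measurable]: "A \<in> borel_measurable borel"
  by (rule borel_measurable_continuous_onI[OF continuous_A])

lemma magnetic_diff_measurable [measurable (raw)]:
  assumes [measurable]: "u \<in> borel_measurable borel" "f \<in> borel_measurable M" "g \<in> borel_measurable M"
  shows "(\<lambda>x. magnetic_diff A u (f x) (g x)) \<in> borel_measurable M"
  unfolding magnetic_diff_def by measurable

definition shift_energy :: "(real^'n \<Rightarrow> complex) \<Rightarrow> real^'n \<Rightarrow> ennreal" where
  "shift_energy u h = (\<integral>\<^sup>+x. ennreal (norm_pow p (magnetic_diff A u h x)) \<partial>lborel)"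

lemma shift_energy_measurable [measurable (raw)]:
  assumes [measurable]: "u \<in> borel_measurable borel" "f \<in> borel_measurable M"
  shows "(\<lambda>x. shift_energy u (f x)) \<in> borel_measurable M"
  unfolding shift_energy_def by measurable

text \<open>The integral over all directions \<open>t\<close>, against the cone measure, of the \<open>p\<close>-th power of the \<open>L\<^sup>p\<close> norm of the magnetic difference
  quotients with increment \<open>r t\<close>.\<close>

definition sphere_energy :: "(real^'n \<Rightarrow> complex) \<Rightarrow> real \<Rightarrow> ennreal" where
  "sphere_energy u r = (\<integral>\<^sup>+k. ennreal (real CARD('n) / r powr p) * shift_energy u (r *\<^sub>R radial_proj k) * indicator K k \<partial>lborel)"

lemma sphere_energy_measurable [measurable]:
  assumes [measurable]: "u \<in> borel_measurable borel"
  shows "sphere_energy u \<in> borel_measurable borel"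
  unfolding sphere_energy_def by measurable

text \<open>Translate \<open>y = x + h\<close>, exchange the integrals, and use polar coordinates in \<open>h\<close>; the weight depends
  on the norm of \<open>h\<close> only.\<close>

lemma nonlocal_energy_eq:
  fixes \<rho> :: "real \<Rightarrow> real"
  assumes [measurable]: "u \<in> borel_measurable borel" "\<rho> \<in> borel_measurable borel" and pos: "\<And>r. 0 \<le> \<rho> r"
  shows "nonlocal_energy p A K \<rho> u
    = (\<integral>\<^sup>+r. ennreal (\<rho> r * r powr (real CARD('n) - 1)) * sphere_energy u r * indicator {0<..} r \<partial>lborel)"
proof -
  let ?N = "real CARD('n)"
  define \<phi> where "\<phi> x y = ennreal (norm_pow p (Psi A u x y - Psi A u x x) / G (x - y) powr p * \<rho> (G (x - y)))" for x y
  have [measurable]: "case_prod \<phi> \<in> borel_measurable (lborel \<Otimes>\<^sub>M lborel)"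
    unfolding \<phi>_def Psi_def by measurable
  have "nonlocal_energy p A K \<rho> u = (\<integral>\<^sup>+(x, y). \<phi> x y \<partial>(lborel :: ((real^'n) \<times> (real^'n)) measure))"
    unfolding nonlocal_energy_def nn_integral_completion \<phi>_def cnorm_powr[OF p1] ..
  also have "\<dots> = (\<integral>\<^sup>+x. (\<integral>\<^sup>+y. \<phi> x y \<partial>lborel) \<partial>lborel)"
    unfolding lborel_prod[symmetric] by (subst lborel.nn_integral_fst[symmetric]) auto
  also have "\<dots> = (\<integral>\<^sup>+x. (\<integral>\<^sup>+h. ennreal (norm_pow p (magnetic_diff A u h x) / G h powr p * \<rho> (G h)) \<partial>lborel) \<partial>lborel)"
  proof (rule nn_integral_cong)
    fix x :: "real^'n"
    have "(\<integral>\<^sup>+y. \<phi> x y \<partial>lborel) = (\<integral>\<^sup>+h. \<phi> x (h + x) \<partial>lborel)"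
      by (rule nn_integral_translate[symmetric]) measurable
    also have "\<dots> = (\<integral>\<^sup>+h. ennreal (norm_pow p (magnetic_diff A u h x) / G h powr p * \<rho> (G h)) \<partial>lborel)"
      unfolding \<phi>_def by (simp add: add.commute[of _ x] Psi_eq_magnetic_diff)
    finally show "(\<integral>\<^sup>+y. \<phi> x y \<partial>lborel) = (\<integral>\<^sup>+h. ennreal (norm_pow p (magnetic_diff A u h x) / G h powr p * \<rho> (G h)) \<partial>lborel)" .
  qed
  also have "\<dots> = (\<integral>\<^sup>+h. (\<integral>\<^sup>+x. ennreal (norm_pow p (magnetic_diff A u h x) / G h powr p * \<rho> (G h)) \<partial>lborel) \<partial>lborel)"
    by (rule lborel_pair.Fubini') measurable
  also have "\<dots> = (\<integral>\<^sup>+h. ennreal (\<rho> (G h) / G h powr p) * shift_energy u h \<partial>lborel)"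
  proof (rule nn_integral_cong)
    fix h :: "real^'n"
    have "(\<integral>\<^sup>+x. ennreal (norm_pow p (magnetic_diff A u h x) / G h powr p * \<rho> (G h)) \<partial>lborel)
       = (\<integral>\<^sup>+x. ennreal (\<rho> (G h) / G h powr p) * ennreal (norm_pow p (magnetic_diff A u h x)) \<partial>lborel)"
      using pos by (intro nn_integral_cong) (simp add: ennreal_mult[symmetric] mult.commute)
    also have "\<dots> = ennreal (\<rho> (G h) / G h powr p) * shift_energy u h"
      unfolding shift_energy_def by (intro nn_integral_cmult) measurable
    finally show "(\<integral>\<^sup>+x. ennreal (norm_pow p (magnetic_diff A u h x) / G h powr p * \<rho> (G h)) \<partial>lborel)
       = ennreal (\<rho> (G h) / G h powr p) * shift_energy u h" .
  qed
  also have "\<dots> = (\<integral>\<^sup>+r. (\<integral>\<^sup>+k. ennreal (?N * r powr (?N - 1)) * (ennreal (\<rho> (G (r *\<^sub>R radial_proj k)) / G (r *\<^sub>R radial_proj k) powr p) * shift_energy u (r *\<^sub>R radial_proj k))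
            * indicator K k \<partial>lborel) * indicator {0<..} r \<partial>lborel)"
    by (rule polar_coordinates) measurable
  also have "\<dots> = (\<integral>\<^sup>+r. ennreal (\<rho> r * r powr (?N - 1)) * sphere_energy u r * indicator {0<..} r \<partial>lborel)"
  proof (rule nn_integral_cong)
    fix r :: real
    show "(\<integral>\<^sup>+k. ennreal (?N * r powr (?N - 1)) * (ennreal (\<rho> (G (r *\<^sub>R radial_proj k)) / G (r *\<^sub>R radial_proj k) powr p) * shift_energy u (r *\<^sub>R radial_proj k))
            * indicator K k \<partial>lborel) * indicator {0<..} r = ennreal (\<rho> r * r powr (?N - 1)) * sphere_energy u r * indicator {0<..} r"
    proof (cases "0 < r")
      case r: True
      have "(\<integral>\<^sup>+k. ennreal (?N * r powr (?N - 1)) * (ennreal (\<rho> (G (r *\<^sub>R radial_proj k)) / G (r *\<^sub>R radial_proj k) powr p) * shift_energy u (r *\<^sub>R radial_proj k)) * indicator K k \<partial>lborel)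
        = (\<integral>\<^sup>+k. ennreal (\<rho> r * r powr (?N - 1)) * (ennreal (?N / r powr p) * shift_energy u (r *\<^sub>R radial_proj k) * indicator K k) \<partial>lborel)"
      proof (rule nn_integral_cong)
        fix k
        have "ennreal (?N * r powr (?N - 1)) * ennreal (\<rho> r / r powr p) = ennreal (\<rho> r * r powr (?N - 1)) * ennreal (?N / r powr p)"
          using pos by (simp add: ennreal_mult[symmetric] mult_ac)
        then show "ennreal (?N * r powr (?N - 1)) * (ennreal (\<rho> (G (r *\<^sub>R radial_proj k)) / G (r *\<^sub>R radial_proj k) powr p) * shift_energy u (r *\<^sub>R radial_proj k)) * indicator K k
          = ennreal (\<rho> r * r powr (?N - 1)) * (ennreal (?N / r powr p) * shift_energy u (r *\<^sub>R radial_proj k) * indicator K k)"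
          using r by (simp add: mult.assoc[symmetric])
      qed
      also have "\<dots> = ennreal (\<rho> r * r powr (?N - 1)) * sphere_energy u r"
        unfolding sphere_energy_def by (intro nn_integral_cmult) measurable
      finally show ?thesis using r by simp
    qed simp
  qed
  finally show ?thesis .
qed

lemma shift_energy_le:
  assumes [measurable]: "u \<in> borel_measurable borel"
  shows "shift_energy u h \<le> ennreal (2 powr (p - 1) * (2 powr p + 1)) * (\<integral>\<^sup>+x. ennreal (norm_pow p (u x)) \<partial>lborel)"
proof -
  have pt: "norm_pow p (magnetic_diff A u h x) \<le> 2 powr (p - 1) * 2 powr p * norm_pow p (u (x + h)) + 2 powr (p - 1) * norm_pow p (u x)" for x
  proof -
    have "norm_pow p (magnetic_diff A u h x) \<le> 2 powr (p - 1) * norm_pow p (cis (- (h \<bullet> A (x + h /\<^sub>R 2))) * u (x + h)) + 2 powr (p - 1) * norm_pow p (- u x)"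
      using norm_pow_add_le[OF p1, of 1 "cis (- (h \<bullet> A (x + h /\<^sub>R 2))) * u (x + h)" "- u x"] by (simp add: magnetic_diff_def)
    also have "norm_pow p (- u x) = norm_pow p (u x)" by (simp add: norm_pow_def)
    also have "norm_pow p (cis (- (h \<bullet> A (x + h /\<^sub>R 2))) * u (x + h)) \<le> (2 * 1) powr p * norm_pow p (u (x + h))"
      by (intro norm_pow_mult_le_norm p1) simp
    finally show ?thesis by (simp add: mult_left_mono)
  qed
  have "shift_energy u h \<le> (\<integral>\<^sup>+x. ennreal (2 powr (p - 1) * 2 powr p) * ennreal (norm_pow p (u (x + h))) + ennreal (2 powr (p - 1)) * ennreal (norm_pow p (u x)) \<partial>lborel)"
    unfolding shift_energy_def
  proof (rule nn_integral_mono)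
    fix x
    have "ennreal (norm_pow p (magnetic_diff A u h x)) \<le> ennreal (2 powr (p - 1) * 2 powr p * norm_pow p (u (x + h)) + 2 powr (p - 1) * norm_pow p (u x))"
      by (rule ennreal_leI[OF pt])
    then show "ennreal (norm_pow p (magnetic_diff A u h x)) \<le> ennreal (2 powr (p - 1) * 2 powr p) * ennreal (norm_pow p (u (x + h))) + ennreal (2 powr (p - 1)) * ennreal (norm_pow p (u x))"
      by (simp add: ennreal_mult[symmetric] ennreal_plus[symmetric] del: ennreal_plus)
  qed
  also have "\<dots> = ennreal (2 powr (p - 1) * 2 powr p) * (\<integral>\<^sup>+x. ennreal (norm_pow p (u x)) \<partial>lborel) + ennreal (2 powr (p - 1)) * (\<integral>\<^sup>+x. ennreal (norm_pow p (u x)) \<partial>lborel)"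
    using nn_integral_translate[of "\<lambda>x. ennreal (norm_pow p (u x))" h] by (simp add: nn_integral_add nn_integral_cmult)
  also have "\<dots> = ennreal (2 powr (p - 1) * (2 powr p + 1)) * (\<integral>\<^sup>+x. ennreal (norm_pow p (u x)) \<partial>lborel)"
    by (simp add: distrib_right[symmetric] ennreal_plus[symmetric] distrib_left del: ennreal_plus)
  finally show ?thesis .
qed

lemma sphere_energy_le:
  assumes [measurable]: "u \<in> borel_measurable borel" and r: "0 < r"
  shows "sphere_energy u r \<le> (ennreal (real CARD('n) * (2 powr (p - 1) * (2 powr p + 1))) * emeasure lborel K
     * (\<integral>\<^sup>+x. ennreal (norm_pow p (u x)) \<partial>lborel)) * ennreal (r powr (- p))"
proof -
  let ?I = "\<integral>\<^sup>+x. ennreal (norm_pow p (u x)) \<partial>lborel" and ?c = "2 powr (p - 1) * (2 powr p + 1)"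
  have "sphere_energy u r \<le> (\<integral>\<^sup>+k. ennreal (real CARD('n) / r powr p) * (ennreal ?c * ?I) * indicator K k \<partial>lborel)"
    unfolding sphere_energy_def by (intro nn_integral_mono mult_right_mono mult_left_mono shift_energy_le) auto
  also have "\<dots> = ennreal (real CARD('n) / r powr p) * (ennreal ?c * ?I) * emeasure lborel K"
    by (subst nn_integral_cmult) auto
  also have "real CARD('n) / r powr p = real CARD('n) * r powr (- p)" by (simp add: powr_minus field_simps)
  also have "ennreal (real CARD('n) * r powr (- p)) * (ennreal ?c * ?I) * emeasure lborel K
    = (ennreal (real CARD('n) * ?c) * emeasure lborel K * ?I) * ennreal (r powr (- p))"
    by (simp only: ennreal_mult powr_ge_zero of_nat_0_le_iff add_nonneg_nonneg mult_nonneg_nonneg zero_le_one mult_ac)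
  finally show ?thesis .
qed

end

section \<open>Difference quotients of smooth functions\<close>

lemma continuous_cdot [continuous_intros]:
  assumes "continuous_on S f" "continuous_on S g"
  shows "continuous_on S (\<lambda>x. cdot (f x) (g x))"
  unfolding cdot_def using assms by (auto intro!: continuous_intros)

lemma cdot_magnetic_gradient:
  "cdot (magnetic_gradient A u g x) t = cdot (g x) t - \<i> * of_real (t \<bullet> A x) * u x"
proof -
  have "of_real (t \<bullet> A x) = (\<Sum>j\<in>UNIV. of_real (t $ j) * complex_of_real (A x $ j))"
    by (simp add: inner_vec_def)
  then show ?thesis
    by (simp add: cdot_def magnetic_gradient_def sum_distrib_left sum_distrib_right sum_subtractf[symmetric] algebra_simps)
qed

text \<open>Jensen's inequality for the normalized Lebesgue measure on \<open>{0..r}\<close>.\<close>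

lemma interval_Jensen:
  fixes f :: "real \<Rightarrow> complex"
  assumes p: "1 \<le> p" and r: "0 < r" and f: "continuous_on {0..r} f" and [measurable]: "f \<in> borel_measurable borel"
  shows "ennreal (norm_pow p (\<integral>s. indicator {0..r} s *\<^sub>R f s \<partial>lborel) / r powr p)
    \<le> (\<integral>\<^sup>+s. ennreal (indicator {0..r} s / r) * ennreal (norm_pow p (f s)) \<partial>lborel)"
proof -
  let ?w = "\<lambda>s. indicator {0..r} s / r"
  let ?M = "density lborel (\<lambda>s. ennreal (?w s))"
  have n: "AE s in lborel. 0 \<le> ?w s" using r by auto
  have "emeasure ?M UNIV = (\<integral>\<^sup>+s. ennreal (1 / r) * indicator {0..r} s \<partial>lborel)"
    by (subst emeasure_density) (auto intro!: nn_integral_cong simp: indicator_def)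
  also have "\<dots> = 1" using r by (subst nn_integral_cmult) (auto simp: ennreal_mult[symmetric])
  finally have "prob_space ?M" by (intro prob_spaceI) simp
  have si: "integrable lborel (\<lambda>s. indicator {0..r} s *\<^sub>R f s)"
    using borel_integrable_atLeastAtMost'[OF f] by (simp add: set_integrable_def)
  have eq: "?w s *\<^sub>R f s = (1 / r) *\<^sub>R (indicator {0..r} s *\<^sub>R f s)" for s by simp
  have wi: "integrable lborel (\<lambda>s. ?w s *\<^sub>R f s)" unfolding eq by (rule integrable_scaleR_right[OF si])
  have fi: "integrable ?M f" using wi n by (subst integrable_density) auto
  have "(\<integral>s. f s \<partial>?M) = of_real (1 / r) * (\<integral>s. indicator {0..r} s *\<^sub>R f s \<partial>lborel)"
  proof -
    have "(\<integral>s. f s \<partial>?M) = (\<integral>s. ?w s *\<^sub>R f s \<partial>lborel)" using n by (subst integral_density) auto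
    also have "\<dots> = (1 / r) *\<^sub>R (\<integral>s. indicator {0..r} s *\<^sub>R f s \<partial>lborel)"
      unfolding eq by (rule integral_scaleR_right)
    finally show ?thesis by (simp add: scaleR_conv_of_real)
  qed
  then have "norm_pow p (\<integral>s. f s \<partial>?M) = norm_pow p (\<integral>s. indicator {0..r} s *\<^sub>R f s \<partial>lborel) / r powr p"
    using r by (simp only: norm_pow_scale) (simp add: powr_divide)
  moreover have "ennreal (norm_pow p (\<integral>s. f s \<partial>?M)) \<le> (\<integral>\<^sup>+s. ennreal (norm_pow p (f s)) \<partial>?M)"
    by (rule norm_pow_Jensen[OF \<open>prob_space ?M\<close> p fi])
  moreover have "(\<integral>\<^sup>+s. ennreal (norm_pow p (f s)) \<partial>?M) = (\<integral>\<^sup>+s. ennreal (?w s) * ennreal (norm_pow p (f s)) \<partial>lborel)"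
    by (rule nn_integral_density) measurable
  ultimately show ?thesis by simp
qed

text \<open>All that is used of the smoothness of a mollified function \<open>v\<close>: it is continuously differentiable along lines,
  with gradient \<open>g\<close>.\<close>

definition line_smooth :: "(real^'n \<Rightarrow> complex) \<Rightarrow> (real^'n \<Rightarrow> complex^'n) \<Rightarrow> bool" where
  "line_smooth v g \<longleftrightarrow> continuous_on UNIV v \<and> continuous_on UNIV g \<and>
     (\<forall>x t s. ((\<lambda>s. v (x + s *\<^sub>R t)) has_vector_derivative cdot (g (x + s *\<^sub>R t)) t) (at s))"

context magnetic begin

text \<open>A bound for the factor by which the phase in \<open>magnetic_diff_pointwise_le\<close> can stretch the norm \<open>\<bar>z\<bar>\<^sub>p\<close> near
  \<open>y\<close>. It tends to one as \<open>r \<rightarrow> 0\<close>, but not uniformly in \<open>y\<close> when \<open>A\<close> is unbounded, while the bound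
  by two is uniform.\<close>

definition phase_weight :: "real \<Rightarrow> real \<Rightarrow> real^'n \<Rightarrow> real" where
  "phase_weight R r y = min 2 (1 + r * (R * (norm (A y) + L * R)))"

lemma continuous_phase_weight: "continuous_on S (phase_weight R r)"
  unfolding phase_weight_def by (intro continuous_intros continuous_A)

lemma phase_weight_measurable [measurable]: "phase_weight R r \<in> borel_measurable borel"
  by (rule borel_measurable_continuous_onI[OF continuous_phase_weight])

text \<open>Freezing the potential at the midpoint, with \<open>c = t \<bullet> A (x + r t / 2)\<close>, the function
  \<open>\<phi>(s) = exp (-\<i> s c) v(x + s t)\<close> satisfies \<open>\<phi>(r) - \<phi>(0) = magnetic_diff A v (r t) x\<close>. Its derivative is the
  rotated directional magnetic gradient, plus an error of order \<open>r \<bar>v\<bar>\<close> because \<open>A\<close> is Lipschitz and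
  all points of the segment are within distance \<open>r \<bar>t\<bar>\<close> of the midpoint.\<close>

lemma magnetic_diff_pointwise_le:
  assumes vg: "line_smooth v g" and r: "0 < r" "r \<le> 1" and R: "1 \<le> R" "norm t \<le> R"
  defines "D \<equiv> magnetic_gradient A v g"
  shows "ennreal (norm_pow p (magnetic_diff A v (r *\<^sub>R t) x) / r powr p)
    \<le> (\<integral>\<^sup>+s. ennreal (indicator {0..r} s / r) * ennreal
         ((1 + r) powr (p - 1) * (phase_weight R r (x + s *\<^sub>R t) powr p * norm_pow p (cdot (D (x + s *\<^sub>R t)) t))
          + (1 + 1 / r) powr (p - 1) * ((2 * (L * R\<^sup>2 * r)) powr p * norm_pow p (v (x + s *\<^sub>R t)))) \<partial>lborel)"
proof -
  have cv: "continuous_on UNIV v" and cg: "continuous_on UNIV g"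
    and der: "\<And>s. ((\<lambda>s. v (x + s *\<^sub>R t)) has_vector_derivative cdot (g (x + s *\<^sub>R t)) t) (at s)"
    using vg by (auto simp: line_smooth_def)
  define c where "c = t \<bullet> A (x + (r *\<^sub>R t) /\<^sub>R 2)"
  define \<phi> where "\<phi> s = cis (- (s * c)) * v (x + s *\<^sub>R t)" for s
  define \<psi> where "\<psi> s = cis (- (s * c)) * (cdot (g (x + s *\<^sub>R t)) t - \<i> * of_real c * v (x + s *\<^sub>R t))" for s
  have d\<phi>: "(\<phi> has_vector_derivative \<psi> s) (at s)" for s
  proof -
    have "((\<lambda>s. cis (- (s * c))) has_derivative (\<lambda>a. (- (a * c)) *\<^sub>R (\<i> * cis (- (s * c))))) (at s)"
      by (auto intro!: derivative_eq_intros has_derivative_cis)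
    then have "((\<lambda>s. cis (- (s * c))) has_vector_derivative (- c) *\<^sub>R (\<i> * cis (- (s * c)))) (at s)"
      by (simp add: has_vector_derivative_def mult.commute)
    from has_vector_derivative_mult[OF this der[of s]] show ?thesis
      unfolding \<phi>_def[abs_def] \<psi>_def
      by (simp add: scaleR_conv_of_real algebra_simps)
  qed
  have cl: "continuous_on S (\<lambda>s. x + s *\<^sub>R t)" for S by (intro continuous_intros)
  have c\<psi>: "continuous_on UNIV \<psi>" unfolding \<psi>_def
    by (intro continuous_intros continuous_on_compose2[OF cv cl] continuous_on_compose2[OF cg cl]) auto
  have m\<psi>: "\<psi> \<in> borel_measurable borel" by (rule borel_measurable_continuous_onI[OF c\<psi>])
  have "(\<integral>s. indicator {0..r} s *\<^sub>R \<psi> s \<partial>lborel) = \<phi> r - \<phi> 0"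
  proof (rule integral_FTC_atLeastAtMost)
    show "(\<phi> has_vector_derivative \<psi> s) (at s within {0..r})" for s
      by (rule has_vector_derivative_at_within[OF d\<phi>])
    show "continuous_on {0..r} \<psi>" by (rule continuous_on_subset[OF c\<psi>]) simp
  qed (use r in simp)
  also have "\<dots> = magnetic_diff A v (r *\<^sub>R t) x" by (simp add: \<phi>_def magnetic_diff_def c_def)
  finally have int: "(\<integral>s. indicator {0..r} s *\<^sub>R \<psi> s \<partial>lborel) = magnetic_diff A v (r *\<^sub>R t) x" .
  have bound: "norm_pow p (\<psi> s) \<le> (1 + r) powr (p - 1) * (phase_weight R r (x + s *\<^sub>R t) powr p * norm_pow p (cdot (D (x + s *\<^sub>R t)) t))
          + (1 + 1 / r) powr (p - 1) * ((2 * (L * R\<^sup>2 * r)) powr p * norm_pow p (v (x + s *\<^sub>R t)))"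
    if s: "0 \<le> s" "s \<le> r" for s
  proof -
    let ?y = "x + s *\<^sub>R t"
    define b where "b = t \<bullet> A ?y - c"
    have "?y - (x + (r *\<^sub>R t) /\<^sub>R 2) = (s - r / 2) *\<^sub>R t"
      by (simp add: scaleR_diff_left)
    then have "norm (?y - (x + (r *\<^sub>R t) /\<^sub>R 2)) = \<bar>s - r / 2\<bar> * norm t" by simp
    also have "\<dots> \<le> r * R" using s r R by (intro mult_mono) auto
    finally have dist: "norm (?y - (x + (r *\<^sub>R t) /\<^sub>R 2)) \<le> r * R" .
    have AL: "norm (A ?y - A (x + (r *\<^sub>R t) /\<^sub>R 2)) \<le> L * (r * R)"
      using A_diff_le[of ?y "x + (r *\<^sub>R t) /\<^sub>R 2"] mult_left_mono[OF dist L_nonneg] by linarith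
    have "\<bar>b\<bar> = \<bar>t \<bullet> (A ?y - A (x + (r *\<^sub>R t) /\<^sub>R 2))\<bar>" by (simp add: b_def c_def inner_diff_right)
    also have "\<dots> \<le> norm t * norm (A ?y - A (x + (r *\<^sub>R t) /\<^sub>R 2))" by (rule Cauchy_Schwarz_ineq2)
    also have "\<dots> \<le> R * (L * (r * R))" using R AL L_nonneg r by (intro mult_mono) auto
    finally have b: "\<bar>b\<bar> \<le> L * R\<^sup>2 * r" by (simp add: power2_eq_square mult_ac)
    have "\<bar>c\<bar> \<le> norm t * norm (A (x + (r *\<^sub>R t) /\<^sub>R 2))" unfolding c_def by (rule Cauchy_Schwarz_ineq2)
    also have "\<dots> \<le> R * (norm (A ?y) + L * R)"
    proof (intro mult_mono R)
      have "norm (A (x + (r *\<^sub>R t) /\<^sub>R 2)) \<le> norm (A ?y) + L * (r * R)"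
        using AL norm_triangle_ineq2[of "A (x + (r *\<^sub>R t) /\<^sub>R 2)" "A ?y"] by (simp add: norm_minus_commute)
      also have "L * (r * R) \<le> L * (1 * R)" using r R L_nonneg by (intro mult_left_mono mult_right_mono) auto
      finally show "norm (A (x + (r *\<^sub>R t) /\<^sub>R 2)) \<le> norm (A ?y) + L * R" by simp
    qed (use R in auto)
    finally have c: "\<bar>c\<bar> \<le> R * (norm (A ?y) + L * R)" .
    have sc: "\<bar>- (s * c)\<bar> \<le> r * (R * (norm (A ?y) + L * R))"
      using s c unfolding abs_minus_cancel abs_mult by (intro mult_mono) auto
    have "\<psi> s = cis (- (s * c)) * cdot (D ?y) t + (cis (- (s * c)) * (\<i> * of_real b)) * v ?y"
      by (simp add: \<psi>_def D_def cdot_magnetic_gradient b_def algebra_simps)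
    then have "norm_pow p (\<psi> s) \<le> (1 + r) powr (p - 1) * norm_pow p (cis (- (s * c)) * cdot (D ?y) t)
       + (1 + 1 / r) powr (p - 1) * norm_pow p ((cis (- (s * c)) * (\<i> * of_real b)) * v ?y)"
      using norm_pow_add_le[OF p1 r(1)] by simp
    also have "\<dots> \<le> (1 + r) powr (p - 1) * (phase_weight R r ?y powr p * norm_pow p (cdot (D ?y) t))
       + (1 + 1 / r) powr (p - 1) * ((2 * (L * R\<^sup>2 * r)) powr p * norm_pow p (v ?y))"
      unfolding phase_weight_def
      by (intro add_mono mult_left_mono norm_pow_cis_le[OF p1 sc] norm_pow_mult_le_norm[OF p1])
        (use b in \<open>auto simp: norm_mult\<close>)
    finally show ?thesis .
  qed
  have "ennreal (norm_pow p (magnetic_diff A v (r *\<^sub>R t) x) / r powr p)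
    \<le> (\<integral>\<^sup>+s. ennreal (indicator {0..r} s / r) * ennreal (norm_pow p (\<psi> s)) \<partial>lborel)"
    unfolding int[symmetric] by (rule interval_Jensen[OF p1 r(1) continuous_on_subset[OF c\<psi>] m\<psi>]) simp
  also have "\<dots> \<le> (\<integral>\<^sup>+s. ennreal (indicator {0..r} s / r) * ennreal
         ((1 + r) powr (p - 1) * (phase_weight R r (x + s *\<^sub>R t) powr p * norm_pow p (cdot (D (x + s *\<^sub>R t)) t))
          + (1 + 1 / r) powr (p - 1) * ((2 * (L * R\<^sup>2 * r)) powr p * norm_pow p (v (x + s *\<^sub>R t)))) \<partial>lborel)"
  proof (rule nn_integral_mono)
    fix s
    show "ennreal (indicator {0..r} s / r) * ennreal (norm_pow p (\<psi> s)) \<le> ennreal (indicator {0..r} s / r) * ennreal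
         ((1 + r) powr (p - 1) * (phase_weight R r (x + s *\<^sub>R t) powr p * norm_pow p (cdot (D (x + s *\<^sub>R t)) t))
          + (1 + 1 / r) powr (p - 1) * ((2 * (L * R\<^sup>2 * r)) powr p * norm_pow p (v (x + s *\<^sub>R t))))"
    proof (cases "s \<in> {0..r}")
      case True
      then show ?thesis using bound[of s] by (intro mult_left_mono ennreal_leI) auto
    qed simp
  qed
  finally show ?thesis .
qed

lemma magnetic_gradient_measurable [measurable (raw)]:
  assumes [measurable]: "v \<in> borel_measurable borel" "g \<in> borel_measurable borel" "f \<in> borel_measurable M"
  shows "(\<lambda>x. cdot (magnetic_gradient A v g (f x)) t) \<in> borel_measurable M"
  unfolding cdot_magnetic_gradient by measurable

text \<open>This is where \<open>p \<ge> 1\<close> pays: the remainder has size \<open>r powr p\<close> and the large constant of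
  \<open>norm_pow_add_le\<close> with \<open>l = r\<close> has size \<open>r powr (1 - p)\<close>.\<close>

lemma small_remainder:
  assumes "0 < r" "r \<le> 1" "0 \<le> c"
  shows "(1 + 1 / r) powr (p - 1) * (2 * (c * r)) powr p \<le> 2 powr (p - 1) * (2 * c) powr p * r"
proof -
  have "(1 + 1 / r) powr (p - 1) * (2 * (c * r)) powr p = ((1 + 1 / r) * r) powr (p - 1) * r * (2 * c) powr p"
    using assms p1 by (simp add: powr_mult powr_diff mult_ac)
  also have "(1 + 1 / r) * r = 1 + r" using assms by (simp add: field_simps)
  also have "(1 + r) powr (p - 1) \<le> 2 powr (p - 1)" using assms p1 by (intro powr_mono2) auto
  finally show ?thesis using assms by (simp add: mult_right_mono mult_ac)
qed

text \<open>Integrate \<open>magnetic_diff_pointwise_le\<close> over \<open>x\<close> and translate by \<open>s t\<close>: the average over \<open>s\<close> then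
  disappears.\<close>

lemma shift_energy_smooth_le:
  assumes vg: "line_smooth v g" and r: "0 < r" "r \<le> 1" and R: "1 \<le> R" "norm t \<le> R"
  defines "D \<equiv> magnetic_gradient A v g"
  shows "ennreal (1 / r powr p) * shift_energy v (r *\<^sub>R t)
    \<le> ennreal ((1 + r) powr (p - 1)) * (\<integral>\<^sup>+y. ennreal (phase_weight R r y powr p) * ennreal (norm_pow p (cdot (D y) t)) \<partial>lborel)
      + ennreal (2 powr (p - 1) * (2 * (L * R\<^sup>2)) powr p * r) * (\<integral>\<^sup>+y. ennreal (norm_pow p (v y)) \<partial>lborel)"
proof -
  have [measurable]: "v \<in> borel_measurable borel" "g \<in> borel_measurable borel"
    using vg by (auto simp: line_smooth_def intro: borel_measurable_continuous_onI)
  have [measurable]: "(\<lambda>x. cdot (D (f x)) t) \<in> borel_measurable M" if "f \<in> borel_measurable M" for f and M :: "'b measure"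
    unfolding D_def using that by measurable
  let ?c = "2 powr (p - 1) * (2 * (L * R\<^sup>2)) powr p * r"
  define Q where "Q y = ennreal ((1 + r) powr (p - 1)) * (ennreal (phase_weight R r y powr p) * ennreal (norm_pow p (cdot (D y) t)))
      + ennreal ?c * ennreal (norm_pow p (v y))" for y
  have [measurable]: "Q \<in> borel_measurable borel" unfolding Q_def D_def by measurable
  have QI: "(\<integral>\<^sup>+y. Q y \<partial>lborel) = ennreal ((1 + r) powr (p - 1)) * (\<integral>\<^sup>+y. ennreal (phase_weight R r y powr p) * ennreal (norm_pow p (cdot (D y) t)) \<partial>lborel)
      + ennreal ?c * (\<integral>\<^sup>+y. ennreal (norm_pow p (v y)) \<partial>lborel)"
    unfolding Q_def D_def by (subst nn_integral_add) (auto simp: nn_integral_cmult)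
  have pt: "ennreal (norm_pow p (magnetic_diff A v (r *\<^sub>R t) x) / r powr p) \<le> (\<integral>\<^sup>+s. ennreal (indicator {0..r} s / r) * Q (x + s *\<^sub>R t) \<partial>lborel)" for x
  proof (rule order_trans[OF magnetic_diff_pointwise_le[OF vg r R]], rule nn_integral_mono, rule mult_left_mono)
    fix s
    let ?y = "x + s *\<^sub>R t"
    have "(1 + 1 / r) powr (p - 1) * ((2 * (L * R\<^sup>2 * r)) powr p * norm_pow p (v ?y)) \<le> ?c * norm_pow p (v ?y)"
      using mult_right_mono[OF small_remainder[OF r, of "L * R\<^sup>2"] norm_pow_nonneg[of p "v ?y"]] L_nonneg by (simp add: mult.assoc)
    then have "ennreal ((1 + r) powr (p - 1) * (phase_weight R r ?y powr p * norm_pow p (cdot (D ?y) t))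
          + (1 + 1 / r) powr (p - 1) * ((2 * (L * R\<^sup>2 * r)) powr p * norm_pow p (v ?y)))
       \<le> ennreal ((1 + r) powr (p - 1) * (phase_weight R r ?y powr p * norm_pow p (cdot (D ?y) t)) + ?c * norm_pow p (v ?y))"
      by (intro ennreal_leI add_left_mono)
    also have "\<dots> = Q ?y" unfolding Q_def using r L_nonneg by (simp add: ennreal_mult ennreal_plus)
    finally show "ennreal ((1 + r) powr (p - 1) * (phase_weight R r ?y powr p * norm_pow p (cdot (magnetic_gradient A v g ?y) t))
          + (1 + 1 / r) powr (p - 1) * ((2 * (L * R\<^sup>2 * r)) powr p * norm_pow p (v ?y))) \<le> Q ?y" unfolding D_def .
  qed simp
  have w1: "(\<integral>\<^sup>+s. ennreal (indicator {0..r} s / r) \<partial>lborel) = 1"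
  proof -
    have "(\<integral>\<^sup>+s. ennreal (indicator {0..r} s / r) \<partial>lborel) = (\<integral>\<^sup>+s. ennreal (1 / r) * indicator {0..r} s \<partial>lborel)"
      by (intro nn_integral_cong) (auto simp: indicator_def)
    also have "\<dots> = 1" using r by (subst nn_integral_cmult) (auto simp: ennreal_mult[symmetric])
    finally show ?thesis .
  qed
  have "ennreal (1 / r powr p) * shift_energy v (r *\<^sub>R t) = (\<integral>\<^sup>+x. ennreal (norm_pow p (magnetic_diff A v (r *\<^sub>R t) x) / r powr p) \<partial>lborel)"
    unfolding shift_energy_def by (subst nn_integral_cmult[symmetric]) (auto simp: ennreal_mult[symmetric])
  also have "\<dots> \<le> (\<integral>\<^sup>+x. (\<integral>\<^sup>+s. ennreal (indicator {0..r} s / r) * Q (x + s *\<^sub>R t) \<partial>lborel) \<partial>lborel)"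
    by (intro nn_integral_mono pt)
  also have "\<dots> = (\<integral>\<^sup>+s. (\<integral>\<^sup>+x. ennreal (indicator {0..r} s / r) * Q (x + s *\<^sub>R t) \<partial>lborel) \<partial>lborel)"
    by (rule lborel_pair.Fubini') measurable
  also have "\<dots> = (\<integral>\<^sup>+s. ennreal (indicator {0..r} s / r) * (\<integral>\<^sup>+y. Q y \<partial>lborel) \<partial>lborel)"
    using nn_integral_translate[of Q] by (simp add: nn_integral_cmult)
  also have "\<dots> = (\<integral>\<^sup>+y. Q y \<partial>lborel)" by (subst nn_integral_multc) (simp_all add: w1)
  finally show ?thesis unfolding QI .
qed

lemma sphere_energy_smooth_le:
  assumes vg: "line_smooth v g" and r: "0 < r" "r \<le> 1" and R: "1 \<le> R" "\<And>x. norm (radial_proj x) \<le> R"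
  defines "D \<equiv> magnetic_gradient A v g"
  shows "sphere_energy v r \<le> ennreal ((1 + r) powr (p - 1)) * (\<integral>\<^sup>+y. ennreal (phase_weight R r y powr p) * energy_density p (D y) \<partial>lborel)
      + ennreal (real CARD('n) * (2 powr (p - 1) * (2 * (L * R\<^sup>2)) powr p * r)) * emeasure lborel K * (\<integral>\<^sup>+y. ennreal (norm_pow p (v y)) \<partial>lborel)"
proof -
  let ?N = "real CARD('n)" and ?c = "2 powr (p - 1) * (2 * (L * R\<^sup>2)) powr p * r"
  let ?I = "\<integral>\<^sup>+y. ennreal (norm_pow p (v y)) \<partial>lborel"
  have [measurable]: "v \<in> borel_measurable borel" "g \<in> borel_measurable borel"
    using vg by (auto simp: line_smooth_def intro: borel_measurable_continuous_onI)
  have [measurable]: "D \<in> borel_measurable borel" 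
  proof (rule borel_measurable_continuous_onI)
    show "continuous_on UNIV D" unfolding D_def magnetic_gradient_def using vg
      by (auto simp: line_smooth_def intro!: continuous_intros continuous_A)
  qed
  have "sphere_energy v r = (\<integral>\<^sup>+k. ennreal ?N * (ennreal (1 / r powr p) * shift_energy v (r *\<^sub>R radial_proj k)) * indicator K k \<partial>lborel)"
    unfolding sphere_energy_def using r by (intro nn_integral_cong) (simp add: mult.assoc[symmetric] ennreal_mult[symmetric])
  also have "\<dots> \<le> (\<integral>\<^sup>+k. ennreal ?N * (ennreal ((1 + r) powr (p - 1)) * (\<integral>\<^sup>+y. ennreal (phase_weight R r y powr p) * ennreal (norm_pow p (cdot (D y) (radial_proj k))) \<partial>lborel)
      + ennreal ?c * ?I) * indicator K k \<partial>lborel)"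
    unfolding D_def by (intro nn_integral_mono mult_right_mono mult_left_mono shift_energy_smooth_le vg r R) auto
  also have "\<dots> = (\<integral>\<^sup>+k. ennreal ((1 + r) powr (p - 1)) * (\<integral>\<^sup>+y. ennreal (phase_weight R r y powr p) * (ennreal (?N * norm_pow p (cdot (D y) (radial_proj k))) * indicator K k) \<partial>lborel)
      + (ennreal (?N * ?c) * ?I) * indicator K k \<partial>lborel)"
  proof (rule nn_integral_cong)
    fix k
    have "(\<integral>\<^sup>+y. ennreal (phase_weight R r y powr p) * (ennreal (?N * norm_pow p (cdot (D y) (radial_proj k))) * indicator K k) \<partial>lborel)
      = (\<integral>\<^sup>+y. (ennreal ?N * indicator K k) * (ennreal (phase_weight R r y powr p) * ennreal (norm_pow p (cdot (D y) (radial_proj k)))) \<partial>lborel)"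
      by (intro nn_integral_cong) (simp add: ennreal_mult mult_ac)
    also have "\<dots> = (ennreal ?N * indicator K k) * (\<integral>\<^sup>+y. ennreal (phase_weight R r y powr p) * ennreal (norm_pow p (cdot (D y) (radial_proj k))) \<partial>lborel)"
      by (intro nn_integral_cmult) measurable
    finally show "ennreal ?N * (ennreal ((1 + r) powr (p - 1)) * (\<integral>\<^sup>+y. ennreal (phase_weight R r y powr p) * ennreal (norm_pow p (cdot (D y) (radial_proj k))) \<partial>lborel)
      + ennreal ?c * ?I) * indicator K k = ennreal ((1 + r) powr (p - 1)) * (\<integral>\<^sup>+y. ennreal (phase_weight R r y powr p) * (ennreal (?N * norm_pow p (cdot (D y) (radial_proj k))) * indicator K k) \<partial>lborel)
      + (ennreal (?N * ?c) * ?I) * indicator K k"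
      using r L_nonneg by (simp add: ennreal_mult distrib_left distrib_right mult_ac)
  qed
  also have "\<dots> = ennreal ((1 + r) powr (p - 1)) * (\<integral>\<^sup>+k. (\<integral>\<^sup>+y. ennreal (phase_weight R r y powr p) * (ennreal (?N * norm_pow p (cdot (D y) (radial_proj k))) * indicator K k) \<partial>lborel) \<partial>lborel)
      + (ennreal (?N * ?c) * ?I) * emeasure lborel K"
    by (subst nn_integral_add) (auto simp: nn_integral_cmult)
  also have "(\<integral>\<^sup>+k. (\<integral>\<^sup>+y. ennreal (phase_weight R r y powr p) * (ennreal (?N * norm_pow p (cdot (D y) (radial_proj k))) * indicator K k) \<partial>lborel) \<partial>lborel)
    = (\<integral>\<^sup>+y. (\<integral>\<^sup>+k. ennreal (phase_weight R r y powr p) * (ennreal (?N * norm_pow p (cdot (D y) (radial_proj k))) * indicator K k) \<partial>lborel) \<partial>lborel)"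
    by (rule lborel_pair.Fubini') measurable
  also have "\<dots> = (\<integral>\<^sup>+y. ennreal (phase_weight R r y powr p) * energy_density p (D y) \<partial>lborel)"
    unfolding energy_density_def by (intro nn_integral_cong nn_integral_cmult) measurable
  finally show ?thesis by (simp add: mult_ac)
qed

end

section \<open>Spherical energies and mollification\<close>

lemma integrable_translate:
  fixes f :: "real^'n \<Rightarrow> 'b::{banach, second_countable_topology}"
  assumes f: "integrable lborel f"
  shows "integrable lborel (\<lambda>y. f (y + h))"
proof -
  have [measurable]: "f \<in> borel_measurable borel" using borel_measurable_integrable[OF f] by simp
  have "(\<integral>\<^sup>+y. ennreal (norm (f (y + h))) \<partial>lborel) = (\<integral>\<^sup>+y. ennreal (norm (f y)) \<partial>lborel)"
    by (rule nn_integral_translate) measurable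
  then show ?thesis using f unfolding integrable_iff_bounded by simp
qed

lemma locint_translate:
  fixes f :: "real^'n \<Rightarrow> 'b::euclidean_space"
  assumes f: "locint f" shows "locint (\<lambda>y. f (y + h))"
  unfolding locint_def
proof (intro conjI allI)
  note [measurable] = locint_measurable[OF f]
  show m: "(\<lambda>y. f (y + h)) \<in> borel_measurable borel" by measurable
  fix R
  let ?F = "\<lambda>y. indicator (cball 0 (R + norm h)) y *\<^sub>R f y"
  have "integrable lborel (\<lambda>y. indicator (cball 0 R) y *\<^sub>R ?F (y + h))"
  proof (rule integrable_mult_indicator)
    have "integrable lborel ?F" using f unfolding locint_def by blast
    then show "integrable lborel (\<lambda>y. ?F (y + h))" by (rule integrable_translate)
  qed simp
  moreover have "indicator (cball 0 R) y *\<^sub>R ?F (y + h) = indicator (cball 0 R) y *\<^sub>R f (y + h)" for y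
    using norm_triangle_ineq[of y h] by (auto simp: indicator_def)
  ultimately show "integrable lborel (\<lambda>y. indicator (cball 0 R) y *\<^sub>R f (y + h))" by (simp only:)
qed

lemma locint_mult:
  fixes f a :: "real^'n \<Rightarrow> complex"
  assumes f: "locint f" and [measurable]: "a \<in> borel_measurable borel"
    and bd: "\<And>R. \<exists>C. \<forall>y\<in>cball 0 R. norm (a y) \<le> C"
  shows "locint (\<lambda>y. a y * f y)"
  unfolding locint_def
proof (intro conjI allI)
  note [measurable] = locint_measurable[OF f]
  show m: "(\<lambda>y. a y * f y) \<in> borel_measurable borel" by measurable
  fix R
  obtain C where C: "\<forall>y\<in>cball 0 R. norm (a y) \<le> C" using bd by blast
  show "integrable lborel (\<lambda>y. indicator (cball 0 R) y *\<^sub>R (a y * f y))"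
  proof (rule locint_mult_bounded[OF f])
    show "(\<lambda>y. indicator (cball 0 R) y *\<^sub>R (a y * f y)) \<in> borel_measurable borel"
      by (intro borel_measurable_scaleR borel_measurable_indicator m) simp
    fix y
    show "norm (indicator (cball 0 R) y *\<^sub>R (a y * f y)) \<le> C * norm (indicator (cball 0 R) y *\<^sub>R f y)"
      using C by (cases "y \<in> cball 0 R") (auto simp: norm_mult intro!: mult_right_mono)
  qed
qed

lemma locint_diff:
  fixes f g :: "real^'n \<Rightarrow> 'b::euclidean_space"
  assumes "locint f" "locint g" shows "locint (\<lambda>x. f x - g x)"
  using assms unfolding locint_def by (auto simp: scaleR_diff_right)

lemma locint_cis_mult:
  fixes f :: "real^'n \<Rightarrow> complex"
  assumes f: "locint f" and [measurable]: "a \<in> borel_measurable borel"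
  shows "locint (\<lambda>y. cis (a y) * f y)"
  by (rule locint_mult[OF f]) (measurable, auto intro!: exI[of _ 1])

lemma norm_cis_diff_le: "cmod (cis a - cis b) \<le> \<bar>a - b\<bar>"
proof -
  have "(cmod (cis a - cis b))\<^sup>2 = (cos a - cos b)\<^sup>2 + (sin a - sin b)\<^sup>2" by (simp add: cmod_power2)
  also have "\<dots> = 2 - 2 * cos (a - b)"
    using sin_cos_squared_add[of a] sin_cos_squared_add[of b]
    by (simp add: power2_diff cos_diff algebra_simps)
  also have "\<dots> = 4 * (sin ((a - b) / 2))\<^sup>2" 
  proof -
    have "cos (2 * ((a - b) / 2)) = 1 - 2 * (sin ((a - b) / 2))\<^sup>2" by (rule cos_double_sin)
    also have "2 * ((a - b) / 2) = a - b" by (simp only: times_divide_eq_right) simp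
    finally show ?thesis by simp
  qed
  also have "\<dots> \<le> 4 * ((a - b) / 2)\<^sup>2"
    using abs_sin_x_le_abs_x[of "(a - b) / 2"] by (intro mult_left_mono) (auto simp: abs_le_square_iff[symmetric])
  also have "\<dots> = \<bar>a - b\<bar>\<^sup>2" by (simp add: power2_eq_square)
  finally show ?thesis by (rule power2_le_imp_le) simp
qed

definition conv_gradient :: "(real^'n \<Rightarrow> real) \<Rightarrow> (real^'n \<Rightarrow> complex) \<Rightarrow> real^'n \<Rightarrow> complex^'n" where
  "conv_gradient \<eta> u x = (\<chi> j. conv (partial j \<eta>) u x)"

lemma line_smooth_mollified:
  fixes \<eta> :: "real^'n \<Rightarrow> real"
  assumes m: "mollifier \<eta> \<epsilon>" and u: "locint u"
  shows "line_smooth (conv \<eta> u) (conv_gradient \<eta> u)"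
  unfolding line_smooth_def
proof (intro conjI allI)
  note k = mollifier_kernel_within[OF m]
  show "continuous_on UNIV (conv \<eta> u)" by (rule conv_continuous[OF k u])
  show "continuous_on UNIV (conv_gradient \<eta> u)" unfolding conv_gradient_def
    by (intro continuous_on_vec_lambda conv_continuous[OF kernel_within_partial[OF k mollifier_C1[OF m]] u])
  fix x t :: "real^'n" and s :: real
  have "((\<lambda>s. x + s *\<^sub>R t) has_derivative (\<lambda>a. a *\<^sub>R t)) (at s)"
    by (auto intro!: derivative_eq_intros)
  from has_derivative_compose[OF this conv_has_derivative[OF k mollifier_C1[OF m] u, where x = "x + s *\<^sub>R t"]]
  have "((\<lambda>s. conv \<eta> u (x + s *\<^sub>R t)) has_derivative
      (\<lambda>a. \<Sum>j\<in>UNIV. (a *\<^sub>R t) $ j *\<^sub>R conv (partial j \<eta>) u (x + s *\<^sub>R t))) (at s)" .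
  moreover have "(\<lambda>a. \<Sum>j\<in>UNIV. (a *\<^sub>R t) $ j *\<^sub>R conv (partial j \<eta>) u (x + s *\<^sub>R t))
      = (\<lambda>a. a *\<^sub>R cdot (conv_gradient \<eta> u (x + s *\<^sub>R t)) t)"
    by (auto simp: cdot_def conv_gradient_def scaleR_sum_right scaleR_conv_of_real[where 'a = complex] sum_distrib_left mult_ac)
  ultimately show "((\<lambda>s. conv \<eta> u (x + s *\<^sub>R t)) has_vector_derivative cdot (conv_gradient \<eta> u (x + s *\<^sub>R t)) t) (at s)"
    unfolding has_vector_derivative_def by simp
qed

context magnetic begin

lemma magnetic_diff_locint:
  assumes u: "locint u" shows "locint (magnetic_diff A u h)"
proof -
  note [measurable] = locint_measurable[OF u]
  have "locint (\<lambda>x. cis (- (h \<bullet> A (x + h /\<^sub>R 2))) * u (x + h) - u x)"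
    by (intro locint_diff locint_cis_mult locint_translate u) measurable
  then show ?thesis unfolding magnetic_diff_def[abs_def] .
qed

text \<open>Mollification commutes with translations but not with the phase. The commutator is the mollification
  of the translate of \<open>u\<close> by \<open>h\<close> against a difference of two phases, whose angles differ by at most
  \<open>\<bar>h\<bar> L \<epsilon>\<close>.\<close>

lemma shift_energy_mollified_le:
  assumes m: "mollifier \<eta> \<epsilon>" and u: "locint u"
  shows "shift_energy (conv \<eta> u) h \<le> ennreal ((1 + \<epsilon>) powr (p - 1)) * shift_energy u h
     + ennreal ((1 + 1 / \<epsilon>) powr (p - 1) * (2 * (norm h * L * \<epsilon>)) powr p) * (\<integral>\<^sup>+x. ennreal (norm_pow p (u x)) \<partial>lborel)"
proof -
  note [measurable] = locint_measurable[OF u]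
  note k = mollifier_kernel_within[OF m]
  define \<theta> where "\<theta> x = - (h \<bullet> A (x + h /\<^sub>R 2))" for x
  have [measurable]: "\<theta> \<in> borel_measurable borel" unfolding \<theta>_def by measurable
  have lt: "locint (\<lambda>y. u (y + h))" by (rule locint_translate[OF u])
  have lc: "locint (\<lambda>y. cis (\<theta> y) * u (y + h))" by (rule locint_cis_mult[OF lt]) measurable
  note ld = magnetic_diff_locint[OF u, of h]
  have i1: "integrable lborel (\<lambda>z. \<eta> z *\<^sub>R (cis (\<theta> x) * u (x - z + h)))" for x
    using integrable_mult_right[OF conv_altdef(2)[OF k lt, of x], of "cis (\<theta> x)"] by (simp add: mult.commute)
  note i2 = conv_altdef(2)[OF k lc]
  have ib: "integrable lborel (\<lambda>z. \<eta> z *\<^sub>R ((cis (\<theta> x) - cis (\<theta> (x - z))) * u (x - z + h)))" for x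
    using Bochner_Integration.integrable_diff[OF i1[of x] i2[of x]]
    by (simp add: left_diff_distrib scaleR_diff_right)
  have "(\<integral>\<^sup>+x. ennreal (norm_pow p (magnetic_diff A (conv \<eta> u) h x)) * indicator UNIV x \<partial>lborel)
    \<le> ennreal ((1 + \<epsilon>) powr (p - 1)) * (\<integral>\<^sup>+x. ennreal (norm_pow p (magnetic_diff A u h x)) * indicator UNIV x \<partial>lborel)
      + ennreal ((1 + 1 / \<epsilon>) powr (p - 1) * (2 * (norm h * L * \<epsilon>)) powr p) * (\<integral>\<^sup>+x. ennreal (norm_pow p (u (x + h))) \<partial>lborel)"
  proof (rule mollified_norm_pow_le[OF m p1, where k = "\<lambda>x z. cis (\<theta> x) - cis (\<theta> (x - z))"])
    fix x z :: "real^'n" assume z: "norm z < \<epsilon>"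
    have "cmod (cis (\<theta> x) - cis (\<theta> (x - z))) \<le> \<bar>\<theta> x - \<theta> (x - z)\<bar>" by (rule norm_cis_diff_le)
    also have "\<dots> = \<bar>h \<bullet> (A (x - z + h /\<^sub>R 2) - A (x + h /\<^sub>R 2))\<bar>"
      by (simp add: \<theta>_def inner_diff_right)
    also have "\<dots> \<le> norm h * norm (A (x - z + h /\<^sub>R 2) - A (x + h /\<^sub>R 2))" by (rule Cauchy_Schwarz_ineq2)
    also have "\<dots> \<le> norm h * (L * \<epsilon>)"
    proof (rule mult_left_mono)
      have "norm (A (x - z + h /\<^sub>R 2) - A (x + h /\<^sub>R 2)) \<le> L * norm ((x - z + h /\<^sub>R 2) - (x + h /\<^sub>R 2))" by (rule A_diff_le)
      also have "(x - z + h /\<^sub>R 2) - (x + h /\<^sub>R 2) = - z" by simp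
      also have "L * norm (- z) \<le> L * \<epsilon>" using z L_nonneg by (intro mult_left_mono) auto
      finally show "norm (A (x - z + h /\<^sub>R 2) - A (x + h /\<^sub>R 2)) \<le> L * \<epsilon>" .
    qed simp
    finally show "cmod (cis (\<theta> x) - cis (\<theta> (x - z))) \<le> norm h * L * \<epsilon>" by (simp add: mult.assoc)
  next
    fix x
    have "(\<integral>z. \<eta> z *\<^sub>R magnetic_diff A u h (x - z) \<partial>lborel) + (\<integral>z. \<eta> z *\<^sub>R ((cis (\<theta> x) - cis (\<theta> (x - z))) * u (x - z + h)) \<partial>lborel)
      = (\<integral>z. \<eta> z *\<^sub>R magnetic_diff A u h (x - z) + \<eta> z *\<^sub>R ((cis (\<theta> x) - cis (\<theta> (x - z))) * u (x - z + h)) \<partial>lborel)"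
      by (intro Bochner_Integration.integral_add[symmetric] ib conv_altdef(2)[OF k ld])
    also have "\<dots> = (\<integral>z. cis (\<theta> x) * (\<eta> z *\<^sub>R u ((x + h) - z)) - \<eta> z *\<^sub>R u (x - z) \<partial>lborel)"
      by (intro Bochner_Integration.integral_cong refl)
        (simp add: magnetic_diff_def \<theta>_def scaleR_conv_of_real algebra_simps)
    also have "\<dots> = (\<integral>z. cis (\<theta> x) * (\<eta> z *\<^sub>R u ((x + h) - z)) \<partial>lborel) - (\<integral>z. \<eta> z *\<^sub>R u (x - z) \<partial>lborel)"
      by (intro Bochner_Integration.integral_diff integrable_mult_right conv_altdef(2)[OF k u])
    also have "\<dots> = magnetic_diff A (conv \<eta> u) h x"
      unfolding conv_altdef(1)[OF k u] magnetic_diff_def \<theta>_def by (simp del: mult_scaleR_right)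
    finally show "magnetic_diff A (conv \<eta> u) h x = (\<integral>z. \<eta> z *\<^sub>R magnetic_diff A u h (x - z) \<partial>lborel)
        + (\<integral>z. \<eta> z *\<^sub>R ((cis (\<theta> x) - cis (\<theta> (x - z))) * u (x - z + h)) \<partial>lborel)" by simp
  next
    show "integrable lborel (\<lambda>z. \<eta> z *\<^sub>R magnetic_diff A u h (x - z))" for x by (rule conv_altdef(2)[OF k ld])
    show "integrable lborel (\<lambda>z. \<eta> z *\<^sub>R ((cis (\<theta> x) - cis (\<theta> (x - z))) * u (x - z + h)))" for x by (rule ib)
    show "magnetic_diff A u h \<in> borel_measurable borel" by (rule locint_measurable[OF ld])
  qed (auto intro: measurable_compose)
  then show ?thesis
    using nn_integral_translate[of "\<lambda>x. ennreal (norm_pow p (u x))" h] by (simp add: shift_energy_def)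
qed

text \<open>The commutator in \<open>shift_energy_mollified_le\<close> is proportional to \<open>\<bar>h\<bar> powr p\<close>, and this cancels the
  division by \<open>r powr p\<close>. So the error does not depend on \<open>r\<close>, and the limits in \<open>\<epsilon>\<close> and in \<open>r\<close> may be
  taken in any order.\<close>

lemma sphere_energy_mollified_le:
  assumes m: "mollifier \<eta> \<epsilon>" and u: "locint u" and r: "0 < r" and R: "1 \<le> R" "\<And>x. norm (radial_proj x) \<le> R"
  shows "sphere_energy (conv \<eta> u) r \<le> ennreal ((1 + \<epsilon>) powr (p - 1)) * sphere_energy u r
     + ennreal (real CARD('n) * (2 powr (p - 1) * (2 * (R * L)) powr p * \<epsilon>)) * emeasure lborel K * (\<integral>\<^sup>+x. ennreal (norm_pow p (u x)) \<partial>lborel)"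
proof -
  note [measurable] = locint_measurable[OF u] conv_measurable[OF mollifier_kernel_within[OF m] u]
  let ?N = "real CARD('n)" and ?c = "2 powr (p - 1) * (2 * (R * L)) powr p * \<epsilon>"
  let ?I = "\<integral>\<^sup>+x. ennreal (norm_pow p (u x)) \<partial>lborel"
  have e: "0 < \<epsilon>" "\<epsilon> \<le> 1" using m by (auto simp: mollifier_def)
  have F: "shift_energy (conv \<eta> u) (r *\<^sub>R radial_proj k) \<le> ennreal ((1 + \<epsilon>) powr (p - 1)) * shift_energy u (r *\<^sub>R radial_proj k) + ennreal (r powr p * ?c) * ?I" for k
  proof -
    have "(1 + 1 / \<epsilon>) powr (p - 1) * (2 * (norm (r *\<^sub>R radial_proj k) * L * \<epsilon>)) powr p
       \<le> (1 + 1 / \<epsilon>) powr (p - 1) * (2 * ((r * (R * L)) * \<epsilon>)) powr p"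
      using r R L_nonneg e p1
      by (intro mult_left_mono powr_mono2) (auto intro!: mult_right_mono mult_left_mono simp: mult.assoc)
    also have "\<dots> \<le> 2 powr (p - 1) * (2 * (r * (R * L))) powr p * \<epsilon>"
      using r R L_nonneg by (intro small_remainder e) auto
    also have "\<dots> = r powr p * ?c" using r R L_nonneg by (simp add: powr_mult mult_ac)
    finally have "ennreal ((1 + 1 / \<epsilon>) powr (p - 1) * (2 * (norm (r *\<^sub>R radial_proj k) * L * \<epsilon>)) powr p) \<le> ennreal (r powr p * ?c)"
      by (rule ennreal_leI)
    then show ?thesis
      by (intro order_trans[OF shift_energy_mollified_le[OF m u]] add_left_mono mult_right_mono) auto
  qed
  have "sphere_energy (conv \<eta> u) r \<le> (\<integral>\<^sup>+k. ennreal (?N / r powr p) * (ennreal ((1 + \<epsilon>) powr (p - 1)) * shift_energy u (r *\<^sub>R radial_proj k) + ennreal (r powr p * ?c) * ?I) * indicator K k \<partial>lborel)"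
    unfolding sphere_energy_def by (intro nn_integral_mono mult_right_mono mult_left_mono F) auto
  also have "\<dots> = (\<integral>\<^sup>+k. ennreal ((1 + \<epsilon>) powr (p - 1)) * (ennreal (?N / r powr p) * shift_energy u (r *\<^sub>R radial_proj k) * indicator K k)
      + ennreal (?N * ?c) * ?I * indicator K k \<partial>lborel)"
  proof (rule nn_integral_cong)
    fix k
    have "ennreal (?N / r powr p) * ennreal (r powr p * ?c) = ennreal (?N * ?c)"
      using r e by (simp add: ennreal_mult[symmetric])
    then show "ennreal (?N / r powr p) * (ennreal ((1 + \<epsilon>) powr (p - 1)) * shift_energy u (r *\<^sub>R radial_proj k) + ennreal (r powr p * ?c) * ?I) * indicator K k
      = ennreal ((1 + \<epsilon>) powr (p - 1)) * (ennreal (?N / r powr p) * shift_energy u (r *\<^sub>R radial_proj k) * indicator K k) + ennreal (?N * ?c) * ?I * indicator K k"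
      by (simp add: distrib_left distrib_right mult.assoc[symmetric]) (simp add: mult_ac)
  qed
  also have "\<dots> = ennreal ((1 + \<epsilon>) powr (p - 1)) * sphere_energy u r + ennreal (?N * ?c) * ?I * emeasure lborel K"
    unfolding sphere_energy_def by (subst nn_integral_add) (auto simp: nn_integral_cmult)
  finally show ?thesis by (simp add: mult_ac)
qed

lemma norm_pow_mollified_le:
  assumes m: "mollifier \<eta> \<epsilon>" and u: "locint u"
  shows "(\<integral>\<^sup>+x. ennreal (norm_pow p (conv \<eta> u x)) \<partial>lborel) \<le> (\<integral>\<^sup>+x. ennreal (norm_pow p (u x)) \<partial>lborel)"
proof -
  note [measurable] = locint_measurable[OF u] mollifier_measurable[OF m]
  note k = mollifier_kernel_within[OF m]
  have "(\<integral>\<^sup>+x. ennreal (norm_pow p (conv \<eta> u x)) \<partial>lborel)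
      \<le> (\<integral>\<^sup>+x. (\<integral>\<^sup>+z. ennreal (\<eta> z) * ennreal (norm_pow p (u (x - z))) \<partial>lborel) * indicator UNIV x \<partial>lborel)"
    unfolding conv_altdef(1)[OF k u]
    by (intro nn_integral_mono) (simp add: mollifier_Jensen[OF m p1 _ conv_altdef(2)[OF k u]])
  also have "\<dots> \<le> (\<integral>\<^sup>+z. ennreal (\<eta> z) \<partial>lborel) * (\<integral>\<^sup>+x. ennreal (norm_pow p (u x)) * indicator UNIV x \<partial>lborel)"
    by (rule nn_conv_le) auto
  finally show ?thesis using m by (simp add: mollifier_def)
qed

lemma magnetic_diff_quotient_tendsto:
  assumes vg: "line_smooth v g" and t: "\<And>j. 0 < (t::nat \<Rightarrow> real) j" "t \<longlonglongrightarrow> 0"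
  shows "(\<lambda>j. norm_pow p (magnetic_diff A v (t j *\<^sub>R e) x) / t j powr p) \<longlonglongrightarrow> norm_pow p (cdot (magnetic_gradient A v g x) e)"
proof -
  have der: "((\<lambda>s. v (x + s *\<^sub>R e)) has_vector_derivative cdot (g x) e) (at 0)"
  proof -
    have "((\<lambda>s. v (x + s *\<^sub>R e)) has_vector_derivative cdot (g (x + 0 *\<^sub>R e)) e) (at 0)"
      using vg unfolding line_smooth_def by blast
    then show ?thesis by simp
  qed
  define a where "a s = e \<bullet> A (x + (s / 2) *\<^sub>R e)" for s
  define \<phi> where "\<phi> s = cis (- (s * a s)) * v (x + s *\<^sub>R e)" for s
  have "continuous_on UNIV a" unfolding a_def
    by (intro continuous_intros continuous_on_compose2[OF continuous_A[of UNIV]]) auto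
  then have ca: "isCont a 0" by (simp add: continuous_on_eq_continuous_at)
  have "((\<lambda>s. s * a s) has_real_derivative a 0) (at 0)"
  proof -
    have "((\<lambda>h. ((0 + h) * a (0 + h) - 0 * a 0) / h) \<longlongrightarrow> a 0) (at 0)"
      using ca by (intro Lim_transform_eventually[OF ca[unfolded isCont_def]])
        (auto simp: eventually_at intro!: exI[of _ 1])
    then show ?thesis by (simp add: DERIV_def)
  qed
  then have "((\<lambda>s. - (s * a s)) has_derivative (\<lambda>h. - (a 0 * h))) (at 0)"
    by (intro has_derivative_minus) (simp add: has_field_derivative_def)
  from has_derivative_cis[OF this]
  have "((\<lambda>s. cis (- (s * a s))) has_vector_derivative - (a 0) *\<^sub>R \<i>) (at 0)"
    by (simp add: has_vector_derivative_def mult.commute)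
  from has_vector_derivative_mult[OF this der]
  have d\<phi>: "(\<phi> has_vector_derivative cdot (magnetic_gradient A v g x) e) (at 0)"
    unfolding \<phi>_def[abs_def] cdot_magnetic_gradient by (simp add: a_def scaleR_conv_of_real algebra_simps)
  have "((\<lambda>s. (\<phi> (0 + s) - \<phi> 0) /\<^sub>R s) \<longlongrightarrow> cdot (magnetic_gradient A v g x) e) (at 0)"
  proof -
    have "((\<lambda>s. norm (\<phi> (0 + s) - \<phi> 0 - s *\<^sub>R cdot (magnetic_gradient A v g x) e) / norm s) \<longlongrightarrow> 0) (at 0)"
      using d\<phi> unfolding has_vector_derivative_def has_derivative_at by blast
    then have "((\<lambda>s. norm ((\<phi> (0 + s) - \<phi> 0) /\<^sub>R s - cdot (magnetic_gradient A v g x) e)) \<longlongrightarrow> 0) (at 0)"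
    proof (rule Lim_transform_eventually)
      show "\<forall>\<^sub>F s in at 0. norm (\<phi> (0 + s) - \<phi> 0 - s *\<^sub>R cdot (magnetic_gradient A v g x) e) / norm s
          = norm ((\<phi> (0 + s) - \<phi> 0) /\<^sub>R s - cdot (magnetic_gradient A v g x) e)"
      proof (rule eventually_at_topological[THEN iffD2], intro exI[of _ UNIV] conjI ballI impI)
        fix s :: real assume "s \<noteq> 0"
        then have "(\<phi> (0 + s) - \<phi> 0) /\<^sub>R s - cdot (magnetic_gradient A v g x) e
            = inverse s *\<^sub>R (\<phi> (0 + s) - \<phi> 0 - s *\<^sub>R cdot (magnetic_gradient A v g x) e)"
          by (simp add: scaleR_diff_right)
        then show "norm (\<phi> (0 + s) - \<phi> 0 - s *\<^sub>R cdot (magnetic_gradient A v g x) e) / norm s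
          = norm ((\<phi> (0 + s) - \<phi> 0) /\<^sub>R s - cdot (magnetic_gradient A v g x) e)"
          by (simp only: norm_scaleR) (simp add: divide_inverse mult.commute)
      qed auto
    qed
    then show ?thesis by (rule LIM_zero_cancel[OF tendsto_norm_zero_cancel])
  qed
  moreover have "filterlim t (at 0) sequentially"
  proof -
    have "t j \<noteq> 0" for j using t(1)[of j] by simp
    then show ?thesis using t(2) by (simp add: filterlim_at)
  qed
  ultimately have "(\<lambda>j. (\<phi> (0 + t j) - \<phi> 0) /\<^sub>R t j) \<longlonglongrightarrow> cdot (magnetic_gradient A v g x) e"
    by (rule filterlim_compose)
  moreover have "\<phi> (0 + t j) - \<phi> 0 = magnetic_diff A v (t j *\<^sub>R e) x" for j
    by (simp add: \<phi>_def magnetic_diff_def a_def)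
  ultimately have lim: "(\<lambda>j. magnetic_diff A v (t j *\<^sub>R e) x /\<^sub>R t j) \<longlonglongrightarrow> cdot (magnetic_gradient A v g x) e" by simp
  have "continuous_on UNIV (norm_pow p)" using p1 by (intro continuous_intros) auto
  from continuous_on_tendsto_compose[OF this lim]
  have "(\<lambda>j. norm_pow p (magnetic_diff A v (t j *\<^sub>R e) x /\<^sub>R t j)) \<longlonglongrightarrow> norm_pow p (cdot (magnetic_gradient A v g x) e)" by simp
  moreover have "norm_pow p (magnetic_diff A v (t j *\<^sub>R e) x /\<^sub>R t j) = norm_pow p (magnetic_diff A v (t j *\<^sub>R e) x) / t j powr p" for j
    using t(1)[of j] norm_pow_scale[of p "inverse (t j)" "magnetic_diff A v (t j *\<^sub>R e) x"]
    by (simp add: scaleR_conv_of_real inverse_powr[symmetric] powr_minus divide_inverse)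
  ultimately show ?thesis by simp
qed

text \<open>The difference quotients of a smooth function converge pointwise
  (\<open>magnetic_diff_quotient_tendsto\<close>); then Fatou's lemma in \<open>x\<close> and in the direction.\<close>

lemma energy_density_le_liminf_sphere_energy:
  assumes vg: "line_smooth v g" and t: "\<And>j. 0 < (t::nat \<Rightarrow> real) j" "t \<longlonglongrightarrow> 0"
  shows "(\<integral>\<^sup>+x. energy_density p (magnetic_gradient A v g x) \<partial>lborel) \<le> liminf (\<lambda>j. sphere_energy v (t j))"
proof -
  let ?N = "real CARD('n)"
  have [measurable]: "v \<in> borel_measurable borel" "g \<in> borel_measurable borel"
    using vg by (auto simp: line_smooth_def intro: borel_measurable_continuous_onI)
  define D where "D = magnetic_gradient A v g"
  have [measurable]: "D \<in> borel_measurable borel"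
  proof (rule borel_measurable_continuous_onI)
    show "continuous_on UNIV D" unfolding D_def magnetic_gradient_def using vg
      by (auto simp: line_smooth_def intro!: continuous_intros continuous_A)
  qed
  define q where "q j k x = ennreal (?N / t j powr p) * ennreal (norm_pow p (magnetic_diff A v (t j *\<^sub>R radial_proj k) x)) * indicator K k" for j k x
  have [measurable]: "(\<lambda>(k, x). q j k x) \<in> borel_measurable (lborel \<Otimes>\<^sub>M lborel)" for j
    unfolding q_def by measurable
  have "(\<integral>\<^sup>+x. energy_density p (D x) \<partial>lborel) = (\<integral>\<^sup>+k. (\<integral>\<^sup>+x. ennreal (?N * norm_pow p (cdot (D x) (radial_proj k))) * indicator K k \<partial>lborel) \<partial>lborel)"
    unfolding energy_density_def by (rule lborel_pair.Fubini') measurable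
  also have "\<dots> \<le> (\<integral>\<^sup>+k. (\<integral>\<^sup>+x. liminf (\<lambda>j. q j k x) \<partial>lborel) \<partial>lborel)"
  proof (rule nn_integral_mono, rule nn_integral_mono)
    fix k x
    have "(\<lambda>j. ?N * (norm_pow p (magnetic_diff A v (t j *\<^sub>R radial_proj k) x) / t j powr p)) \<longlonglongrightarrow> ?N * norm_pow p (cdot (D x) (radial_proj k))"
      unfolding D_def by (intro tendsto_intros magnetic_diff_quotient_tendsto[OF vg t])
    from tendsto_ennrealI[OF this]
    have "(\<lambda>j. ennreal (?N / t j powr p) * ennreal (norm_pow p (magnetic_diff A v (t j *\<^sub>R radial_proj k) x))) \<longlonglongrightarrow> ennreal (?N * norm_pow p (cdot (D x) (radial_proj k)))"
      by (simp add: ennreal_mult[symmetric])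
    from lim_imp_Liminf[OF _ this]
    show "ennreal (?N * norm_pow p (cdot (D x) (radial_proj k))) * indicator K k \<le> liminf (\<lambda>j. q j k x)"
      unfolding q_def by (cases "k \<in> K") auto
  qed
  also have "\<dots> \<le> (\<integral>\<^sup>+k. liminf (\<lambda>j. \<integral>\<^sup>+x. q j k x \<partial>lborel) \<partial>lborel)"
    by (intro nn_integral_mono nn_integral_liminf) measurable
  also have "\<dots> \<le> liminf (\<lambda>j. \<integral>\<^sup>+k. (\<integral>\<^sup>+x. q j k x \<partial>lborel) \<partial>lborel)"
    by (intro nn_integral_liminf) measurable
  also have "(\<lambda>j. \<integral>\<^sup>+k. (\<integral>\<^sup>+x. q j k x \<partial>lborel) \<partial>lborel) = (\<lambda>j. sphere_energy v (t j))"
    unfolding sphere_energy_def shift_energy_def q_def by (simp add: nn_integral_cmult nn_integral_multc)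
  finally show ?thesis unfolding D_def .
qed

text \<open>For a fixed increment the differences of the mollified functions converge in \<open>L\<^sup>1\<close> on balls, so
  \<open>nn_integral_lsc_L1loc\<close> applies for each direction, followed by Fatou's lemma over the directions.\<close>

lemma sphere_energy_le_liminf:
  assumes m: "\<And>m. mollifier (\<eta> m) (\<epsilon> m)" and e0: "\<epsilon> \<longlonglongrightarrow> 0" and u: "locint u" and r: "0 < r"
  shows "sphere_energy u r \<le> liminf (\<lambda>m. sphere_energy (conv (\<eta> m) u) r)"
proof -
  let ?c = "real CARD('n) / r powr p"
  note k = mollifier_kernel_within[OF m]
  note [measurable] = locint_measurable[OF u] conv_measurable[OF k u]
  have c0: "0 \<le> ?c" by simp
  define q where "q w k x = ennreal (?c * norm_pow p (magnetic_diff A w (r *\<^sub>R radial_proj k) x))" for w k x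
  have [measurable]: "(\<lambda>(k, x). q w k x) \<in> borel_measurable (lborel \<Otimes>\<^sub>M lborel)" if "w \<in> borel_measurable borel" for w
    unfolding q_def using that by measurable
  have Sq: "sphere_energy w r = (\<integral>\<^sup>+k. (\<integral>\<^sup>+x. q w k x \<partial>lborel) * indicator K k \<partial>lborel)" if [measurable]: "w \<in> borel_measurable borel" for w
  proof -
    have "(\<integral>\<^sup>+x. q w k x \<partial>lborel) = ennreal ?c * (\<integral>\<^sup>+x. ennreal (norm_pow p (magnetic_diff A w (r *\<^sub>R radial_proj k) x)) \<partial>lborel)" for k
      unfolding q_def ennreal_mult[OF c0 norm_pow_nonneg] by (rule nn_integral_cmult) measurable
    then show ?thesis unfolding sphere_energy_def shift_energy_def by (simp only:)
  qed
  have conv: "(\<lambda>m. \<integral>\<^sup>+x. ennreal (norm (magnetic_diff A (conv (\<eta> m) u) h x - magnetic_diff A u h x)) * indicator (cball 0 R) x \<partial>lborel) \<longlonglongrightarrow> 0" for h R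
  proof -
    let ?d = "\<lambda>m x. ennreal (norm (conv (\<eta> m) u x - u x))"
    have bd: "(\<integral>\<^sup>+x. ennreal (norm (magnetic_diff A (conv (\<eta> m) u) h x - magnetic_diff A u h x)) * indicator (cball 0 R) x \<partial>lborel)
      \<le> (\<integral>\<^sup>+x. ?d m x * indicator (cball 0 (R + norm h)) x \<partial>lborel) + (\<integral>\<^sup>+x. ?d m x * indicator (cball 0 R) x \<partial>lborel)" for m
    proof -
      have "(\<integral>\<^sup>+x. ennreal (norm (magnetic_diff A (conv (\<eta> m) u) h x - magnetic_diff A u h x)) * indicator (cball 0 R) x \<partial>lborel)
        \<le> (\<integral>\<^sup>+x. (?d m (x + h) * indicator (cball 0 (R + norm h)) (x + h)) + ?d m x * indicator (cball 0 R) x \<partial>lborel)"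
      proof (rule nn_integral_mono)
        fix x :: "real^'n"
        show "ennreal (norm (magnetic_diff A (conv (\<eta> m) u) h x - magnetic_diff A u h x)) * indicator (cball 0 R) x
          \<le> (?d m (x + h) * indicator (cball 0 (R + norm h)) (x + h)) + ?d m x * indicator (cball 0 R) x"
        proof (cases "norm x \<le> R")
          case True
          have "magnetic_diff A (conv (\<eta> m) u) h x - magnetic_diff A u h x = cis (- (h \<bullet> A (x + h /\<^sub>R 2))) * (conv (\<eta> m) u (x + h) - u (x + h)) - (conv (\<eta> m) u x - u x)"
            by (simp add: magnetic_diff_def algebra_simps)
          also have "norm \<dots> \<le> norm (conv (\<eta> m) u (x + h) - u (x + h)) + norm (conv (\<eta> m) u x - u x)"
            by (rule order_trans[OF norm_triangle_ineq4]) (simp add: norm_mult)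
          finally have "ennreal (norm (magnetic_diff A (conv (\<eta> m) u) h x - magnetic_diff A u h x)) \<le> ?d m (x + h) + ?d m x"
            by (simp add: ennreal_plus[symmetric] ennreal_leI del: ennreal_plus)
          moreover have "norm (x + h) \<le> R + norm h" using True norm_triangle_ineq[of x h] by linarith
          ultimately show ?thesis using True by simp
        qed simp
      qed
      also have "\<dots> = (\<integral>\<^sup>+x. ?d m (x + h) * indicator (cball 0 (R + norm h)) (x + h) \<partial>lborel) + (\<integral>\<^sup>+x. ?d m x * indicator (cball 0 R) x \<partial>lborel)"
        by (rule nn_integral_add) measurable
      also have "(\<integral>\<^sup>+x. ?d m (x + h) * indicator (cball 0 (R + norm h)) (x + h) \<partial>lborel) = (\<integral>\<^sup>+x. ?d m x * indicator (cball 0 (R + norm h)) x \<partial>lborel)"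
        by (rule nn_integral_translate[of "\<lambda>x. ?d m x * indicator (cball 0 (R + norm h)) x"]) measurable
      finally show ?thesis .
    qed
    have "(\<lambda>m. (\<integral>\<^sup>+x. ?d m x * indicator (cball 0 (R + norm h)) x \<partial>lborel) + (\<integral>\<^sup>+x. ?d m x * indicator (cball 0 R) x \<partial>lborel)) \<longlonglongrightarrow> 0 + 0"
      by (intro tendsto_add mollify_L1loc[OF m e0 u])
    then have lim: "(\<lambda>m. (\<integral>\<^sup>+x. ?d m x * indicator (cball 0 (R + norm h)) x \<partial>lborel) + (\<integral>\<^sup>+x. ?d m x * indicator (cball 0 R) x \<partial>lborel)) \<longlonglongrightarrow> 0" by simp
    show ?thesis
      by (rule tendsto_sandwich[OF _ _ tendsto_const lim]) (use bd in \<open>auto intro!: always_eventually\<close>)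
  qed
  have "sphere_energy u r \<le> (\<integral>\<^sup>+k. liminf (\<lambda>m. (\<integral>\<^sup>+x. q (conv (\<eta> m) u) k x \<partial>lborel) * indicator K k) \<partial>lborel)"
    unfolding Sq[OF locint_measurable[OF u]]
  proof (rule nn_integral_mono)
    fix k
    have "(\<integral>\<^sup>+x. q u k x \<partial>lborel) \<le> liminf (\<lambda>m. (\<integral>\<^sup>+x. q (conv (\<eta> m) u) k x \<partial>lborel))"
      unfolding q_def
    proof (rule nn_integral_lsc_L1loc[where \<Phi> = "\<lambda>z. ?c * norm_pow p z"])
      show "continuous_on UNIV (\<lambda>z. ?c * norm_pow p z)" using p1 by (intro continuous_intros) auto
    qed (use conv in auto)
    then show "(\<integral>\<^sup>+x. q u k x \<partial>lborel) * indicator K k \<le> liminf (\<lambda>m. (\<integral>\<^sup>+x. q (conv (\<eta> m) u) k x \<partial>lborel) * indicator K k)"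
      by (cases "k \<in> K") auto
  qed
  also have "\<dots> \<le> liminf (\<lambda>m. \<integral>\<^sup>+k. (\<integral>\<^sup>+x. q (conv (\<eta> m) u) k x \<partial>lborel) * indicator K k \<partial>lborel)"
    by (intro nn_integral_liminf) measurable
  also have "\<dots> = liminf (\<lambda>m. sphere_energy (conv (\<eta> m) u) r)" by (simp add: Sq[OF conv_measurable[OF k u]])
  finally show ?thesis .
qed

end

section \<open>The spherical energy at small radii\<close>

lemma liminf_le_of_eventually_le:
  fixes f :: "nat \<Rightarrow> ennreal"
  assumes "eventually (\<lambda>m. f m \<le> C) sequentially" shows "liminf f \<le> C"
proof -
  have "liminf f \<le> limsup f" by (intro Liminf_le_Limsup) simp
  also have "\<dots> \<le> C" by (rule Limsup_bounded[OF assms])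
  finally show ?thesis .
qed

context magnetic begin

definition mollified_gradient :: "(real^'n \<Rightarrow> real) \<Rightarrow> (real^'n \<Rightarrow> complex) \<Rightarrow> real^'n \<Rightarrow> complex^'n" where
  "mollified_gradient \<eta> u = magnetic_gradient A (conv \<eta> u) (conv_gradient \<eta> u)"

lemma mollified_gradient_measurable:
  assumes m: "mollifier \<eta> \<epsilon>" and u: "locint u"
  shows "mollified_gradient \<eta> u \<in> borel_measurable borel"
proof (rule borel_measurable_continuous_onI)
  show "continuous_on UNIV (mollified_gradient \<eta> u)" unfolding mollified_gradient_def magnetic_gradient_def
    using line_smooth_mollified[OF m u]
    by (auto simp: line_smooth_def intro!: continuous_intros continuous_A)
qed

lemma A_bounded_on_cball: obtains B where "0 \<le> B" "\<And>y. norm y \<le> R \<Longrightarrow> norm (A y) \<le> B"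
proof -
  have "norm (A y) \<le> norm (A 0) + L * \<bar>R\<bar>" if "norm y \<le> R" for y
  proof -
    have "norm (A y) \<le> norm (A 0) + norm (A y - A 0)" using norm_triangle_ineq[of "A 0" "A y - A 0"] by simp
    also have "norm (A y - A 0) \<le> L * norm (y - 0)" by (rule A_diff_le)
    also have "\<dots> \<le> L * \<bar>R\<bar>" using that L_nonneg by (intro mult_left_mono) auto
    finally show ?thesis by simp
  qed
  moreover have "0 \<le> norm (A 0) + L * \<bar>R\<bar>" using L_nonneg by simp
  ultimately show thesis using that by blast
qed

text \<open>The weight is replaced by a constant tending to one inside a ball and by \<open>2 powr p\<close> outside.\<close>

lemma weighted_energy_split:
  assumes D[measurable]: "D \<in> borel_measurable borel" and r: "0 < r" and R1: "1 \<le> R1"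
    and B: "0 \<le> B" "\<And>y. norm y \<le> R \<Longrightarrow> norm (A y) \<le> B"
  shows "(\<integral>\<^sup>+y. ennreal (phase_weight R1 r y powr p) * energy_density p (D y) \<partial>lborel)
    \<le> ennreal ((1 + r * (R1 * (B + L * R1))) powr p) * (\<integral>\<^sup>+y. energy_density p (D y) \<partial>lborel)
      + ennreal (2 powr p) * (\<integral>\<^sup>+y. energy_density p (D y) * indicator (- cball 0 R) y \<partial>lborel)"
proof -
  let ?c = "(1 + r * (R1 * (B + L * R1))) powr p"
  have "(\<integral>\<^sup>+y. ennreal (phase_weight R1 r y powr p) * energy_density p (D y) \<partial>lborel)
    \<le> (\<integral>\<^sup>+y. ennreal ?c * energy_density p (D y) + ennreal (2 powr p) * (energy_density p (D y) * indicator (- cball 0 R) y) \<partial>lborel)"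
  proof (rule nn_integral_mono)
    fix y
    have w0: "0 \<le> phase_weight R1 r y" unfolding phase_weight_def using r R1 L_nonneg by auto
    show "ennreal (phase_weight R1 r y powr p) * energy_density p (D y) \<le> ennreal ?c * energy_density p (D y) + ennreal (2 powr p) * (energy_density p (D y) * indicator (- cball 0 R) y)"
    proof (cases "norm y \<le> R")
      case True
      have "phase_weight R1 r y \<le> 1 + r * (R1 * (norm (A y) + L * R1))" unfolding phase_weight_def by simp
      also have "\<dots> \<le> 1 + r * (R1 * (B + L * R1))"
        using B(2)[OF True] r R1 by (intro add_left_mono mult_left_mono add_right_mono) auto
      finally have "ennreal (phase_weight R1 r y powr p) \<le> ennreal ?c"
        using w0 p1 by (intro ennreal_leI powr_mono2) auto
      then have "ennreal (phase_weight R1 r y powr p) * energy_density p (D y) \<le> ennreal ?c * energy_density p (D y)" by (rule mult_right_mono) simp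
      then show ?thesis by (rule order_trans) simp
    next
      case False
      have "phase_weight R1 r y \<le> 2" unfolding phase_weight_def by simp
      then have "ennreal (phase_weight R1 r y powr p) \<le> ennreal (2 powr p)"
        using w0 p1 by (intro ennreal_leI powr_mono2) auto
      then have "ennreal (phase_weight R1 r y powr p) * energy_density p (D y) \<le> ennreal (2 powr p) * energy_density p (D y)" by (rule mult_right_mono) simp
      then show ?thesis using False by (intro order_trans[OF _ add_increasing[OF _ order_refl]]) auto
    qed
  qed
  also have "\<dots> = ennreal ?c * (\<integral>\<^sup>+y. energy_density p (D y) \<partial>lborel)
      + ennreal (2 powr p) * (\<integral>\<^sup>+y. energy_density p (D y) * indicator (- cball 0 R) y \<partial>lborel)"
    by (subst nn_integral_add) (auto simp: nn_integral_cmult)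
  finally show ?thesis .
qed

text \<open>The abstract principle behind both parts of the theorem. Only the energies of the mollified
  functions enter, so the same argument serves weak gradients and measures. The upper bound estimates
  \<open>S(r)\<close> for the mollified functions at fixed \<open>r\<close>, lets \<open>m \<rightarrow> \<infinity>\<close> by lower semicontinuity and
  then \<open>r \<rightarrow> 0\<close>. The lower bound bounds the energy of each mollified function by \<open>S\<close> at radii tending to zero
  and lets \<open>m \<rightarrow> \<infinity>\<close> at the end.\<close>

theorem sphere_energy_tendsto:
  assumes m: "\<And>m. mollifier (\<eta> m) (\<epsilon> m)" and e0: "\<epsilon> \<longlonglongrightarrow> 0" and u: "locint u"
    and fin: "(\<integral>\<^sup>+x. ennreal (norm_pow p (u x)) \<partial>lborel) < \<infinity>" and l0: "0 \<le> l"
    and up: "\<And>e. 0 < e \<Longrightarrow> eventually (\<lambda>m. (\<integral>\<^sup>+x. energy_density p (mollified_gradient (\<eta> m) u x) \<partial>lborel) \<le> ennreal (l + e)) sequentially"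
    and tight: "\<And>e. 0 < e \<Longrightarrow> \<exists>R. eventually (\<lambda>m. (\<integral>\<^sup>+x. energy_density p (mollified_gradient (\<eta> m) u x) * indicator (- cball 0 R) x \<partial>lborel) \<le> ennreal e) sequentially"
    and low: "ennreal l \<le> liminf (\<lambda>m. \<integral>\<^sup>+x. energy_density p (mollified_gradient (\<eta> m) u x) \<partial>lborel)"
  shows "(sphere_energy u \<longlongrightarrow> ennreal l) (at_right 0)"
proof -
  obtain R1 where R1: "1 \<le> R1" "\<And>x. norm (radial_proj x) \<le> R1" using radial_proj_bound by metis
  define J where "J = emeasure lborel K * (\<integral>\<^sup>+x. ennreal (norm_pow p (u x)) \<partial>lborel)"
  have Jfin: "J < top" unfolding J_def using fin emeasure_K_finite by (simp add: ennreal_mult_less_top)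
  define j where "j = enn2real J"
  have J: "J = ennreal j" "0 \<le> j" unfolding j_def using Jfin by auto
  define c1 where "c1 = real CARD('n) * (2 powr (p - 1) * (2 * (L * R1\<^sup>2)) powr p)"
  define c2 where "c2 = real CARD('n) * (2 powr (p - 1) * (2 * (R1 * L)) powr p)"
  have c: "0 \<le> c1" "0 \<le> c2" unfolding c1_def c2_def by auto
  show ?thesis
  proof (rule order_tendstoI)
    fix a assume "ennreal l < a"
    then obtain a' where a': "ennreal l < a'" "a' < a" using dense by blast
    define b where "b = enn2real a'"
    have "a' < top" using a'(2) by (rule order_less_le_trans) simp
    then have a'b: "a' = ennreal b" unfolding b_def by simp
    have lb: "l < b" using a'(1) l0 unfolding a'b by (simp add: ennreal_less_iff)
    \<comment> \<open>the limit of the bound \<open>Q\<close> below is \<open>l + e + 2 powr p * e\<close>, the last term being the energy outside the ball\<close>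
    define e where "e = (b - l) / (2 * (1 + 2 powr p))"
    have p2: "0 < 1 + 2 powr p" by (simp add: add_pos_nonneg)
    have e: "0 < e" unfolding e_def using lb p2 by simp
    have eb: "l + e + 2 powr p * e < b"
    proof -
      have "e * (1 + 2 powr p) = (b - l) / 2" unfolding e_def using p2 by (simp add: field_simps)
      then have "e + 2 powr p * e = (b - l) / 2" by (simp add: algebra_simps)
      moreover have "l + (b - l) / 2 < b" using lb by (simp add: field_simps)
      ultimately show ?thesis by (simp only: add.assoc)
    qed
    obtain R where R: "eventually (\<lambda>m. (\<integral>\<^sup>+x. energy_density p (mollified_gradient (\<eta> m) u x) * indicator (- cball 0 R) x \<partial>lborel) \<le> ennreal e) sequentially"
      using tight[OF e] by blast
    obtain B where B: "0 \<le> B" "\<And>y. norm y \<le> R \<Longrightarrow> norm (A y) \<le> B" using A_bounded_on_cball by blast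
    define M where "M = R1 * (B + L * R1)"
    have M: "0 \<le> M" unfolding M_def using R1 B L_nonneg by auto
    \<comment> \<open>bounds all mollified spherical energies from some index on, hence the one of \<open>u\<close>\<close>
    define Q where "Q r = (1 + r) powr (p - 1) * ((1 + r * M) powr p * (l + e) + 2 powr p * e) + c1 * r * j" for r
    have SQ: "sphere_energy u r \<le> ennreal (Q r)" if r: "0 < r" "r \<le> 1" for r
    proof -
      have "eventually (\<lambda>m. sphere_energy (conv (\<eta> m) u) r \<le> ennreal (Q r)) sequentially"
        using up[OF e] R
      proof eventually_elim
        case (elim i)
        have "sphere_energy (conv (\<eta> i) u) r \<le> ennreal ((1 + r) powr (p - 1)) * (\<integral>\<^sup>+y. ennreal (phase_weight R1 r y powr p) * energy_density p (mollified_gradient (\<eta> i) u y) \<partial>lborel)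
          + ennreal (real CARD('n) * (2 powr (p - 1) * (2 * (L * R1\<^sup>2)) powr p * r)) * emeasure lborel K * (\<integral>\<^sup>+y. ennreal (norm_pow p (conv (\<eta> i) u y)) \<partial>lborel)"
          unfolding mollified_gradient_def by (rule sphere_energy_smooth_le[OF line_smooth_mollified[OF m u] r R1])
        also have "\<dots> \<le> ennreal ((1 + r) powr (p - 1)) * (ennreal ((1 + r * M) powr p) * ennreal (l + e) + ennreal (2 powr p) * ennreal e)
          + ennreal (c1 * r) * emeasure lborel K * (\<integral>\<^sup>+y. ennreal (norm_pow p (u y)) \<partial>lborel)"
        proof (rule add_mono)
          have "(\<integral>\<^sup>+y. ennreal (phase_weight R1 r y powr p) * energy_density p (mollified_gradient (\<eta> i) u y) \<partial>lborel)
            \<le> ennreal ((1 + r * M) powr p) * (\<integral>\<^sup>+y. energy_density p (mollified_gradient (\<eta> i) u y) \<partial>lborel)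
              + ennreal (2 powr p) * (\<integral>\<^sup>+y. energy_density p (mollified_gradient (\<eta> i) u y) * indicator (- cball 0 R) y \<partial>lborel)"
            unfolding M_def by (rule weighted_energy_split[OF mollified_gradient_measurable[OF m u] r(1) R1(1) B])
          also have "\<dots> \<le> ennreal ((1 + r * M) powr p) * ennreal (l + e) + ennreal (2 powr p) * ennreal e"
            using elim by (intro add_mono mult_left_mono) auto
          finally show "ennreal ((1 + r) powr (p - 1)) * (\<integral>\<^sup>+y. ennreal (phase_weight R1 r y powr p) * energy_density p (mollified_gradient (\<eta> i) u y) \<partial>lborel)
            \<le> ennreal ((1 + r) powr (p - 1)) * (ennreal ((1 + r * M) powr p) * ennreal (l + e) + ennreal (2 powr p) * ennreal e)"
            by (rule mult_left_mono) simp
          have "real CARD('n) * (2 powr (p - 1) * (2 * (L * R1\<^sup>2)) powr p * r) = c1 * r" by (simp add: c1_def)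
          then show "ennreal (real CARD('n) * (2 powr (p - 1) * (2 * (L * R1\<^sup>2)) powr p * r)) * emeasure lborel K * (\<integral>\<^sup>+y. ennreal (norm_pow p (conv (\<eta> i) u y)) \<partial>lborel)
            \<le> ennreal (c1 * r) * emeasure lborel K * (\<integral>\<^sup>+y. ennreal (norm_pow p (u y)) \<partial>lborel)"
            by (simp only:) (intro mult_left_mono norm_pow_mollified_le[OF m u], simp)
        qed
        also have "\<dots> = ennreal ((1 + r) powr (p - 1)) * (ennreal ((1 + r * M) powr p) * ennreal (l + e) + ennreal (2 powr p) * ennreal e)
          + ennreal (c1 * r) * ennreal j"
          unfolding J(1)[symmetric] J_def by (simp only: mult.assoc)
        also have "\<dots> = ennreal (Q r)"
          unfolding Q_def using l0 e c J(2) r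
          by (simp add: ennreal_mult[symmetric] ennreal_plus[symmetric] del: ennreal_plus)
        finally show ?case .
      qed
      then have "liminf (\<lambda>m. sphere_energy (conv (\<eta> m) u) r) \<le> ennreal (Q r)" by (rule liminf_le_of_eventually_le)
      with sphere_energy_le_liminf[OF m e0 u r(1)] show ?thesis by (rule order_trans)
    qed
    have "(Q \<longlongrightarrow> (1 + 0) powr (p - 1) * ((1 + 0 * M) powr p * (l + e) + 2 powr p * e) + c1 * 0 * j) (at_right 0)"
      unfolding Q_def by (intro tendsto_intros) auto
    then have "(Q \<longlongrightarrow> l + e + 2 powr p * e) (at_right 0)" by simp
    then have "eventually (\<lambda>r. Q r < b) (at_right 0)" using eb by (rule order_tendstoD)
    moreover have "eventually (\<lambda>r. 0 < r \<and> r < (1::real)) (at_right 0)"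
      by (auto simp: eventually_at_right_field intro!: exI[of _ 1])
    ultimately show "eventually (\<lambda>r. sphere_energy u r < a) (at_right 0)"
    proof eventually_elim
      case (elim r)
      have "sphere_energy u r \<le> ennreal (Q r)" using elim by (intro SQ) auto
      also have "\<dots> < ennreal b" using elim l0 lb by (intro ennreal_lessI) auto
      also have "\<dots> < a" using a'(2) unfolding a'b .
      finally show ?case .
    qed
  next
    fix a assume a: "a < ennreal l"
    then have afin: "a < top" by (rule order_less_le_trans) simp
    show "eventually (\<lambda>r. a < sphere_energy u r) (at_right 0)"
    proof (rule sequentially_imp_eventually_at_right[of 0 1])
      fix f :: "nat \<Rightarrow> real" assume f: "\<And>n. 0 < f n" "f \<longlonglongrightarrow> 0"
      show "eventually (\<lambda>n. a < sphere_energy u (f n)) sequentially"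
      proof (rule ccontr)
        assume ne: "\<not> eventually (\<lambda>n. a < sphere_energy u (f n)) sequentially"
        obtain s where s1: "strict_mono (s :: nat \<Rightarrow> nat) \<and> (\<forall>n. \<not> a < sphere_energy u (f (s n)))"
          using not_eventually_sequentiallyD[OF ne] by (rule exE)
        then have s: "strict_mono s" "\<And>n. \<not> a < sphere_energy u (f (s n))" by auto
        have t0: "(\<lambda>n. f (s n)) \<longlonglongrightarrow> 0" using LIMSEQ_subseq_LIMSEQ[OF f(2) s(1)] by (simp add: comp_def)
        \<comment> \<open>the bound is the same for all radii of the sequence, so it survives \<open>n \<rightarrow> \<infinity>\<close> at fixed \<open>i\<close>\<close>
        define W where "W i = ennreal ((1 + \<epsilon> i) powr (p - 1)) * a + ennreal (c2 * \<epsilon> i) * J" for i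
        have "(\<integral>\<^sup>+x. energy_density p (mollified_gradient (\<eta> i) u x) \<partial>lborel) \<le> W i" for i
        proof -
          have "sphere_energy (conv (\<eta> i) u) (f (s n)) \<le> W i" for n
          proof -
            have "sphere_energy (conv (\<eta> i) u) (f (s n)) \<le> ennreal ((1 + \<epsilon> i) powr (p - 1)) * sphere_energy u (f (s n))
              + ennreal (real CARD('n) * (2 powr (p - 1) * (2 * (R1 * L)) powr p * \<epsilon> i)) * emeasure lborel K * (\<integral>\<^sup>+x. ennreal (norm_pow p (u x)) \<partial>lborel)"
              by (rule sphere_energy_mollified_le[OF m u f(1) R1])
            also have "\<dots> = ennreal ((1 + \<epsilon> i) powr (p - 1)) * sphere_energy u (f (s n)) + ennreal (c2 * \<epsilon> i) * J"
              unfolding J_def c2_def by (simp only: mult.assoc)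
            also have "\<dots> \<le> W i" unfolding W_def using s(2)[of n] by (intro add_right_mono mult_left_mono) auto
            finally show ?thesis .
          qed
          then have "liminf (\<lambda>n. sphere_energy (conv (\<eta> i) u) (f (s n))) \<le> W i"
            by (intro liminf_le_of_eventually_le always_eventually allI)
          with energy_density_le_liminf_sphere_energy[OF line_smooth_mollified[OF m[of i] u] f(1) t0]
          show ?thesis unfolding mollified_gradient_def by (rule order_trans)
        qed
        then have le: "liminf (\<lambda>i. \<integral>\<^sup>+x. energy_density p (mollified_gradient (\<eta> i) u x) \<partial>lborel) \<le> liminf W"
          by (intro Liminf_mono always_eventually allI)
        have Wlim: "W \<longlonglongrightarrow> ennreal ((1 + 0) powr (p - 1)) * a + ennreal (c2 * 0) * J"
          unfolding W_def using e0 Jfin afin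
          by (intro tendsto_add tendsto_mult_ennreal tendsto_const tendsto_ennrealI tendsto_intros) auto
        then have "liminf W = a" using lim_imp_Liminf[OF _ Wlim] by simp
        then show False using low a le by order
      qed
    qed simp
  qed
qed

end

section \<open>Magnetic Sobolev functions\<close>

lemma partial_odd:
  fixes \<eta> :: "real^'n \<Rightarrow> real"
  assumes C: "Ck 1 \<eta>" and ev: "\<And>x. \<eta> (- x) = \<eta> x"
  shows "partial j \<eta> (- z) = - partial j \<eta> z"
proof -
  have "(\<eta> has_derivative (\<lambda>h. \<Sum>i\<in>UNIV. h $ i *\<^sub>R partial i \<eta> (- z))) (at (- z))"
    using C by (intro differentiable_has_partials) auto
  moreover have "(uminus has_derivative uminus) (at z)" by (auto intro!: derivative_eq_intros)
  ultimately have "((\<lambda>x. \<eta> (- x)) has_derivative (\<lambda>h. \<Sum>i\<in>UNIV. (- h) $ i *\<^sub>R partial i \<eta> (- z))) (at z)"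
    using has_derivative_compose[of uminus uminus z UNIV \<eta>] by blast
  from partial_eqI[OF this, of j] show ?thesis
    unfolding ev by (simp add: axis_def if_distrib[of "\<lambda>x. x * _"] sum_negf cong: if_cong)
qed

lemma loc_integrable_imp_locint:
  fixes f :: "real^'n \<Rightarrow> 'b::euclidean_space"
  assumes f: "loc_integrable f" and [measurable]: "f \<in> borel_measurable borel"
  shows "locint f"
  unfolding locint_def
proof (intro conjI allI)
  fix R
  have m: "(\<lambda>x. indicator (cball 0 R) x *\<^sub>R f x) \<in> borel_measurable lborel"
    by (intro borel_measurable_scaleR borel_measurable_indicator) simp_all
  have "set_integrable lebesgue (cball 0 R) f" using f unfolding loc_integrable_def by simp
  then show "integrable lborel (\<lambda>x. indicator (cball 0 R) x *\<^sub>R f x)"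
    unfolding set_integrable_def integrable_completion[OF m] .
qed fact

lemma locint_component:
  fixes f :: "real^'n \<Rightarrow> complex^'n"
  assumes f: "locint f" shows "locint (\<lambda>y. f y $ j)"
  unfolding locint_def
proof (intro conjI allI)
  note [measurable] = locint_measurable[OF f]
  show mj: "(\<lambda>y. f y $ j) \<in> borel_measurable borel" by measurable
  fix R
  have "integrable lborel (\<lambda>x. indicator (cball 0 R) x *\<^sub>R f x)" using f unfolding locint_def by blast
  from integrable_bounded_linear[OF bounded_linear_vec_nth[of j] this]
  show "integrable lborel (\<lambda>x. indicator (cball 0 R) x *\<^sub>R f x $ j)" by simp
qed

lemma locint_sum:
  fixes f :: "'i \<Rightarrow> real^'n \<Rightarrow> 'b::euclidean_space"
  assumes "\<And>i. i \<in> I \<Longrightarrow> locint (f i)" shows "locint (\<lambda>y. \<Sum>i\<in>I. f i y)"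
  using assms unfolding locint_def by (auto simp: scaleR_sum_right intro!: borel_measurable_sum)

lemma locint_cdot:
  fixes G :: "real^'n \<Rightarrow> complex^'n"
  assumes G: "\<And>j. locint (\<lambda>y. G y $ j)" shows "locint (\<lambda>y. cdot (G y) t)"
proof -
  have "locint (\<lambda>y. of_real (t $ j) * G y $ j)" for j
    by (rule locint_mult[OF G]) auto
  then show ?thesis unfolding cdot_def by (intro locint_sum) (simp add: mult.commute)
qed

lemma cdot_conv_gradient:
  fixes G :: "real^'n \<Rightarrow> complex^'n"
  assumes m: "mollifier \<eta> \<epsilon>" and G: "\<And>j. locint (\<lambda>y. G y $ j)"
    and cg: "\<And>x j. conv_gradient \<eta> u x $ j = conv \<eta> (\<lambda>y. G y $ j) x"
  shows "cdot (conv_gradient \<eta> u x) t = conv \<eta> (\<lambda>y. cdot (G y) t) x"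
proof -
  note k = mollifier_kernel_within[OF m]
  have "conv \<eta> (\<lambda>y. cdot (G y) t) x = (\<integral>y. (\<Sum>j\<in>UNIV. (\<eta> (x - y) *\<^sub>R G y $ j) * of_real (t $ j)) \<partial>lborel)"
    unfolding conv_def cdot_def by (simp add: scaleR_sum_right)
  also have "\<dots> = (\<Sum>j\<in>UNIV. (\<integral>y. (\<eta> (x - y) *\<^sub>R G y $ j) * of_real (t $ j) \<partial>lborel))"
    by (intro Bochner_Integration.integral_sum integrable_mult_left conv_integrable[OF k G])
  also have "\<dots> = (\<Sum>j\<in>UNIV. conv \<eta> (\<lambda>y. G y $ j) x * of_real (t $ j))"
    unfolding conv_def
    by (intro sum.cong refl Bochner_Integration.integral_mult_left conv_integrable[OF k G])
  finally show ?thesis by (simp add: cdot_def cg)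
qed

text \<open>The translates of \<open>\<eta>\<close> are admissible test functions in the definition of the weak gradient.\<close>

lemma conv_gradient_weak_gradient:
  fixes u :: "real^'n \<Rightarrow> complex" and G :: "real^'n \<Rightarrow> complex^'n"
  assumes w: "has_weak_gradient u G" and m: "mollifier \<eta> \<epsilon>"
    and [measurable]: "u \<in> borel_measurable borel" "G \<in> borel_measurable borel"
  shows "conv_gradient \<eta> u x $ j = conv \<eta> (\<lambda>y. G y $ j) x"
proof -
  note k = mollifier_kernel_within[OF m]
  note [measurable] = mollifier_measurable[OF m] kernel_within_measurable[OF kernel_within_partial[OF k mollifier_C1[OF m]]]
  let ?\<phi> = "\<lambda>y. \<eta> (y - x)"
  have ev: "\<eta> (- z) = \<eta> z" for z using m by (auto simp: mollifier_def)
  have "\<forall>i. Ck i ?\<phi>" using m by (auto simp: mollifier_def intro: Ck_translate)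
  moreover have "has_compact_support ?\<phi>"
  proof -
    have "{y. ?\<phi> y \<noteq> 0} \<subseteq> cball x \<epsilon>"
      using k by (auto simp: kernel_within_def dist_norm norm_minus_commute) (meson linear)
    then have "closure {y. ?\<phi> y \<noteq> 0} \<subseteq> cball x \<epsilon>" by (intro closure_minimal) auto
    then show ?thesis unfolding has_compact_support_def
      by (meson bounded_cball bounded_subset closed_closure compact_eq_bounded_closed)
  qed
  ultimately have eq: "(LINT y|lebesgue. partial j ?\<phi> y *\<^sub>R u y) = - (LINT y|lebesgue. ?\<phi> y *\<^sub>R (G y $ j))"
    using w unfolding has_weak_gradient_def by blast
  have p: "partial j ?\<phi> y = - partial j \<eta> (x - y)" for y
  proof -
    have "(\<eta> has_derivative frechet_derivative \<eta> (at (y - x))) (at (y - x))"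
      using mollifier_C1[OF m] frechet_derivative_works by auto
    then have "(?\<phi> has_derivative frechet_derivative \<eta> (at (y - x))) (at y)"
      using has_derivative_compose[of "\<lambda>y. y - x" "\<lambda>h. h" y UNIV \<eta> "frechet_derivative \<eta> (at (y - x))"]
      by (simp add: has_derivative_diff[OF has_derivative_ident has_derivative_const, simplified])
    from partial_eqI[OF this] have "partial j ?\<phi> y = partial j \<eta> (y - x)" by (simp add: partial_def)
    also have "\<dots> = - partial j \<eta> (x - y)"
      using partial_odd[OF mollifier_C1[OF m] ev, of j "x - y"] by simp
    finally show ?thesis .
  qed
  have "(LINT y|lebesgue. partial j ?\<phi> y *\<^sub>R u y) = - (\<integral>y. partial j \<eta> (x - y) *\<^sub>R u y \<partial>lborel)"
    unfolding p by (subst integral_completion) auto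
  moreover have "(LINT y|lebesgue. ?\<phi> y *\<^sub>R (G y $ j)) = (\<integral>y. \<eta> (x - y) *\<^sub>R (G y $ j) \<partial>lborel)"
    using ev[of "x - y" for y] by (subst integral_completion) auto
  ultimately show ?thesis using eq by (simp add: conv_gradient_def conv_def)
qed

text \<open>Both gradients have the same mollifications, and these converge in \<open>L\<^sup>1\<close> on balls. Uniqueness is
  needed because finiteness of the energy is known for one weak gradient only, and the limit is
  claimed for every one.\<close>

lemma weak_gradient_unique:
  fixes u :: "real^'n \<Rightarrow> complex" and G G' :: "real^'n \<Rightarrow> complex^'n"
    and \<eta> :: "nat \<Rightarrow> real^'n \<Rightarrow> real"
  assumes w: "has_weak_gradient u G" "has_weak_gradient u G'"
    and [measurable]: "u \<in> borel_measurable borel" "G \<in> borel_measurable borel" "G' \<in> borel_measurable borel"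
    and m: "\<And>m. mollifier (\<eta> m) (\<epsilon> m)" and e0: "\<epsilon> \<longlonglongrightarrow> 0"
  shows "AE x in lborel. G x = G' x"
proof -
  have lG: "locint (\<lambda>y. G y $ j)" "locint (\<lambda>y. G' y $ j)" for j
    using w unfolding has_weak_gradient_def by (auto intro!: locint_component loc_integrable_imp_locint)
  have eq: "conv (\<eta> i) (\<lambda>y. G y $ j) x = conv (\<eta> i) (\<lambda>y. G' y $ j) x" for i j x
    using conv_gradient_weak_gradient[OF w(1) m] conv_gradient_weak_gradient[OF w(2) m] assms by metis
  have "AE x in lborel. G x $ j = G' x $ j" for j
  proof -
    let ?a = "\<lambda>i x. ennreal (norm (conv (\<eta> i) (\<lambda>y. G y $ j) x - G x $ j))"
    let ?b = "\<lambda>i x. ennreal (norm (conv (\<eta> i) (\<lambda>y. G' y $ j) x - G' x $ j))"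
    have [measurable]: "?a i \<in> borel_measurable borel" "?b i \<in> borel_measurable borel" for i
      using conv_measurable[OF mollifier_kernel_within[OF m[of i]] lG(1)[of j]] conv_measurable[OF mollifier_kernel_within[OF m[of i]] lG(2)[of j]]
      by measurable
    have "(\<integral>\<^sup>+x. ennreal (norm (G x $ j - G' x $ j)) \<partial>lborel) \<le> 0"
    proof (rule nn_integral_le_from_cballs)
      fix n :: nat
      have bd: "(\<integral>\<^sup>+x. ennreal (norm (G x $ j - G' x $ j)) * indicator (cball 0 (real n)) x \<partial>lborel)
        \<le> (\<integral>\<^sup>+x. ?a i x * indicator (cball 0 (real n)) x \<partial>lborel) + (\<integral>\<^sup>+x. ?b i x * indicator (cball 0 (real n)) x \<partial>lborel)" for i
      proof -
        have "ennreal (norm (G x $ j - G' x $ j)) \<le> ?a i x + ?b i x" for x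
        proof -
          have "norm (G x $ j - G' x $ j) \<le> norm (conv (\<eta> i) (\<lambda>y. G y $ j) x - G x $ j) + norm (conv (\<eta> i) (\<lambda>y. G' y $ j) x - G' x $ j)"
            unfolding eq by norm
          then show ?thesis by (simp add: ennreal_plus[symmetric] ennreal_leI del: ennreal_plus)
        qed
        then show ?thesis
          by (subst nn_integral_add[symmetric]) (auto intro!: nn_integral_mono simp: distrib_right[symmetric] mult_right_mono)
      qed
      have "(\<lambda>i. (\<integral>\<^sup>+x. ?a i x * indicator (cball 0 (real n)) x \<partial>lborel) + (\<integral>\<^sup>+x. ?b i x * indicator (cball 0 (real n)) x \<partial>lborel)) \<longlonglongrightarrow> 0 + 0"
        by (intro tendsto_add mollify_L1loc[OF m e0] lG)
      from LIMSEQ_le_const[OF this] bd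
      show "(\<integral>\<^sup>+x. ennreal (norm (G x $ j - G' x $ j)) * indicator (cball 0 (real n)) x \<partial>lborel) \<le> 0" by simp
    qed measurable
    then have "(\<integral>\<^sup>+x. ennreal (norm (G x $ j - G' x $ j)) \<partial>lborel) = 0" by simp
    then have "AE x in lborel. ennreal (norm (G x $ j - G' x $ j)) = 0"
      by (subst (asm) nn_integral_0_iff_AE) measurable
    then show ?thesis by eventually_elim simp
  qed
  then have "AE x in lborel. \<forall>j. G x $ j = G' x $ j" by (simp add: AE_all_countable)
  then show ?thesis by eventually_elim (simp add: vec_eq_iff)
qed

lemma mollifier_sequence:
  obtains \<eta> :: "nat \<Rightarrow> real^'n \<Rightarrow> real" and \<epsilon> :: "nat \<Rightarrow> real"
  where "\<And>m. mollifier (\<eta> m) (\<epsilon> m)" "\<epsilon> \<longlonglongrightarrow> 0"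
proof -
  have "\<exists>\<eta>::real^'n \<Rightarrow> real. mollifier \<eta> (inverse (real (Suc m)))" for m
    by (rule mollifier_exists) (auto simp: field_simps)
  then obtain \<eta> :: "nat \<Rightarrow> real^'n \<Rightarrow> real" where "\<And>m. mollifier (\<eta> m) (inverse (real (Suc m)))" by metis
  then show thesis using LIMSEQ_inverse_real_of_nat by (rule that)
qed

context magnetic begin

lemma nn_integral_energy_density:
  assumes [measurable]: "D \<in> borel_measurable borel" "B \<in> sets borel"
  shows "(\<integral>\<^sup>+x. energy_density p (D x) * indicator B x \<partial>lborel)
    = (\<integral>\<^sup>+k. ennreal (real CARD('n)) * (\<integral>\<^sup>+x. ennreal (norm_pow p (cdot (D x) (radial_proj k))) * indicator B x \<partial>lborel) * indicator K k \<partial>lborel)"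
proof -
  let ?N = "real CARD('n)"
  have "(\<integral>\<^sup>+x. energy_density p (D x) * indicator B x \<partial>lborel)
    = (\<integral>\<^sup>+x. (\<integral>\<^sup>+k. ennreal (?N * norm_pow p (cdot (D x) (radial_proj k))) * indicator K k * indicator B x \<partial>lborel) \<partial>lborel)"
    unfolding energy_density_def by (simp add: nn_integral_multc)
  also have "\<dots> = (\<integral>\<^sup>+k. (\<integral>\<^sup>+x. ennreal (?N * norm_pow p (cdot (D x) (radial_proj k))) * indicator K k * indicator B x \<partial>lborel) \<partial>lborel)"
    by (rule lborel_pair.Fubini') measurable
  also have "\<dots> = (\<integral>\<^sup>+k. ennreal ?N * (\<integral>\<^sup>+x. ennreal (norm_pow p (cdot (D x) (radial_proj k))) * indicator B x \<partial>lborel) * indicator K k \<partial>lborel)"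
  proof (rule nn_integral_cong)
    fix k
    have "(\<integral>\<^sup>+x. ennreal (?N * norm_pow p (cdot (D x) (radial_proj k))) * indicator K k * indicator B x \<partial>lborel)
      = (\<integral>\<^sup>+x. (ennreal ?N * indicator K k) * (ennreal (norm_pow p (cdot (D x) (radial_proj k))) * indicator B x) \<partial>lborel)"
      by (intro nn_integral_cong) (simp add: ennreal_mult mult_ac)
    also have "\<dots> = (ennreal ?N * indicator K k) * (\<integral>\<^sup>+x. ennreal (norm_pow p (cdot (D x) (radial_proj k))) * indicator B x \<partial>lborel)"
      by (rule nn_integral_cmult) measurable
    finally show "(\<integral>\<^sup>+x. ennreal (?N * norm_pow p (cdot (D x) (radial_proj k))) * indicator K k * indicator B x \<partial>lborel)
      = ennreal ?N * (\<integral>\<^sup>+x. ennreal (norm_pow p (cdot (D x) (radial_proj k))) * indicator B x \<partial>lborel) * indicator K k"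
      by (simp add: mult_ac)
  qed
  finally show ?thesis .
qed

context
  fixes u :: "real^'n \<Rightarrow> complex" and Gr :: "real^'n \<Rightarrow> complex^'n"
  assumes u: "locint u" and Gm [measurable]: "Gr \<in> borel_measurable borel" and Gr: "\<And>j. locint (\<lambda>y. Gr y $ j)"
begin

definition weak_magnetic_gradient :: "real^'n \<Rightarrow> complex^'n" where "weak_magnetic_gradient = magnetic_gradient A u Gr"

lemma weak_magnetic_gradient_measurable [measurable]: "weak_magnetic_gradient \<in> borel_measurable borel"
proof -
  note [measurable] = locint_measurable[OF u]
  have "(\<lambda>x. weak_magnetic_gradient x $ j) \<in> borel_measurable borel" for j
    unfolding weak_magnetic_gradient_def magnetic_gradient_def by simp
  then have "(\<lambda>x. weak_magnetic_gradient x \<bullet> b) \<in> borel_measurable borel" if "b \<in> Basis" for b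
    using that by (auto simp: inner_vec_def intro!: borel_measurable_sum borel_measurable_inner)
  then show ?thesis by (rule borel_measurable_euclidean_space[THEN iffD2, rule_format])
qed

lemma locint_phase: "locint (\<lambda>y. (\<i> * of_real (t \<bullet> A y)) * u y)"
proof (rule locint_mult[OF u])
  fix R
  obtain B where B: "0 \<le> B" "\<And>y. norm y \<le> R \<Longrightarrow> norm (A y) \<le> B" using A_bounded_on_cball by blast
  have "norm (\<i> * complex_of_real (t \<bullet> A y)) \<le> norm t * B" if "y \<in> cball 0 R" for y
    using Cauchy_Schwarz_ineq2[of t "A y"] mult_left_mono[OF B(2)[of y], of "norm t"] that by (simp add: norm_mult)
  then show "\<exists>C. \<forall>y\<in>cball 0 R. norm (\<i> * complex_of_real (t \<bullet> A y)) \<le> C" by blast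
qed measurable

lemma locint_cdot_weak_magnetic_gradient: "locint (\<lambda>y. cdot (weak_magnetic_gradient y) t)"
  unfolding weak_magnetic_gradient_def cdot_magnetic_gradient by (intro locint_diff locint_cdot Gr locint_phase)

lemma cdot_mollified_gradient:
  assumes m: "mollifier \<eta> \<epsilon>" and cg: "\<And>x j. conv_gradient \<eta> u x $ j = conv \<eta> (\<lambda>y. Gr y $ j) x"
  shows "cdot (mollified_gradient \<eta> u x) t = conv \<eta> (\<lambda>y. cdot (Gr y) t) x - \<i> * of_real (t \<bullet> A x) * conv \<eta> u x"
  unfolding mollified_gradient_def cdot_magnetic_gradient by (simp only: cdot_conv_gradient[OF m Gr cg])

text \<open>The magnetic gradient of the mollified function is the mollified magnetic gradient plus the
  commutator of the mollifier with multiplication by \<open>t \<bullet> A\<close>, which is small as \<open>A\<close> is Lipschitz.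
  The version localized to \<open>B\<close> also yields tightness.\<close>

lemma mollified_energy_le:
  assumes m: "mollifier \<eta> \<epsilon>" and cg: "\<And>x j. conv_gradient \<eta> u x $ j = conv \<eta> (\<lambda>y. Gr y $ j) x"
    and B[measurable]: "B \<in> sets borel" "B' \<in> sets borel" and sub: "\<And>x z. x \<in> B \<Longrightarrow> norm z < \<epsilon> \<Longrightarrow> x - z \<in> B'"
    and R: "1 \<le> R" "\<And>x. norm (radial_proj x) \<le> R"
  shows "(\<integral>\<^sup>+x. energy_density p (mollified_gradient \<eta> u x) * indicator B x \<partial>lborel)
    \<le> ennreal ((1 + \<epsilon>) powr (p - 1)) * (\<integral>\<^sup>+x. energy_density p (weak_magnetic_gradient x) * indicator B' x \<partial>lborel)
     + ennreal (real CARD('n) * (2 powr (p - 1) * (2 * (R * L)) powr p * \<epsilon>)) * emeasure lborel K * (\<integral>\<^sup>+x. ennreal (norm_pow p (u x)) \<partial>lborel)"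
proof -
  note k = mollifier_kernel_within[OF m]
  note [measurable] = locint_measurable[OF u] mollified_gradient_measurable[OF m u]
  let ?N = "real CARD('n)" and ?c = "2 powr (p - 1) * (2 * (R * L)) powr p * \<epsilon>"
  let ?I = "\<integral>\<^sup>+x. ennreal (norm_pow p (u x)) \<partial>lborel"
  have e: "0 < \<epsilon>" "\<epsilon> \<le> 1" using m by (auto simp: mollifier_def)
  have dir: "(\<integral>\<^sup>+x. ennreal (norm_pow p (cdot (mollified_gradient \<eta> u x) t)) * indicator B x \<partial>lborel)
    \<le> ennreal ((1 + \<epsilon>) powr (p - 1)) * (\<integral>\<^sup>+x. ennreal (norm_pow p (cdot (weak_magnetic_gradient x) t)) * indicator B' x \<partial>lborel) + ennreal ?c * ?I"
    if t: "norm t \<le> R" for t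
  proof -
    define q where "q y = \<i> * complex_of_real (t \<bullet> A y)" for y
    have qm [measurable]: "q \<in> borel_measurable borel" unfolding q_def by measurable
    have lq: "locint (\<lambda>y. q y * u y)" unfolding q_def by (rule locint_phase)
    have i1: "integrable lborel (\<lambda>z. \<eta> z *\<^sub>R (q x * u (x - z)))" for x
      using integrable_mult_right[OF conv_altdef(2)[OF k u, of x], of "q x"] by (simp add: mult.commute)
    note i2 = conv_altdef(2)[OF k lq]
    have ib: "integrable lborel (\<lambda>z. \<eta> z *\<^sub>R ((q (x - z) - q x) * u (x - z)))" for x
      using Bochner_Integration.integrable_diff[OF i2[of x] i1[of x]] by (simp add: left_diff_distrib scaleR_diff_right)
    have "(\<integral>\<^sup>+x. ennreal (norm_pow p (cdot (mollified_gradient \<eta> u x) t)) * indicator B x \<partial>lborel)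
      \<le> ennreal ((1 + \<epsilon>) powr (p - 1)) * (\<integral>\<^sup>+x. ennreal (norm_pow p (cdot (weak_magnetic_gradient x) t)) * indicator B' x \<partial>lborel)
       + ennreal ((1 + 1 / \<epsilon>) powr (p - 1) * (2 * (R * L * \<epsilon>)) powr p) * ?I"
    proof (rule mollified_norm_pow_le[OF m p1, where k = "\<lambda>x z. q (x - z) - q x"])
      fix x z :: "real^'n" assume z: "norm z < \<epsilon>"
      have "q (x - z) - q x = \<i> * complex_of_real (t \<bullet> (A (x - z) - A x))"
        by (simp add: q_def inner_diff_right right_diff_distrib)
      then have "cmod (q (x - z) - q x) = \<bar>t \<bullet> (A (x - z) - A x)\<bar>" by (simp add: norm_mult)
      also have "\<dots> \<le> norm t * norm (A (x - z) - A x)" by (rule Cauchy_Schwarz_ineq2)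
      also have "\<dots> \<le> R * (L * \<epsilon>)"
      proof (rule mult_mono[OF t])
        have "norm (A (x - z) - A x) \<le> L * norm ((x - z) - x)" by (rule A_diff_le)
        also have "\<dots> \<le> L * \<epsilon>" using z L_nonneg by (intro mult_left_mono) auto
        finally show "norm (A (x - z) - A x) \<le> L * \<epsilon>" .
      qed (use R in auto)
      finally show "cmod (q (x - z) - q x) \<le> R * L * \<epsilon>" by (simp add: mult.assoc)
    next
      fix x
      have "(\<integral>z. \<eta> z *\<^sub>R cdot (weak_magnetic_gradient (x - z)) t \<partial>lborel) + (\<integral>z. \<eta> z *\<^sub>R ((q (x - z) - q x) * u (x - z)) \<partial>lborel)
        = (\<integral>z. \<eta> z *\<^sub>R cdot (weak_magnetic_gradient (x - z)) t + \<eta> z *\<^sub>R ((q (x - z) - q x) * u (x - z)) \<partial>lborel)"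
        by (intro Bochner_Integration.integral_add[symmetric] ib conv_altdef(2)[OF k locint_cdot_weak_magnetic_gradient])
      also have "\<dots> = (\<integral>z. \<eta> z *\<^sub>R cdot (Gr (x - z)) t - q x * (\<eta> z *\<^sub>R u (x - z)) \<partial>lborel)"
        by (intro Bochner_Integration.integral_cong refl)
          (simp add: weak_magnetic_gradient_def cdot_magnetic_gradient q_def scaleR_conv_of_real algebra_simps)
      also have "\<dots> = (\<integral>z. \<eta> z *\<^sub>R cdot (Gr (x - z)) t \<partial>lborel) - (\<integral>z. q x * (\<eta> z *\<^sub>R u (x - z)) \<partial>lborel)"
        by (intro Bochner_Integration.integral_diff integrable_mult_right conv_altdef(2)[OF k u] conv_altdef(2)[OF k locint_cdot[OF Gr]])
      also have "\<dots> = cdot (mollified_gradient \<eta> u x) t"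
        unfolding cdot_mollified_gradient[OF m cg] conv_altdef(1)[OF k u] conv_altdef(1)[OF k locint_cdot[OF Gr]]
        by (simp add: q_def del: mult_scaleR_right)
      finally show "cdot (mollified_gradient \<eta> u x) t = (\<integral>z. \<eta> z *\<^sub>R cdot (weak_magnetic_gradient (x - z)) t \<partial>lborel) + (\<integral>z. \<eta> z *\<^sub>R ((q (x - z) - q x) * u (x - z)) \<partial>lborel)" by simp
    next
      show "integrable lborel (\<lambda>z. \<eta> z *\<^sub>R cdot (weak_magnetic_gradient (x - z)) t)" for x by (rule conv_altdef(2)[OF k locint_cdot_weak_magnetic_gradient])
      show "integrable lborel (\<lambda>z. \<eta> z *\<^sub>R ((q (x - z) - q x) * u (x - z)))" for x by (rule ib)
    qed (use sub in auto)
    also have "ennreal ((1 + 1 / \<epsilon>) powr (p - 1) * (2 * (R * L * \<epsilon>)) powr p) \<le> ennreal ?c"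
      using R L_nonneg by (intro ennreal_leI small_remainder e) auto
    finally show ?thesis by (simp add: mult_right_mono)
  qed
  have "(\<integral>\<^sup>+x. energy_density p (mollified_gradient \<eta> u x) * indicator B x \<partial>lborel)
    \<le> (\<integral>\<^sup>+k. ennreal ?N * (ennreal ((1 + \<epsilon>) powr (p - 1)) * (\<integral>\<^sup>+x. ennreal (norm_pow p (cdot (weak_magnetic_gradient x) (radial_proj k))) * indicator B' x \<partial>lborel) + ennreal ?c * ?I) * indicator K k \<partial>lborel)"
    unfolding nn_integral_energy_density[OF mollified_gradient_measurable[OF m u] B(1)]
    by (intro nn_integral_mono mult_right_mono mult_left_mono dir R) auto
  also have "\<dots> = (\<integral>\<^sup>+k. ennreal ((1 + \<epsilon>) powr (p - 1)) * (ennreal ?N * (\<integral>\<^sup>+x. ennreal (norm_pow p (cdot (weak_magnetic_gradient x) (radial_proj k))) * indicator B' x \<partial>lborel) * indicator K k)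
      + (ennreal ?N * (ennreal ?c * ?I)) * indicator K k \<partial>lborel)"
    by (intro nn_integral_cong) (simp add: distrib_left distrib_right mult_ac)
  also have "\<dots> = ennreal ((1 + \<epsilon>) powr (p - 1)) * (\<integral>\<^sup>+x. energy_density p (weak_magnetic_gradient x) * indicator B' x \<partial>lborel)
      + (ennreal ?N * (ennreal ?c * ?I)) * emeasure lborel K"
    unfolding nn_integral_energy_density[OF weak_magnetic_gradient_measurable B(2)]
    by (subst nn_integral_add) (auto simp: nn_integral_cmult)
  also have "(ennreal ?N * (ennreal ?c * ?I)) * emeasure lborel K = ennreal (?N * ?c) * emeasure lborel K * ?I"
    using e by (simp add: ennreal_mult mult_ac)
  finally show ?thesis .
qed

text \<open>In each direction the mollified magnetic gradients converge in \<open>L\<^sup>1\<close> on balls, since \<open>A\<close> is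
  bounded there.\<close>

lemma energy_le_liminf:
  assumes m: "\<And>m. mollifier (\<eta> m) (\<epsilon> m)" and e0: "\<epsilon> \<longlonglongrightarrow> 0"
    and cg: "\<And>m x j. conv_gradient (\<eta> m) u x $ j = conv (\<eta> m) (\<lambda>y. Gr y $ j) x"
  shows "(\<integral>\<^sup>+x. energy_density p (weak_magnetic_gradient x) \<partial>lborel) \<le> liminf (\<lambda>m. \<integral>\<^sup>+x. energy_density p (mollified_gradient (\<eta> m) u x) \<partial>lborel)"
proof -
  note [measurable] = locint_measurable[OF u] mollified_gradient_measurable[OF m u] conv_measurable[OF mollifier_kernel_within[OF m] u]
  let ?N = "real CARD('n)"
  have conv0: "(\<lambda>i. \<integral>\<^sup>+x. ennreal (norm (cdot (mollified_gradient (\<eta> i) u x) t - cdot (weak_magnetic_gradient x) t)) * indicator (cball 0 R) x \<partial>lborel) \<longlonglongrightarrow> 0" for t R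
  proof -
    obtain B where B: "0 \<le> B" "\<And>y. norm y \<le> R \<Longrightarrow> norm (A y) \<le> B" using A_bounded_on_cball by blast
    note lt = locint_cdot[OF Gr, of t]
    note [measurable] = locint_measurable[OF lt] conv_measurable[OF mollifier_kernel_within[OF m] lt]
    let ?a = "\<lambda>i x. ennreal (norm (conv (\<eta> i) (\<lambda>y. cdot (Gr y) t) x - cdot (Gr x) t))"
    let ?b = "\<lambda>i x. ennreal (norm (conv (\<eta> i) u x - u x))"
    have bd: "(\<integral>\<^sup>+x. ennreal (norm (cdot (mollified_gradient (\<eta> i) u x) t - cdot (weak_magnetic_gradient x) t)) * indicator (cball 0 R) x \<partial>lborel)
      \<le> (\<integral>\<^sup>+x. ?a i x * indicator (cball 0 R) x \<partial>lborel) + ennreal (norm t * B) * (\<integral>\<^sup>+x. ?b i x * indicator (cball 0 R) x \<partial>lborel)" for i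
    proof -
      have "(\<integral>\<^sup>+x. ennreal (norm (cdot (mollified_gradient (\<eta> i) u x) t - cdot (weak_magnetic_gradient x) t)) * indicator (cball 0 R) x \<partial>lborel)
        \<le> (\<integral>\<^sup>+x. ?a i x * indicator (cball 0 R) x + ennreal (norm t * B) * (?b i x * indicator (cball 0 R) x) \<partial>lborel)"
      proof (rule nn_integral_mono)
        fix x :: "real^'n"
        show "ennreal (norm (cdot (mollified_gradient (\<eta> i) u x) t - cdot (weak_magnetic_gradient x) t)) * indicator (cball 0 R) x
          \<le> ?a i x * indicator (cball 0 R) x + ennreal (norm t * B) * (?b i x * indicator (cball 0 R) x)"
        proof (cases "norm x \<le> R")
          case True
          have "cdot (mollified_gradient (\<eta> i) u x) t - cdot (weak_magnetic_gradient x) t = (conv (\<eta> i) (\<lambda>y. cdot (Gr y) t) x - cdot (Gr x) t) - \<i> * of_real (t \<bullet> A x) * (conv (\<eta> i) u x - u x)"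
            unfolding cdot_mollified_gradient[OF m cg] weak_magnetic_gradient_def cdot_magnetic_gradient by (simp add: algebra_simps)
          also have "norm \<dots> \<le> norm (conv (\<eta> i) (\<lambda>y. cdot (Gr y) t) x - cdot (Gr x) t) + \<bar>t \<bullet> A x\<bar> * norm (conv (\<eta> i) u x - u x)"
            by (rule order_trans[OF norm_triangle_ineq4]) (simp add: norm_mult)
          also have "\<bar>t \<bullet> A x\<bar> \<le> norm t * B"
            using Cauchy_Schwarz_ineq2[of t "A x"] mult_left_mono[OF B(2)[OF True], of "norm t"] by simp
          finally have "norm (cdot (mollified_gradient (\<eta> i) u x) t - cdot (weak_magnetic_gradient x) t) \<le> norm (conv (\<eta> i) (\<lambda>y. cdot (Gr y) t) x - cdot (Gr x) t) + (norm t * B) * norm (conv (\<eta> i) u x - u x)"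
            by (simp add: mult_right_mono)
          then have "ennreal (norm (cdot (mollified_gradient (\<eta> i) u x) t - cdot (weak_magnetic_gradient x) t)) \<le> ?a i x + ennreal (norm t * B) * ?b i x"
            using B(1) by (simp add: ennreal_plus[symmetric] ennreal_mult[symmetric] ennreal_leI del: ennreal_plus)
          then show ?thesis using True by simp
        qed simp
      qed
      also have "\<dots> = (\<integral>\<^sup>+x. ?a i x * indicator (cball 0 R) x \<partial>lborel) + ennreal (norm t * B) * (\<integral>\<^sup>+x. ?b i x * indicator (cball 0 R) x \<partial>lborel)"
        by (subst nn_integral_add) (auto simp: nn_integral_cmult)
      finally show ?thesis .
    qed
    have "(\<lambda>i. (\<integral>\<^sup>+x. ?a i x * indicator (cball 0 R) x \<partial>lborel) + ennreal (norm t * B) * (\<integral>\<^sup>+x. ?b i x * indicator (cball 0 R) x \<partial>lborel)) \<longlonglongrightarrow> 0 + ennreal (norm t * B) * 0"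
      by (intro tendsto_add tendsto_mult_ennreal tendsto_const mollify_L1loc[OF m e0] lt u) auto
    then have lim: "(\<lambda>i. (\<integral>\<^sup>+x. ?a i x * indicator (cball 0 R) x \<partial>lborel) + ennreal (norm t * B) * (\<integral>\<^sup>+x. ?b i x * indicator (cball 0 R) x \<partial>lborel)) \<longlonglongrightarrow> 0" by simp
    show ?thesis
      by (rule tendsto_sandwich[OF _ _ tendsto_const lim]) (use bd in \<open>auto intro!: always_eventually\<close>)
  qed
  define q where "q D k x = ennreal (?N * norm_pow p (cdot (D x) (radial_proj k)))" for D k and x :: "real^'n"
  have [measurable]: "(\<lambda>(k, x). q D k x) \<in> borel_measurable (lborel \<Otimes>\<^sub>M lborel)" if "D \<in> borel_measurable borel" for D
    unfolding q_def using that by measurable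
  have eq: "(\<integral>\<^sup>+x. energy_density p (D x) \<partial>lborel) = (\<integral>\<^sup>+k. (\<integral>\<^sup>+x. q D k x \<partial>lborel) * indicator K k \<partial>lborel)"
    if [measurable]: "D \<in> borel_measurable borel" for D
  proof -
    have "(\<integral>\<^sup>+x. q D k x \<partial>lborel) = ennreal ?N * (\<integral>\<^sup>+x. ennreal (norm_pow p (cdot (D x) (radial_proj k))) \<partial>lborel)" for k
      unfolding q_def ennreal_mult[OF of_nat_0_le_iff norm_pow_nonneg] by (rule nn_integral_cmult) measurable
    then show ?thesis using nn_integral_energy_density[of D UNIV] by simp
  qed
  have "(\<integral>\<^sup>+x. energy_density p (weak_magnetic_gradient x) \<partial>lborel) \<le> (\<integral>\<^sup>+k. liminf (\<lambda>i. (\<integral>\<^sup>+x. q (mollified_gradient (\<eta> i) u) k x \<partial>lborel) * indicator K k) \<partial>lborel)"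
    unfolding eq[OF weak_magnetic_gradient_measurable]
  proof (rule nn_integral_mono)
    fix k
    have "(\<integral>\<^sup>+x. q weak_magnetic_gradient k x \<partial>lborel) \<le> liminf (\<lambda>i. (\<integral>\<^sup>+x. q (mollified_gradient (\<eta> i) u) k x \<partial>lborel))"
      unfolding q_def
    proof (rule nn_integral_lsc_L1loc[where \<Phi> = "\<lambda>z. ?N * norm_pow p z"])
      show "continuous_on UNIV (\<lambda>z. ?N * norm_pow p z)" using p1 by (intro continuous_intros) auto
    qed (use conv0 in auto)
    then show "(\<integral>\<^sup>+x. q weak_magnetic_gradient k x \<partial>lborel) * indicator K k \<le> liminf (\<lambda>i. (\<integral>\<^sup>+x. q (mollified_gradient (\<eta> i) u) k x \<partial>lborel) * indicator K k)"
      by (cases "k \<in> K") auto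
  qed
  also have "\<dots> \<le> liminf (\<lambda>i. \<integral>\<^sup>+k. (\<integral>\<^sup>+x. q (mollified_gradient (\<eta> i) u) k x \<partial>lborel) * indicator K k \<partial>lborel)"
    by (intro nn_integral_liminf) measurable
  also have "\<dots> = liminf (\<lambda>i. \<integral>\<^sup>+x. energy_density p (mollified_gradient (\<eta> i) u x) \<partial>lborel)" by (simp add: eq[OF mollified_gradient_measurable[OF m u]])
  finally show ?thesis .
qed

lemma Sobolev_sphere_energy_tendsto:
  assumes m: "\<And>m. mollifier (\<eta> m) (\<epsilon> m)" and e0: "\<epsilon> \<longlonglongrightarrow> 0"
    and cg: "\<And>m x j. conv_gradient (\<eta> m) u x $ j = conv (\<eta> m) (\<lambda>y. Gr y $ j) x"
    and fin: "(\<integral>\<^sup>+x. ennreal (norm_pow p (u x)) \<partial>lborel) < \<infinity>"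
    and efin: "(\<integral>\<^sup>+x. energy_density p (weak_magnetic_gradient x) \<partial>lborel) < \<infinity>"
  shows "(sphere_energy u \<longlongrightarrow> (\<integral>\<^sup>+x. energy_density p (weak_magnetic_gradient x) \<partial>lborel)) (at_right 0)"
proof -
  obtain R where R: "1 \<le> R" "\<And>x. norm (radial_proj x) \<le> R" using radial_proj_bound by metis
  define J where "J = emeasure lborel K * (\<integral>\<^sup>+x. ennreal (norm_pow p (u x)) \<partial>lborel)"
  have Jfin: "J < top" unfolding J_def using fin emeasure_K_finite by (simp add: ennreal_mult_less_top)
  define c where "c = real CARD('n) * (2 powr (p - 1) * (2 * (R * L)) powr p)"
  define l where "l = enn2real (\<integral>\<^sup>+x. energy_density p (weak_magnetic_gradient x) \<partial>lborel)"
  have l: "(\<integral>\<^sup>+x. energy_density p (weak_magnetic_gradient x) \<partial>lborel) = ennreal l" "0 \<le> l" unfolding l_def using efin by auto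
  have lim: "(\<lambda>i. ennreal ((1 + \<epsilon> i) powr (p - 1)) * X + ennreal (c * \<epsilon> i) * J) \<longlonglongrightarrow> X" if X: "X < top" for X
  proof -
    have "(\<lambda>i. ennreal ((1 + \<epsilon> i) powr (p - 1)) * X + ennreal (c * \<epsilon> i) * J) \<longlonglongrightarrow> ennreal ((1 + 0) powr (p - 1)) * X + ennreal (c * 0) * J"
      using e0 Jfin X by (intro tendsto_add tendsto_mult_ennreal tendsto_const tendsto_ennrealI tendsto_intros) auto
    then show ?thesis by simp
  qed
  have le: "(\<integral>\<^sup>+x. energy_density p (mollified_gradient (\<eta> i) u x) * indicator B x \<partial>lborel)
      \<le> ennreal ((1 + \<epsilon> i) powr (p - 1)) * (\<integral>\<^sup>+x. energy_density p (weak_magnetic_gradient x) * indicator B' x \<partial>lborel) + ennreal (c * \<epsilon> i) * J"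
    if "B \<in> sets borel" "B' \<in> sets borel" "\<And>x z. x \<in> B \<Longrightarrow> norm z < \<epsilon> i \<Longrightarrow> x - z \<in> B'" for B B' i
    using mollified_energy_le[OF m cg that R] unfolding c_def J_def by (simp add: mult.assoc)
  show ?thesis unfolding l(1)
  proof (rule sphere_energy_tendsto[OF m e0 u fin l(2)])
    fix e :: real assume e: "0 < e"
    have "(\<lambda>i. ennreal ((1 + \<epsilon> i) powr (p - 1)) * ennreal l + ennreal (c * \<epsilon> i) * J) \<longlonglongrightarrow> ennreal l" by (rule lim) simp
    moreover have "ennreal l < ennreal (l + e)" using e l(2) by (intro ennreal_lessI) auto
    ultimately have "eventually (\<lambda>i. ennreal ((1 + \<epsilon> i) powr (p - 1)) * ennreal l + ennreal (c * \<epsilon> i) * J < ennreal (l + e)) sequentially"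
      by (rule order_tendstoD)
    then show "eventually (\<lambda>i. (\<integral>\<^sup>+x. energy_density p (mollified_gradient (\<eta> i) u x) \<partial>lborel) \<le> ennreal (l + e)) sequentially"
    proof eventually_elim
      case (elim i)
      have "(\<integral>\<^sup>+x. energy_density p (mollified_gradient (\<eta> i) u x) \<partial>lborel) \<le> ennreal ((1 + \<epsilon> i) powr (p - 1)) * ennreal l + ennreal (c * \<epsilon> i) * J"
        using le[of UNIV UNIV i] by (simp add: l(1))
      with elim show ?case by simp
    qed
  next
    fix e :: real assume e: "0 < e"
    have "(\<lambda>n. \<integral>\<^sup>+x. energy_density p (weak_magnetic_gradient x) * indicator (- cball 0 (real n)) x \<partial>lborel) \<longlonglongrightarrow> (\<integral>\<^sup>+x. 0 \<partial>(lborel :: (real^'n) measure))"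
    proof (rule nn_integral_dominated_convergence[where w = "\<lambda>x. energy_density p (weak_magnetic_gradient x)"])
      show "AE x in lborel. (\<lambda>n. energy_density p (weak_magnetic_gradient x) * indicator (- cball 0 (real n)) x) \<longlonglongrightarrow> 0"
      proof (rule AE_I2)
        fix x :: "real^'n"
        obtain n0 :: nat where n0: "norm x \<le> real n0" using real_arch_simple by blast
        have "eventually (\<lambda>n. energy_density p (weak_magnetic_gradient x) * indicator (- cball 0 (real n)) x = 0) sequentially"
          using eventually_ge_at_top[of n0]
        proof eventually_elim
          case (elim n)
          then have "norm x \<le> real n" using n0 by simp
          then show ?case by simp
        qed
        then show "(\<lambda>n. energy_density p (weak_magnetic_gradient x) * indicator (- cball 0 (real n)) x) \<longlonglongrightarrow> 0" by (rule tendsto_eventually)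
      qed
      show "AE x in lborel. energy_density p (weak_magnetic_gradient x) * indicator (- cball 0 (real n)) x \<le> energy_density p (weak_magnetic_gradient x)" for n
        by (auto simp: indicator_def)
    qed (use efin in auto)
    then have "eventually (\<lambda>n. (\<integral>\<^sup>+x. energy_density p (weak_magnetic_gradient x) * indicator (- cball 0 (real n)) x \<partial>lborel) < ennreal e) sequentially"
      using e by (intro order_tendstoD) auto
    then obtain n where n: "(\<integral>\<^sup>+x. energy_density p (weak_magnetic_gradient x) * indicator (- cball 0 (real n)) x \<partial>lborel) < ennreal e"
      by (auto simp: eventually_sequentially)
    define X where "X = (\<integral>\<^sup>+x. energy_density p (weak_magnetic_gradient x) * indicator (- cball 0 (real n)) x \<partial>lborel)"
    have "X < top" using n unfolding X_def by (rule order_less_le_trans) simp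
    then have "eventually (\<lambda>i. ennreal ((1 + \<epsilon> i) powr (p - 1)) * X + ennreal (c * \<epsilon> i) * J < ennreal e) sequentially"
      using lim n by (intro order_tendstoD) (auto simp: X_def)
    then have "eventually (\<lambda>i. (\<integral>\<^sup>+x. energy_density p (mollified_gradient (\<eta> i) u x) * indicator (- cball 0 (real n + 1)) x \<partial>lborel) \<le> ennreal e) sequentially"
    proof eventually_elim
      case (elim i)
      have "(\<integral>\<^sup>+x. energy_density p (mollified_gradient (\<eta> i) u x) * indicator (- cball 0 (real n + 1)) x \<partial>lborel) \<le> ennreal ((1 + \<epsilon> i) powr (p - 1)) * X + ennreal (c * \<epsilon> i) * J"
        unfolding X_def
      proof (rule le)
        fix x z :: "real^'n" assume "x \<in> - cball 0 (real n + 1)" "norm z < \<epsilon> i"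
        moreover have "\<epsilon> i \<le> 1" using m[of i] by (simp add: mollifier_def)
        ultimately show "x - z \<in> - cball 0 (real n)" using norm_triangle_ineq2[of x z] by auto
      qed auto
      with elim show ?case by simp
    qed
    then show "\<exists>R. eventually (\<lambda>i. (\<integral>\<^sup>+x. energy_density p (mollified_gradient (\<eta> i) u x) * indicator (- cball 0 R) x \<partial>lborel) \<le> ennreal e) sequentially" by blast
  next
    show "ennreal l \<le> liminf (\<lambda>i. \<integral>\<^sup>+x. energy_density p (mollified_gradient (\<eta> i) u x) \<partial>lborel)"
      unfolding l(1)[symmetric] by (rule energy_le_liminf[OF m e0 cg])
  qed
qed

end

end

section \<open>Integration by parts and convolution\<close>

lemma bounded_support_integrable:
  fixes f :: "real^'n \<Rightarrow> 'b::euclidean_space"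
  assumes [measurable]: "f \<in> borel_measurable borel" and bd: "\<And>x. norm (f x) \<le> C" and sup: "\<And>x. R < norm x \<Longrightarrow> f x = 0"
  shows "integrable lborel f"
proof (rule Bochner_Integration.integrable_bound)
  have "emeasure lborel (cball (0::real^'n) R) < \<infinity>" using emeasure_lborel_cball_finite[of "0::real^'n" R] by simp
  then show "integrable lborel (\<lambda>x. C * indicator (cball (0::real^'n) R) x)"
    by (intro integrable_mult_right integrable_real_indicator) auto
  have "norm (f x) \<le> norm (C * indicator (cball 0 R) x)" for x
    using bd[of x] sup[of x] by (cases "norm x \<le> R") auto
  then show "AE x in lborel. norm (f x) \<le> norm (C * indicator (cball 0 R) x)" by simp
qed simp

text \<open>Fubini's theorem: convolution with \<open>\<kappa>\<close> is adjoint to convolution with the reflected kernel.\<close>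

lemma conv_swap:
  fixes f g :: "real^'n \<Rightarrow> real"
  assumes k: "kernel_within \<kappa> \<epsilon>" and [measurable]: "f \<in> borel_measurable borel"
    and f: "\<And>x. \<bar>f x\<bar> \<le> C" "\<And>x. R < norm x \<Longrightarrow> f x = 0" and g: "integrable lborel g"
  shows "(\<integral>x. f x * conv \<kappa> g x \<partial>lborel) = (\<integral>y. g y * conv (\<lambda>z. \<kappa> (- z)) f y \<partial>lborel)"
    and "integrable lborel (\<lambda>x. f x * conv \<kappa> g x)"
    and "integrable lborel (\<lambda>y. g y * conv (\<lambda>z. \<kappa> (- z)) f y)"
proof -
  obtain Ck where Ck: "0 \<le> Ck" "\<And>z. \<bar>\<kappa> z\<bar> \<le> Ck" using kernel_within_bounded[OF k] by metis
  have lg: "locint g" by (rule integrable_imp_locint[OF g])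
  have fi: "integrable lborel f" by (rule bounded_support_integrable[of f C R]) (use f in auto)
  have lf: "locint f" by (rule integrable_imp_locint[OF fi])
  have k': "kernel_within (\<lambda>z. \<kappa> (- z)) \<epsilon>" using k unfolding kernel_within_def
    by (auto intro!: continuous_on_compose2[of UNIV \<kappa>] continuous_intros)
  note [measurable] = kernel_within_measurable[OF k] locint_measurable[OF lg]
  define h where "h x y = f x * (\<kappa> (x - y) * g y)" for x y
  have [measurable]: "case_prod h \<in> borel_measurable (lborel \<Otimes>\<^sub>M lborel)" unfolding h_def by measurable
  have int: "integrable (lborel \<Otimes>\<^sub>M lborel) (case_prod h)"
  proof (rule integrableI_bounded)
    have "(\<integral>\<^sup>+z. ennreal (norm (case_prod h z)) \<partial>(lborel \<Otimes>\<^sub>M lborel)) = (\<integral>\<^sup>+x. (\<integral>\<^sup>+y. ennreal (norm (h x y)) \<partial>lborel) \<partial>lborel)"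
      by (subst lborel.nn_integral_fst[symmetric]) (auto simp: split_beta')
    also have "\<dots> \<le> (\<integral>\<^sup>+x. (\<integral>\<^sup>+y. ennreal \<bar>f x\<bar> * (ennreal Ck * ennreal \<bar>g y\<bar>) \<partial>lborel) \<partial>lborel)"
    proof (rule nn_integral_mono, rule nn_integral_mono)
      fix x y
      have "norm (h x y) \<le> \<bar>f x\<bar> * (Ck * \<bar>g y\<bar>)"
        unfolding h_def using Ck by (auto simp: abs_mult intro!: mult_left_mono mult_right_mono)
      then show "ennreal (norm (h x y)) \<le> ennreal \<bar>f x\<bar> * (ennreal Ck * ennreal \<bar>g y\<bar>)"
        using Ck(1) by (simp add: ennreal_mult[symmetric] ennreal_leI)
    qed
    also have "\<dots> = (\<integral>\<^sup>+x. ennreal \<bar>f x\<bar> \<partial>lborel) * (ennreal Ck * (\<integral>\<^sup>+y. ennreal \<bar>g y\<bar> \<partial>lborel))"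
      by (simp add: nn_integral_cmult nn_integral_multc)
    also have "\<dots> < \<infinity>"
      using fi g unfolding integrable_iff_bounded by (auto simp: ennreal_mult_less_top)
    finally show "(\<integral>\<^sup>+z. ennreal (norm (case_prod h z)) \<partial>(lborel \<Otimes>\<^sub>M lborel)) < \<infinity>" .
  qed measurable
  have e1: "(\<integral>y. h x y \<partial>lborel) = f x * conv \<kappa> g x" for x
    unfolding h_def conv_def using conv_integrable[OF k lg, of x] by simp
  have e2: "(\<integral>x. h x y \<partial>lborel) = g y * conv (\<lambda>z. \<kappa> (- z)) f y" for y
  proof -
    have "(\<integral>x. h x y \<partial>lborel) = (\<integral>x. g y * (\<kappa> (- (y - x)) *\<^sub>R f x) \<partial>lborel)"
      unfolding h_def by (intro Bochner_Integration.integral_cong refl) simp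
    also have "\<dots> = g y * conv (\<lambda>z. \<kappa> (- z)) f y"
      unfolding conv_def using conv_integrable[OF k' lf, of y] by simp
    finally show ?thesis .
  qed
  show "(\<integral>x. f x * conv \<kappa> g x \<partial>lborel) = (\<integral>y. g y * conv (\<lambda>z. \<kappa> (- z)) f y \<partial>lborel)"
    using lborel_pair.Fubini_integral[OF int] unfolding e1 e2 by simp
  show "integrable lborel (\<lambda>x. f x * conv \<kappa> g x)" using lborel_pair.integrable_fst'[OF int] by (simp add: e1)
  show "integrable lborel (\<lambda>y. g y * conv (\<lambda>z. \<kappa> (- z)) f y)"
    using lborel_pair.integrable_fst'[OF lborel_pair.integrable_product_swap[OF int]] by (simp add: e2)
qed

lemma conv_component:
  fixes f :: "real^'n \<Rightarrow> real^'n"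
  assumes "kernel_within \<kappa> \<epsilon>" "locint f"
  shows "conv \<kappa> f y $ j = conv \<kappa> (\<lambda>x. f x $ j) y"
  unfolding conv_def using integral_bounded_linear[OF bounded_linear_vec_nth[of j] conv_integrable[OF assms, of y]] by simp

lemma conv_Re: "kernel_within \<kappa> \<epsilon> \<Longrightarrow> locint f \<Longrightarrow> Re (conv \<kappa> f y) = conv \<kappa> (\<lambda>x. Re (f x)) y"
  and conv_Im: "kernel_within \<kappa> \<epsilon> \<Longrightarrow> locint f \<Longrightarrow> Im (conv \<kappa> f y) = conv \<kappa> (\<lambda>x. Im (f x)) y"
  unfolding conv_def using integral_bounded_linear[OF bounded_linear_Re conv_integrable[of \<kappa> \<epsilon> f y]]
    integral_bounded_linear[OF bounded_linear_Im conv_integrable[of \<kappa> \<epsilon> f y]] by auto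

lemma partial_conv:
  fixes f :: "real^'n \<Rightarrow> 'b::euclidean_space"
  assumes "kernel_within \<kappa> \<epsilon>" "Ck 1 \<kappa>" "locint f"
  shows "partial j (conv \<kappa> f) x = conv (partial j \<kappa>) f x"
  using partial_eqI[OF conv_has_derivative[OF assms], of j]
  by (simp add: axis_def if_distrib[of "\<lambda>x. x *\<^sub>R _"] cong: if_cong)

lemma conv_Ck1:
  fixes f :: "real^'n \<Rightarrow> 'b::euclidean_space"
  assumes "kernel_within \<kappa> \<epsilon>" "Ck 1 \<kappa>" "locint f"
  shows "Ck 1 (conv \<kappa> f)"
proof -
  have "partial j (conv \<kappa> f) = conv (partial j \<kappa>) f" for j using partial_conv[OF assms] by auto
  moreover have "conv \<kappa> f differentiable (at x)" for x
    using conv_has_derivative[OF assms] by (auto simp: differentiable_def)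
  ultimately show ?thesis using conv_continuous[OF kernel_within_partial[OF assms(1,2)] assms(3)] by simp
qed

lemma Ck1_component:
  fixes f :: "real^'n \<Rightarrow> real^'n"
  assumes "Ck 1 f"
  shows "Ck 1 (\<lambda>x. f x $ j)" "partial i (\<lambda>x. f x $ j) x = partial i f x $ j"
proof -
  have d: "((\<lambda>x. f x $ j) has_derivative (\<lambda>h. frechet_derivative f (at x) h $ j)) (at x)" for x
    using assms by (intro bounded_linear.has_derivative[OF bounded_linear_vec_nth])
      (auto simp: frechet_derivative_works[symmetric])
  show p: "partial i (\<lambda>x. f x $ j) x = partial i f x $ j" for i x
    using partial_eqI[OF d] by (simp add: partial_def)
  then have "partial i (\<lambda>x. f x $ j) = (\<lambda>x. partial i f x $ j)" for i by auto
  moreover have "(\<lambda>x. f x $ j) differentiable (at x)" for x using d by (auto simp: differentiable_def)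
  ultimately show "Ck 1 (\<lambda>x. f x $ j)" using assms by (auto intro!: continuous_intros)
qed

lemma conv_commute:
  fixes f \<kappa> :: "real^'n \<Rightarrow> real"
  assumes "kernel_within \<kappa> \<epsilon>" "kernel_within f R"
  shows "conv \<kappa> f x = conv f \<kappa> x"
proof -
  have lf: "locint f"
  proof -
    obtain C where C: "0 \<le> C" "\<And>z. \<bar>f z\<bar> \<le> C" using kernel_within_bounded[OF assms(2)] by metis
    show ?thesis
      by (rule integrable_imp_locint, rule bounded_support_integrable[of f C R])
        (use C assms kernel_within_measurable[OF assms(2)] in \<open>auto simp: kernel_within_def\<close>)
  qed
  show ?thesis unfolding conv_altdef(1)[OF assms(1) lf] unfolding conv_def by (simp add: mult.commute)
qed

lemma kernel_within_locint:
  fixes f :: "real^'n \<Rightarrow> real"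
  assumes "kernel_within f R" shows "locint f" "integrable lborel f"
proof -
  obtain C where C: "0 \<le> C" "\<And>z. \<bar>f z\<bar> \<le> C" using kernel_within_bounded[OF assms] by metis
  show "integrable lborel f"
    by (rule bounded_support_integrable[of f C R])
      (use C assms kernel_within_measurable[OF assms] in \<open>auto simp: kernel_within_def\<close>)
  then show "locint f" by (rule integrable_imp_locint)
qed

lemma conv_partial_swap:
  fixes f \<kappa> :: "real^'n \<Rightarrow> real"
  assumes k: "kernel_within \<kappa> \<epsilon>" "Ck 1 \<kappa>" and f: "kernel_within f R" "Ck 1 f"
  shows "conv (partial j \<kappa>) f x = conv \<kappa> (partial j f) x"
proof -
  have "conv (partial j \<kappa>) f x = partial j (conv \<kappa> f) x" by (rule partial_conv[OF k kernel_within_locint(1)[OF f(1)], symmetric])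
  also have "conv \<kappa> f = conv f \<kappa>" using conv_commute[OF k(1) f(1)] by auto
  also have "partial j (conv f \<kappa>) x = conv (partial j f) \<kappa> x" by (rule partial_conv[OF f kernel_within_locint(1)[OF k(1)]])
  also have "\<dots> = conv \<kappa> (partial j f) x" by (rule conv_commute[OF k(1) kernel_within_partial[OF f], symmetric])
  finally show ?thesis .
qed

section \<open>The norm for p = 1 and its dual ball\<close>

definition Re_vec :: "complex^'n \<Rightarrow> real^'n" where "Re_vec v = (\<chi> j. Re (v $ j))"

lemma Re_cdot: "Re (cdot v x) = Re_vec v \<bullet> x" and Im_cdot: "Im (cdot v x) = (\<chi> j. Im (v $ j)) \<bullet> x"
  by (simp_all add: cdot_def Re_vec_def inner_vec_def)

locale magnetic1 = magnetic K A L 1 for K :: "(real^'n) set" and A :: "real^'n \<Rightarrow> real^'n" and L :: real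
begin

text \<open>The norm \<open>Z\<^sub>1\<^sup>* K\<close> on real vectors. It is the support function of a zonoid, the dual ball that
  the test fields take values in.\<close>

definition zonoid_norm :: "real^'n \<Rightarrow> real" where "zonoid_norm w = zstar_norm 1 K (cvec w)"

lemma inner_K_integrable: "integrable lborel (\<lambda>k. indicator K k *\<^sub>R \<bar>w \<bullet> k\<bar>)"
  by (intro K_integral_finite continuous_intros)

lemma zonoid_norm_eq: "zonoid_norm w = (real CARD('n) + 1) * (\<integral>k. indicator K k *\<^sub>R \<bar>w \<bullet> k\<bar> \<partial>lborel)"
proof -
  have "cdot (cvec w) x = of_real (w \<bullet> x)" for x by (simp add: cdot_def cvec_def inner_vec_def)
  then have "(LINT x:K|lebesgue. cnorm_p 1 (cdot (cvec w) x) powr 1) = (\<integral>k. indicator K k *\<^sub>R \<bar>w \<bullet> k\<bar> \<partial>lborel)"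
    unfolding set_lebesgue_integral_def cnorm_powr[OF order_refl]
    by (subst integral_completion) (auto simp: norm_pow_def)
  moreover have "0 \<le> (\<integral>k. indicator K k *\<^sub>R \<bar>w \<bullet> k\<bar> \<partial>lborel)" by (intro integral_nonneg_AE) auto
  ultimately show ?thesis unfolding zonoid_norm_def zstar_norm_def by simp
qed

lemma zonoid_norm_nonneg [simp]: "0 \<le> zonoid_norm w"
  unfolding zonoid_norm_eq by (intro mult_nonneg_nonneg integral_nonneg_AE) auto

lemma zonoid_norm_scaleR: "zonoid_norm (c *\<^sub>R w) = \<bar>c\<bar> * zonoid_norm w"
proof -
  have eq: "indicator K k *\<^sub>R \<bar>(c *\<^sub>R w) \<bullet> k\<bar> = \<bar>c\<bar> * (indicator K k *\<^sub>R \<bar>w \<bullet> k\<bar>)" for k by (simp add: abs_mult)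
  show ?thesis unfolding zonoid_norm_eq eq integral_mult_right_zero by (rule mult.left_commute)
qed

lemma zonoid_norm_minus [simp]: "zonoid_norm (- w) = zonoid_norm w" using zonoid_norm_scaleR[of "-1" w] by simp

lemma zonoid_norm_measurable [measurable (raw)]:
  assumes [measurable]: "f \<in> borel_measurable M" shows "(\<lambda>x. zonoid_norm (f x)) \<in> borel_measurable M"
  unfolding zonoid_norm_eq by measurable

text \<open>For \<open>p = 1\<close> the norm \<open>\<bar>z\<bar>\<^sub>1\<close> is the sum of the absolute values of the real and imaginary parts, so
  the energy decouples.\<close>

lemma energy_density_1_eq: "energy_density 1 v = ennreal (zonoid_norm (Re_vec v)) + ennreal (zonoid_norm (\<chi> j. Im (v $ j)))"
proof -
  let ?I = "\<lambda>w. \<integral>k. indicator K k *\<^sub>R \<bar>w \<bullet> k\<bar> \<partial>lborel"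
  have "ennreal (?I w) = (\<integral>\<^sup>+k. ennreal \<bar>w \<bullet> k\<bar> * indicator K k \<partial>lborel)" for w
    using inner_K_integrable[of w] by (subst nn_integral_eq_integral[symmetric]) (auto intro!: nn_integral_cong simp: indicator_def)
  then have "ennreal (?I (Re_vec v)) + ennreal (?I (\<chi> j. Im (v $ j))) = (\<integral>\<^sup>+k. ennreal \<bar>Re_vec v \<bullet> k\<bar> * indicator K k + ennreal \<bar>(\<chi> j. Im (v $ j)) \<bullet> k\<bar> * indicator K k \<partial>lborel)"
    by (subst nn_integral_add) auto
  also have "\<dots> = (\<integral>\<^sup>+k. ennreal (norm_pow 1 (cdot v k)) * indicator K k \<partial>lborel)"
    by (intro nn_integral_cong) (simp add: norm_pow_def Re_cdot Im_cdot distrib_right)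
  also have "\<dots> = ennreal (1 / (real CARD('n) + 1)) * energy_density 1 v" by (rule nn_integral_K_energy_density) simp
  finally have "ennreal (real CARD('n) + 1) * (ennreal (?I (Re_vec v)) + ennreal (?I (\<chi> j. Im (v $ j))))
     = ennreal (real CARD('n) + 1) * (ennreal (1 / (real CARD('n) + 1)) * energy_density 1 v)" by simp
  also have "\<dots> = energy_density 1 v" by (simp add: mult.assoc[symmetric] ennreal_mult[symmetric] del: ennreal_plus)
  finally have "energy_density 1 v = ennreal (real CARD('n) + 1) * (ennreal (?I (Re_vec v)) + ennreal (?I (\<chi> j. Im (v $ j))))" ..
  also have "\<dots> = ennreal (zonoid_norm (Re_vec v)) + ennreal (zonoid_norm (\<chi> j. Im (v $ j)))"
    unfolding zonoid_norm_eq by (simp add: distrib_left ennreal_mult del: ennreal_plus)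
  finally show ?thesis .
qed

text \<open>\<open>K\<close> contains a ball on which \<open>\<bar>w \<bullet> k\<bar>\<close> is bounded below. This makes the supremum in the dual norm a
  supremum of a bounded set.\<close>

lemma zonoid_norm_ge: obtains c where "0 < c" "\<And>w. c * norm w \<le> zonoid_norm w"
proof -
  obtain C where C: "0 < C" "\<And>x. G x \<le> C * norm x" using G_le by metis
  define r where "r = 1 / C"
  have r: "0 < r" and Cr: "C * r = 1" unfolding r_def using C by auto
  define c where "c = r / 4 * measure lborel (ball (0::real^'n) (r / 4))"
  have mpos: "0 < measure lborel (ball (0::real^'n) (r / 4))"
    using content_ball_pos[of "r / 4" "0::real^'n"] r by simp
  have "c * norm w \<le> zonoid_norm w" for w
  proof (cases "w = 0")
    case False
    define e where "e = w /\<^sub>R norm w"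
    have e: "norm e = 1" "w = norm w *\<^sub>R e" using False by (auto simp: e_def)
    let ?B = "ball ((r / 2) *\<^sub>R e) (r / 4)"
    have in_B: "k \<in> K \<and> norm w * (r / 4) \<le> \<bar>w \<bullet> k\<bar>" if "k \<in> ?B" for k
    proof
      have d: "norm (k - (r / 2) *\<^sub>R e) \<le> r / 4" using that by (simp add: dist_norm norm_minus_commute)
      have "norm k \<le> norm ((r / 2) *\<^sub>R e) + norm (k - (r / 2) *\<^sub>R e)" using norm_triangle_ineq[of "(r / 2) *\<^sub>R e" "k - (r / 2) *\<^sub>R e"] by simp
      also have "\<dots> \<le> r" using d e r by simp
      finally have "C * norm k \<le> C * r" using C by (intro mult_left_mono) auto
      then have "G k \<le> 1" using C(2)[of k] Cr by simp
      then show "k \<in> K" by (simp add: mem_K)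
      have "e \<bullet> k = r / 2 + e \<bullet> (k - (r / 2) *\<^sub>R e)" using e by (simp add: inner_diff_right dot_square_norm)
      moreover have "\<bar>e \<bullet> (k - (r / 2) *\<^sub>R e)\<bar> \<le> r / 4"
        using Cauchy_Schwarz_ineq2[of e "k - (r / 2) *\<^sub>R e"] d e by simp
      ultimately have "r / 4 \<le> e \<bullet> k" by linarith
      then have "norm w * (r / 4) \<le> norm w * (e \<bullet> k)" by (intro mult_left_mono) auto
      also have "\<dots> = w \<bullet> k" by (subst e(2)) simp
      finally show "norm w * (r / 4) \<le> \<bar>w \<bullet> k\<bar>" by linarith
    qed
    have "(\<integral>k. indicator ?B k * (norm w * (r / 4)) \<partial>lborel) \<le> (\<integral>k. indicator K k *\<^sub>R \<bar>w \<bullet> k\<bar> \<partial>lborel)"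
    proof (rule integral_mono[OF _ inner_K_integrable])
      have "emeasure lborel ?B < \<infinity>" using emeasure_lborel_ball_finite[of "(r / 2) *\<^sub>R e" "r / 4"] by simp
      then show "integrable lborel (\<lambda>k. indicator ?B k * (norm w * (r / 4)))"
        by (intro integrable_mult_left integrable_real_indicator) auto
      fix k
      show "indicator ?B k * (norm w * (r / 4)) \<le> indicator K k *\<^sub>R \<bar>w \<bullet> k\<bar>"
      proof (cases "k \<in> ?B")
        case True
        then have "k \<in> K" "norm w * (r / 4) \<le> \<bar>w \<bullet> k\<bar>" using in_B by auto
        then show ?thesis using True by simp
      qed simp
    qed
    also have "(\<integral>k. indicator ?B k * (norm w * (r / 4)) \<partial>lborel) = c * norm w"
    proof -
      have "measure lborel ?B = measure lborel (ball (0::real^'n) (r / 4))"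
        using r by (simp add: content_ball_conv_unit_ball[of "r / 4"])
      then show ?thesis by (simp add: c_def)
    qed
    finally have "c * norm w \<le> (\<integral>k. indicator K k *\<^sub>R \<bar>w \<bullet> k\<bar> \<partial>lborel)" .
    also have "\<dots> \<le> zonoid_norm w"
    proof -
      have "0 \<le> (\<integral>k. indicator K k *\<^sub>R \<bar>w \<bullet> k\<bar> \<partial>lborel)" by (intro integral_nonneg_AE) auto
      then have "1 * (\<integral>k. indicator K k *\<^sub>R \<bar>w \<bullet> k\<bar> \<partial>lborel) \<le> zonoid_norm w"
        unfolding zonoid_norm_eq by (intro mult_right_mono) auto
      then show ?thesis by simp
    qed
    finally show ?thesis .
  qed simp
  moreover have "0 < c" unfolding c_def using mpos r by simp
  ultimately show thesis using that by blast
qed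

lemma bv_test_inner_le:
  assumes "\<psi> \<in> bv_tests K" shows "\<psi> x \<bullet> w \<le> zonoid_norm w"
proof (cases "w = 0")
  case False
  obtain c where c: "0 < c" "\<And>w. c * norm w \<le> zonoid_norm w" using zonoid_norm_ge by metis
  have np: "0 < zonoid_norm w" using c(1) c(2)[of w] False by (meson mult_pos_pos order_less_le_trans zero_less_norm_iff)
  have bdd: "bdd_above ((\<bullet>) (\<psi> x) ` {w. zstar_norm 1 K (cvec w) \<le> 1})"
  proof (rule bdd_aboveI2)
    fix w assume "w \<in> {w. zstar_norm 1 K (cvec w) \<le> 1}"
    then have "c * norm w \<le> 1" using c(2)[of w] by (simp add: zonoid_norm_def)
    then have "norm w \<le> 1 / c" using c(1) by (simp add: field_simps)
    then show "\<psi> x \<bullet> w \<le> norm (\<psi> x) * (1 / c)"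
      using norm_cauchy_schwarz[of "\<psi> x" w] mult_left_mono[of "norm w" "1 / c" "norm (\<psi> x)"] by simp
  qed
  have "zonoid_norm ((1 / zonoid_norm w) *\<^sub>R w) = 1" using np by (simp add: zonoid_norm_scaleR)
  then have "\<psi> x \<bullet> ((1 / zonoid_norm w) *\<^sub>R w) \<le> zstar1_dual_norm K (\<psi> x)"
    unfolding zstar1_dual_norm_def by (intro cSUP_upper bdd) (simp add: zonoid_norm_def)
  also have "\<dots> \<le> 1" using assms by (simp add: bv_tests_def)
  finally show ?thesis using np by (simp add: field_simps)
qed simp

lemma bv_testI:
  assumes "Ck 1 \<psi>" "has_compact_support \<psi>" "\<And>x w. zonoid_norm w \<le> 1 \<Longrightarrow> \<psi> x \<bullet> w \<le> 1"
  shows "\<psi> \<in> bv_tests K"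
proof -
  have "zonoid_norm 0 = 0" using zonoid_norm_scaleR[of 0 0] by simp
  then have "(0::real^'n) \<in> {w. zstar_norm 1 K (cvec w) \<le> 1}" by (simp add: zonoid_norm_def)
  then have "zstar1_dual_norm K (\<psi> x) \<le> 1" for x
    unfolding zstar1_dual_norm_def using assms(3) by (intro cSUP_least) (auto simp: zonoid_norm_def)
  then show ?thesis using assms by (simp add: bv_tests_def)
qed

end

section \<open>Test fields and mollification\<close>

lemma has_compact_support_iff: "has_compact_support f \<longleftrightarrow> bounded {x. f x \<noteq> 0}"
  unfolding has_compact_support_def compact_eq_bounded_closed
  by (metis bounded_closure bounded_subset closed_closure closure_subset)

lemma has_compact_support_radius:
  assumes "has_compact_support f"
  obtains R where "0 < R" "\<And>x. R \<le> norm x \<Longrightarrow> f x = 0"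
proof -
  obtain a where a: "\<And>x. f x \<noteq> 0 \<Longrightarrow> norm x \<le> a"
    using assms unfolding has_compact_support_iff bounded_iff by blast
  have "f x = 0" if "\<bar>a\<bar> + 1 \<le> norm x" for x using a[of x] that by force
  then show thesis by (intro that[of "\<bar>a\<bar> + 1"]) auto
qed

lemma integrable_mult_bounded:
  fixes f h :: "'a \<Rightarrow> real"
  assumes f: "integrable M f" and [measurable]: "h \<in> borel_measurable M" and h: "\<And>x. \<bar>h x\<bar> \<le> C"
  shows "integrable M (\<lambda>x. f x * h x)"
proof (rule Bochner_Integration.integrable_bound)
  note [measurable] = borel_measurable_integrable[OF f]
  show "integrable M (\<lambda>x. C * norm (f x))" using f by (intro integrable_mult_right integrable_norm)
  show "(\<lambda>x. f x * h x) \<in> borel_measurable M" by measurable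
  have "norm (f x * h x) \<le> norm (C * norm (f x))" for x
    using h[of x] mult_right_mono[OF h[of x], of "\<bar>f x\<bar>"] by (simp add: abs_mult mult.commute)
  then show "AE x in M. norm (f x * h x) \<le> norm (C * norm (f x))" by simp
qed

lemma divergence_eq_sum:
  fixes \<psi> :: "real^'n \<Rightarrow> real^'n"
  assumes "Ck 1 \<psi>" shows "divergence \<psi> x = (\<Sum>j\<in>UNIV. partial j (\<lambda>x. \<psi> x $ j) x)"
  unfolding divergence_def using Ck1_component(2)[OF assms] by simp

lemma kernel_within_component:
  fixes \<psi> :: "real^'n \<Rightarrow> real^'n"
  assumes "Ck 1 \<psi>" "\<And>x. R \<le> norm x \<Longrightarrow> \<psi> x = 0"
  shows "kernel_within (\<lambda>x. \<psi> x $ j) R"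
  unfolding kernel_within_def using assms Ck_continuous[OF Ck1_component(1)[OF assms(1)]] by auto

lemma kernel_within_divergence:
  fixes \<psi> :: "real^'n \<Rightarrow> real^'n"
  assumes "Ck 1 \<psi>" "\<And>x. R \<le> norm x \<Longrightarrow> \<psi> x = 0"
  shows "kernel_within (divergence \<psi>) (R + 1)"
proof -
  note k = kernel_within_partial[OF kernel_within_component[OF assms] Ck1_component(1)[OF assms(1)]]
  have "divergence \<psi> = (\<lambda>x. \<Sum>j\<in>UNIV. partial j (\<lambda>x. \<psi> x $ j) x)"
    using divergence_eq_sum[OF assms(1)] by auto
  then show ?thesis using k unfolding kernel_within_def by (auto intro!: continuous_on_sum)
qed

lemma conv_minus_kernel: "conv (\<lambda>z. - \<kappa> z) f x = - conv \<kappa> f x"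
  unfolding conv_def by simp

lemma conv_vanishes:
  assumes k: "kernel_within \<eta> \<epsilon>" and "\<And>x. dist x y < \<epsilon> \<Longrightarrow> f x = 0"
  shows "conv \<eta> f y = 0"
proof -
  have z: "\<eta> (y - x) *\<^sub>R f x = 0" for x
    using k assms(2)[of x] unfolding kernel_within_def dist_norm
    by (cases "norm (x - y) < \<epsilon>") (auto simp: norm_minus_commute)
  show ?thesis unfolding conv_def z by simp
qed

lemma conv_const_bound:
  assumes m: "mollifier \<eta> \<epsilon>" shows "(\<integral>x. \<eta> (y - x) \<partial>lborel) = 1" "integrable lborel (\<lambda>x. \<eta> (y - x))"
proof -
  note [measurable] = mollifier_measurable[OF m]
  show "(\<integral>x. \<eta> (y - x) \<partial>lborel) = 1" using integral_reflect[of \<eta> y] mollifier_integral(2)[OF m] by simp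
  show "integrable lborel (\<lambda>x. \<eta> (y - x))" using integrable_reflect[of \<eta> y] mollifier_integral(1)[OF m] by simp
qed

lemma conv_integrable_L1:
  assumes m: "mollifier \<eta> \<epsilon>" and u: "integrable lborel u"
  shows "integrable lborel (conv \<eta> u)"
proof (rule integrableI_bounded)
  note lu = integrable_imp_locint[OF u]
  show "conv \<eta> u \<in> borel_measurable lborel" using conv_measurable[OF mollifier_kernel_within[OF m] lu] by simp
  have "(\<integral>\<^sup>+x. ennreal (norm (conv \<eta> u x)) \<partial>lborel) \<le> (\<integral>\<^sup>+x. ennreal (norm (u x)) \<partial>lborel)"
    using mollify_L1_le[OF m lu, of UNIV UNIV] by simp
  also have "\<dots> < \<infinity>" using u unfolding integrable_iff_bounded by simp
  finally show "(\<integral>\<^sup>+x. ennreal (norm (conv \<eta> u x)) \<partial>lborel) < \<infinity>" .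
qed

context magnetic1 begin

text \<open>The integral in the first supremum of the magnetic variation. The second supremum is the first for the
  function \<open>-\<i> u\<close>.\<close>

definition bv_pairing :: "(real^'n \<Rightarrow> complex) \<Rightarrow> (real^'n \<Rightarrow> real^'n) \<Rightarrow> real" where
  "bv_pairing u \<psi> = (\<integral>x. Re (u x) * divergence \<psi> x - (A x \<bullet> \<psi> x) * Im (u x) \<partial>lborel)"

text \<open>This is \<open>\<nabla>(Re u\<^sub>m) + A Im u\<^sub>m\<close> for the mollification \<open>u\<^sub>m\<close> of \<open>u\<close>.\<close>

definition re_gradient :: "(real^'n \<Rightarrow> real) \<Rightarrow> (real^'n \<Rightarrow> complex) \<Rightarrow> real^'n \<Rightarrow> real^'n" where
  "re_gradient \<eta> u x = Re_vec (mollified_gradient \<eta> u x)"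

lemma kernel_within_inner_A:
  assumes "Ck 1 \<psi>" "\<And>x. R \<le> norm x \<Longrightarrow> \<psi> x = 0"
  shows "kernel_within (\<lambda>x. A x \<bullet> \<psi> x) R"
  unfolding kernel_within_def using assms Ck_continuous[OF assms(1)] by (auto intro!: continuous_intros continuous_A)

lemma bv_pairing_integrable:
  assumes u: "integrable lborel u" and \<psi>: "Ck 1 \<psi>" "has_compact_support \<psi>"
  shows "integrable lborel (\<lambda>x. Re (u x) * divergence \<psi> x)" "integrable lborel (\<lambda>x. (A x \<bullet> \<psi> x) * Im (u x))"
proof -
  obtain R where R: "0 < R" "\<And>x. R \<le> norm x \<Longrightarrow> \<psi> x = 0" using has_compact_support_radius[OF \<psi>(2)] by metis
  note kd = kernel_within_divergence[OF \<psi>(1) R(2)] and ka = kernel_within_inner_A[OF \<psi>(1) R(2)]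
  obtain C where "\<And>z. \<bar>divergence \<psi> z\<bar> \<le> C" using kernel_within_bounded[OF kd] by metis
  then show "integrable lborel (\<lambda>x. Re (u x) * divergence \<psi> x)"
    using u kernel_within_measurable[OF kd] by (intro integrable_mult_bounded[where C = C]) auto
  obtain C where "\<And>z. \<bar>A z \<bullet> \<psi> z\<bar> \<le> C" using kernel_within_bounded[OF ka] by metis
  then show "integrable lborel (\<lambda>x. (A x \<bullet> \<psi> x) * Im (u x))"
    using u kernel_within_measurable[OF ka] by (subst mult.commute, intro integrable_mult_bounded[where C = C]) auto
qed

lemma bv_pairing_add:
  assumes u: "integrable lborel u" and f: "Ck 1 f" "has_compact_support f" and g: "Ck 1 g" "has_compact_support g"
  shows "bv_pairing u (\<lambda>x. f x + g x) = bv_pairing u f + bv_pairing u g" "Ck 1 (\<lambda>x. f x + g x)" "has_compact_support (\<lambda>x. f x + g x)"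
proof -
  have d: "((\<lambda>x. f x + g x) has_derivative (\<lambda>h. frechet_derivative f (at x) h + frechet_derivative g (at x) h)) (at x)" for x
    using f(1) g(1) by (intro has_derivative_add) (auto simp: frechet_derivative_works[symmetric])
  have p: "partial j (\<lambda>x. f x + g x) x = partial j f x + partial j g x" for j x
    using partial_eqI[OF d] by (simp add: partial_def)
  have "partial j (\<lambda>x. f x + g x) = (\<lambda>x. partial j f x + partial j g x)" for j using p by auto
  moreover have "(\<lambda>x. f x + g x) differentiable (at x)" for x using d by (auto simp: differentiable_def)
  ultimately show "Ck 1 (\<lambda>x. f x + g x)" using f(1) g(1) by (auto intro!: continuous_intros)
  have "{x. f x + g x \<noteq> 0} \<subseteq> {x. f x \<noteq> 0} \<union> {x. g x \<noteq> 0}" by auto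
  then show "has_compact_support (\<lambda>x. f x + g x)"
    using f(2) g(2) unfolding has_compact_support_iff by (meson bounded_Un bounded_subset)
  have dv: "divergence (\<lambda>x. f x + g x) x = divergence f x + divergence g x" for x
    by (simp add: divergence_def p sum.distrib)
  have "bv_pairing u (\<lambda>x. f x + g x) = (\<integral>x. (Re (u x) * divergence f x - (A x \<bullet> f x) * Im (u x)) + (Re (u x) * divergence g x - (A x \<bullet> g x) * Im (u x)) \<partial>lborel)"
    unfolding bv_pairing_def dv by (intro Bochner_Integration.integral_cong refl) (simp add: inner_add_right algebra_simps)
  also have "\<dots> = bv_pairing u f + bv_pairing u g"
    unfolding bv_pairing_def using bv_pairing_integrable[OF u f] bv_pairing_integrable[OF u g]
    by (intro Bochner_Integration.integral_add Bochner_Integration.integrable_diff)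
  finally show "bv_pairing u (\<lambda>x. f x + g x) = bv_pairing u f + bv_pairing u g" .
qed

lemma inner_re_gradient:
  assumes m: "mollifier \<eta> \<epsilon>" and u: "locint u"
  shows "v \<bullet> re_gradient \<eta> u x = (\<Sum>j\<in>UNIV. v $ j * conv (partial j \<eta>) (\<lambda>y. Re (u y)) x) + (A x \<bullet> v) * conv \<eta> (\<lambda>y. Im (u y)) x"
proof -
  note k = mollifier_kernel_within[OF m]
  have "re_gradient \<eta> u x $ j = conv (partial j \<eta>) (\<lambda>y. Re (u y)) x + A x $ j * conv \<eta> (\<lambda>y. Im (u y)) x" for j
    unfolding re_gradient_def Re_vec_def mollified_gradient_def magnetic_gradient_def conv_gradient_def
    by (simp add: conv_Re[OF kernel_within_partial[OF k mollifier_C1[OF m]] u] conv_Im[OF k u])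
  then show ?thesis
    by (simp add: inner_vec_def distrib_left sum.distrib sum_distrib_left sum_distrib_right mult_ac)
qed

context
  fixes \<eta> :: "real^'n \<Rightarrow> real" and \<epsilon> :: real and u :: "real^'n \<Rightarrow> complex"
  assumes m: "mollifier \<eta> \<epsilon>" and u: "integrable lborel u"
begin

lemma conv_odd: "conv (\<lambda>z. partial j \<eta> (- z)) f y = - conv (partial j \<eta>) f y"
proof -
  have "\<eta> (- z) = \<eta> z" for z using m by (auto simp: mollifier_def)
  from partial_odd[OF mollifier_C1[OF m] this] have "(\<lambda>z. partial j \<eta> (- z)) = (\<lambda>z. - partial j \<eta> z)" by auto
  then show ?thesis by (simp add: conv_minus_kernel)
qed

text \<open>The mollifier is moved from \<open>u\<close> to the field, both in the gradient, where the oddness of its partial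
  derivatives produces the sign, and in the term with the potential.\<close>

lemma weak_identity:
  fixes \<phi> :: "real^'n \<Rightarrow> real^'n"
  assumes [measurable]: "\<phi> \<in> borel_measurable borel" and bd: "\<And>x. norm (\<phi> x) \<le> C" and sup: "\<And>x. R < norm x \<Longrightarrow> \<phi> x = 0"
  shows "(\<integral>x. \<phi> x \<bullet> re_gradient \<eta> u x \<partial>lborel) = - (\<integral>y. Re (u y) * (\<Sum>j\<in>UNIV. conv (partial j \<eta>) (\<lambda>x. \<phi> x $ j) y) \<partial>lborel)
      + (\<integral>y. Im (u y) * conv \<eta> (\<lambda>x. A x \<bullet> \<phi> x) y \<partial>lborel)"
    and "integrable lborel (\<lambda>x. \<phi> x \<bullet> re_gradient \<eta> u x)"
    and "integrable lborel (\<lambda>y. Re (u y) * (\<Sum>j\<in>UNIV. conv (partial j \<eta>) (\<lambda>x. \<phi> x $ j) y))"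
    and "integrable lborel (\<lambda>y. Im (u y) * conv \<eta> (\<lambda>x. A x \<bullet> \<phi> x) y)"
proof -
  note k = mollifier_kernel_within[OF m] and lu = integrable_imp_locint[OF u]
  note kp = kernel_within_partial[OF k mollifier_C1[OF m]]
  have ev: "(\<lambda>z. \<eta> (- z)) = \<eta>" using m by (auto simp: mollifier_def)
  have iRe: "integrable lborel (\<lambda>y. Re (u y))" and iIm: "integrable lborel (\<lambda>y. Im (u y))" using u by auto
  have fj: "\<bar>\<phi> x $ j\<bar> \<le> C" for x j using component_le_norm_cart[of "\<phi> x" j] bd[of x] by linarith
  have fj0: "\<phi> x $ j = 0" if "R < norm x" for x j using sup[OF that] by simp
  have mj: "(\<lambda>x. \<phi> x $ j) \<in> borel_measurable borel" for j by measurable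
  note S = conv_swap[OF kp mj fj fj0 iRe]
  obtain B where B: "0 \<le> B" "\<And>y. norm y \<le> R \<Longrightarrow> norm (A y) \<le> B" using A_bounded_on_cball by blast
  have C0: "0 \<le> C" using bd[of 0] norm_ge_zero[of "\<phi> 0"] by linarith
  have a: "\<bar>A x \<bullet> \<phi> x\<bar> \<le> B * C" for x
  proof (cases "norm x \<le> R")
    case True
    have "\<bar>A x \<bullet> \<phi> x\<bar> \<le> norm (A x) * norm (\<phi> x)" by (rule Cauchy_Schwarz_ineq2)
    also have "\<dots> \<le> B * C" using B(2)[OF True] bd B(1) by (intro mult_mono) auto
    finally show ?thesis .
  next
    case False then show ?thesis using sup[of x] B(1) C0 by simp
  qed
  have a0: "A x \<bullet> \<phi> x = 0" if "R < norm x" for x using sup[OF that] by simp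
  have ma: "(\<lambda>x. A x \<bullet> \<phi> x) \<in> borel_measurable borel" by measurable
  note T = conv_swap[OF k ma a a0 iIm, unfolded ev]
  have iw: "\<phi> x \<bullet> re_gradient \<eta> u x = (\<Sum>j\<in>UNIV. \<phi> x $ j * conv (partial j \<eta>) (\<lambda>y. Re (u y)) x) + (A x \<bullet> \<phi> x) * conv \<eta> (\<lambda>y. Im (u y)) x" for x
    by (rule inner_re_gradient[OF m lu])
  show i1: "integrable lborel (\<lambda>x. \<phi> x \<bullet> re_gradient \<eta> u x)" unfolding iw
    by (intro Bochner_Integration.integrable_add Bochner_Integration.integrable_sum S(2) T(2))
  have eqs: "Re (u y) * (\<Sum>j\<in>UNIV. conv (partial j \<eta>) (\<lambda>x. \<phi> x $ j) y) = - (\<Sum>j\<in>UNIV. Re (u y) * conv (\<lambda>z. partial j \<eta> (- z)) (\<lambda>x. \<phi> x $ j) y)" for y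
    by (simp add: conv_odd sum_distrib_left sum_negf)
  show i2: "integrable lborel (\<lambda>y. Re (u y) * (\<Sum>j\<in>UNIV. conv (partial j \<eta>) (\<lambda>x. \<phi> x $ j) y))"
    unfolding eqs by (intro Bochner_Integration.integrable_minus Bochner_Integration.integrable_sum S(3))
  show "integrable lborel (\<lambda>y. Im (u y) * conv \<eta> (\<lambda>x. A x \<bullet> \<phi> x) y)" by (rule T(3))
  have "(\<integral>x. \<phi> x \<bullet> re_gradient \<eta> u x \<partial>lborel) = (\<Sum>j\<in>UNIV. \<integral>x. \<phi> x $ j * conv (partial j \<eta>) (\<lambda>y. Re (u y)) x \<partial>lborel)
      + (\<integral>x. (A x \<bullet> \<phi> x) * conv \<eta> (\<lambda>y. Im (u y)) x \<partial>lborel)"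
    unfolding iw using S(2) T(2) by (subst Bochner_Integration.integral_add) (auto simp: Bochner_Integration.integral_sum)
  also have "\<dots> = (\<Sum>j\<in>UNIV. \<integral>y. Re (u y) * conv (\<lambda>z. partial j \<eta> (- z)) (\<lambda>x. \<phi> x $ j) y \<partial>lborel)
      + (\<integral>y. Im (u y) * conv \<eta> (\<lambda>x. A x \<bullet> \<phi> x) y \<partial>lborel)"
    by (simp only: S(1) T(1))
  also have "(\<Sum>j\<in>UNIV. \<integral>y. Re (u y) * conv (\<lambda>z. partial j \<eta> (- z)) (\<lambda>x. \<phi> x $ j) y \<partial>lborel)
      = (\<integral>y. (\<Sum>j\<in>UNIV. Re (u y) * conv (\<lambda>z. partial j \<eta> (- z)) (\<lambda>x. \<phi> x $ j) y) \<partial>lborel)"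
    by (intro Bochner_Integration.integral_sum[symmetric] S(3))
  also have "\<dots> = - (\<integral>y. Re (u y) * (\<Sum>j\<in>UNIV. conv (partial j \<eta>) (\<lambda>x. \<phi> x $ j) y) \<partial>lborel)"
    unfolding eqs by simp
  finally show "(\<integral>x. \<phi> x \<bullet> re_gradient \<eta> u x \<partial>lborel) = - (\<integral>y. Re (u y) * (\<Sum>j\<in>UNIV. conv (partial j \<eta>) (\<lambda>x. \<phi> x $ j) y) \<partial>lborel)
      + (\<integral>y. Im (u y) * conv \<eta> (\<lambda>x. A x \<bullet> \<phi> x) y \<partial>lborel)" .
qed

text \<open>Pairing \<open>u\<close> with the mollified field is the same as pairing the gradient of the mollified function
  with the field, except that the potential is evaluated at the wrong point. The Lipschitz bound makes
  this error proportional to \<open>\<epsilon> \<parallel>u\<parallel>\<^sub>1\<close>, even though \<open>A\<close> may be unbounded.\<close>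

lemma mollified_test_identity:
  fixes \<phi> :: "real^'n \<Rightarrow> real^'n"
  assumes \<phi>[measurable]: "\<phi> \<in> borel_measurable borel" and bd: "\<And>x. norm (\<phi> x) \<le> C" and sup: "\<And>x. R < norm x \<Longrightarrow> \<phi> x = 0"
  shows "\<bar>bv_pairing u (conv \<eta> \<phi>) + (\<integral>x. \<phi> x \<bullet> re_gradient \<eta> u x \<partial>lborel)\<bar> \<le> C * L * \<epsilon> * (\<integral>x. norm (u x) \<partial>lborel)"
proof -
  note k = mollifier_kernel_within[OF m] and C1 = mollifier_C1[OF m]
  note W = weak_identity[OF \<phi> bd sup]
  have i\<phi>: "integrable lborel \<phi>" by (rule bounded_support_integrable[of \<phi> C R]) (use bd sup in auto)
  note l\<phi> = integrable_imp_locint[OF i\<phi>]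
  have C0: "0 \<le> C" using bd[of 0] norm_ge_zero[of "\<phi> 0"] by linarith
  have e: "0 < \<epsilon>" using m by (simp add: mollifier_def)
  have dv: "divergence (conv \<eta> \<phi>) y = (\<Sum>j\<in>UNIV. conv (partial j \<eta>) (\<lambda>x. \<phi> x $ j) y)" for y
    unfolding divergence_def partial_conv[OF k C1 l\<phi>] by (simp add: conv_component[OF kernel_within_partial[OF k C1] l\<phi>])
  have la: "locint (\<lambda>x. A x \<bullet> \<phi> x)"
  proof -
    obtain B where B: "0 \<le> B" "\<And>y. norm y \<le> R \<Longrightarrow> norm (A y) \<le> B" using A_bounded_on_cball by blast
    have "norm (A x \<bullet> \<phi> x) \<le> B * C" for x
    proof (cases "norm x \<le> R")
      case True
      have "\<bar>A x \<bullet> \<phi> x\<bar> \<le> norm (A x) * norm (\<phi> x)" by (rule Cauchy_Schwarz_ineq2)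
      also have "\<dots> \<le> B * C" using B(2)[OF True] bd B(1) by (intro mult_mono) auto
      finally show ?thesis by simp
    next
      case False then show ?thesis using sup[of x] B(1) C0 by simp
    qed
    then show ?thesis using sup by (intro integrable_imp_locint bounded_support_integrable[of _ "B * C" R]) auto
  qed
  \<comment> \<open>the commutator of the mollifier with the potential\<close>
  define q where "q y = conv \<eta> (\<lambda>x. A x \<bullet> \<phi> x) y - A y \<bullet> conv \<eta> \<phi> y" for y
  have qb: "\<bar>q y\<bar> \<le> C * L * \<epsilon>" for y
  proof -
    have in1: "integrable lborel (\<lambda>x. A y \<bullet> (\<eta> (y - x) *\<^sub>R \<phi> x))"
      by (rule integrable_bounded_linear[OF bounded_linear_inner_right conv_integrable[OF k l\<phi>]])
    have "A y \<bullet> conv \<eta> \<phi> y = (\<integral>x. A y \<bullet> (\<eta> (y - x) *\<^sub>R \<phi> x) \<partial>lborel)"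
      unfolding conv_def by (rule integral_bounded_linear[OF bounded_linear_inner_right conv_integrable[OF k l\<phi>], symmetric])
    then have "q y = (\<integral>x. \<eta> (y - x) *\<^sub>R (A x \<bullet> \<phi> x) - A y \<bullet> (\<eta> (y - x) *\<^sub>R \<phi> x) \<partial>lborel)"
      unfolding q_def using conv_integrable[OF k la, of y] in1
      by (subst Bochner_Integration.integral_diff) (auto simp: conv_def)
    moreover have "norm (\<integral>x. \<eta> (y - x) *\<^sub>R (A x \<bullet> \<phi> x) - A y \<bullet> (\<eta> (y - x) *\<^sub>R \<phi> x) \<partial>lborel) \<le> (\<integral>x. \<eta> (y - x) * (C * L * \<epsilon>) \<partial>lborel)"
    proof (rule norm_integral_le)
      show "integrable lborel (\<lambda>x. \<eta> (y - x) *\<^sub>R (A x \<bullet> \<phi> x) - A y \<bullet> (\<eta> (y - x) *\<^sub>R \<phi> x))"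
        using conv_integrable[OF k la, of y] in1 by (rule Bochner_Integration.integrable_diff)
      show "integrable lborel (\<lambda>x. \<eta> (y - x) * (C * L * \<epsilon>))" using conv_const_bound(2)[OF m] by (rule integrable_mult_left)
      fix x
      have eq: "\<eta> (y - x) *\<^sub>R (A x \<bullet> \<phi> x) - A y \<bullet> (\<eta> (y - x) *\<^sub>R \<phi> x) = \<eta> (y - x) * ((A x - A y) \<bullet> \<phi> x)"
        by (simp add: inner_diff_left algebra_simps)
      show "norm (\<eta> (y - x) *\<^sub>R (A x \<bullet> \<phi> x) - A y \<bullet> (\<eta> (y - x) *\<^sub>R \<phi> x)) \<le> \<eta> (y - x) * (C * L * \<epsilon>)"
      proof (cases "norm (y - x) < \<epsilon>")
        case True
        have "\<bar>(A x - A y) \<bullet> \<phi> x\<bar> \<le> norm (A x - A y) * norm (\<phi> x)" by (rule Cauchy_Schwarz_ineq2)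
        also have "\<dots> \<le> (L * \<epsilon>) * C"
        proof (intro mult_mono bd)
          show "norm (A x - A y) \<le> L * \<epsilon>"
            using A_diff_le[of x y] mult_left_mono[of "norm (x - y)" \<epsilon> L] L_nonneg True by (simp add: norm_minus_commute)
        qed (use L_nonneg e in auto)
        finally have "\<bar>(A x - A y) \<bullet> \<phi> x\<bar> \<le> C * L * \<epsilon>" by (simp add: mult_ac)
        then show ?thesis unfolding eq using mollifier_nonneg[OF m] by (simp add: abs_mult mult_left_mono)
      next
        case False
        then have "\<eta> (y - x) = 0" using k by (simp add: kernel_within_def)
        then show ?thesis by simp
      qed
    qed
    moreover have "(\<integral>x. \<eta> (y - x) * (C * L * \<epsilon>) \<partial>lborel) = C * L * \<epsilon>" using conv_const_bound[OF m, of y] by simp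
    ultimately show ?thesis by (metis real_norm_def)
  qed
  have qm [measurable]: "q \<in> borel_measurable borel" unfolding q_def
    using conv_measurable[OF k la] conv_measurable[OF k l\<phi>] by measurable
  have iq: "integrable lborel (\<lambda>y. Im (u y) * q y)" by (rule integrable_mult_bounded[OF _ _ qb]) (use u in auto)
  have iA: "integrable lborel (\<lambda>y. Im (u y) * (A y \<bullet> conv \<eta> \<phi> y))"
  proof -
    have "Im (u y) * (A y \<bullet> conv \<eta> \<phi> y) = Im (u y) * conv \<eta> (\<lambda>x. A x \<bullet> \<phi> x) y - Im (u y) * q y" for y
      by (simp add: q_def algebra_simps)
    then show ?thesis using Bochner_Integration.integrable_diff[OF W(4) iq] by simp
  qed
  have "bv_pairing u (conv \<eta> \<phi>) = (\<integral>y. Re (u y) * (\<Sum>j\<in>UNIV. conv (partial j \<eta>) (\<lambda>x. \<phi> x $ j) y) \<partial>lborel) - (\<integral>y. Im (u y) * (A y \<bullet> conv \<eta> \<phi> y) \<partial>lborel)"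
    unfolding bv_pairing_def dv using W(3) iA by (subst Bochner_Integration.integral_diff[symmetric]) (auto simp: mult.commute)
  also have "(\<integral>y. Im (u y) * (A y \<bullet> conv \<eta> \<phi> y) \<partial>lborel) = (\<integral>y. Im (u y) * conv \<eta> (\<lambda>x. A x \<bullet> \<phi> x) y \<partial>lborel) - (\<integral>y. Im (u y) * q y \<partial>lborel)"
    using W(4) iq by (subst Bochner_Integration.integral_diff[symmetric]) (auto simp: q_def algebra_simps)
  finally have "bv_pairing u (conv \<eta> \<phi>) + (\<integral>x. \<phi> x \<bullet> re_gradient \<eta> u x \<partial>lborel) = (\<integral>y. Im (u y) * q y \<partial>lborel)"
  proof -
    have w: "(\<integral>x. \<phi> x \<bullet> re_gradient \<eta> u x \<partial>lborel) = - (\<integral>y. Re (u y) * (\<Sum>j\<in>UNIV. conv (partial j \<eta>) (\<lambda>x. \<phi> x $ j) y) \<partial>lborel)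
      + (\<integral>y. Im (u y) * conv \<eta> (\<lambda>x. A x \<bullet> \<phi> x) y \<partial>lborel)" by (rule W(1))
    show "bv_pairing u (conv \<eta> \<phi>) + (\<integral>x. \<phi> x \<bullet> re_gradient \<eta> u x \<partial>lborel) = (\<integral>y. Im (u y) * q y \<partial>lborel)"
      if "bv_pairing u (conv \<eta> \<phi>) = (\<integral>y. Re (u y) * (\<Sum>j\<in>UNIV. conv (partial j \<eta>) (\<lambda>x. \<phi> x $ j) y) \<partial>lborel) - ((\<integral>y. Im (u y) * conv \<eta> (\<lambda>x. A x \<bullet> \<phi> x) y \<partial>lborel) - (\<integral>y. Im (u y) * q y \<partial>lborel))"
      using w that by linarith
  qed
  also have "\<bar>\<dots>\<bar> \<le> (\<integral>y. C * L * \<epsilon> * norm (u y) \<partial>lborel)"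
    unfolding real_norm_def[symmetric]
  proof (rule norm_integral_le[OF iq])
    show "integrable lborel (\<lambda>y. C * L * \<epsilon> * norm (u y))" using u by (intro integrable_mult_right integrable_norm)
    fix y
    have "\<bar>Im (u y)\<bar> * \<bar>q y\<bar> \<le> norm (u y) * (C * L * \<epsilon>)" using qb[of y] abs_Im_le_cmod[of "u y"] by (intro mult_mono) auto
    then show "norm (Im (u y) * q y) \<le> C * L * \<epsilon> * norm (u y)" by (simp add: abs_mult mult_ac)
  qed
  finally show ?thesis by simp
qed

text \<open>Integration by parts for the mollified function. For it the potential is evaluated at the right point,
  and the identity is exact.\<close>

lemma mollified_function_identity:
  assumes \<psi>: "Ck 1 \<psi>" "has_compact_support \<psi>"
  shows "bv_pairing (conv \<eta> u) \<psi> = - (\<integral>x. \<psi> x \<bullet> re_gradient \<eta> u x \<partial>lborel)" "integrable lborel (\<lambda>x. \<psi> x \<bullet> re_gradient \<eta> u x)"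
proof -
  note k = mollifier_kernel_within[OF m] and C1 = mollifier_C1[OF m] and lu = integrable_imp_locint[OF u]
  obtain R where R: "0 < R" "\<And>x. R \<le> norm x \<Longrightarrow> \<psi> x = 0" using has_compact_support_radius[OF \<psi>(2)] by metis
  note kj = kernel_within_component[OF \<psi>(1) R(2)] and cj = Ck1_component(1)[OF \<psi>(1)]
  note kd = kernel_within_divergence[OF \<psi>(1) R(2)] and ka = kernel_within_inner_A[OF \<psi>(1) R(2)]
  have m\<psi>: "\<psi> \<in> borel_measurable borel" by (rule borel_measurable_continuous_onI[OF Ck_continuous[OF \<psi>(1)]])
  have "bounded (\<psi> ` cball 0 R)"
    by (intro compact_imp_bounded compact_continuous_image continuous_on_subset[OF Ck_continuous[OF \<psi>(1)]]) auto
  then obtain C where "\<forall>y\<in>\<psi> ` cball 0 R. norm y \<le> C" unfolding bounded_iff by blast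
  then have C: "norm (\<psi> x) \<le> C" if "norm x \<le> R" for x using that by auto
  have bd: "norm (\<psi> x) \<le> max C 0" for x using C[of x] R(2)[of x] by (cases "norm x \<le> R") auto
  have sup: "\<psi> x = 0" if "R < norm x" for x using R(2)[of x] that by simp
  note W = weak_identity[OF m\<psi> bd sup]
  show "integrable lborel (\<lambda>x. \<psi> x \<bullet> re_gradient \<eta> u x)" by (rule W(2))
  have ev: "(\<lambda>z. \<eta> (- z)) = \<eta>" using m by (auto simp: mollifier_def)
  have iRe: "integrable lborel (\<lambda>y. Re (u y))" and iIm: "integrable lborel (\<lambda>y. Im (u y))" using u by auto
  obtain Cd where Cd: "\<And>z. \<bar>divergence \<psi> z\<bar> \<le> Cd" using kernel_within_bounded[OF kd] by metis
  obtain Ca where Ca: "\<And>z. \<bar>A z \<bullet> \<psi> z\<bar> \<le> Ca" using kernel_within_bounded[OF ka] by metis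
  have d0: "divergence \<psi> x = 0" if "R + 1 < norm x" for x using kd that by (simp add: kernel_within_def)
  have a0: "A x \<bullet> \<psi> x = 0" if "R < norm x" for x using sup[OF that] by simp
  note S = conv_swap[OF k kernel_within_measurable[OF kd] Cd d0 iRe, unfolded ev]
  note T = conv_swap[OF k kernel_within_measurable[OF ka] Ca a0 iIm, unfolded ev]
  have cd: "conv \<eta> (divergence \<psi>) y = (\<Sum>j\<in>UNIV. conv (partial j \<eta>) (\<lambda>x. \<psi> x $ j) y)" for y
  proof -
    have "conv \<eta> (divergence \<psi>) y = (\<Sum>j\<in>UNIV. conv \<eta> (partial j (\<lambda>x. \<psi> x $ j)) y)"
      unfolding conv_def divergence_eq_sum[OF \<psi>(1)] scaleR_sum_right
      by (intro Bochner_Integration.integral_sum conv_integrable[OF k] kernel_within_locint(1)[OF kernel_within_partial[OF kj cj]])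
    then show ?thesis by (simp add: conv_partial_swap[OF k C1 kj cj])
  qed
  have "bv_pairing (conv \<eta> u) \<psi> = (\<integral>x. divergence \<psi> x * conv \<eta> (\<lambda>y. Re (u y)) x \<partial>lborel) - (\<integral>x. (A x \<bullet> \<psi> x) * conv \<eta> (\<lambda>y. Im (u y)) x \<partial>lborel)"
    unfolding bv_pairing_def conv_Re[OF k lu] conv_Im[OF k lu] using S(2) T(2)
    by (subst Bochner_Integration.integral_diff[symmetric]) (auto simp: mult.commute)
  also have "\<dots> = - (\<integral>x. \<psi> x \<bullet> re_gradient \<eta> u x \<partial>lborel)"
  proof -
    have s: "(\<integral>x. divergence \<psi> x * conv \<eta> (\<lambda>y. Re (u y)) x \<partial>lborel) = (\<integral>y. Re (u y) * (\<Sum>j\<in>UNIV. conv (partial j \<eta>) (\<lambda>x. \<psi> x $ j) y) \<partial>lborel)"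
      unfolding cd[symmetric] by (rule S(1))
    have t: "(\<integral>x. (A x \<bullet> \<psi> x) * conv \<eta> (\<lambda>y. Im (u y)) x \<partial>lborel) = (\<integral>y. Im (u y) * conv \<eta> (\<lambda>x. A x \<bullet> \<psi> x) y \<partial>lborel)"
      by (rule T(1))
    have w: "(\<integral>x. \<psi> x \<bullet> re_gradient \<eta> u x \<partial>lborel) = - (\<integral>y. Re (u y) * (\<Sum>j\<in>UNIV. conv (partial j \<eta>) (\<lambda>x. \<psi> x $ j) y) \<partial>lborel)
      + (\<integral>y. Im (u y) * conv \<eta> (\<lambda>x. A x \<bullet> \<psi> x) y \<partial>lborel)" by (rule W(1))
    show ?thesis using s t w by linarith
  qed
  finally show "bv_pairing (conv \<eta> u) \<psi> = - (\<integral>x. \<psi> x \<bullet> re_gradient \<eta> u x \<partial>lborel)" .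
qed

text \<open>The dual ball is convex, so averaging the values of a field by a mollifier does not leave it.\<close>

lemma conv_bv_test:
  assumes \<phi>[measurable]: "\<phi> \<in> borel_measurable borel" and bd: "\<And>x. norm (\<phi> x) \<le> C" and sup: "\<And>x. R < norm x \<Longrightarrow> \<phi> x = 0"
    and le: "\<And>x w. zonoid_norm w \<le> 1 \<Longrightarrow> \<phi> x \<bullet> w \<le> 1"
  shows "conv \<eta> \<phi> \<in> bv_tests K"
proof (rule bv_testI)
  note k = mollifier_kernel_within[OF m] and C1 = mollifier_C1[OF m]
  have i\<phi>: "integrable lborel \<phi>" by (rule bounded_support_integrable[of \<phi> C R]) (use bd sup in auto)
  note l\<phi> = integrable_imp_locint[OF i\<phi>]
  show "Ck 1 (conv \<eta> \<phi>)" by (rule conv_Ck1[OF k C1 l\<phi>])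
  have "conv \<eta> \<phi> y = 0" if y: "R + \<epsilon> < norm y" for y
  proof (rule conv_vanishes[OF k])
    fix x assume "dist x y < \<epsilon>"
    then have "R < norm x" using y norm_triangle_ineq2[of y x] by (simp add: dist_norm norm_minus_commute)
    then show "\<phi> x = 0" by (rule sup)
  qed
  then have "{y. conv \<eta> \<phi> y \<noteq> 0} \<subseteq> cball 0 (R + \<epsilon>)" by (auto simp: not_less[symmetric])
  then show "has_compact_support (conv \<eta> \<phi>)" unfolding has_compact_support_iff using bounded_subset[OF bounded_cball] by blast
  fix y w assume w: "zonoid_norm w \<le> 1"
  have in1: "integrable lborel (\<lambda>x. (\<eta> (y - x) *\<^sub>R \<phi> x) \<bullet> w)"
    by (rule integrable_bounded_linear[OF bounded_linear_inner_left conv_integrable[OF k l\<phi>]])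
  have "conv \<eta> \<phi> y \<bullet> w = (\<integral>x. (\<eta> (y - x) *\<^sub>R \<phi> x) \<bullet> w \<partial>lborel)"
    unfolding conv_def by (rule integral_bounded_linear[OF bounded_linear_inner_left conv_integrable[OF k l\<phi>], symmetric])
  also have "\<dots> \<le> (\<integral>x. \<eta> (y - x) \<partial>lborel)"
  proof (rule integral_mono[OF in1 conv_const_bound(2)[OF m]])
    fix x show "(\<eta> (y - x) *\<^sub>R \<phi> x) \<bullet> w \<le> \<eta> (y - x)"
      using mult_left_mono[OF le[OF w, of x] mollifier_nonneg[OF m, of "y - x"]] by simp
  qed
  finally show "conv \<eta> \<phi> y \<bullet> w \<le> 1" using conv_const_bound(1)[OF m] by simp
qed

end

end

section \<open>Functions of bounded magnetic variation\<close>

lemma norm_pow_1_finite: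
  fixes u :: "real^'n \<Rightarrow> complex"
  assumes u: "integrable lborel u"
  shows "(\<integral>\<^sup>+x. ennreal (norm_pow 1 (u x)) \<partial>lborel) < \<infinity>"
proof -
  note [measurable] = borel_measurable_integrable[OF u]
  have "(\<integral>\<^sup>+x. ennreal (norm_pow 1 (u x)) \<partial>lborel) \<le> (\<integral>\<^sup>+x. 2 * ennreal (norm (u x)) \<partial>lborel)"
  proof (rule nn_integral_mono)
    fix x
    have "norm_pow 1 (u x) \<le> 2 * norm (u x)" using abs_Re_le_cmod[of "u x"] abs_Im_le_cmod[of "u x"] by (simp add: norm_pow_def)
    from ennreal_leI[OF this] show "ennreal (norm_pow 1 (u x)) \<le> 2 * ennreal (norm (u x))" by (simp add: ennreal_mult)
  qed
  also have "\<dots> = 2 * (\<integral>\<^sup>+x. ennreal (norm (u x)) \<partial>lborel)" by (rule nn_integral_cmult) measurable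
  also have "\<dots> < \<infinity>" using u unfolding integrable_iff_bounded by (auto simp: ennreal_mult_less_top)
  finally show ?thesis .
qed

lemma Re_vec_measurable [measurable (raw)]:
  assumes [measurable]: "f \<in> borel_measurable M"
  shows "(\<lambda>x. Re_vec (f x)) \<in> borel_measurable M"
proof -
  have "continuous_on UNIV (Re_vec :: complex^'n \<Rightarrow> real^'n)" unfolding Re_vec_def by (intro continuous_intros)
  from measurable_compose[OF assms borel_measurable_continuous_onI[OF this]] show ?thesis .
qed

context magnetic1 begin

definition sign_along :: "real^'n \<Rightarrow> real^'n \<Rightarrow> real" where "sign_along a k = (if 0 \<le> a \<bullet> k then 1 else - 1)"

text \<open>The norm of \<open>a\<close> is \<open>N + 1\<close> times the integral of \<open>\<bar>a \<bullet> k\<bar>\<close> over \<open>K\<close>, hence \<open>(N + 1)\<close> times this vector is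
  a point of the dual ball at which the norm of \<open>a\<close> is attained (\<open>inner_sign_moment_self\<close>,
  \<open>inner_sign_moment_le\<close>). Having a formula for it makes the choice measurable in \<open>a\<close>.\<close>

definition sign_moment :: "real^'n \<Rightarrow> real^'n" where "sign_moment a = (\<integral>k. indicator K k *\<^sub>R (sign_along a k *\<^sub>R k) \<partial>lborel)"

definition moment_bound :: real where "moment_bound = (real CARD('n) + 1) * (\<integral>k. indicator K k *\<^sub>R norm k \<partial>lborel)"

lemma norm_K_integrable: "integrable lborel (\<lambda>k. indicator K k *\<^sub>R norm k)"
  by (intro K_integral_finite continuous_intros)

lemma sign_moment_integrable: "integrable lborel (\<lambda>k. indicator K k *\<^sub>R (sign_along a k *\<^sub>R k))"
proof (rule Bochner_Integration.integrable_bound[OF norm_K_integrable])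
  show "(\<lambda>k. indicator K k *\<^sub>R (sign_along a k *\<^sub>R k)) \<in> borel_measurable lborel" unfolding sign_along_def by measurable
  show "AE k in lborel. norm (indicator K k *\<^sub>R (sign_along a k *\<^sub>R k)) \<le> norm (indicator K k *\<^sub>R norm k)"
    by (simp add: sign_along_def)
qed

lemma norm_sign_moment_le: "(real CARD('n) + 1) * norm (sign_moment a) \<le> moment_bound"
proof -
  have "norm (sign_moment a) \<le> (\<integral>k. indicator K k *\<^sub>R norm k \<partial>lborel)"
    unfolding sign_moment_def by (rule norm_integral_le[OF sign_moment_integrable norm_K_integrable]) (simp add: sign_along_def)
  then show ?thesis unfolding moment_bound_def by (intro mult_left_mono) auto
qed

lemma moment_bound_nonneg: "0 \<le> moment_bound" using norm_sign_moment_le[of 0] by (meson add_nonneg_nonneg mult_nonneg_nonneg norm_ge_zero of_nat_0_le_iff order_trans zero_le_one)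

lemma inner_sign_moment: "sign_moment a \<bullet> b = (\<integral>k. indicator K k *\<^sub>R (sign_along a k * (b \<bullet> k)) \<partial>lborel)"
  and inner_sign_moment_integrable: "integrable lborel (\<lambda>k. indicator K k *\<^sub>R (sign_along a k * (b \<bullet> k)))"
proof -
  have eq: "(indicator K k *\<^sub>R (sign_along a k *\<^sub>R k)) \<bullet> b = indicator K k *\<^sub>R (sign_along a k * (b \<bullet> k))" for k
    by (simp add: inner_commute)
  show "sign_moment a \<bullet> b = (\<integral>k. indicator K k *\<^sub>R (sign_along a k * (b \<bullet> k)) \<partial>lborel)"
    unfolding sign_moment_def eq[symmetric] by (rule integral_bounded_linear[OF bounded_linear_inner_left sign_moment_integrable, symmetric])
  show "integrable lborel (\<lambda>k. indicator K k *\<^sub>R (sign_along a k * (b \<bullet> k)))"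
    unfolding eq[symmetric] by (rule integrable_bounded_linear[OF bounded_linear_inner_left sign_moment_integrable])
qed

lemma inner_sign_moment_self: "(real CARD('n) + 1) * (sign_moment a \<bullet> a) = zonoid_norm a"
proof -
  have "sign_along a k * (a \<bullet> k) = \<bar>a \<bullet> k\<bar>" for k by (simp add: sign_along_def)
  then show ?thesis unfolding inner_sign_moment zonoid_norm_eq by simp
qed

lemma inner_sign_moment_le: "(real CARD('n) + 1) * \<bar>sign_moment a \<bullet> b\<bar> \<le> zonoid_norm b"
proof -
  have "\<bar>sign_moment a \<bullet> b\<bar> \<le> (\<integral>k. indicator K k *\<^sub>R \<bar>b \<bullet> k\<bar> \<partial>lborel)"
    unfolding inner_sign_moment real_norm_def[symmetric]
    by (rule norm_integral_le[OF inner_sign_moment_integrable]) (use inner_K_integrable in \<open>auto simp: sign_along_def abs_mult\<close>)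
  then show ?thesis unfolding zonoid_norm_eq by (intro mult_left_mono) auto
qed

lemma sign_moment_measurable [measurable (raw)]:
  assumes [measurable]: "f \<in> borel_measurable M"
  shows "(\<lambda>x. sign_moment (f x)) \<in> borel_measurable M"
  unfolding sign_moment_def sign_along_def by measurable

lemma re_gradient_measurable: "mollifier \<eta> \<epsilon> \<Longrightarrow> locint u \<Longrightarrow> re_gradient \<eta> u \<in> borel_measurable borel"
  unfolding re_gradient_def[abs_def] by (intro Re_vec_measurable mollified_gradient_measurable)

text \<open>Restrict the optimal field for \<open>re_gradient \<eta> u\<close> to \<open>B\<close> and mollify it. The test field
  obtained depends on \<open>\<eta>\<close>, but its pairing with \<open>u\<close> is the energy on \<open>B\<close> up to an error that depends
  on \<open>\<epsilon>\<close> only. Its support stays within distance \<open>\<epsilon>\<close> of \<open>B\<close>.\<close>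

lemma energy_test:
  assumes m: "mollifier \<eta> \<epsilon>" and u: "integrable lborel u"
    and B[measurable]: "B \<in> sets borel" and BR: "B \<subseteq> cball 0 R"
  shows "\<exists>\<psi>\<in>bv_tests K. (\<forall>y. (\<forall>x\<in>B. \<epsilon> \<le> dist x y) \<longrightarrow> \<psi> y = 0) \<and>
    (\<integral>\<^sup>+x. ennreal (zonoid_norm (re_gradient \<eta> u x)) * indicator B x \<partial>lborel) \<le> ennreal (bv_pairing u \<psi> + moment_bound * L * \<epsilon> * (\<integral>x. norm (u x) \<partial>lborel))"
proof -
  let ?N = "real CARD('n) + 1"
  note lu = integrable_imp_locint[OF u]
  note wm [measurable] = re_gradient_measurable[OF m lu]
  \<comment> \<open>the sign compensates the one produced by integration by parts\<close>
  define \<phi> where "\<phi> x = - ((indicator B x * ?N) *\<^sub>R sign_moment (re_gradient \<eta> u x))" for x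
  have \<phi>m: "\<phi> \<in> borel_measurable borel" unfolding \<phi>_def by measurable
  have bd: "norm (\<phi> x) \<le> moment_bound" for x
    using norm_sign_moment_le[of "re_gradient \<eta> u x"] moment_bound_nonneg by (cases "x \<in> B") (auto simp: \<phi>_def)
  have sup: "\<phi> x = 0" if "R < norm x" for x using BR that by (auto simp: \<phi>_def indicator_def)
  have le: "\<phi> x \<bullet> w \<le> 1" if "zonoid_norm w \<le> 1" for x w
  proof (cases "x \<in> B")
    case True
    have "\<phi> x \<bullet> w = - (?N * (sign_moment (re_gradient \<eta> u x) \<bullet> w))" using True by (simp add: \<phi>_def)
    also have "\<dots> \<le> ?N * \<bar>sign_moment (re_gradient \<eta> u x) \<bullet> w\<bar>"
      using mult_left_mono[of "- (sign_moment (re_gradient \<eta> u x) \<bullet> w)" "\<bar>sign_moment (re_gradient \<eta> u x) \<bullet> w\<bar>" ?N] by simp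
    also have "\<dots> \<le> zonoid_norm w" by (rule inner_sign_moment_le)
    finally show ?thesis using that by simp
  qed (simp add: \<phi>_def)
  have \<phi>w: "\<phi> x \<bullet> re_gradient \<eta> u x = - (indicator B x * zonoid_norm (re_gradient \<eta> u x))" for x
    using inner_sign_moment_self[of "re_gradient \<eta> u x"] by (simp add: \<phi>_def mult.assoc)
  have iw: "integrable lborel (\<lambda>x. \<phi> x \<bullet> re_gradient \<eta> u x)" by (rule weak_identity(2)[OF m u \<phi>m bd sup])
  have ib: "integrable lborel (\<lambda>x. indicator B x * zonoid_norm (re_gradient \<eta> u x))"
    using Bochner_Integration.integrable_minus[OF iw] unfolding \<phi>w by simp
  have "\<bar>bv_pairing u (conv \<eta> \<phi>) + (\<integral>x. \<phi> x \<bullet> re_gradient \<eta> u x \<partial>lborel)\<bar> \<le> moment_bound * L * \<epsilon> * (\<integral>x. norm (u x) \<partial>lborel)"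
    by (rule mollified_test_identity[OF m u \<phi>m bd sup])
  moreover have "(\<integral>x. \<phi> x \<bullet> re_gradient \<eta> u x \<partial>lborel) = - (\<integral>x. indicator B x * zonoid_norm (re_gradient \<eta> u x) \<partial>lborel)"
    unfolding \<phi>w by simp
  ultimately have "(\<integral>x. indicator B x * zonoid_norm (re_gradient \<eta> u x) \<partial>lborel) \<le> bv_pairing u (conv \<eta> \<phi>) + moment_bound * L * \<epsilon> * (\<integral>x. norm (u x) \<partial>lborel)"
    by linarith
  then have "ennreal (\<integral>x. indicator B x * zonoid_norm (re_gradient \<eta> u x) \<partial>lborel) \<le> ennreal (bv_pairing u (conv \<eta> \<phi>) + moment_bound * L * \<epsilon> * (\<integral>x. norm (u x) \<partial>lborel))"
    by (rule ennreal_leI)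
  moreover have "ennreal (\<integral>x. indicator B x * zonoid_norm (re_gradient \<eta> u x) \<partial>lborel) = (\<integral>\<^sup>+x. ennreal (zonoid_norm (re_gradient \<eta> u x)) * indicator B x \<partial>lborel)"
    using ib by (subst nn_integral_eq_integral[symmetric]) (auto intro!: nn_integral_cong simp: indicator_def)
  ultimately have e: "(\<integral>\<^sup>+x. ennreal (zonoid_norm (re_gradient \<eta> u x)) * indicator B x \<partial>lborel) \<le> ennreal (bv_pairing u (conv \<eta> \<phi>) + moment_bound * L * \<epsilon> * (\<integral>x. norm (u x) \<partial>lborel))"
    by simp
  have t: "conv \<eta> \<phi> \<in> bv_tests K" by (rule conv_bv_test[OF m u \<phi>m bd sup le])
  have van: "conv \<eta> \<phi> y = 0" if "\<forall>x\<in>B. \<epsilon> \<le> dist x y" for y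
  proof (rule conv_vanishes[OF mollifier_kernel_within[OF m]])
    fix x assume "dist x y < \<epsilon>"
    then have "x \<notin> B" using that by force
    then show "\<phi> x = 0" by (simp add: \<phi>_def)
  qed
  show ?thesis using t van e by blast
qed

context
  fixes u :: "real^'n \<Rightarrow> complex" and c :: real
  assumes u: "integrable lborel u" and ub: "\<And>\<psi>. \<psi> \<in> bv_tests K \<Longrightarrow> bv_pairing u \<psi> \<le> c"
begin

lemma energy_upper:
  assumes m: "mollifier \<eta> \<epsilon>"
  shows "(\<integral>\<^sup>+x. ennreal (zonoid_norm (re_gradient \<eta> u x)) \<partial>lborel) \<le> ennreal (c + moment_bound * L * \<epsilon> * (\<integral>x. norm (u x) \<partial>lborel))"
proof (rule nn_integral_le_from_cballs)
  note [measurable] = re_gradient_measurable[OF m integrable_imp_locint[OF u]]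
  show "(\<lambda>x. ennreal (zonoid_norm (re_gradient \<eta> u x))) \<in> borel_measurable borel" by measurable
  fix n :: nat
  have "cball 0 (real n) \<in> sets (borel :: (real^'n) measure)" by simp
  from energy_test[OF m u this order_refl] obtain \<psi> where \<psi>: "\<psi> \<in> bv_tests K"
    "(\<integral>\<^sup>+x. ennreal (zonoid_norm (re_gradient \<eta> u x)) * indicator (cball 0 (real n)) x \<partial>lborel) \<le> ennreal (bv_pairing u \<psi> + moment_bound * L * \<epsilon> * (\<integral>x. norm (u x) \<partial>lborel))"
    by blast
  note \<psi>(2)
  also have "ennreal (bv_pairing u \<psi> + moment_bound * L * \<epsilon> * (\<integral>x. norm (u x) \<partial>lborel)) \<le> ennreal (c + moment_bound * L * \<epsilon> * (\<integral>x. norm (u x) \<partial>lborel))"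
    using ub[OF \<psi>(1)] by (intro ennreal_leI) simp
  finally show "(\<integral>\<^sup>+x. ennreal (zonoid_norm (re_gradient \<eta> u x)) * indicator (cball 0 (real n)) x \<partial>lborel) \<le> ennreal (c + moment_bound * L * \<epsilon> * (\<integral>x. norm (u x) \<partial>lborel))" .
qed

text \<open>Mass far away would contribute to the supremum in addition to what the almost optimal field
  \<open>\<psi>0\<close> already collects near the origin.\<close>

lemma energy_tight:
  assumes \<psi>0: "\<psi>0 \<in> bv_tests K" "c - \<delta> < bv_pairing u \<psi>0"
  shows "\<exists>R. \<forall>\<eta> \<epsilon>. mollifier \<eta> \<epsilon> \<longrightarrow> (\<integral>\<^sup>+x. ennreal (zonoid_norm (re_gradient \<eta> u x)) * indicator (- cball 0 R) x \<partial>lborel) \<le> ennreal (\<delta> + moment_bound * L * \<epsilon> * (\<integral>x. norm (u x) \<partial>lborel))"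
proof -
  have C0: "Ck 1 \<psi>0" "has_compact_support \<psi>0" using \<psi>0(1) by (auto simp: bv_tests_def)
  obtain R where R: "0 < R" "\<And>x. R \<le> norm x \<Longrightarrow> \<psi>0 x = 0" using has_compact_support_radius[OF C0(2)] by metis
  show ?thesis
  proof (intro exI[of _ "R + 1"] allI impI)
    fix \<eta> :: "real^'n \<Rightarrow> real" and \<epsilon> assume m: "mollifier \<eta> \<epsilon>"
    note [measurable] = re_gradient_measurable[OF m integrable_imp_locint[OF u]]
    let ?U = "moment_bound * L * \<epsilon> * (\<integral>x. norm (u x) \<partial>lborel)"
    show "(\<integral>\<^sup>+x. ennreal (zonoid_norm (re_gradient \<eta> u x)) * indicator (- cball 0 (R + 1)) x \<partial>lborel) \<le> ennreal (\<delta> + ?U)"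
    proof (rule nn_integral_le_from_cballs)
      show "(\<lambda>x. ennreal (zonoid_norm (re_gradient \<eta> u x)) * indicator (- cball 0 (R + 1)) x) \<in> borel_measurable borel" by measurable
      fix n :: nat
      let ?B = "- cball 0 (R + 1) \<inter> cball (0::real^'n) (real n)"
      have B: "?B \<in> sets borel" "?B \<subseteq> cball 0 (real n)" by auto
      from energy_test[OF m u B] obtain \<psi> where \<psi>: "\<psi> \<in> bv_tests K" "\<forall>y. (\<forall>x\<in>?B. \<epsilon> \<le> dist x y) \<longrightarrow> \<psi> y = 0"
        "(\<integral>\<^sup>+x. ennreal (zonoid_norm (re_gradient \<eta> u x)) * indicator ?B x \<partial>lborel) \<le> ennreal (bv_pairing u \<psi> + ?U)"
        by blast
      have C: "Ck 1 \<psi>" "has_compact_support \<psi>" using \<psi>(1) by (auto simp: bv_tests_def)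
      have z: "\<psi> y = 0" if y: "norm y \<le> R" for y
      proof (rule \<psi>(2)[rule_format])
        fix x assume "x \<in> ?B"
        then have "R + 1 < norm x" by auto
        then have "1 \<le> dist x y" using y norm_triangle_ineq2[of x y] by (simp add: dist_norm)
        then show "\<epsilon> \<le> dist x y" using m by (auto simp: mollifier_def)
      qed
      \<comment> \<open>the two supports are disjoint, so the sum is again a test field\<close>
      have "(\<lambda>x. \<psi>0 x + \<psi> x) \<in> bv_tests K"
      proof (rule bv_testI)
        show "Ck 1 (\<lambda>x. \<psi>0 x + \<psi> x)" "has_compact_support (\<lambda>x. \<psi>0 x + \<psi> x)" by (rule bv_pairing_add[OF u C0 C])+
        fix x w assume w: "zonoid_norm w \<le> 1"
        show "(\<psi>0 x + \<psi> x) \<bullet> w \<le> 1"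
          using bv_test_inner_le[OF \<psi>0(1), of x w] bv_test_inner_le[OF \<psi>(1), of x w] w R(2)[of x] z[of x]
          by (cases "norm x \<le> R") auto
      qed
      from ub[OF this] have "bv_pairing u \<psi> \<le> \<delta>" using bv_pairing_add(1)[OF u C0 C] \<psi>0(2) by simp
      then have "ennreal (bv_pairing u \<psi> + ?U) \<le> ennreal (\<delta> + ?U)" by (intro ennreal_leI) simp
      with \<psi>(3) have "(\<integral>\<^sup>+x. ennreal (zonoid_norm (re_gradient \<eta> u x)) * indicator ?B x \<partial>lborel) \<le> ennreal (\<delta> + ?U)" by (rule order_trans)
      moreover have "(\<integral>\<^sup>+x. ennreal (zonoid_norm (re_gradient \<eta> u x)) * indicator (- cball 0 (R + 1)) x * indicator (cball 0 (real n)) x \<partial>lborel)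
        = (\<integral>\<^sup>+x. ennreal (zonoid_norm (re_gradient \<eta> u x)) * indicator ?B x \<partial>lborel)"
        by (intro nn_integral_cong) (auto simp: indicator_def)
      ultimately show "(\<integral>\<^sup>+x. ennreal (zonoid_norm (re_gradient \<eta> u x)) * indicator (- cball 0 (R + 1)) x * indicator (cball 0 (real n)) x \<partial>lborel) \<le> ennreal (\<delta> + ?U)" by simp
    qed
  qed
qed

end

lemma bv_pairing_mollified_tendsto:
  assumes m: "\<And>m. mollifier (\<eta> m) (\<epsilon> m)" and e0: "\<epsilon> \<longlonglongrightarrow> 0" and u: "integrable lborel u"
    and \<psi>: "Ck 1 \<psi>" "has_compact_support \<psi>"
  shows "(\<lambda>i. bv_pairing (conv (\<eta> i) u) \<psi>) \<longlonglongrightarrow> bv_pairing u \<psi>"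
proof -
  obtain R where R: "0 < R" "\<And>x. R \<le> norm x \<Longrightarrow> \<psi> x = 0" using has_compact_support_radius[OF \<psi>(2)] by metis
  note kd = kernel_within_divergence[OF \<psi>(1) R(2)] and ka = kernel_within_inner_A[OF \<psi>(1) R(2)]
  note lu = integrable_imp_locint[OF u]
  note [measurable] = locint_measurable[OF lu] conv_measurable[OF mollifier_kernel_within[OF m] lu]
  obtain Cd where Cd: "0 \<le> Cd" "\<And>z. \<bar>divergence \<psi> z\<bar> \<le> Cd" using kernel_within_bounded[OF kd] by metis
  obtain Ca where Ca: "0 \<le> Ca" "\<And>z. \<bar>A z \<bullet> \<psi> z\<bar> \<le> Ca" using kernel_within_bounded[OF ka] by metis
  let ?f = "\<lambda>u x. Re (u x) * divergence \<psi> x - (A x \<bullet> \<psi> x) * Im (u x)"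
  have int: "integrable lborel (?f v)" if "integrable lborel v" for v
    using bv_pairing_integrable[OF that \<psi>] by (rule Bochner_Integration.integrable_diff)
  show ?thesis unfolding bv_pairing_def
  proof (rule tendsto_L1_int)
    show "integrable lborel (?f (conv (\<eta> i) u))" for i by (rule int[OF conv_integrable_L1[OF m u]])
    show "integrable lborel (?f u)" by (rule int[OF u])
    have bd: "(\<integral>\<^sup>+x. ennreal (norm (?f (conv (\<eta> i) u) x - ?f u x)) \<partial>lborel) \<le> ennreal (Cd + Ca) * (\<integral>\<^sup>+x. ennreal (norm (conv (\<eta> i) u x - u x)) \<partial>lborel)" for i
    proof -
      have "(\<integral>\<^sup>+x. ennreal (norm (?f (conv (\<eta> i) u) x - ?f u x)) \<partial>lborel) \<le> (\<integral>\<^sup>+x. ennreal (Cd + Ca) * ennreal (norm (conv (\<eta> i) u x - u x)) \<partial>lborel)"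
      proof (rule nn_integral_mono)
        fix x
        let ?d = "conv (\<eta> i) u x - u x"
        have "?f (conv (\<eta> i) u) x - ?f u x = Re ?d * divergence \<psi> x - (A x \<bullet> \<psi> x) * Im ?d" by (simp add: algebra_simps)
        then have "norm (?f (conv (\<eta> i) u) x - ?f u x) \<le> \<bar>Re ?d\<bar> * \<bar>divergence \<psi> x\<bar> + \<bar>A x \<bullet> \<psi> x\<bar> * \<bar>Im ?d\<bar>"
          using abs_triangle_ineq4[of "Re ?d * divergence \<psi> x" "(A x \<bullet> \<psi> x) * Im ?d"] by (simp add: abs_mult)
        also have "\<dots> \<le> norm ?d * Cd + Ca * norm ?d"
          using Cd Ca by (intro add_mono mult_mono abs_Re_le_cmod abs_Im_le_cmod) auto
        finally have "norm (?f (conv (\<eta> i) u) x - ?f u x) \<le> (Cd + Ca) * norm ?d" by (simp add: algebra_simps)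
        then show "ennreal (norm (?f (conv (\<eta> i) u) x - ?f u x)) \<le> ennreal (Cd + Ca) * ennreal (norm ?d)"
          using Cd Ca by (subst ennreal_mult[symmetric]) (auto intro: ennreal_leI)
      qed
      also have "\<dots> = ennreal (Cd + Ca) * (\<integral>\<^sup>+x. ennreal (norm (conv (\<eta> i) u x - u x)) \<partial>lborel)"
        by (rule nn_integral_cmult) measurable
      finally show ?thesis .
    qed
    have "(\<lambda>i. ennreal (Cd + Ca) * (\<integral>\<^sup>+x. ennreal (norm (conv (\<eta> i) u x - u x)) \<partial>lborel)) \<longlonglongrightarrow> ennreal (Cd + Ca) * 0"
      by (intro tendsto_mult_ennreal tendsto_const mollify_L1[OF m e0 u]) auto
    then have lim: "(\<lambda>i. ennreal (Cd + Ca) * (\<integral>\<^sup>+x. ennreal (norm (conv (\<eta> i) u x - u x)) \<partial>lborel)) \<longlonglongrightarrow> 0" by simp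
    show "(\<lambda>i. \<integral>\<^sup>+x. ennreal (norm (?f (conv (\<eta> i) u) x - ?f u x)) \<partial>lborel) \<longlonglongrightarrow> 0"
      by (rule tendsto_sandwich[OF _ _ tendsto_const lim]) (use bd in \<open>auto intro!: always_eventually\<close>)
  qed
qed

lemma energy_lower:
  assumes m: "mollifier \<eta> \<epsilon>" and u: "integrable lborel u" and \<psi>: "\<psi> \<in> bv_tests K"
  shows "ennreal (bv_pairing (conv \<eta> u) \<psi>) \<le> (\<integral>\<^sup>+x. ennreal (zonoid_norm (re_gradient \<eta> u x)) \<partial>lborel)"
proof -
  have C: "Ck 1 \<psi>" "has_compact_support \<psi>" using \<psi> by (auto simp: bv_tests_def)
  note I = mollified_function_identity[OF m u C]
  have "bv_pairing (conv \<eta> u) \<psi> = (\<integral>x. - (\<psi> x \<bullet> re_gradient \<eta> u x) \<partial>lborel)" unfolding I(1) by simp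
  also have "\<dots> \<le> (\<integral>x. max 0 (- (\<psi> x \<bullet> re_gradient \<eta> u x)) \<partial>lborel)"
    using I(2) by (intro integral_mono) auto
  finally have "ennreal (bv_pairing (conv \<eta> u) \<psi>) \<le> ennreal (\<integral>x. max 0 (- (\<psi> x \<bullet> re_gradient \<eta> u x)) \<partial>lborel)" by (rule ennreal_leI)
  also have "\<dots> = (\<integral>\<^sup>+x. ennreal (max 0 (- (\<psi> x \<bullet> re_gradient \<eta> u x))) \<partial>lborel)"
    using I(2) by (intro nn_integral_eq_integral[symmetric]) auto
  also have "\<dots> \<le> (\<integral>\<^sup>+x. ennreal (zonoid_norm (re_gradient \<eta> u x)) \<partial>lborel)"
  proof (intro nn_integral_mono ennreal_leI)
    fix x show "max 0 (- (\<psi> x \<bullet> re_gradient \<eta> u x)) \<le> zonoid_norm (re_gradient \<eta> u x)"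
      using bv_test_inner_le[OF \<psi>, of x "- re_gradient \<eta> u x"] by simp
  qed
  finally show ?thesis .
qed

lemma conv_cmult:
  fixes a :: complex
  assumes "kernel_within \<kappa> \<epsilon>" "locint u"
  shows "conv \<kappa> (\<lambda>x. a * u x) y = a * conv \<kappa> u (y :: real^'n)"
proof -
  have "conv \<kappa> (\<lambda>x. a * u x) y = (\<integral>x. a * (\<kappa> (y - x) *\<^sub>R u x) \<partial>lborel)" unfolding conv_def by simp
  also have "\<dots> = a * conv \<kappa> u y" unfolding conv_def
    by (intro Bochner_Integration.integral_mult_right) (simp add: conv_integrable[OF assms])
  finally show ?thesis .
qed

text \<open>The imaginary part of \<open>D\<^sub>m\<close> is the real part for \<open>-\<i> u\<close>.\<close>

lemma energy_density_mollified_gradient_eq: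
  assumes m: "mollifier \<eta> \<epsilon>" and u: "locint u"
  shows "energy_density 1 (mollified_gradient \<eta> u x) = ennreal (zonoid_norm (re_gradient \<eta> u x)) + ennreal (zonoid_norm (re_gradient \<eta> (\<lambda>x. - \<i> * u x) x))"
proof -
  note k = mollifier_kernel_within[OF m]
  have "re_gradient \<eta> (\<lambda>x. - \<i> * u x) x = (\<chi> j. Im (mollified_gradient \<eta> u x $ j))"
    unfolding re_gradient_def Re_vec_def mollified_gradient_def magnetic_gradient_def conv_gradient_def
    by (simp only: conv_cmult[OF k u] conv_cmult[OF kernel_within_partial[OF k mollifier_C1[OF m]] u]) (simp add: vec_eq_iff)
  then show ?thesis unfolding energy_density_1_eq by (simp add: re_gradient_def)
qed

text \<open>The constants \<open>c1\<close> and \<open>c2\<close> are the two suprema defining the magnetic variation of \<open>u\<close>. Each of the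
  three hypotheses of \<open>sphere_energy_tendsto\<close> is obtained for \<open>u\<close> and for \<open>-\<i> u\<close> separately and
  added.\<close>

theorem BV_sphere_energy_tendsto:
  fixes u :: "real^'n \<Rightarrow> complex"
  defines "u' \<equiv> (\<lambda>x. - \<i> * u x)"
  assumes u: "integrable lborel u"
    and ub: "\<And>\<psi>. \<psi> \<in> bv_tests K \<Longrightarrow> bv_pairing u \<psi> \<le> c1" "\<And>\<psi>. \<psi> \<in> bv_tests K \<Longrightarrow> bv_pairing u' \<psi> \<le> c2"
    and sup: "\<And>e. 0 < e \<Longrightarrow> \<exists>\<psi>\<in>bv_tests K. c1 - e < bv_pairing u \<psi>" "\<And>e. 0 < e \<Longrightarrow> \<exists>\<psi>\<in>bv_tests K. c2 - e < bv_pairing u' \<psi>"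
    and c: "0 \<le> c1" "0 \<le> c2"
  shows "(sphere_energy u \<longlongrightarrow> ennreal (c1 + c2)) (at_right 0)"
proof -
  obtain \<eta> :: "nat \<Rightarrow> real^'n \<Rightarrow> real" and \<epsilon> where m: "\<And>m. mollifier (\<eta> m) (\<epsilon> m)" and e0: "\<epsilon> \<longlonglongrightarrow> 0"
    using mollifier_sequence by metis
  have u': "integrable lborel u'" unfolding u'_def using u by simp
  note lu = integrable_imp_locint[OF u] and lu' = integrable_imp_locint[OF u']
  note [measurable] = locint_measurable[OF lu] re_gradient_measurable[OF m lu] re_gradient_measurable[OF m lu']
  let ?U = "\<integral>x. norm (u x) \<partial>lborel"
  have U': "(\<integral>x. norm (u' x) \<partial>lborel) = ?U" by (simp add: u'_def norm_mult)
  have U0: "0 \<le> ?U" by (intro integral_nonneg_AE) auto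
  have e: "0 \<le> \<epsilon> i" for i using m[of i] by (auto simp: mollifier_def)
  define d where "d i = moment_bound * L * \<epsilon> i * ?U" for i
  have d0: "d \<longlonglongrightarrow> 0" unfolding d_def using e0 by (auto intro!: tendsto_eq_intros)
  have dn: "0 \<le> d i" for i unfolding d_def using moment_bound_nonneg L_nonneg e U0 by simp
  have split: "(\<integral>\<^sup>+x. energy_density 1 (mollified_gradient (\<eta> i) u x) * indicator B x \<partial>lborel)
     = (\<integral>\<^sup>+x. ennreal (zonoid_norm (re_gradient (\<eta> i) u x)) * indicator B x \<partial>lborel) + (\<integral>\<^sup>+x. ennreal (zonoid_norm (re_gradient (\<eta> i) u' x)) * indicator B x \<partial>lborel)"
    if [measurable]: "B \<in> sets borel" for i B
    unfolding energy_density_mollified_gradient_eq[OF m lu] u'_def[symmetric] distrib_right by (rule nn_integral_add) measurable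
  have split1: "(\<integral>\<^sup>+x. energy_density 1 (mollified_gradient (\<eta> i) u x) \<partial>lborel)
     = (\<integral>\<^sup>+x. ennreal (zonoid_norm (re_gradient (\<eta> i) u x)) \<partial>lborel) + (\<integral>\<^sup>+x. ennreal (zonoid_norm (re_gradient (\<eta> i) u' x)) \<partial>lborel)" for i
    using split[of UNIV i] by simp
  show ?thesis
  proof (rule sphere_energy_tendsto[OF m e0 lu])
    show "(\<integral>\<^sup>+x. ennreal (norm_pow 1 (u x)) \<partial>lborel) < \<infinity>" by (rule norm_pow_1_finite[OF u])
  next
    fix e :: real assume e: "0 < e"
    have "eventually (\<lambda>i. d i < e / 2) sequentially" using d0 e by (intro order_tendstoD) auto
    then show "eventually (\<lambda>i. (\<integral>\<^sup>+x. energy_density 1 (mollified_gradient (\<eta> i) u x) \<partial>lborel) \<le> ennreal (c1 + c2 + e)) sequentially"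
    proof eventually_elim
      case (elim i)
      have "(\<integral>\<^sup>+x. energy_density 1 (mollified_gradient (\<eta> i) u x) \<partial>lborel) \<le> ennreal (c1 + d i) + ennreal (c2 + d i)"
        unfolding split1 d_def using energy_upper[OF u ub(1) m[of i]] energy_upper[OF u' ub(2) m[of i]] unfolding U' by (rule add_mono)
      also have "\<dots> \<le> ennreal (c1 + c2 + e)"
        using elim c dn[of i] e by (simp add: ennreal_plus[symmetric] ennreal_leI del: ennreal_plus)
      finally show ?case .
    qed
  next
    fix e :: real assume e: "0 < e"
    obtain \<psi>1 \<psi>2 where p: "\<psi>1 \<in> bv_tests K" "c1 - e / 4 < bv_pairing u \<psi>1" "\<psi>2 \<in> bv_tests K" "c2 - e / 4 < bv_pairing u' \<psi>2"
      using sup(1)[of "e / 4"] sup(2)[of "e / 4"] e by auto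
    obtain R1 where R1: "\<And>\<eta> \<epsilon>. mollifier \<eta> \<epsilon> \<Longrightarrow> (\<integral>\<^sup>+x. ennreal (zonoid_norm (re_gradient \<eta> u x)) * indicator (- cball 0 R1) x \<partial>lborel) \<le> ennreal (e / 4 + moment_bound * L * \<epsilon> * ?U)"
      using energy_tight[OF u ub(1) p(1,2)] by blast
    obtain R2 where R2: "\<And>\<eta> \<epsilon>. mollifier \<eta> \<epsilon> \<Longrightarrow> (\<integral>\<^sup>+x. ennreal (zonoid_norm (re_gradient \<eta> u' x)) * indicator (- cball 0 R2) x \<partial>lborel) \<le> ennreal (e / 4 + moment_bound * L * \<epsilon> * ?U)"
      using energy_tight[OF u' ub(2) p(3,4)] unfolding U' by blast
    let ?R = "max R1 R2"
    have "eventually (\<lambda>i. d i < e / 4) sequentially" using d0 e by (intro order_tendstoD) auto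
    then have "eventually (\<lambda>i. (\<integral>\<^sup>+x. energy_density 1 (mollified_gradient (\<eta> i) u x) * indicator (- cball 0 ?R) x \<partial>lborel) \<le> ennreal e) sequentially"
    proof eventually_elim
      case (elim i)
      have "(\<integral>\<^sup>+x. ennreal (zonoid_norm (re_gradient (\<eta> i) u x)) * indicator (- cball 0 ?R) x \<partial>lborel) \<le> (\<integral>\<^sup>+x. ennreal (zonoid_norm (re_gradient (\<eta> i) u x)) * indicator (- cball 0 R1) x \<partial>lborel)"
        by (intro nn_integral_mono) (auto simp: indicator_def)
      also have "\<dots> \<le> ennreal (e / 4 + d i)" unfolding d_def by (rule R1[OF m])
      finally have 1: "(\<integral>\<^sup>+x. ennreal (zonoid_norm (re_gradient (\<eta> i) u x)) * indicator (- cball 0 ?R) x \<partial>lborel) \<le> ennreal (e / 4 + d i)" .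
      have "(\<integral>\<^sup>+x. ennreal (zonoid_norm (re_gradient (\<eta> i) u' x)) * indicator (- cball 0 ?R) x \<partial>lborel) \<le> (\<integral>\<^sup>+x. ennreal (zonoid_norm (re_gradient (\<eta> i) u' x)) * indicator (- cball 0 R2) x \<partial>lborel)"
        by (intro nn_integral_mono) (auto simp: indicator_def)
      also have "\<dots> \<le> ennreal (e / 4 + d i)" unfolding d_def by (rule R2[OF m])
      finally have 2: "(\<integral>\<^sup>+x. ennreal (zonoid_norm (re_gradient (\<eta> i) u' x)) * indicator (- cball 0 ?R) x \<partial>lborel) \<le> ennreal (e / 4 + d i)" .
      have "(\<integral>\<^sup>+x. energy_density 1 (mollified_gradient (\<eta> i) u x) * indicator (- cball 0 ?R) x \<partial>lborel) \<le> ennreal (e / 4 + d i) + ennreal (e / 4 + d i)"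
        by (subst split) (use 1 2 in \<open>auto intro: add_mono\<close>)
      also have "\<dots> \<le> ennreal e"
        using elim dn[of i] e by (simp add: ennreal_plus[symmetric] ennreal_leI del: ennreal_plus)
      finally show ?case .
    qed
    then show "\<exists>R. eventually (\<lambda>i. (\<integral>\<^sup>+x. energy_density 1 (mollified_gradient (\<eta> i) u x) * indicator (- cball 0 R) x \<partial>lborel) \<le> ennreal e) sequentially" by blast
  next
    let ?l = "liminf (\<lambda>i. \<integral>\<^sup>+x. energy_density 1 (mollified_gradient (\<eta> i) u x) \<partial>lborel)"
    show "ennreal (c1 + c2) \<le> ?l"
    proof (rule ennreal_le_epsilon)
      fix e :: real assume e: "0 < e"
      obtain \<psi>1 \<psi>2 where p: "\<psi>1 \<in> bv_tests K" "c1 - e / 2 < bv_pairing u \<psi>1" "\<psi>2 \<in> bv_tests K" "c2 - e / 2 < bv_pairing u' \<psi>2"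
        using sup(1)[of "e / 2"] sup(2)[of "e / 2"] e by auto
      have C: "Ck 1 \<psi>1" "has_compact_support \<psi>1" "Ck 1 \<psi>2" "has_compact_support \<psi>2"
        using p by (auto simp: bv_tests_def)
      have "eventually (\<lambda>i. c1 - e / 2 < bv_pairing (conv (\<eta> i) u) \<psi>1) sequentially"
        using bv_pairing_mollified_tendsto[OF m e0 u C(1,2)] p(2) by (rule order_tendstoD)
      moreover have "eventually (\<lambda>i. c2 - e / 2 < bv_pairing (conv (\<eta> i) u') \<psi>2) sequentially"
        using bv_pairing_mollified_tendsto[OF m e0 u' C(3,4)] p(4) by (rule order_tendstoD)
      ultimately have "eventually (\<lambda>i. ennreal (c1 + c2 - e) \<le> (\<integral>\<^sup>+x. energy_density 1 (mollified_gradient (\<eta> i) u x) \<partial>lborel)) sequentially"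
      proof eventually_elim
        case (elim i)
        have "ennreal (c1 + c2 - e) \<le> ennreal (bv_pairing (conv (\<eta> i) u) \<psi>1 + bv_pairing (conv (\<eta> i) u') \<psi>2)"
          using elim by (intro ennreal_leI) simp
        also have "\<dots> \<le> ennreal (max 0 (bv_pairing (conv (\<eta> i) u) \<psi>1) + max 0 (bv_pairing (conv (\<eta> i) u') \<psi>2))"
          by (intro ennreal_leI) simp
        also have "\<dots> = ennreal (bv_pairing (conv (\<eta> i) u) \<psi>1) + ennreal (bv_pairing (conv (\<eta> i) u') \<psi>2)"
          by (subst ennreal_plus) (auto simp: max_def ennreal_neg)
        also have "\<dots> \<le> (\<integral>\<^sup>+x. energy_density 1 (mollified_gradient (\<eta> i) u x) \<partial>lborel)"
          unfolding split1 by (intro add_mono energy_lower[OF m] u u' p)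
        finally show ?case .
      qed
      then have "ennreal (c1 + c2 - e) \<le> ?l" by (rule Liminf_bounded)
      then have "ennreal (c1 + c2 - e) + ennreal e \<le> ?l + ennreal e" by (rule add_right_mono)
      have "ennreal (c1 + c2) \<le> ennreal (max 0 (c1 + c2 - e) + e)" by (intro ennreal_leI) simp
      also have "\<dots> = ennreal (c1 + c2 - e) + ennreal e"
        using e by (subst ennreal_plus) (auto simp: max_def ennreal_neg)
      also have "\<dots> \<le> ?l + ennreal e" by fact
      finally show "ennreal (c1 + c2) \<le> ?l + ennreal e" .
    qed
  qed (use c in auto)
qed

end

section \<open>Borel representatives of Lebesgue measurable data\<close>

lemma lebesgue_borel_representative:
  fixes f :: "'a::euclidean_space \<Rightarrow> 'b::euclidean_space"
  assumes "f \<in> borel_measurable lebesgue"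
  shows "\<exists>g\<in>borel_measurable borel. AE x in lborel. f x = g x"
proof -
  have "\<exists>g\<in>borel_measurable lborel. AE x in lborel. f x \<bullet> b = g x" for b
    using assms by (intro completion_ex_borel_measurable_real) simp
  then obtain g where g: "\<And>b. g b \<in> borel_measurable borel" "\<And>b. AE x in lborel. f x \<bullet> b = g b x"
    by (simp add: Bex_def) metis
  have "(\<lambda>x. \<Sum>b\<in>Basis. g b x *\<^sub>R b) \<in> borel_measurable borel" using g(1) by measurable
  moreover have "AE x in lborel. \<forall>b\<in>(Basis::'b set). f x \<bullet> b = g b x" using g(2) by (intro AE_finite_allI) auto
  then have "AE x in lborel. f x = (\<Sum>b\<in>Basis. g b x *\<^sub>R b)"
  proof eventually_elim
    case (elim x)
    have "f x = (\<Sum>b\<in>Basis. (f x \<bullet> b) *\<^sub>R b)" by (simp add: euclidean_representation)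
    also have "\<dots> = (\<Sum>b\<in>Basis. g b x *\<^sub>R b)" by (intro sum.cong) (use elim in auto)
    finally show ?case .
  qed
  ultimately show ?thesis by (intro bexI)
qed

lemma borel_lebesgue_measurable: "f \<in> borel_measurable borel \<Longrightarrow> f \<in> borel_measurable (lebesgue :: 'a::euclidean_space measure)"
  by (intro measurable_completion) simp

lemma loc_integrable_measurable:
  fixes f :: "real^'n \<Rightarrow> 'b::euclidean_space"
  assumes f: "loc_integrable f" shows "f \<in> borel_measurable lebesgue"
proof (rule borel_measurable_LIMSEQ_metric)
  show "(\<lambda>x. indicator (cball 0 (real i)) x *\<^sub>R f x) \<in> borel_measurable lebesgue" for i
    using f unfolding loc_integrable_def set_integrable_def by (simp add: borel_measurable_integrable)
  fix x :: "real^'n"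
  obtain i0 :: nat where "norm x \<le> real i0" using real_arch_simple by blast
  then have "eventually (\<lambda>i. indicator (cball 0 (real i)) x *\<^sub>R f x = f x) sequentially"
    unfolding eventually_sequentially by (intro exI[of _ i0]) auto
  then show "(\<lambda>i. indicator (cball 0 (real i)) x *\<^sub>R f x) \<longlonglongrightarrow> f x" by (rule tendsto_eventually)
qed

lemma loc_integrable_cong_AE:
  fixes f :: "real^'n \<Rightarrow> 'b::euclidean_space"
  assumes f: "loc_integrable f" and g: "g \<in> borel_measurable borel" and ae: "AE x in lborel. f x = g x"
  shows "loc_integrable g"
  unfolding loc_integrable_def set_integrable_def
proof (intro allI impI)
  fix S :: "(real^'n) set" assume S: "compact S"
  show "integrable lebesgue (\<lambda>x. indicator S x *\<^sub>R g x)"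
  proof (rule integrable_cong_AE_imp)
    show "integrable lebesgue (\<lambda>x. indicator S x *\<^sub>R f x)" using f S by (auto simp: loc_integrable_def set_integrable_def)
    show "(\<lambda>x. indicator S x *\<^sub>R g x) \<in> borel_measurable lebesgue"
      using S g by (intro borel_lebesgue_measurable) (auto intro!: borel_measurable_scaleR borel_measurable_indicator borel_compact)
    show "AE x in lebesgue. indicator S x *\<^sub>R f x = indicator S x *\<^sub>R g x" unfolding AE_completion_iff using ae by eventually_elim simp
  qed
qed

lemma has_weak_gradient_cong_AE:
  fixes u u' :: "real^'n \<Rightarrow> complex" and G G' :: "real^'n \<Rightarrow> complex^'n"
  assumes w: "has_weak_gradient u G"
    and u': "u' \<in> borel_measurable borel" "AE x in lborel. u x = u' x"
    and G': "G' \<in> borel_measurable borel" "AE x in lborel. G x = G' x"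
  shows "has_weak_gradient u' G'"
proof -
  have li: "loc_integrable u" "loc_integrable G" using w by (auto simp: has_weak_gradient_def)
  note m = loc_integrable_measurable[OF li(1)] loc_integrable_measurable[OF li(2)]
    borel_lebesgue_measurable[OF u'(1)] borel_lebesgue_measurable[OF G'(1)]
  note ae = u'(2)[folded AE_completion_iff[of _ lborel]] G'(2)[folded AE_completion_iff[of _ lborel]]
  have comp: "(\<lambda>x. F x $ j) \<in> borel_measurable lebesgue" if "F \<in> borel_measurable lebesgue" for F :: "real^'n \<Rightarrow> complex^'n" and j
    using that by measurable
  show ?thesis unfolding has_weak_gradient_def
  proof (intro conjI allI impI)
    show "loc_integrable u'" "loc_integrable G'" using loc_integrable_cong_AE[OF li(1) u'] loc_integrable_cong_AE[OF li(2) G'] .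
    fix \<phi> :: "real^'n \<Rightarrow> real" and j assume \<phi>: "(\<forall>k. Ck k \<phi>) \<and> has_compact_support \<phi>"
    have "continuous_on UNIV \<phi>" "continuous_on UNIV (partial j \<phi>)"
      using \<phi>[THEN conjunct1, rule_format, of 0] \<phi>[THEN conjunct1, rule_format, of 1] by auto
    then have c: "\<phi> \<in> borel_measurable lebesgue" "partial j \<phi> \<in> borel_measurable lebesgue"
      by (auto intro!: borel_lebesgue_measurable borel_measurable_continuous_onI)
    have "(LINT x|lebesgue. partial j \<phi> x *\<^sub>R u' x) = (LINT x|lebesgue. partial j \<phi> x *\<^sub>R u x)"
      by (intro integral_cong_AE borel_measurable_scaleR c m) (use ae(1) in eventually_elim, simp)
    also have "\<dots> = - (LINT x|lebesgue. \<phi> x *\<^sub>R (G x $ j))" using w \<phi> unfolding has_weak_gradient_def by blast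
    also have "(LINT x|lebesgue. \<phi> x *\<^sub>R (G x $ j)) = (LINT x|lebesgue. \<phi> x *\<^sub>R (G' x $ j))"
      by (intro integral_cong_AE borel_measurable_scaleR c comp m) (use ae(2) in eventually_elim, simp)
    finally show "(LINT x|lebesgue. partial j \<phi> x *\<^sub>R u' x) = - (LINT x|lebesgue. \<phi> x *\<^sub>R (G' x $ j))" .
  qed
qed

context convex_body begin

text \<open>A null set of radii corresponds to a null set of points, by polar coordinates. This allows the
  radial weight to be modified on a null set.\<close>

lemma AE_gauge_not_in:
  assumes M: "M \<in> sets borel" and null: "AE r in lborel. r \<notin> M" and 0: "0 \<notin> M"
  shows "AE y in lborel. G (x - y) \<notin> M"
proof -
  note [measurable] = M
  have "(\<integral>\<^sup>+y. indicator M (G (x - y)) \<partial>lborel) = (\<integral>\<^sup>+y. indicator M (G (y + - x)) \<partial>lborel)"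
  proof (rule nn_integral_cong)
    fix y show "(indicator M (G (x - y)) :: ennreal) = indicator M (G (y + - x))"
      using G_minus[of "y + - x"] by simp
  qed
  also have "\<dots> = (\<integral>\<^sup>+h. indicator M (G h) \<partial>lborel)" by (rule nn_integral_translate) measurable
  also have "\<dots> = (\<integral>\<^sup>+r. (\<integral>\<^sup>+k. ennreal (real CARD('n) * r powr (real CARD('n) - 1)) * indicator M (G (r *\<^sub>R radial_proj k))
            * indicator K k \<partial>lborel) * indicator {0<..} r \<partial>lborel)" by (rule polar_coordinates) measurable
  also have "\<dots> = (\<integral>\<^sup>+(r::real). 0 \<partial>lborel)"
  proof (rule nn_integral_cong_AE)
    show "AE r in lborel. (\<integral>\<^sup>+k. ennreal (real CARD('n) * r powr (real CARD('n) - 1)) * indicator M (G (r *\<^sub>R radial_proj k))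
            * indicator K k \<partial>lborel) * indicator {0<..} r = 0"
      using null by eventually_elim (auto simp: indicator_def)
  qed
  finally have "(\<integral>\<^sup>+y. indicator M (G (x - y)) \<partial>lborel) = 0" by simp
  then have "AE y in lborel. (indicator M (G (x - y)) :: ennreal) = 0"
    by (subst (asm) nn_integral_0_iff_AE) measurable
  then show ?thesis by eventually_elim (auto simp: indicator_def split: if_splits)
qed

text \<open>On the diagonal the integrand is zero whatever the value of \<open>\<rho>\<close> at the origin; off the diagonal
  the exceptional set is null in the product.\<close>

lemma nonlocal_energy_cong_AE:
  assumes u: "AE x in lborel. u x = u' x" and \<rho>: "AE r in lborel. 0 < r \<longrightarrow> \<rho> r = \<rho>' r"
  shows "nonlocal_energy p A K \<rho> u = nonlocal_energy p A K \<rho>' u'"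
proof -
  obtain N where N: "{x \<in> space lborel. \<not> u x = u' x} \<subseteq> N" "emeasure lborel N = 0" "N \<in> sets lborel"
    using AE_E[OF u] by blast
  obtain M0 where M0: "{r \<in> space lborel. \<not> (0 < r \<longrightarrow> \<rho> r = \<rho>' r)} \<subseteq> M0" "emeasure lborel M0 = 0" "M0 \<in> sets lborel"
    using AE_E[OF \<rho>] by blast
  define M where "M = M0 \<inter> {0<..}"
  have Nm [measurable]: "N \<in> sets borel" and M0m [measurable]: "M0 \<in> sets borel" using N M0 by auto
  have Mm [measurable]: "M \<in> sets borel" unfolding M_def by measurable
  have N0: "AE x in lborel. x \<notin> N" using N by (intro AE_not_in) (auto simp: null_sets_def)
  have "AE r in lborel. r \<notin> M0" using M0 by (intro AE_not_in) (auto simp: null_sets_def)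
  then have M1: "AE r in lborel. r \<notin> M" by eventually_elim (simp add: M_def)
  have "AE z in (lborel \<Otimes>\<^sub>M lborel). fst z \<notin> N \<and> snd z \<notin> N \<and> G (fst z - snd z) \<notin> M"
  proof (rule lborel_pair.AE_pair_measure)
    show "{z \<in> space (lborel \<Otimes>\<^sub>M lborel). fst z \<notin> N \<and> snd z \<notin> N \<and> G (fst z - snd z) \<notin> M} \<in> sets (lborel \<Otimes>\<^sub>M lborel)"
      by measurable
    show "AE x in lborel. AE y in lborel. fst (x, y) \<notin> N \<and> snd (x, y) \<notin> N \<and> G (fst (x, y) - snd (x, y)) \<notin> M"
      using N0
    proof eventually_elim
      case (elim x)
      have "AE y in lborel. G (x - y) \<notin> M" by (rule AE_gauge_not_in[OF Mm M1]) (simp add: M_def)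
      with N0 show ?case by eventually_elim (use elim in simp)
    qed
  qed
  then have ae: "AE z in lborel. fst z \<notin> N \<and> snd z \<notin> N \<and> G (fst z - snd z) \<notin> M" unfolding lborel_prod .
  show ?thesis unfolding nonlocal_energy_def nn_integral_completion
  proof (rule nn_integral_cong_AE)
    show "AE z in lborel. (case z of (x, y) \<Rightarrow> ennreal (cnorm_p p (Psi A u x y - Psi A u x x) powr p / G (x - y) powr p * \<rho> (G (x - y))))
      = (case z of (x, y) \<Rightarrow> ennreal (cnorm_p p (Psi A u' x y - Psi A u' x x) powr p / G (x - y) powr p * \<rho>' (G (x - y))))"
      using ae
    proof eventually_elim
      case (elim z)
      obtain x y where z: "z = (x, y)" by (cases z)
      have "u x = u' x" "u y = u' y" using elim N(1) by (auto simp: z)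
      moreover have "\<rho> (G (x - y)) = \<rho>' (G (x - y))" if "x \<noteq> y"
      proof -
        have "G (x - y) \<notin> M0" using elim that by (auto simp: z M_def)
        moreover have "0 < G (x - y)" using that by simp
        ultimately show ?thesis using M0(1) by (auto simp del: G_pos)
      qed
      moreover have G0: "G 0 = 0" by simp
      ultimately show ?case unfolding z Psi_def by (cases "x = y") (auto simp: G0)
    qed
  qed
qed

end

section \<open>The nonlocal limits\<close>

context magnetic begin

lemma nonlocal_energy_tendsto_Borel:
  fixes \<rho> :: "nat \<Rightarrow> real \<Rightarrow> real"
  assumes u[measurable]: "u \<in> borel_measurable borel" and fin: "(\<integral>\<^sup>+x. ennreal (norm_pow p (u x)) \<partial>lborel) < \<infinity>"
    and lim: "(sphere_energy u \<longlongrightarrow> l) (at_right 0)" and l: "l < \<infinity>"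
    and \<rho>: "\<And>n. \<rho> n \<in> borel_measurable borel" and pos: "\<And>n r. 0 \<le> \<rho> n r"
    and tail: "\<And>\<delta>. 0 < \<delta> \<Longrightarrow> (\<lambda>n. \<integral>\<^sup>+ r\<in>{\<delta><..}. ennreal (\<rho> n r * r powr (real CARD('n) - 1 - p)) \<partial>lborel) \<longlonglongrightarrow> 0"
    and one: "\<And>n. (\<integral>\<^sup>+ r\<in>{0<..<1}. ennreal (\<rho> n r * r powr (real CARD('n) - 1)) \<partial>lborel) = 1"
  shows "(\<lambda>n. nonlocal_energy p A K (\<rho> n) u) \<longlonglongrightarrow> l"
  unfolding nonlocal_energy_eq[OF u \<rho> pos]
proof (rule radial_limit[OF \<rho> _ p1 lim l sphere_energy_le[OF u] _ tail one pos])
  show "sphere_energy u \<in> borel_measurable borel" by measurable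
  show "ennreal (real CARD('n) * (2 powr (p - 1) * (2 powr p + 1))) * emeasure lborel K * (\<integral>\<^sup>+x. ennreal (norm_pow p (u x)) \<partial>lborel) < \<infinity>"
    using fin emeasure_K_finite by (simp add: ennreal_mult_less_top)
qed

lemma nonlocal_energy_tendsto:
  fixes \<rho> :: "nat \<Rightarrow> real \<Rightarrow> real"
  assumes u: "u' \<in> borel_measurable borel" and fin: "(\<integral>\<^sup>+x. ennreal (norm_pow p (u' x)) \<partial>lborel) < \<infinity>"
    and lim: "(sphere_energy u' \<longlongrightarrow> l) (at_right 0)" and l: "l < \<infinity>" and ae: "AE x in lborel. u x = u' x"
    and \<rho>: "\<forall>n. \<rho> n \<in> borel_measurable (lebesgue_on {0<..})" and pos: "\<forall>n. \<forall>r>0. \<rho> n r \<ge> 0"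
    and tail: "\<forall>\<delta>>0. (\<lambda>n. \<integral>\<^sup>+ r\<in>{\<delta><..}. ennreal (\<rho> n r * r powr (real CARD('n) - 1 - p)) \<partial>lebesgue) \<longlonglongrightarrow> 0"
    and one: "\<forall>n. (\<integral>\<^sup>+ r\<in>{0<..<1}. ennreal (\<rho> n r * r powr (real CARD('n) - 1)) \<partial>lebesgue) = 1"
  shows "(\<lambda>n. nonlocal_energy p A K (\<rho> n) u) \<longlonglongrightarrow> l"
proof -
  have "\<exists>g\<in>borel_measurable borel. AE r in lborel. (if r \<in> {0<..} then \<rho> n r else 0) = g r" for n
    using \<rho> by (intro lebesgue_borel_representative borel_measurable_if_I) auto
  then have "\<forall>n. \<exists>g. g \<in> borel_measurable borel \<and> (AE r in lborel. (if r \<in> {0<..} then \<rho> n r else 0) = g r)"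
    unfolding Bex_def by (rule allI)
  from choice[OF this] obtain g where "\<forall>n. g n \<in> borel_measurable borel \<and> (AE r in lborel. (if r \<in> {0<..} then \<rho> n r else 0) = g n r)"
    by (rule exE)
  note g = this[THEN spec, THEN conjunct1] this[THEN spec, THEN conjunct2]
  \<comment> \<open>a representative of a nonnegative function may be negative on a null set\<close>
  define \<rho>' where "\<rho>' n r = max 0 (g n r)" for n r
  have \<rho>'m: "\<rho>' n \<in> borel_measurable borel" for n unfolding \<rho>'_def using g(1) by measurable
  have eq: "AE r in lborel. 0 < r \<longrightarrow> \<rho> n r = \<rho>' n r" for n
    using g(2)[of n]
  proof eventually_elim
    case (elim r)
    show ?case
    proof
      assume "0 < r"
      then have "\<rho> n r = g n r" "0 \<le> \<rho> n r" using elim pos by (simp, blast)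
      then show "\<rho> n r = \<rho>' n r" by (simp add: \<rho>'_def)
    qed
  qed
  have transfer: "(\<integral>\<^sup>+ r\<in>B. ennreal (\<rho> n r * r powr a) \<partial>lebesgue) = (\<integral>\<^sup>+ r\<in>B. ennreal (\<rho>' n r * r powr a) \<partial>lborel)"
    if B: "B \<subseteq> {0<..}" for B n a
    unfolding nn_integral_completion
  proof (rule nn_integral_cong_AE)
    show "AE r in lborel. ennreal (\<rho> n r * r powr a) * indicator B r = ennreal (\<rho>' n r * r powr a) * indicator B r"
      using eq[of n] by eventually_elim (use B in \<open>auto simp: indicator_def\<close>)
  qed
  have "(\<lambda>n. nonlocal_energy p A K (\<rho>' n) u') \<longlonglongrightarrow> l"
  proof (rule nonlocal_energy_tendsto_Borel[OF u fin lim l \<rho>'m])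
    show "0 \<le> \<rho>' n r" for n r by (simp add: \<rho>'_def)
    show "(\<integral>\<^sup>+ r\<in>{0<..<1}. ennreal (\<rho>' n r * r powr (real CARD('n) - 1)) \<partial>lborel) = 1" for n
      using one transfer[of "{0<..<1}" n "real CARD('n) - 1"] by (simp add: subset_eq)
    fix \<delta> :: real assume \<delta>: "0 < \<delta>"
    show "(\<lambda>n. \<integral>\<^sup>+ r\<in>{\<delta><..}. ennreal (\<rho>' n r * r powr (real CARD('n) - 1 - p)) \<partial>lborel) \<longlonglongrightarrow> 0"
      using tail[rule_format, OF \<delta>] transfer[of "{\<delta><..}" _ "real CARD('n) - 1 - p"] \<delta> by (simp add: subset_eq)
  qed
  then show ?thesis unfolding nonlocal_energy_cong_AE[OF ae eq] .
qed

lemma magnetic_energy_eq: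
  assumes u: "AE x in lborel. u x = u' x" and Gr: "AE x in lborel. Gr x = Gr' x"
    and m: "magnetic_gradient A u' Gr' \<in> borel_measurable borel"
  shows "ennreal p * magnetic_energy p A K u Gr = (\<integral>\<^sup>+x. energy_density p (magnetic_gradient A u' Gr' x) \<partial>lborel)"
proof -
  note [measurable] = m
  have pw: "ennreal (zstar_norm p K v powr p) = ennreal (1 / p) * energy_density p v" for v
    using p1 unfolding zstar_norm_powr[OF p1, symmetric] by (subst ennreal_mult[symmetric]) auto
  have "magnetic_energy p A K u Gr = (\<integral>\<^sup>+x. ennreal (1 / p) * energy_density p (magnetic_gradient A u' Gr' x) \<partial>lborel)"
    unfolding magnetic_energy_def nn_integral_completion pw
  proof (rule nn_integral_cong_AE)
    show "AE x in lborel. ennreal (1 / p) * energy_density p (magnetic_gradient A u Gr x) = ennreal (1 / p) * energy_density p (magnetic_gradient A u' Gr' x)"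
      using u Gr by eventually_elim (simp add: magnetic_gradient_def)
  qed
  also have "\<dots> = ennreal (1 / p) * (\<integral>\<^sup>+x. energy_density p (magnetic_gradient A u' Gr' x) \<partial>lborel)"
    by (rule nn_integral_cmult) measurable
  finally show ?thesis using p1 by (simp add: mult.assoc[symmetric] ennreal_mult[symmetric])
qed

theorem Sobolev_limit:
  fixes \<rho> :: "nat \<Rightarrow> real \<Rightarrow> real"
  assumes u: "u \<in> W_mag p A K" and Gr: "has_weak_gradient u Gr"
    and \<rho>: "\<forall>n. \<rho> n \<in> borel_measurable (lebesgue_on {0<..})" and pos: "\<forall>n. \<forall>r>0. \<rho> n r \<ge> 0"
    and tail: "\<forall>\<delta>>0. (\<lambda>n. \<integral>\<^sup>+ r\<in>{\<delta><..}. ennreal (\<rho> n r * r powr (real CARD('n) - 1 - p)) \<partial>lebesgue) \<longlonglongrightarrow> 0"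
    and one: "\<forall>n. (\<integral>\<^sup>+ r\<in>{0<..<1}. ennreal (\<rho> n r * r powr (real CARD('n) - 1)) \<partial>lebesgue) = 1"
  shows "(\<lambda>n. nonlocal_energy p A K (\<rho> n) u) \<longlonglongrightarrow> ennreal p * magnetic_energy p A K u Gr"
proof -
  obtain G0 where G0: "has_weak_gradient u G0" "magnetic_energy p A K u G0 < \<infinity>" using u by (auto simp: W_mag_def)
  have um: "u \<in> borel_measurable lebesgue" and ufin: "(\<integral>\<^sup>+ x. ennreal (norm_pow p (u x)) \<partial>lebesgue) < \<infinity>"
    using u by (auto simp: W_mag_def Lp_def cnorm_powr[OF p1])
  obtain u' where u': "u' \<in> borel_measurable borel" "AE x in lborel. u x = u' x"
    using lebesgue_borel_representative[OF um] by blast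
  have rep: "\<exists>G'. G' \<in> borel_measurable borel \<and> (AE x in lborel. H x = G' x) \<and> has_weak_gradient u' G'"
    if "has_weak_gradient u H" for H
  proof -
    have "H \<in> borel_measurable lebesgue" using that by (auto simp: has_weak_gradient_def intro: loc_integrable_measurable)
    from lebesgue_borel_representative[OF this] show ?thesis using has_weak_gradient_cong_AE[OF that u'] by blast
  qed
  obtain Gr' where Gr': "Gr' \<in> borel_measurable borel" "AE x in lborel. Gr x = Gr' x" "has_weak_gradient u' Gr'"
    using rep[OF Gr] by blast
  obtain G0' where G0': "G0' \<in> borel_measurable borel" "AE x in lborel. G0 x = G0' x" "has_weak_gradient u' G0'"
    using rep[OF G0(1)] by blast
  obtain \<eta> :: "nat \<Rightarrow> real^'n \<Rightarrow> real" and \<epsilon> where m: "\<And>m. mollifier (\<eta> m) (\<epsilon> m)" and e0: "\<epsilon> \<longlonglongrightarrow> 0"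
    using mollifier_sequence by metis
  have lu: "locint u'" and lG: "\<And>j. locint (\<lambda>y. Gr' y $ j)"
    using Gr'(3) u'(1) Gr'(1) by (auto simp: has_weak_gradient_def intro!: locint_component loc_integrable_imp_locint)
  note D = weak_magnetic_gradient_measurable[OF lu Gr'(1) lG, unfolded weak_magnetic_gradient_def[OF lu Gr'(1) lG]]
  have "AE x in lborel. G0' x = Gr' x" by (rule weak_gradient_unique[OF G0'(3) Gr'(3) u'(1) G0'(1) Gr'(1) m e0])
  with G0'(2) have ae: "AE x in lborel. G0 x = Gr' x" by eventually_elim simp
  have efin: "(\<integral>\<^sup>+x. energy_density p (magnetic_gradient A u' Gr' x) \<partial>lborel) < \<infinity>"
    using magnetic_energy_eq[OF u'(2) ae D] G0(2) by (simp add: ennreal_mult_less_top flip: magnetic_energy_eq[OF u'(2) ae D])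
  have "(\<integral>\<^sup>+ x. ennreal (norm_pow p (u' x)) \<partial>lborel) = (\<integral>\<^sup>+ x. ennreal (norm_pow p (u x)) \<partial>lebesgue)"
    unfolding nn_integral_completion by (rule nn_integral_cong_AE) (use u'(2) in eventually_elim, simp)
  then have fin: "(\<integral>\<^sup>+ x. ennreal (norm_pow p (u' x)) \<partial>lborel) < \<infinity>" using ufin by simp
  have "(sphere_energy u' \<longlongrightarrow> (\<integral>\<^sup>+x. energy_density p (magnetic_gradient A u' Gr' x) \<partial>lborel)) (at_right 0)"
    using Sobolev_sphere_energy_tendsto[OF lu Gr'(1) lG m e0, unfolded weak_magnetic_gradient_def[OF lu Gr'(1) lG]]
      conv_gradient_weak_gradient[OF Gr'(3) m u'(1) Gr'(1)] fin efin by blast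
  from nonlocal_energy_tendsto[OF u'(1) fin this efin u'(2) \<rho> pos tail one]
  show ?thesis unfolding magnetic_energy_eq[OF u'(2) Gr'(2) D] .
qed

end

lemma zero_Ck1: "Ck 1 (\<lambda>x::real^'n. 0 :: real^'n)"
proof -
  have "partial j (\<lambda>x::real^'n. 0 :: real^'n) = (\<lambda>x. 0)" for j
    by (rule ext) (simp add: partial_def frechet_derivative_const)
  then show ?thesis by simp
qed

context magnetic1 begin

lemma bv_pairing_Lebesgue:
  assumes um: "u \<in> borel_measurable lebesgue" and u': "u' \<in> borel_measurable borel" and ae: "AE x in lborel. u x = u' x"
    and \<psi>: "\<psi> \<in> bv_tests K"
  shows "(LINT x|lebesgue. Re (u x) * divergence \<psi> x - (A x \<bullet> \<psi> x) * Im (u x)) = bv_pairing u' \<psi>"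
    and "(LINT x|lebesgue. Im (u x) * divergence \<psi> x + (A x \<bullet> \<psi> x) * Re (u x)) = bv_pairing (\<lambda>x. - \<i> * u' x) \<psi>"
proof -
  have C: "Ck 1 \<psi>" "has_compact_support \<psi>" using \<psi> by (auto simp: bv_tests_def)
  obtain R where R: "0 < R" "\<And>x. R \<le> norm x \<Longrightarrow> \<psi> x = 0" using has_compact_support_radius[OF C(2)] by metis
  have d [measurable]: "divergence \<psi> \<in> borel_measurable borel" "(\<lambda>x. A x \<bullet> \<psi> x) \<in> borel_measurable borel"
    using kernel_within_measurable[OF kernel_within_divergence[OF C(1) R(2)]] kernel_within_measurable[OF kernel_within_inner_A[OF C(1) R(2)]] by auto
  note [measurable] = um u' borel_lebesgue_measurable[OF u'] d[THEN borel_lebesgue_measurable]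
  have ae': "AE x in lebesgue. u x = u' x" using ae unfolding AE_completion_iff .
  have "(LINT x|lebesgue. Re (u x) * divergence \<psi> x - (A x \<bullet> \<psi> x) * Im (u x)) = (LINT x|lebesgue. Re (u' x) * divergence \<psi> x - (A x \<bullet> \<psi> x) * Im (u' x))"
  proof (rule integral_cong_AE)
    show "AE x in lebesgue. Re (u x) * divergence \<psi> x - (A x \<bullet> \<psi> x) * Im (u x) = Re (u' x) * divergence \<psi> x - (A x \<bullet> \<psi> x) * Im (u' x)"
      using ae' by eventually_elim simp
  qed measurable
  also have "\<dots> = bv_pairing u' \<psi>" unfolding bv_pairing_def by (rule integral_completion) measurable
  finally show "(LINT x|lebesgue. Re (u x) * divergence \<psi> x - (A x \<bullet> \<psi> x) * Im (u x)) = bv_pairing u' \<psi>" .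
  have "(LINT x|lebesgue. Im (u x) * divergence \<psi> x + (A x \<bullet> \<psi> x) * Re (u x)) = (LINT x|lebesgue. Re (- \<i> * u' x) * divergence \<psi> x - (A x \<bullet> \<psi> x) * Im (- \<i> * u' x))"
  proof (rule integral_cong_AE)
    show "AE x in lebesgue. Im (u x) * divergence \<psi> x + (A x \<bullet> \<psi> x) * Re (u x) = Re (- \<i> * u' x) * divergence \<psi> x - (A x \<bullet> \<psi> x) * Im (- \<i> * u' x)"
      using ae' by eventually_elim simp
  qed measurable
  also have "\<dots> = bv_pairing (\<lambda>x. - \<i> * u' x) \<psi>" unfolding bv_pairing_def by (rule integral_completion) measurable
  finally show "(LINT x|lebesgue. Im (u x) * divergence \<psi> x + (A x \<bullet> \<psi> x) * Re (u x)) = bv_pairing (\<lambda>x. - \<i> * u' x) \<psi>" .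
qed

lemma zero_bv_test: "(\<lambda>x. 0) \<in> bv_tests K"
  by (rule bv_testI[OF zero_Ck1]) (auto simp: has_compact_support_def)

text \<open>The zero field shows that the supremum is not negative, so a finite upper bound makes it a real number.\<close>

lemma finite_SUP_bv_pairing:
  assumes fin: "(SUP \<psi>\<in>bv_tests K. ereal (bv_pairing v \<psi>)) < \<infinity>"
  shows "\<exists>c\<ge>0. (SUP \<psi>\<in>bv_tests K. ereal (bv_pairing v \<psi>)) = ereal c \<and> (\<forall>\<psi>\<in>bv_tests K. bv_pairing v \<psi> \<le> c) \<and> (\<forall>e>0. \<exists>\<psi>\<in>bv_tests K. c - e < bv_pairing v \<psi>)"
proof -
  let ?S = "SUP \<psi>\<in>bv_tests K. ereal (bv_pairing v \<psi>)"
  have "bv_pairing v (\<lambda>x. 0) = 0" by (simp add: bv_pairing_def divergence_def partial_def frechet_derivative_const)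
  then have S0: "0 \<le> ?S" using SUP_upper[OF zero_bv_test, of "\<lambda>\<psi>. ereal (bv_pairing v \<psi>)"] by (simp add: zero_ereal_def)
  then obtain c where c: "?S = ereal c" using fin by (cases ?S) auto
  have "bv_pairing v \<psi> \<le> c" if "\<psi> \<in> bv_tests K" for \<psi> using SUP_upper[OF that, of "\<lambda>\<psi>. ereal (bv_pairing v \<psi>)"] c by simp
  moreover have "\<exists>\<psi>\<in>bv_tests K. c - e < bv_pairing v \<psi>" if "0 < e" for e
  proof -
    have "ereal (c - e) < ?S" using that c by simp
    then show ?thesis unfolding less_SUP_iff by simp
  qed
  ultimately show ?thesis using S0 c by auto
qed

theorem BV_limit:
  fixes \<rho> :: "nat \<Rightarrow> real \<Rightarrow> real"
  assumes u: "u \<in> BV_mag A K"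
    and \<rho>: "\<forall>n. \<rho> n \<in> borel_measurable (lebesgue_on {0<..})" and pos: "\<forall>n. \<forall>r>0. \<rho> n r \<ge> 0"
    and tail: "\<forall>\<delta>>0. (\<lambda>n. \<integral>\<^sup>+ r\<in>{\<delta><..}. ennreal (\<rho> n r * r powr (real CARD('n) - 1 - 1)) \<partial>lebesgue) \<longlonglongrightarrow> 0"
    and one: "\<forall>n. (\<integral>\<^sup>+ r\<in>{0<..<1}. ennreal (\<rho> n r * r powr (real CARD('n) - 1)) \<partial>lebesgue) = 1"
  shows "(\<lambda>n. enn2ereal (nonlocal_energy 1 A K (\<rho> n) u)) \<longlonglongrightarrow> total_variation_mag A K u"
proof -
  have ui: "integrable lebesgue u" and tv: "C1_mag A K u + C2_mag A K u < \<infinity>"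
    using u by (auto simp: BV_mag_def total_variation_mag_def)
  note um = borel_measurable_integrable[OF ui]
  obtain u' where u': "u' \<in> borel_measurable borel" "AE x in lborel. u x = u' x"
    using lebesgue_borel_representative[OF um] by blast
  have "integrable lebesgue u'"
    by (rule integrable_cong_AE_imp[OF ui borel_lebesgue_measurable[OF u'(1)]])
      (use u'(2) in \<open>simp add: AE_completion_iff\<close>)
  then have ui': "integrable lborel u'" using u'(1) by (simp add: integrable_completion)
  let ?v = "\<lambda>x. - \<i> * u' x"
  have C1: "C1_mag A K u = (SUP \<psi>\<in>bv_tests K. ereal (bv_pairing u' \<psi>))" and C2: "C2_mag A K u = (SUP \<psi>\<in>bv_tests K. ereal (bv_pairing ?v \<psi>))"
    unfolding C1_mag_def C2_mag_def using bv_pairing_Lebesgue[OF um u'] by (auto intro!: SUP_cong)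
  have nonneg: "0 \<le> C1_mag A K u" "0 \<le> C2_mag A K u"
  proof -
    have z: "bv_pairing v (\<lambda>x. 0) = 0" for v by (simp add: bv_pairing_def divergence_def partial_def frechet_derivative_const)
    show "0 \<le> C1_mag A K u" unfolding C1 by (rule SUP_upper2[OF zero_bv_test]) (simp add: z)
    show "0 \<le> C2_mag A K u" unfolding C2 by (rule SUP_upper2[OF zero_bv_test]) (simp add: z)
  qed
  then have f: "C1_mag A K u < \<infinity>" "C2_mag A K u < \<infinity>"
    using tv by (cases "C1_mag A K u"; cases "C2_mag A K u"; simp)+
  obtain c1 where c1: "0 \<le> c1" "C1_mag A K u = ereal c1" "\<forall>\<psi>\<in>bv_tests K. bv_pairing u' \<psi> \<le> c1" "\<forall>e>0. \<exists>\<psi>\<in>bv_tests K. c1 - e < bv_pairing u' \<psi>"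
    using finite_SUP_bv_pairing[OF f(1)[unfolded C1]] unfolding C1 by blast
  obtain c2 where c2: "0 \<le> c2" "C2_mag A K u = ereal c2" "\<forall>\<psi>\<in>bv_tests K. bv_pairing ?v \<psi> \<le> c2" "\<forall>e>0. \<exists>\<psi>\<in>bv_tests K. c2 - e < bv_pairing ?v \<psi>"
    using finite_SUP_bv_pairing[OF f(2)[unfolded C2]] unfolding C2 by blast
  have S: "(sphere_energy u' \<longlongrightarrow> ennreal (c1 + c2)) (at_right 0)"
    by (rule BV_sphere_energy_tendsto[OF ui' c1(3)[rule_format] c2(3)[rule_format] c1(4)[rule_format] c2(4)[rule_format] c1(1) c2(1)])
  have fin: "(\<integral>\<^sup>+x. ennreal (norm_pow 1 (u' x)) \<partial>lborel) < \<infinity>" by (rule norm_pow_1_finite[OF ui'])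
  have "(\<lambda>n. nonlocal_energy 1 A K (\<rho> n) u) \<longlonglongrightarrow> ennreal (c1 + c2)"
    by (rule nonlocal_energy_tendsto[OF u'(1) fin S _ u'(2) \<rho> pos tail one]) simp
  then have "(\<lambda>n. enn2ereal (nonlocal_energy 1 A K (\<rho> n) u)) \<longlonglongrightarrow> enn2ereal (ennreal (c1 + c2))"
    by (intro continuous_on_tendsto_compose[OF continuous_on_enn2ereal]) auto
  moreover have "enn2ereal (ennreal (c1 + c2)) = total_variation_mag A K u"
    using c1(1,2) c2(1,2) enn2ereal_ennreal[of "c1 + c2"] by (simp add: total_variation_mag_def del: ennreal_plus)
  ultimately show ?thesis by (simp only:)
qed

end

theorem theorem1p2:
  fixes K :: "(real^'n) set"
    and A :: "real^'n \<Rightarrow> real^'n"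
    and p :: real
    and \<rho> :: "nat \<Rightarrow> real \<Rightarrow> real"
  assumes "convex K" and "\<forall>x\<in>K. - x \<in> K" and "0 \<in> K"
    and "is_norm (gauge_norm K)" and "{x. gauge_norm K x \<le> 1} = K"
    and "p \<ge> 1"
    and "\<exists>L. L-lipschitz_on UNIV A"
    and "\<forall>n. \<rho> n \<in> borel_measurable (lebesgue_on {0<..})"
    and "\<forall>n. \<forall>r>0. \<rho> n r \<ge> 0"
    and "\<forall>\<delta>>0. (\<lambda>n. \<integral>\<^sup>+ r\<in>{\<delta><..}. ennreal (\<rho> n r * r powr (real CARD('n) - 1 - p)) \<partial>lebesgue)
           \<longlonglongrightarrow> 0"
    and "\<forall>n. (\<integral>\<^sup>+ r\<in>{0<..<1}. ennreal (\<rho> n r * r powr (real CARD('n) - 1)) \<partial>lebesgue) = 1"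
  shows "(\<forall>u\<in>W_mag p A K. \<forall>G. has_weak_gradient u G \<longrightarrow>
            (\<lambda>n. nonlocal_energy p A K (\<rho> n) u) \<longlonglongrightarrow> ennreal p * magnetic_energy p A K u G)
       \<and> (p = 1 \<longrightarrow> (\<forall>u\<in>BV_mag A K.
            (\<lambda>n. enn2ereal (nonlocal_energy 1 A K (\<rho> n) u)) \<longlonglongrightarrow> total_variation_mag A K u))"
proof -
  obtain L where L: "L-lipschitz_on UNIV A" using assms(7) by blast
  interpret magnetic K A L p by unfold_locales (fact assms L)+
  show ?thesis
  proof (intro conjI ballI allI impI)
    fix u G assume "u \<in> W_mag p A K" "has_weak_gradient u G"
    then show "(\<lambda>n. nonlocal_energy p A K (\<rho> n) u) \<longlonglongrightarrow> ennreal p * magnetic_energy p A K u G"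
      by (rule Sobolev_limit) (fact assms)+
  next
    fix u assume p: "p = 1" and u: "u \<in> BV_mag A K"
    interpret BV: magnetic1 K A L by unfold_locales (use L in auto)
    show "(\<lambda>n. enn2ereal (nonlocal_energy 1 A K (\<rho> n) u)) \<longlonglongrightarrow> total_variation_mag A K u"
      by (rule BV.BV_limit[OF u]) (use assms p in auto)
  qed
qed

end
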